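(* In every dimension $d\ge 4$ there exists a combinatorial $d$-polytope that does not have a balanced pair, does not have an antiprism, and does not have an interval polytope.
   Context: A combinatorial polytope $\mathcal{P}$ is a bounded poset (least element $\bot$, greatest $\top$) isomorphic to the face lattice of a convex polytope; a realization is a polytope $P$ with an isomorphism from $\mathcal{P}$ to its face lattice, and $\operatorname{face}(P,f)$ is the face with index $f$. Interval polytope and antiprism: an interval polytope of $\mathcal{P}$ is a polytope whose face lattice is isomorphic to the poset of all intervals of $\mathcal{P}$ (including the empty interval) ordered by inclusion; an antiprism of $\mathcal{P}$ is a polytope whose face lattice is isomorphic to the poset of all intervals of $\mathcal{P}$ (including the empty interval) ordered by reverse inclusion. Balanced pair: a polytope in $\mathbb{R}^d$ is centered if it contains the origin in its interior. For a polytope $P\subset\mathbb{R}^d$ and index $g\ne\bot$, the normal cone $\operatorname{ncone}(P,g)$ is the set of $u\in\mathbb{R}^d$ such that the linear functional $\langle u,\cdot\rangle$ attains its maximum over $P$ at every point of $\operatorname{face}(P,g)$; $X^\circ$ denotes relative interior. An ordered pair $(P_1,P_2)$ of centered realizations in $\mathbb{R}^d$ of the same combinatorial polytope is balanced if for all indices $g,f\neq\bot$, $$\operatorname{ncone}(P_1,g)^\circ\cap\operatorname{face}(P_2,f)^\circ\neq\emptyset\iff g\le f .$$ $\mathcal{P}$ has a balanced pair if there is a balanced pair of realizations of $\mathcal{P}$. *)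

theory Defs
  imports "HOL-Analysis.Analysis" "HOL-Analysis.Finite_Function_Topology"
begin

text \<open>A poset is encoded by its reflexive order relation \<open>r\<close>; its elements form \<open>Field r\<close>.\<close>

definition poset_iso :: "('i \<Rightarrow> 'j) \<Rightarrow> 'i rel \<Rightarrow> 'j rel \<Rightarrow> bool" where
  "poset_iso \<phi> r s \<longleftrightarrow> bij_betw \<phi> (Field r) (Field s) \<and>
     (\<forall>f\<in>Field r. \<forall>g\<in>Field r. (f, g) \<in> r \<longleftrightarrow> (\<phi> f, \<phi> g) \<in> s)"

definition poset_bot :: "'i rel \<Rightarrow> 'i" where
  "poset_bot r = (THE b. b \<in> Field r \<and> (\<forall>f\<in>Field r. (b, f) \<in> r))"

text \<open>Both \<open>{}\<close> and \<open>P\<close> itself satisfy \<open>_ face_of P\<close> when \<open>P\<close> is convex.\<close>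

definition face_lattice :: "'a::real_vector set \<Rightarrow> 'a set rel" where
  "face_lattice P = relation_of (\<subseteq>) {F. F face_of P}"

text \<open>For a realization \<open>(P, \<phi>)\<close>, the face of \<open>P\<close> with index \<open>f\<close> is \<open>\<phi> f\<close>.\<close>

definition realization :: "'i rel \<Rightarrow> 'a::real_vector set \<Rightarrow> ('i \<Rightarrow> 'a set) \<Rightarrow> bool" where
  "realization r P \<phi> \<longleftrightarrow> polytope P \<and> poset_iso \<phi> r (face_lattice P)"

text \<open>A relation isomorphic to a face lattice is automatically a bounded partial order; see
  \<open>realization_Partial_order\<close>, \<open>realization_bot\<close> and \<open>realization_top\<close> below.\<close>

definition combinatorial_polytope :: "'a::euclidean_space itself \<Rightarrow> nat \<Rightarrow> 'i rel \<Rightarrow> bool" where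
  "combinatorial_polytope _ d r \<longleftrightarrow>
     (\<exists>(P :: 'a set) \<phi>. realization r P \<phi> \<and> aff_dim P = int d)"

definition centered :: "'a::euclidean_space set \<Rightarrow> bool" where
  "centered P \<longleftrightarrow> 0 \<in> interior P"

definition normal_cone :: "'a::euclidean_space set \<Rightarrow> 'a set \<Rightarrow> 'a set" where
  "normal_cone P F = {u. \<forall>x\<in>F. \<forall>y\<in>P. u \<bullet> y \<le> u \<bullet> x}"

definition balanced_pair ::
  "'i rel \<Rightarrow> 'a::euclidean_space set \<Rightarrow> ('i \<Rightarrow> 'a set) \<Rightarrow> 'a set \<Rightarrow> ('i \<Rightarrow> 'a set) \<Rightarrow> bool" where
  "balanced_pair r P1 \<phi>1 P2 \<phi>2 \<longleftrightarrow>
     realization r P1 \<phi>1 \<and> realization r P2 \<phi>2 \<and> centered P1 \<and> centered P2 \<and>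
     (\<forall>g \<in> Field r - {poset_bot r}. \<forall>f \<in> Field r - {poset_bot r}.
        rel_interior (normal_cone P1 (\<phi>1 g)) \<inter> rel_interior (\<phi>2 f) \<noteq> {} \<longleftrightarrow> (g, f) \<in> r)"

definition has_balanced_pair :: "'a::euclidean_space itself \<Rightarrow> 'i rel \<Rightarrow> bool" where
  "has_balanced_pair _ r \<longleftrightarrow> (\<exists>(P1 :: 'a set) \<phi>1 P2 \<phi>2. balanced_pair r P1 \<phi>1 P2 \<phi>2)"

definition intervals :: "'i rel \<Rightarrow> 'i set set" where
  "intervals r = insert {} {{z. (x, z) \<in> r \<and> (z, y) \<in> r} | x y. (x, y) \<in> r}"

definition interval_poset :: "'i rel \<Rightarrow> 'i set rel" where
  "interval_poset r = relation_of (\<subseteq>) (intervals r)"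

definition interval_polytope_of :: "'i rel \<Rightarrow> 'b::real_vector set \<Rightarrow> bool" where
  "interval_polytope_of r Q \<longleftrightarrow>
     polytope Q \<and> (\<exists>\<psi>. poset_iso \<psi> (interval_poset r) (face_lattice Q))"

definition antiprism_of :: "'i rel \<Rightarrow> 'b::real_vector set \<Rightarrow> bool" where
  "antiprism_of r Q \<longleftrightarrow>
     polytope Q \<and> (\<exists>\<psi>. poset_iso \<psi> ((interval_poset r)\<inverse>) (face_lattice Q))"

text \<open>
  An interval polytope or antiprism may live in a Euclidean space of any dimension. To quantify
  over all of these at once, we work in the space of finitely supported real sequences, which is
  the union of the coordinate subspaces \<open>\<real>\<^sup>m\<close>. Every polytope in it lies in one of
  them, and conversely all polytopes in Euclidean spaces are covered, see
  \<open>has_interval_polytopeI\<close> and \<open>has_antiprismI\<close>.\<close>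

definition has_interval_polytope :: "'i rel \<Rightarrow> bool" where
  "has_interval_polytope r \<longleftrightarrow> (\<exists>Q :: (nat \<Rightarrow>\<^sub>0 real) set. interval_polytope_of r Q)"

definition has_antiprism :: "'i rel \<Rightarrow> bool" where
  "has_antiprism r \<longleftrightarrow> (\<exists>Q :: (nat \<Rightarrow>\<^sub>0 real) set. antiprism_of r Q)"


lemma Field_relation_of_subset: "Field (relation_of (\<subseteq>) A) = A"
  by (auto simp: relation_of_def Field_def)

lemma Field_face_lattice: "Field (face_lattice P) = {F. F face_of P}"
  by (simp add: face_lattice_def Field_relation_of_subset)

lemma face_lattice_iff:
  "(F, G) \<in> face_lattice P \<longleftrightarrow> F face_of P \<and> G face_of P \<and> F \<subseteq> G"
  by (auto simp: face_lattice_def relation_of_def)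

lemma realization_Partial_order:
  assumes "realization r P \<phi>"
  shows "Partial_order r"
proof -
  have bij: "bij_betw \<phi> (Field r) (Field (face_lattice P))"
    and iff: "\<And>f g. f \<in> Field r \<Longrightarrow> g \<in> Field r \<Longrightarrow> (f, g) \<in> r \<longleftrightarrow> (\<phi> f, \<phi> g) \<in> face_lattice P"
    using assms by (auto simp: realization_def poset_iso_def)
  have face: "\<phi> f face_of P" if "f \<in> Field r" for f
    using bij that by (auto simp: bij_betw_def Field_face_lattice)
  have inj: "inj_on \<phi> (Field r)" using bij by (simp add: bij_betw_def)
  have le: "(f, g) \<in> r \<longleftrightarrow> f \<in> Field r \<and> g \<in> Field r \<and> \<phi> f \<subseteq> \<phi> g" for f g
    using iff face by (auto simp: face_lattice_iff intro: FieldI1 FieldI2)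
  show ?thesis
    unfolding partial_order_on_def preorder_on_def refl_on_def trans_def antisym_def
    using le inj by (auto simp: inj_on_def)
qed

lemma realization_bot:
  assumes "realization r P \<phi>"
  shows "poset_bot r \<in> Field r" "\<And>f. f \<in> Field r \<Longrightarrow> (poset_bot r, f) \<in> r"
    "\<phi> (poset_bot r) = {}"
proof -
  have bij: "bij_betw \<phi> (Field r) {F. F face_of P}"
    and iff: "\<And>f g. f \<in> Field r \<Longrightarrow> g \<in> Field r \<Longrightarrow> (f, g) \<in> r \<longleftrightarrow> (\<phi> f, \<phi> g) \<in> face_lattice P"
    using assms by (auto simp: realization_def poset_iso_def Field_face_lattice)
  have "{} \<in> \<phi> ` Field r" using bij by (simp add: bij_betw_def)
  then obtain b where b: "b \<in> Field r" "\<phi> b = {}" by (metis image_iff)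
  have face: "\<phi> f face_of P" if "f \<in> Field r" for f
    using bij that by (auto simp: bij_betw_def)
  have least: "(b, f) \<in> r" if "f \<in> Field r" for f
    using iff[of b f] b that face by (simp add: face_lattice_iff)
  have "poset_bot r = b"
    unfolding poset_bot_def
  proof (rule the_equality)
    show "b \<in> Field r \<and> (\<forall>f\<in>Field r. (b, f) \<in> r)" using b least by blast
  next
    fix c assume "c \<in> Field r \<and> (\<forall>f\<in>Field r. (c, f) \<in> r)"
    then show "c = b"
      using realization_Partial_order[OF assms] b least
      by (auto simp: partial_order_on_def antisym_def)
  qed
  then show "poset_bot r \<in> Field r" "\<And>f. f \<in> Field r \<Longrightarrow> (poset_bot r, f) \<in> r"
    "\<phi> (poset_bot r) = {}"
    using b least by auto
qed

lemma realization_top: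
  assumes "realization r P \<phi>"
  shows "\<exists>t\<in>Field r. \<phi> t = P \<and> (\<forall>f\<in>Field r. (f, t) \<in> r)"
proof -
  have P: "P face_of P"
    using assms by (simp add: realization_def polytope_def face_of_refl) 
      (metis convex_convex_hull face_of_refl)
  have bij: "bij_betw \<phi> (Field r) {F. F face_of P}"
    and iff: "\<And>f g. f \<in> Field r \<Longrightarrow> g \<in> Field r \<Longrightarrow> (f, g) \<in> r \<longleftrightarrow> (\<phi> f, \<phi> g) \<in> face_lattice P"
    using assms by (auto simp: realization_def poset_iso_def Field_face_lattice)
  have "P \<in> \<phi> ` Field r" using bij P by (simp add: bij_betw_def)
  then obtain t where t: "t \<in> Field r" "\<phi> t = P" by (metis image_iff)
  have face: "\<phi> f face_of P" if "f \<in> Field r" for f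
    using bij that by (auto simp: bij_betw_def)
  show ?thesis
    using t iff face face_of_imp_subset P by (metis face_lattice_iff)
qed

lemma exists_linear_embedding_finite_support:
  "\<exists>h :: 'b::euclidean_space \<Rightarrow> (nat \<Rightarrow>\<^sub>0 real). linear h \<and> inj h"
proof -
  obtain n where n: "inj_on n (Basis :: 'b set)" "\<And>b. n b \<in> (UNIV :: nat set)"
    using finite_imp_inj_to_nat_seg[OF finite_Basis] by blast
  define h :: "'b \<Rightarrow> (nat \<Rightarrow>\<^sub>0 real)"
    where "h = (\<lambda>x. \<Sum>b\<in>Basis. Poly_Mapping.single (n b) (x \<bullet> b))"
  have scale: "c *\<^sub>R Poly_Mapping.single k a = Poly_Mapping.single k (c * a)"
    for c a :: real and k :: nat
  proof (rule poly_mapping_eqI)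
    fix i
    have "finite {i. c *\<^sub>R Poly_Mapping.lookup (Poly_Mapping.single k a) i \<noteq> 0}"
      by (rule finite_subset[of _ "{k}"]) (auto simp: lookup_single when_def)
    then show "Poly_Mapping.lookup (c *\<^sub>R Poly_Mapping.single k a) i =
        Poly_Mapping.lookup (Poly_Mapping.single k (c * a)) i"
      by (simp add: scaleR_poly_mapping_def Abs_poly_mapping_inverse lookup_single when_def)
  qed
  have "linear h"
    by (rule linearI)
      (simp_all add: h_def inner_add_left single_add sum.distrib scaleR_sum_right scale)
  have coord: "Poly_Mapping.lookup (h x) (n b) = x \<bullet> b" if "b \<in> Basis" for x b
  proof -
    have "Poly_Mapping.lookup (h x) (n b) = (\<Sum>c\<in>Basis. if c = b then x \<bullet> c else 0)"
      unfolding h_def lookup_sum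
      using n(1) that by (intro sum.cong) (auto simp: lookup_single when_def inj_on_def)
    then show ?thesis using that by simp
  qed
  have "inj h"
    by (rule injI, rule euclidean_eqI) (metis coord)
  with \<open>linear h\<close> show ?thesis by blast
qed

lemma poset_iso_face_lattice_linear_image:
  fixes h :: "'a::real_vector \<Rightarrow> 'b::real_vector"
  assumes "linear h" "inj h"
  shows "poset_iso ((`) h) (face_lattice P) (face_lattice (h ` P))"
  unfolding poset_iso_def
proof
  have "inj_on ((`) h) {F. F face_of P}"
    using \<open>inj h\<close> by (meson inj_on_subset inj_image_eq_iff inj_onI)
  moreover have "(`) h ` {F. F face_of P} = {G. G face_of h ` P}"
  proof (safe)
    fix F assume "F face_of P"
    then show "h ` F face_of h ` P" using face_of_linear_image[OF assms] by blast
  next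
    fix G assume G: "G face_of h ` P"
    then obtain F where "F \<subseteq> P" "G = h ` F"
      by (meson face_of_imp_subset subset_imageE)
    with G show "G \<in> (`) h ` {F. F face_of P}"
      using face_of_linear_image[OF assms] by blast
  qed
  ultimately show "bij_betw ((`) h) (Field (face_lattice P)) (Field (face_lattice (h ` P)))"
    by (simp add: bij_betw_def Field_face_lattice)
  show "\<forall>F\<in>Field (face_lattice P). \<forall>G\<in>Field (face_lattice P).
      (F, G) \<in> face_lattice P \<longleftrightarrow> (h ` F, h ` G) \<in> face_lattice (h ` P)"
    using \<open>inj h\<close> by (simp add: face_lattice_iff face_of_linear_image[OF assms] inj_image_subset_iff)
qed

lemma poset_iso_trans:
  assumes "poset_iso \<phi> r s" "poset_iso \<psi> s t"
  shows "poset_iso (\<psi> \<circ> \<phi>) r t"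
  using assms by (auto simp: poset_iso_def intro: bij_betw_trans dest: bij_betwE)

lemma has_interval_polytopeI:
  fixes Q :: "'b::euclidean_space set"
  assumes "interval_polytope_of r Q"
  shows "has_interval_polytope r"
proof -
  obtain h :: "'b \<Rightarrow> (nat \<Rightarrow>\<^sub>0 real)" where h: "linear h" "inj h"
    using exists_linear_embedding_finite_support by blast
  have "polytope (h ` Q)"
    using assms h(1) unfolding interval_polytope_of_def polytope_def
    by (metis convex_hull_linear_image finite_imageI)
  then show ?thesis
    using assms poset_iso_trans[OF _ poset_iso_face_lattice_linear_image[OF h]]
    unfolding has_interval_polytope_def interval_polytope_of_def by metis
qed

lemma has_antiprismI:
  fixes Q :: "'b::euclidean_space set"
  assumes "antiprism_of r Q"
  shows "has_antiprism r"
proof -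
  obtain h :: "'b \<Rightarrow> (nat \<Rightarrow>\<^sub>0 real)" where h: "linear h" "inj h"
    using exists_linear_embedding_finite_support by blast
  have "polytope (h ` Q)"
    using assms h(1) unfolding antiprism_of_def polytope_def
    by (metis convex_hull_linear_image finite_imageI)
  then show ?thesis
    using assms poset_iso_trans[OF _ poset_iso_face_lattice_linear_image[OF h]]
    unfolding has_antiprism_def antiprism_of_def by metis
qed

end

theory Submission
  imports Defs
begin

text \<open>
  For each of the three notions, choosing points in the relative interiors of faces and functionals
  exposing faces produces two nonnegative matrices \<open>A\<close>, \<open>B\<close> whose zeros are the
  incidences of the poset, and a matrix \<open>N\<close> with \<open>N x y < N x x\<close> unless
  \<open>y \<le> x\<close>, which depends affinely on the points underlying \<open>A\<close> in one argument and
  on those underlying \<open>B\<close> in the other. Restricted to the vertices of a polygonal face,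
  \<open>A\<close> and \<open>B\<close> become two projective realizations \<open>a\<close>, \<open>b\<close> of a
  63-gon, and \<open>N\<close> becomes a singular linear map \<open>K\<close> with
  \<open>det (b\<^sub>i, K a\<^sub>i, b\<^sub>j) > 0\<close> for all \<open>i \<noteq> j\<close>.

  Such a map is invertible if both polygons are projectively close enough to a triangle: the
  inequalities for vertices near the three corners make the off-diagonal entries of \<open>K\<close> small
  and give all diagonal entries the same sign. Closeness can be expressed by finitely many conditions
  saying that three triangles spanned by vertices of the polygon have a common interior point, and some
  polygon fulfils them. A 4-polytope can enforce these conditions: over the polygon one erects a tower
  of layers of three vertices each. Layer \<open>l\<close> and the faces joining it to the edges of the
  polygon determine a point \<open>W\<^sub>l\<close> inside a triangle prescribed by the incidences, and
  faces containing two consecutive layers force \<open>W\<^sub>l = W\<^sub>l\<^sub>+\<^sub>1\<close>. Iterated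
  pyramids over this polytope give all larger dimensions.\<close>

text \<open>The vectors \<open>a i\<close> and \<open>b i\<close> are edge lines of the polygonal
  face, so the polygons being pinned are dual to it, and the point \<open>W l\<close> is the line in
  which the plane of layer \<open>l\<close> meets the plane of the face. \<open>K\<close> acts on an
  edge line through the difference of its two endpoints; it therefore kills the constant functional
  (the line at infinity), which makes it singular. The obstacle is that closeness to a triangle is
  metric, whereas the poset only knows incidences, and only up to projective maps. Three corners and
  one common point form a projective frame, which gives sizes below 1. Halving yields 1/2, and
  multiplying sizes taken at two corners squares the bound four times, down to 1/65536. Small sizes
  alone do not suffice: the two inequalities for the off-diagonal entries at a corner contract only
  if the product of two slopes stays away from 1. Hence the slopes are confined between 1/4 and 1,
  and one of them to less than 4/5. Ten vertices on each side of each of three corners make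
  63.\<close>

section \<open>Linear maps pinned at three corners\<close>

text \<open>Vectors in \<open>\<real>\<^sup>3\<close> are homogeneous coordinates in the plane.\<close>

type_synonym vec3 = "real \<times> real \<times> real"

fun det3 :: "vec3 \<Rightarrow> vec3 \<Rightarrow> vec3 \<Rightarrow> real" where
  "det3 (a, b, c) (d, e, f) (g, h, i) =
     a * (e * i - f * h) - b * (d * i - f * g) + c * (d * h - e * g)"

fun rot3 :: "vec3 \<Rightarrow> vec3" where
  "rot3 (x, y, z) = (y, z, x)"

fun mat_vec :: "vec3 \<times> vec3 \<times> vec3 \<Rightarrow> vec3 \<Rightarrow> vec3" where
  "mat_vec (r1, r2, r3) v = (r1 \<bullet> v, r2 \<bullet> v, r3 \<bullet> v)"

text \<open>The conjugate of the matrix by \<open>rot3\<close>: the effect of renaming the three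
  corners cyclically.\<close>

fun rot_mat :: "vec3 \<times> vec3 \<times> vec3 \<Rightarrow> vec3 \<times> vec3 \<times> vec3" where
  "rot_mat (r1, r2, r3) = (rot3 r2, rot3 r3, rot3 r1)"

fun mat_det :: "vec3 \<times> vec3 \<times> vec3 \<Rightarrow> real" where
  "mat_det (r1, r2, r3) = det3 r1 r2 r3"

lemma det3_rot3: "det3 (rot3 u) (rot3 v) (rot3 w) = det3 u v w"
proof -
  obtain a b c d e f g h i where "u = (a,b,c)" "v = (d,e,f)" "w = (g,h,i)"
    by (metis prod.exhaust)
  then show ?thesis by (simp add: algebra_simps)
qed

lemma mat_vec_rot: "mat_vec (rot_mat K) (rot3 v) = rot3 (mat_vec K v)"
proof -
  obtain a b c d e f g h i where K: "K = ((a,b,c),(d,e,f),(g,h,i))"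
    by (metis prod.exhaust)
  obtain x y z where v: "v = (x,y,z)" by (metis prod.exhaust)
  show ?thesis unfolding K v by (simp add: inner_prod_def)
qed

lemma mat_det_rot: "mat_det (rot_mat K) = mat_det K"
proof -
  obtain a b c d e f g h i where K: "K = ((a,b,c),(d,e,f),(g,h,i))"
    by (metis prod.exhaust)
  show ?thesis unfolding K by (simp, algebra)
qed

text \<open>Entries of a linear map with respect to bases given by the corners of two polygons. The slopes \<open>d, d', e, e'\<close>
  and the sizes \<open>\<eta>, \<xi>\<close> belong to vertices near the first corner.\<close>

definition corner_bound :: "vec3 \<times> vec3 \<times> vec3 \<Rightarrow> bool" where
  "corner_bound K \<longleftrightarrow> (case K of ((k11, k12, k13), (k21, k22, k23), (k31, k32, k33)) \<Rightarrow>
     \<exists>d d' e e' \<eta> \<xi>. 1/4 < d \<and> d < 1 \<and> 1/4 < d' \<and> d' < 1 \<and> d * d' < 4/5 \<and>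
       1/4 < e \<and> e < 1 \<and> 1/4 < e' \<and> e' < 1 \<and> 0 < \<eta> \<and> \<eta> \<le> 1/4096 \<and> 0 < \<xi> \<and> \<xi> \<le> 1/4096 \<and>
       0 < k21 \<and> k31 < 0 \<and> 0 < - k31 - d * k21 \<and> 0 < k21 + d' * k31 \<and>
       - k31 - d * k21 < \<eta> * (d * k22 - e * k33 + k32 - e * d * k23) \<and>
       k21 + d' * k31 < \<xi> * (e' * k22 - d' * k33 + e' * d' * k32 - k23))"

text \<open>The estimates \<open>v < d * u + B / 4096\<close> and
  \<open>u < d' * v + B / 4096\<close>, substituted into each other, contract with factor
  \<open>d * d' < 4/5\<close>. The constant 10 is 2 / (1 - 4/5).\<close>

lemma offdiag_bound:
  fixes u v d d' \<eta> \<xi> B \<beta> \<beta>' :: real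
  assumes d: "1/4 < d" "d < 1" "1/4 < d'" "d' < 1" "d * d' < 4/5"
    and s: "0 < \<eta>" "\<eta> \<le> 1/4096" "0 < \<xi>" "\<xi> \<le> 1/4096"
    and pos: "0 < u" "0 < v" "v - d * u < \<eta> * \<beta>" "u - d' * v < \<xi> * \<beta>'"
    and le: "\<beta> \<le> B" "\<beta>' \<le> B" "0 \<le> B"
  shows "u \<le> 10/4096 * B" "v \<le> 10/4096 * B"
proof -
  have "\<eta> * \<beta> \<le> 1/4096 * B" 
    using mult_left_mono[OF le(1), of \<eta>] mult_right_mono[OF s(2) le(3)] s by linarith
  then have v: "v - d * u < 1/4096 * B" using pos by linarith
  have "\<xi> * \<beta>' \<le> 1/4096 * B" 
    using mult_left_mono[OF le(2), of \<xi>] mult_right_mono[OF s(4) le(3)] s by linarith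
  then have u: "u - d' * v < 1/4096 * B" using pos by linarith
  have 1: "d * u - d * d' * v \<le> 1/4096 * B"
  proof -
    have "d * (u - d' * v) \<le> d * (1/4096 * B)" using u d by simp
    also have "\<dots> \<le> 1 * (1/4096 * B)" using d le by (intro mult_right_mono) auto
    finally show ?thesis by (simp add: algebra_simps)
  qed
  have "d * d' * v \<le> 4/5 * v" using d pos by (intro mult_right_mono) auto
  then show "v \<le> 10/4096 * B" using 1 v by linarith
  have 2: "d' * v - d * d' * u \<le> 1/4096 * B"
  proof -
    have "d' * (v - d * u) \<le> d' * (1/4096 * B)" using v d by simp
    also have "\<dots> \<le> 1 * (1/4096 * B)" using d le by (intro mult_right_mono) auto
    finally show ?thesis by (simp add: algebra_simps)
  qed
  have "d * d' * u \<le> 4/5 * u" using d pos by (intro mult_right_mono) auto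
  then show "u \<le> 10/4096 * B" using 2 u by linarith
qed

lemma bracket_le:
  fixes d e x y u v m N :: real
  assumes "0 < d" "d < 1" "0 < e" "e < 1" "\<bar>x\<bar> \<le> m" "\<bar>y\<bar> \<le> m" "0 < u" "0 < v" "u \<le> N" "v \<le> N"
  shows "d * x - e * y + u + e * d * v \<le> 2 * m + 2 * N"
proof -
  have "d * x \<le> 1 * m"
  proof (rule order_trans)
    show "d * x \<le> d * m" using assms by (intro mult_left_mono) auto
    show "d * m \<le> 1 * m" using assms by (intro mult_right_mono) auto
  qed
  moreover have "- (e * y) \<le> 1 * m"
  proof (rule order_trans)
    have "e * (- y) \<le> e * m" using assms by (intro mult_left_mono) auto
    then show "- (e * y) \<le> e * m" by simp
    show "e * m \<le> 1 * m" using assms by (intro mult_right_mono) auto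
  qed
  moreover have "e * d * v \<le> 1 * N"
  proof (rule mult_mono)
    show "e * d \<le> 1" using assms mult_mono[of e 1 d 1] by simp
  qed (use assms in auto)
  ultimately show ?thesis using assms by linarith
qed

text \<open>Positivity of a bracket in \<open>corner_bound\<close> links two diagonal entries: once
  the off-diagonal entries are small, a large positive \<open>y\<close> forces \<open>x\<close> to
  be nearly a quarter of it or more. With \<open>diag_step_neg\<close> for negative entries, this
  carries a sign around the three corners.\<close>

lemma diag_step_pos:
  fixes d e x y u v N :: real
  assumes "1/4 < d" "d < 1" "1/4 < e" "e < 1" "0 < u" "0 < v" "u \<le> N" "v \<le> N"
    and "0 < d * x - e * y + u + e * d * v" and "8 * N \<le> y"
  shows "y / 4 - 2 * N \<le> x"
proof -
  have "e * d * v \<le> 1 * N"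
  proof (rule mult_mono)
    show "e * d \<le> 1" using assms mult_mono[of e 1 d 1] by simp
  qed (use assms in auto)
  then have 1: "e * y - 2 * N < d * x" using assms by linarith
  have "1/4 * y \<le> e * y" using assms by (intro mult_right_mono) auto
  then have 2: "y / 4 - 2 * N < d * x" using 1 by linarith
  then have "0 < d * x" using assms by linarith
  then have "0 < x" using assms by (simp add: zero_less_mult_iff)
  then have "d * x \<le> 1 * x" using assms by (intro mult_right_mono) auto
  then show ?thesis using 2 by linarith
qed

lemma diag_step_neg:
  fixes d e x y u v N :: real
  assumes "1/4 < d" "d < 1" "1/4 < e" "e < 1" "0 < u" "0 < v" "u \<le> N" "v \<le> N"
    and "0 < d * x - e * y + u + e * d * v" and "x \<le> - 8 * N"
  shows "y \<le> x / 4 + 2 * N"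
proof -
  have "e * d * v \<le> 1 * N"
  proof (rule mult_mono)
    show "e * d \<le> 1" using assms mult_mono[of e 1 d 1] by simp
  qed (use assms in auto)
  then have 1: "e * y < d * x + 2 * N" using assms by linarith
  have "d * x \<le> 1/4 * x" using assms by (intro mult_right_mono_neg) auto
  then have 2: "e * y < x / 4 + 2 * N" using 1 by linarith
  then have "e * y < 0" using assms by linarith
  then have "y < 0" using assms by (simp add: mult_less_0_iff)
  then have "1 * y \<le> e * y" using assms by (intro mult_right_mono_neg) auto
  then show ?thesis using 2 by linarith
qed

lemma mult3_le:
  fixes a b c N :: real
  assumes "0 \<le> a" "0 \<le> b" "0 \<le> c" "a \<le> N" "b \<le> N" "c \<le> N"
  shows "a * b * c \<le> N * N * N"
  using assms by (intro mult_mono) auto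

text \<open>The largest diagonal entry exceeds every off-diagonal one by a factor 200 and passes its
  sign on to the other two, each keeping roughly a fourth of the size. The diagonal product then
  decides the sign of the determinant.\<close>

lemma corner_bounds_diag_max:
  assumes "corner_bound ((k11, k12, k13), (k21, k22, k23), (k31, k32, k33))"
    and "corner_bound ((k22, k23, k21), (k32, k33, k31), (k12, k13, k11))"
    and "corner_bound ((k33, k31, k32), (k13, k11, k12), (k23, k21, k22))"
    and max: "\<bar>k11\<bar> \<le> \<bar>k33\<bar>" "\<bar>k22\<bar> \<le> \<bar>k33\<bar>"
  shows "det3 (k11, k12, k13) (k21, k22, k23) (k31, k32, k33) \<noteq> 0"
proof -
  define m where "m = \<bar>k33\<bar>"
  \<comment> \<open>The three bounds fix the signs of the off-diagonal entries, so this is the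
    maximum of their absolute values.\<close>
  define N where "N = Max {k21, - k31, k32, - k12, k13, - k23}"
  have le: "k21 \<le> N" "- k31 \<le> N" "k32 \<le> N" "- k12 \<le> N" "k13 \<le> N" "- k23 \<le> N"
    by (simp_all add: N_def)
  obtain d1 d1' e1 e1' \<eta>1 \<xi>1 where c1: "1/4 < d1" "d1 < 1" "1/4 < d1'" "d1' < 1" "d1 * d1' < 4/5"
       "1/4 < e1" "e1 < 1" "1/4 < e1'" "e1' < 1" "0 < \<eta>1" "\<eta>1 \<le> 1/4096" "0 < \<xi>1" "\<xi>1 \<le> 1/4096"
       "0 < k21" "k31 < 0" "0 < - k31 - d1 * k21" "0 < k21 + d1' * k31"
       "- k31 - d1 * k21 < \<eta>1 * (d1 * k22 - e1 * k33 + k32 - e1 * d1 * k23)"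
       "k21 + d1' * k31 < \<xi>1 * (e1' * k22 - d1' * k33 + e1' * d1' * k32 - k23)"
    using assms(1) unfolding corner_bound_def by auto
  obtain d2 d2' e2 e2' \<eta>2 \<xi>2 where c2: "1/4 < d2" "d2 < 1" "1/4 < d2'" "d2' < 1" "d2 * d2' < 4/5"
       "1/4 < e2" "e2 < 1" "1/4 < e2'" "e2' < 1" "0 < \<eta>2" "\<eta>2 \<le> 1/4096" "0 < \<xi>2" "\<xi>2 \<le> 1/4096"
       "0 < k32" "k12 < 0" "0 < - k12 - d2 * k32" "0 < k32 + d2' * k12"
       "- k12 - d2 * k32 < \<eta>2 * (d2 * k33 - e2 * k11 + k13 - e2 * d2 * k31)"
       "k32 + d2' * k12 < \<xi>2 * (e2' * k33 - d2' * k11 + e2' * d2' * k13 - k31)"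
    using assms(2) unfolding corner_bound_def by auto
  obtain d3 d3' e3 e3' \<eta>3 \<xi>3 where c3: "1/4 < d3" "d3 < 1" "1/4 < d3'" "d3' < 1" "d3 * d3' < 4/5"
       "1/4 < e3" "e3 < 1" "1/4 < e3'" "e3' < 1" "0 < \<eta>3" "\<eta>3 \<le> 1/4096" "0 < \<xi>3" "\<xi>3 \<le> 1/4096"
       "0 < k13" "k23 < 0" "0 < - k23 - d3 * k13" "0 < k13 + d3' * k23"
       "- k23 - d3 * k13 < \<eta>3 * (d3 * k11 - e3 * k22 + k21 - e3 * d3 * k12)"
       "k13 + d3' * k23 < \<xi>3 * (e3' * k11 - d3' * k22 + e3' * d3' * k21 - k12)"
    using assms(3) unfolding corner_bound_def by auto
  have sg: "0 < k21" "k31 < 0" "0 < k32" "k12 < 0" "0 < k13" "k23 < 0"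
    using c1(14,15) c2(14,15) c3(14,15) by auto
  have N0: "0 < N" using le(1) sg(1) by linarith
  have m: "\<bar>k11\<bar> \<le> m" "\<bar>k22\<bar> \<le> m" "\<bar>k33\<bar> \<le> m" "0 \<le> m" using max by (auto simp: m_def)
  define B where "B = 2 * m + 2 * N"
  have B0: "0 \<le> B" using N0 m by (simp add: B_def)
  have b1: "d1 * k22 - e1 * k33 + k32 - e1 * d1 * k23 \<le> B" "e1' * k22 - d1' * k33 + e1' * d1' * k32 - k23 \<le> B"
    using bracket_le[of d1 e1 k22 m k33 k32 "-k23" N] bracket_le[of e1' d1' k22 m k33 "-k23" k32 N] c1 c2 c3 m le
    by (simp_all add: B_def mult.commute mult.left_commute)
  have b2: "d2 * k33 - e2 * k11 + k13 - e2 * d2 * k31 \<le> B" "e2' * k33 - d2' * k11 + e2' * d2' * k13 - k31 \<le> B"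
    using bracket_le[of d2 e2 k33 m k11 k13 "-k31" N] bracket_le[of e2' d2' k33 m k11 "-k31" k13 N] c1 c2 c3 m le
    by (simp_all add: B_def mult.commute mult.left_commute)
  have b3: "d3 * k11 - e3 * k22 + k21 - e3 * d3 * k12 \<le> B" "e3' * k11 - d3' * k22 + e3' * d3' * k21 - k12 \<le> B"
    using bracket_le[of d3 e3 k11 m k22 k21 "-k12" N] bracket_le[of e3' d3' k11 m k22 "-k12" k21 N] c1 c2 c3 m le
    by (simp_all add: B_def mult.commute mult.left_commute)
  have "k21 \<le> 10/4096 * B" "- k31 \<le> 10/4096 * B"
    using offdiag_bound[OF c1(1-5,10-13) _ _ _ _ b1 B0, of k21 "- k31"] c1 by auto
  moreover have "k32 \<le> 10/4096 * B" "- k12 \<le> 10/4096 * B"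
    using offdiag_bound[OF c2(1-5,10-13) _ _ _ _ b2 B0, of k32 "- k12"] c2 by auto
  moreover have "k13 \<le> 10/4096 * B" "- k23 \<le> 10/4096 * B"
    using offdiag_bound[OF c3(1-5,10-13) _ _ _ _ b3 B0, of k13 "- k23"] c3 by auto
  ultimately have "N \<le> 10/4096 * B" by (simp add: N_def)
  then have "N \<le> 10/4096 * (2 * m + 2 * N)" unfolding B_def .
  then have "N * 4076 \<le> m * 20" by (simp add: algebra_simps)
  then have Nm: "N \<le> m / 200" using m(4) by linarith
  have p1: "0 < d1 * k22 - e1 * k33 + k32 + e1 * d1 * (- k23)"
    using c1(10,16,18) by (smt (verit) mult_minus_right zero_less_mult_iff)
  have p2: "0 < d2 * k33 - e2 * k11 + k13 + e2 * d2 * (- k31)"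
    using c2(10,16,18) by (smt (verit) mult_minus_right zero_less_mult_iff)
  have p3: "0 < d3 * k11 - e3 * k22 + k21 + e3 * d3 * (- k12)"
    using c3(10,16,18) by (smt (verit) mult_minus_right zero_less_mult_iff)
  \<comment> \<open>Each diagonal entry is multiplied by a positive off-diagonal product, so these
    terms have the sign of the diagonal. Only one of the two cubic off-diagonal terms can oppose
    it.\<close>
  have det: "det3 (k11, k12, k13) (k21, k22, k23) (k31, k32, k33) =
    k11 * k22 * k33 + k11 * (- k23 * k32) + k22 * (- k31 * k13) + k33 * (- k12 * k21)
     - (- k12) * (- k23) * (- k31) + k13 * k21 * k32"
    by (simp add: algebra_simps)
  have cub: "(- k12) * (- k23) * (- k31) \<le> N * N * N" "k13 * k21 * k32 \<le> N * N * N"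
    by (rule mult3_le; use le sg in linarith)+
  have N3: "N * N * N \<le> (m/200) * (m/200) * (m/200)" using N0 Nm by (intro mult3_le) auto
  have m0: "0 < m" using N0 Nm by linarith
  then have m3: "0 < m * m * m" by simp
  show ?thesis
  proof (cases "0 \<le> k33")
    case True
    then have k33: "k33 = m" by (simp add: m_def)
    have "k33 / 4 - 2 * N \<le> k22"
      by (rule diag_step_pos[OF c1(1,2,6,7) _ _ le(3,6) p1]) (use sg Nm k33 N0 in auto)
    then have k22: "24/100 * m \<le> k22" using Nm k33 by linarith
    have "k22 / 4 - 2 * N \<le> k11"
      by (rule diag_step_pos[OF c3(1,2,6,7) _ _ le(1,4) p3]) (use sg Nm k22 N0 in auto)
    then have k11: "5/100 * m \<le> k11" using Nm k22 by linarith
    have "5/100 * m * (24/100 * m) * m \<le> k11 * k22 * k33"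
      using k11 k22 k33 m0 by (intro mult_mono) auto
    then have 1: "12/1000 * (m * m * m) \<le> k11 * k22 * k33" by (simp add: algebra_simps)
    have "0 < k11" "0 < k22" "0 < k33" using k11 k22 k33 m0 by linarith+
    then have "0 \<le> k11 * (- k23 * k32)" "0 \<le> k22 * (- k31 * k13)" "0 \<le> k33 * (- k12 * k21)"
      "0 \<le> k13 * k21 * k32"
      using sg by (auto intro!: mult_nonneg_nonneg mult_nonpos_nonneg simp: mult_le_0_iff)
    then have "0 < det3 (k11, k12, k13) (k21, k22, k23) (k31, k32, k33)"
      unfolding det using 1 cub N3 m3 by (simp add: algebra_simps)
    then show ?thesis by simp
  next
    case False
    then have k33: "k33 = - m" by (simp add: m_def)
    \<comment> \<open>A negative sign travels around the corners in the other direction, from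
      \<open>k33\<close> to \<open>k11\<close> and on to \<open>k22\<close>.\<close>
    have "k11 \<le> k33 / 4 + 2 * N"
      by (rule diag_step_neg[OF c2(1,2,6,7) _ _ le(5,2) p2]) (use sg Nm k33 N0 in auto)
    then have k11: "k11 \<le> - (24/100 * m)" using Nm k33 by linarith
    have "k22 \<le> k11 / 4 + 2 * N"
      by (rule diag_step_neg[OF c3(1,2,6,7) _ _ le(1,4) p3]) (use sg Nm k11 N0 in auto)
    then have k22: "k22 \<le> - (5/100 * m)" using Nm k11 by linarith
    have "(24/100 * m) * (5/100 * m) * m \<le> (- k11) * (- k22) * (- k33)"
      by (intro mult_mono mult_nonneg_nonneg; use k11 k22 k33 m0 in linarith)
    then have 1: "k11 * k22 * k33 \<le> - (12/1000 * (m * m * m))" by (simp add: algebra_simps)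
    have "k11 < 0" "k22 < 0" "k33 < 0" using k11 k22 k33 m0 by linarith+
    then have "k11 * (- k23 * k32) \<le> 0" "k22 * (- k31 * k13) \<le> 0" "k33 * (- k12 * k21) \<le> 0"
      "0 \<le> (- k12) * (- k23) * (- k31)"
      using sg by (auto intro!: mult_nonneg_nonneg mult_nonpos_nonneg simp: mult_le_0_iff zero_le_mult_iff)
    then have "det3 (k11, k12, k13) (k21, k22, k23) (k31, k32, k33) < 0"
      unfolding det using 1 cub N3 m3 by (simp add: algebra_simps)
    then show ?thesis by simp
  qed
qed

text \<open>Conjugation by \<open>rot3\<close> brings any diagonal entry to the last place, so the
  largest may be assumed there.\<close>

lemma corner_bounds_mat_det:
  assumes "corner_bound K" "corner_bound (rot_mat K)" "corner_bound (rot_mat (rot_mat K))"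
  shows "mat_det K \<noteq> 0"
proof -
  obtain a b c d e f g h i where K: "K = ((a,b,c),(d,e,f),(g,h,i))"
    by (metis prod.exhaust)
  consider "\<bar>a\<bar> \<le> \<bar>i\<bar> \<and> \<bar>e\<bar> \<le> \<bar>i\<bar>" | "\<bar>e\<bar> \<le> \<bar>a\<bar> \<and> \<bar>i\<bar> \<le> \<bar>a\<bar>" | "\<bar>a\<bar> \<le> \<bar>e\<bar> \<and> \<bar>i\<bar> \<le> \<bar>e\<bar>"
    by linarith
  then show ?thesis
  proof cases
    case 1
    then show ?thesis using corner_bounds_diag_max[of a b c d e f g h i] assms unfolding K by simp
  next
    case 2
    then have "mat_det (rot_mat K) \<noteq> 0"
      using corner_bounds_diag_max[of e f d h i g b c a] assms unfolding K by simp
    then show ?thesis by (simp add: mat_det_rot)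
  next
    case 3
    then have "mat_det (rot_mat (rot_mat K)) \<noteq> 0"
      using corner_bounds_diag_max[of i g h c a b f d e] assms unfolding K by simp
    then show ?thesis by (simp add: mat_det_rot)
  qed
qed

section \<open>Triangles with a common point\<close>

text \<open>The open triangle \<open>u v w\<close> in homogeneous form; rescaling a corner by a
  positive factor does not change it.\<close>

definition open_cone :: "vec3 \<Rightarrow> vec3 \<Rightarrow> vec3 \<Rightarrow> vec3 set" where
  "open_cone u v w = {p *\<^sub>R u + q *\<^sub>R v + r *\<^sub>R w | p q r. 0 < p \<and> 0 < q \<and> 0 < r}"

section \<open>Comparing sizes and slopes through a common point of three triangles\<close>

lemma open_cone_halfplanes:
  fixes p1 p2 p3 :: real
  assumes W: "(X, Y, Z) \<in> open_cone u v w" and "0 < p1" "0 < p2" "0 < p3" "0 < x"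
  shows "u = (0, p2, 0) \<Longrightarrow> v = (0, 0, p3) \<Longrightarrow> w = (x, - \<theta> * x, \<xi> * x) \<Longrightarrow> 0 < X \<and> \<xi> * X < Z"
    and "u = (0, 0, p3) \<Longrightarrow> v = (0, p2, 0) \<Longrightarrow> w = (x, \<eta> * x, - \<delta> * x) \<Longrightarrow> 0 < X \<and> \<eta> * X < Y"
    and "u = (p1, 0, 0) \<Longrightarrow> v = (0, p2, 0) \<Longrightarrow> w = (- \<delta> * x, x, \<phi> * x) \<Longrightarrow> 0 < \<phi> \<Longrightarrow> 0 < Y \<and> Z < \<phi> * Y"
    and "u = (p1, 0, 0) \<Longrightarrow> v = (0, 0, p3) \<Longrightarrow> w = (- \<theta> * x, \<phi> * x, x) \<Longrightarrow> 0 < \<phi> \<Longrightarrow> 0 < Z \<and> Y < \<phi> * Z"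
    and "u = (0, 0, p3) \<Longrightarrow> v = (p1, 0, 0) \<Longrightarrow> w = (x, \<eta> * x, - \<delta> * x) \<Longrightarrow> 0 < \<eta> \<Longrightarrow> 0 < X \<and> Y < \<eta> * X"
    and "u = (0, p2, 0) \<Longrightarrow> v = (p1, 0, 0) \<Longrightarrow> w = (x, - \<theta> * x, \<xi> * x) \<Longrightarrow> 0 < \<xi> \<Longrightarrow> 0 < X \<and> Z < \<xi> * X"
    and "u = (p1, 0, 0) \<Longrightarrow> v = (0, p2, 0) \<Longrightarrow> w = (x, \<eta> * x, - \<delta> * x) \<Longrightarrow> 0 < \<delta> \<Longrightarrow> Z < 0"
    and "u = (p1, 0, 0) \<Longrightarrow> v = (0, 0, p3) \<Longrightarrow> w = (x, - \<theta> * x, \<xi> * x) \<Longrightarrow> 0 < \<theta> \<Longrightarrow> Y < 0"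
    and "u = (p1, 0, 0) \<Longrightarrow> v = (0, p2, 0) \<Longrightarrow> w = (0, 0, p3) \<Longrightarrow> 0 < X \<and> 0 < Y \<and> 0 < Z"
  using W assms(2-) by (auto simp: open_cone_def algebra_simps intro!: add_pos_pos mult_pos_pos)

text \<open>The triangles give the chain
  \<open>\<xi> * X < Z < \<phi> * Y < \<phi> * \<eta> * X\<close>. In the application
  \<open>\<phi>\<close> is a size at another corner than \<open>\<xi>\<close> and
  \<open>\<eta>\<close>.\<close>

lemma size_product_xi:
  fixes p1 p2 p3 :: real
  assumes "0 < p1" "0 < p2" "0 < p3" "0 < x" "0 < x'" "0 < x''" "0 < \<phi>" "0 < \<eta>"
    and "W \<in> open_cone (0, p2, 0) (0, 0, p3) (x, - \<theta> * x, \<xi> * x)"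
    and "W \<in> open_cone (p1, 0, 0) (0, p2, 0) (- \<delta>' * x', x', \<phi> * x')"
    and "W \<in> open_cone (0, 0, p3) (p1, 0, 0) (x'', \<eta> * x'', - \<delta> * x'')"
  shows "\<xi> < \<phi> * \<eta>"
proof -
  obtain X Y Z where W: "W = (X, Y, Z)" by (metis prod.exhaust)
  have 1: "0 < X" "\<xi> * X < Z" using open_cone_halfplanes(1)[OF assms(9)[unfolded W]] assms by auto
  have 2: "Z < \<phi> * Y" using open_cone_halfplanes(3)[OF assms(10)[unfolded W]] assms by auto
  have 3: "Y < \<eta> * X" using open_cone_halfplanes(5)[OF assms(11)[unfolded W]] assms by auto
  have "\<phi> * Y < \<phi> * \<eta> * X" using mult_strict_left_mono[OF 3, of \<phi>] assms by (simp add: mult.assoc)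
  then have "\<xi> * X < \<phi> * \<eta> * X" using 1 2 by linarith
  then show ?thesis using 1 by (simp only: mult_less_cancel_right_pos)
qed

lemma size_product_eta:
  fixes p1 p2 p3 :: real
  assumes "0 < p1" "0 < p2" "0 < p3" "0 < x" "0 < x'" "0 < x''" "0 < \<phi>" "0 < \<xi>"
    and "W \<in> open_cone (0, 0, p3) (0, p2, 0) (x, \<eta> * x, - \<delta> * x)"
    and "W \<in> open_cone (p1, 0, 0) (0, 0, p3) (- \<theta>' * x', \<phi> * x', x')"
    and "W \<in> open_cone (0, p2, 0) (p1, 0, 0) (x'', - \<theta> * x'', \<xi> * x'')"
  shows "\<eta> < \<phi> * \<xi>"
proof -
  obtain X Y Z where W: "W = (X, Y, Z)" by (metis prod.exhaust)
  have 1: "0 < X" "\<eta> * X < Y" using open_cone_halfplanes(2)[OF assms(9)[unfolded W]] assms by auto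
  have 2: "Y < \<phi> * Z" using open_cone_halfplanes(4)[OF assms(10)[unfolded W]] assms by auto
  have 3: "Z < \<xi> * X" using open_cone_halfplanes(6)[OF assms(11)[unfolded W]] assms by auto
  have "\<phi> * Z < \<phi> * \<xi> * X" using mult_strict_left_mono[OF 3, of \<phi>] assms by (simp add: mult.assoc)
  then have "\<eta> * X < \<phi> * \<xi> * X" using 1 2 by linarith
  then show ?thesis using 1 by (simp only: mult_less_cancel_right_pos)
qed

text \<open>From \<open>Y < q * \<eta>\<close> and \<open>Y < p * \<xi>\<close> follows
  \<open>Y / \<eta> + Y / \<xi> < p + q < Y / c\<close>, so \<open>c\<close> is below half the
  harmonic mean of \<open>\<eta>\<close> and \<open>\<xi>\<close>.\<close>

lemma size_halving_aux:
  fixes X Y Z o' p q \<eta> \<xi> \<theta> \<delta> c :: real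
  assumes "0 < o'" "0 < p" "0 < q" "0 < \<eta>" "0 < \<xi>" "0 < \<theta>" "0 < \<delta>" "0 < c"
    and "X = o' + p + q" "Y = q * \<eta> - p * \<theta>" "Z = p * \<xi> - q * \<delta>" "c * X < Y" "Y < Z"
  shows "c * (\<eta> + \<xi>) < \<eta> * \<xi>"
proof -
  have "c * (p + q) < Y"
  proof -
    have "c * (p + q) < c * X" using assms by simp
    then show ?thesis using assms by linarith
  qed
  moreover have "Y < q * \<eta>" "Y < p * \<xi>" using assms mult_pos_pos[of p \<theta>] mult_pos_pos[of q \<delta>] by linarith+
  ultimately have 1: "c * (p + q) * (\<eta> + \<xi>) < Y * (\<eta> + \<xi>)" and 2: "Y * \<xi> + Y * \<eta> < q * \<eta> * \<xi> + p * \<xi> * \<eta>"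
    using assms by (auto intro!: add_strict_mono)
  have "(p + q) * (c * (\<eta> + \<xi>)) < (p + q) * (\<eta> * \<xi>)" using 1 2 by (simp add: algebra_simps)
  then show ?thesis using assms by simp
qed

lemma size_halving_eta:
  fixes p1 p2 p3 :: real
  assumes "0 < p1" "0 < p2" "0 < p3" "0 < x" "0 < x'" "0 < y" "0 < y'" "0 < \<phi>" "\<phi> \<le> 1" "0 < \<xi>" "0 < \<eta>" "0 < \<theta>" "0 < \<delta>" "0 < c"
    and "W \<in> open_cone (0, 0, p3) (0, p2, 0) (x, c * x, - \<delta>'' * x)"
    and "W \<in> open_cone (p1, 0, 0) (0, 0, p3) (- \<theta>' * x', \<phi> * x', x')"
    and "W \<in> open_cone (p1, 0, 0) (y, \<eta> * y, - \<delta> * y) (y', - \<theta> * y', \<xi> * y')"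
  shows "c * (\<eta> + \<xi>) < \<eta> * \<xi>"
proof -
  obtain X Y Z where W: "W = (X, Y, Z)" by (metis prod.exhaust)
  have 1: "0 < X" "c * X < Y" using open_cone_halfplanes(2)[OF assms(15)[unfolded W]] assms by auto
  have 2: "Y < \<phi> * Z" "0 < Z" using open_cone_halfplanes(4)[OF assms(16)[unfolded W]] assms by auto
  then have "Y < Z" using mult_right_mono[OF assms(9), of Z] by linarith
  moreover obtain p q r where "0 < p" "0 < q" "0 < r" "X = p * p1 + r * y' + q * y" "Y = q * y * \<eta> - r * y' * \<theta>" "Z = r * y' * \<xi> - q * y * \<delta>"
    using assms(17) unfolding W open_cone_def by (auto simp: algebra_simps)
  ultimately show ?thesis using 1 assms
    by (intro size_halving_aux[of "p * p1" "r * y'" "q * y" \<eta> \<xi> \<theta> \<delta> c X Y Z]) auto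
qed

lemma size_halving_xi:
  fixes p1 p2 p3 :: real
  assumes "0 < p1" "0 < p2" "0 < p3" "0 < x" "0 < x'" "0 < y" "0 < y'" "0 < \<phi>" "\<phi> \<le> 1" "0 < \<xi>" "0 < \<eta>" "0 < \<theta>" "0 < \<delta>" "0 < c"
    and "W \<in> open_cone (0, p2, 0) (0, 0, p3) (x, - \<theta>'' * x, c * x)"
    and "W \<in> open_cone (p1, 0, 0) (0, p2, 0) (- \<delta>' * x', x', \<phi> * x')"
    and "W \<in> open_cone (p1, 0, 0) (y, \<eta> * y, - \<delta> * y) (y', - \<theta> * y', \<xi> * y')"
  shows "c * (\<eta> + \<xi>) < \<eta> * \<xi>"
proof -
  obtain X Y Z where W: "W = (X, Y, Z)" by (metis prod.exhaust)
  have 1: "0 < X" "c * X < Z" using open_cone_halfplanes(1)[OF assms(15)[unfolded W]] assms by auto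
  have 2: "Z < \<phi> * Y" "0 < Y" using open_cone_halfplanes(3)[OF assms(16)[unfolded W]] assms by auto
  then have "Z < Y" using mult_right_mono[OF assms(9), of Y] by linarith
  moreover obtain p q r where "0 < p" "0 < q" "0 < r" "X = p * p1 + q * y + r * y'" "Y = q * y * \<eta> - r * y' * \<theta>" "Z = r * y' * \<xi> - q * y * \<delta>"
    using assms(17) unfolding W open_cone_def by (auto simp: algebra_simps)
  ultimately have "c * (\<xi> + \<eta>) < \<xi> * \<eta>" using 1 assms
    by (intro size_halving_aux[of "p * p1" "q * y" "r * y'" \<xi> \<eta> \<delta> \<theta> c X Z Y]) auto
  then show ?thesis by (simp add: algebra_simps)
qed

lemma chord_mult:
  fixes p q a b c d :: real
  assumes "p * a < q * b" "q * c < p * d" "0 < p" "0 < q" "0 < c" "0 < a"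
  shows "a * c < b * d"
proof -
  have "p * a * (q * c) < q * b * (p * d)"
    using assms by (intro mult_strict_mono'[of "p * a" "q * b" "q * c" "p * d"]) simp_all
  then have "(p * q) * (a * c) < (p * q) * (b * d)" by (simp add: algebra_simps)
  then show ?thesis using assms by simp
qed

text \<open>In the chart \<open>X = 1\<close> the chord from \<open>(\<eta>, - \<delta>)\<close> to
  \<open>(- \<theta>, \<xi>)\<close> crosses the axis \<open>Z = 0\<close> at
  \<open>(\<xi> * \<eta> - \<delta> * \<theta>) / (\<xi> + \<delta>)\<close>; the conclusion says
  that this crossing lies below \<open>c\<close>.\<close>

lemma slope_lower_w:
  fixes p1 p2 p3 :: real
  assumes "0 < p1" "0 < p2" "0 < p3" "0 < x" "0 < y" "0 < y'" "0 < \<xi>" "0 < \<eta>" "0 < \<theta>" "0 < \<delta>" "0 < c" "c < \<eta>"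
    and "W \<in> open_cone (0, 0, p3) (p1, 0, 0) (x, c * x, - \<delta>'' * x)"
    and "W \<in> open_cone (p1, 0, 0) (0, p2, 0) (y, \<eta> * y, - \<delta> * y)"
    and "W \<in> open_cone (0, p2, 0) (y, \<eta> * y, - \<delta> * y) (y', - \<theta> * y', \<xi> * y')"
  shows "\<xi> * (\<eta> - c) < \<delta> * (c + \<theta>)"
proof -
  obtain X Y Z where W: "W = (X, Y, Z)" by (metis prod.exhaust)
  have 1: "0 < X" "Y < c * X" using open_cone_halfplanes(5)[OF assms(13)[unfolded W]] assms by auto
  have 2: "Z < 0" using open_cone_halfplanes(7)[OF assms(14)[unfolded W]] assms by auto
  obtain t a b where pq: "0 < t" "0 < a" "0 < b" "X = a + b" "Y = t + a * \<eta> - b * \<theta>" "Z = b * \<xi> - a * \<delta>"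
  proof -
    obtain p q r where "0 < p" "0 < q" "0 < r" and "W = p *\<^sub>R (0, p2, 0) + q *\<^sub>R (y, \<eta> * y, - \<delta> * y) + r *\<^sub>R (y', - \<theta> * y', \<xi> * y')"
      using assms(15) unfolding open_cone_def by blast
    then show thesis using assms(1-6)
      by (intro that[of "p * p2" "q * y" "r * y'"]) (auto simp: W algebra_simps)
  qed
  have "b * \<xi> < a * \<delta>" using 2 pq by simp
  moreover have "a * (\<eta> - c) < b * (c + \<theta>)"
    using 1 pq assms by (simp add: algebra_simps)
  ultimately show ?thesis using pq assms chord_mult[of "b" \<xi> "a" \<delta> "\<eta> - c" "c + \<theta>"] by simp
qed

lemma slope_lower_u:
  fixes p1 p2 p3 :: real
  assumes "0 < p1" "0 < p2" "0 < p3" "0 < x" "0 < y" "0 < y'" "0 < \<xi>" "0 < \<eta>" "0 < \<theta>" "0 < \<delta>" "0 < c" "c < \<xi>"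
    and "W \<in> open_cone (0, p2, 0) (p1, 0, 0) (x, - \<theta>'' * x, c * x)"
    and "W \<in> open_cone (p1, 0, 0) (0, 0, p3) (y', - \<theta> * y', \<xi> * y')"
    and "W \<in> open_cone (0, 0, p3) (y, \<eta> * y, - \<delta> * y) (y', - \<theta> * y', \<xi> * y')"
  shows "\<eta> * (\<xi> - c) < \<theta> * (c + \<delta>)"
proof -
  obtain X Y Z where W: "W = (X, Y, Z)" by (metis prod.exhaust)
  have 1: "0 < X" "Z < c * X" using open_cone_halfplanes(6)[OF assms(13)[unfolded W]] assms by auto
  have 2: "Y < 0" using open_cone_halfplanes(8)[OF assms(14)[unfolded W]] assms by auto
  obtain t a b where pq: "0 < t" "0 < a" "0 < b" "X = a + b" "Y = a * \<eta> - b * \<theta>" "Z = t + b * \<xi> - a * \<delta>"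
  proof -
    obtain p q r where "0 < p" "0 < q" "0 < r" and "W = p *\<^sub>R (0, 0, p3) + q *\<^sub>R (y, \<eta> * y, - \<delta> * y) + r *\<^sub>R (y', - \<theta> * y', \<xi> * y')"
      using assms(15) unfolding open_cone_def by blast
    then show thesis using assms(1-6)
      by (intro that[of "p * p3" "q * y" "r * y'"]) (auto simp: W algebra_simps)
  qed
  have "a * \<eta> < b * \<theta>" using 2 pq by simp
  moreover have "b * (\<xi> - c) < a * (c + \<delta>)"
    using 1 pq assms by (simp add: algebra_simps)
  ultimately show ?thesis using pq assms chord_mult[of "a" \<eta> "b" \<theta> "\<xi> - c" "c + \<delta>"] by simp
qed

text \<open>Here \<open>W\<close> lies between corner 0 and the chord, so \<open>c * X < Y\<close>
  and \<open>0 < Z\<close> push the crossing of the chord with \<open>Z = 0\<close> beyond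
  \<open>c\<close>.\<close>

lemma slope_upper_w:
  fixes p1 p2 p3 :: real
  assumes "0 < p1" "0 < p2" "0 < p3" "0 < x" "0 < y" "0 < y'" "0 < \<xi>" "0 < \<eta>" "0 < \<theta>" "0 < \<delta>" "0 < c" "c < \<eta>"
    and "W \<in> open_cone (0, 0, p3) (0, p2, 0) (x, c * x, - \<delta>'' * x)"
    and "W \<in> open_cone (p1, 0, 0) (0, p2, 0) (0, 0, p3)"
    and "W \<in> open_cone (p1, 0, 0) (y, \<eta> * y, - \<delta> * y) (y', - \<theta> * y', \<xi> * y')"
  shows "\<delta> * (c + \<theta>) < \<xi> * (\<eta> - c)"
proof -
  obtain X Y Z where W: "W = (X, Y, Z)" by (metis prod.exhaust)
  have 1: "0 < X" "c * X < Y" using open_cone_halfplanes(2)[OF assms(13)[unfolded W]] assms by auto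
  have 2: "0 < Z" using open_cone_halfplanes(9)[OF assms(14)[unfolded W]] assms by auto
  obtain t a b where pq: "0 < t" "0 < a" "0 < b" "X = t + a + b" "Y = a * \<eta> - b * \<theta>" "Z = b * \<xi> - a * \<delta>"
  proof -
    obtain p q r where "0 < p" "0 < q" "0 < r" and "W = p *\<^sub>R (p1, 0, 0) + q *\<^sub>R (y, \<eta> * y, - \<delta> * y) + r *\<^sub>R (y', - \<theta> * y', \<xi> * y')"
      using assms(15) unfolding open_cone_def by blast
    then show thesis using assms(1-6)
      by (intro that[of "p * p1" "q * y" "r * y'"]) (auto simp: W algebra_simps)
  qed
  have "a * \<delta> < b * \<xi>" using 2 pq by simp
  moreover have "b * (c + \<theta>) < a * (\<eta> - c)"
    using 1 pq mult_pos_pos[OF assms(11) pq(1)] distrib_left[of c t "a + b"]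
    by (simp add: algebra_simps del: zero_less_mult_iff; linarith)
  ultimately show ?thesis using pq assms chord_mult[of "a" \<delta> "b" \<xi> "c + \<theta>" "\<eta> - c"] by simp
qed

lemma slope_upper_u:
  fixes p1 p2 p3 :: real
  assumes "0 < p1" "0 < p2" "0 < p3" "0 < x" "0 < y" "0 < y'" "0 < \<xi>" "0 < \<eta>" "0 < \<theta>" "0 < \<delta>" "0 < c" "c < \<xi>"
    and "W \<in> open_cone (0, p2, 0) (0, 0, p3) (x, - \<theta>'' * x, c * x)"
    and "W \<in> open_cone (p1, 0, 0) (0, p2, 0) (0, 0, p3)"
    and "W \<in> open_cone (p1, 0, 0) (y, \<eta> * y, - \<delta> * y) (y', - \<theta> * y', \<xi> * y')"
  shows "\<theta> * (c + \<delta>) < \<eta> * (\<xi> - c)"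
proof -
  obtain X Y Z where W: "W = (X, Y, Z)" by (metis prod.exhaust)
  have 1: "0 < X" "c * X < Z" using open_cone_halfplanes(1)[OF assms(13)[unfolded W]] assms by auto
  have 2: "0 < Y" using open_cone_halfplanes(9)[OF assms(14)[unfolded W]] assms by auto
  obtain t a b where pq: "0 < t" "0 < a" "0 < b" "X = t + a + b" "Y = a * \<eta> - b * \<theta>" "Z = b * \<xi> - a * \<delta>"
  proof -
    obtain p q r where "0 < p" "0 < q" "0 < r" and "W = p *\<^sub>R (p1, 0, 0) + q *\<^sub>R (y, \<eta> * y, - \<delta> * y) + r *\<^sub>R (y', - \<theta> * y', \<xi> * y')"
      using assms(15) unfolding open_cone_def by blast
    then show thesis using assms(1-6)
      by (intro that[of "p * p1" "q * y" "r * y'"]) (auto simp: W algebra_simps)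
  qed
  have "b * \<theta> < a * \<eta>" using 2 pq by simp
  moreover have "a * (c + \<delta>) < b * (\<xi> - c)"
    using 1 pq mult_pos_pos[OF assms(11) pq(1)] distrib_left[of c t "a + b"]
    by (simp add: algebra_simps del: zero_less_mult_iff; linarith)
  ultimately show ?thesis using pq assms chord_mult[of "b" \<theta> "a" \<eta> "c + \<delta>" "\<xi> - c"] by simp
qed

text \<open>In the coordinates of \<open>w_form\<close> and \<open>u_form\<close> below, the first two families bound the sizes of the
  vertices \<open>10 - k\<close> and \<open>53 + k\<close> by half the harmonic mean of earlier sizes, the next two bound them by products of
  earlier sizes. The last four families confine the slopes of the vertices 5 and 59.\<close>

definition corner_constraints :: "(nat \<times> nat \<times> nat) list list" where
  "corner_constraints =
    [[(21, 42, 53 + c), (0, 21, 31), (0, 10 - b, 53 + a)]. (c, a, b) \<leftarrow> [(1, 0, 0), (7, 6, 6)]] @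
    [[(42, 21, 10 - c), (0, 42, 32), (0, 10 - b, 53 + a)]. (c, a, b) \<leftarrow> [(1, 0, 0), (6, 5, 5)]] @
    [[(21, 42, 53 + a), (0, 21, 31 - k), (42, 0, 10 - c)].
      (a, k, c) \<leftarrow> [(2, 1, 1), (3, 2, 2), (4, 3, 3), (5, 4, 4), (5, 0, 5), (7, 0, 7), (9, 0, 9)]] @
    [[(42, 21, 10 - c), (0, 42, 32 + k), (21, 0, 53 + a)].
      (c, k, a) \<leftarrow> [(2, 1, 1), (3, 2, 2), (4, 3, 3), (5, 4, 4), (6, 0, 6), (8, 0, 8)]] @
    [[(42, 0, 10 - c), (0, 21, 10 - b), (21, 10 - b, 53 + a)]. (a, b, c) \<leftarrow> [(6, 5, 6)]] @
    [[(21, 0, 53 + c), (0, 42, 53 + b), (42, 10 - a, 53 + b)]. (a, b, c) \<leftarrow> [(7, 6, 7)]] @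
    [[(42, 21, 10 - c), (0, 21, 42), (0, 10 - b, 53 + a)]. (a, b, c) \<leftarrow> [(7, 5, 7), (9, 7, 9)]] @
    [[(21, 42, 53 + c), (0, 21, 42), (0, 10 - a, 53 + b)]. (a, b, c) \<leftarrow> [(8, 6, 8)]]"

definition cones_meet :: "(nat \<Rightarrow> vec3) \<Rightarrow> (nat \<times> nat \<times> nat) list \<Rightarrow> bool" where
  "cones_meet a cs \<longleftrightarrow>
    (\<exists>W. \<forall>c \<in> set cs. W \<in> open_cone (a (fst c)) (a (fst (snd c))) (a (snd (snd c))))"

definition convex_polygon :: "(nat \<Rightarrow> vec3) \<Rightarrow> bool" where
  "convex_polygon a \<longleftrightarrow> (\<forall>i j k. i < j \<longrightarrow> j < k \<longrightarrow> k < 63 \<longrightarrow> 0 < det3 (a i) (a j) (a k))"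

text \<open>The vertices 0, 21, 42 and the point \<open>(1, 1, 1)\<close> form a projective frame,
  which uses up the freedom of projective maps. The three triangles around \<open>(1, 1, 1)\<close>
  start the size estimates; the shift by \<open>21 * s\<close> imposes each constraint at every
  corner.\<close>

definition normalized :: "(nat \<Rightarrow> vec3) \<Rightarrow> bool" where
  "normalized a \<longleftrightarrow> convex_polygon a \<and>
    (\<exists>p>0. a 0 = (p, 0, 0)) \<and> (\<exists>p>0. a 21 = (0, p, 0)) \<and> (\<exists>p>0. a 42 = (0, 0, p)) \<and>
    (1, 1, 1) \<in> open_cone (a 0) (a 31) (a 32) \<and> (1, 1, 1) \<in> open_cone (a 21) (a 52) (a 53) \<and>
    (1, 1, 1) \<in> open_cone (a 42) (a 10) (a 11) \<and>
    (\<forall>s<3. \<forall>c\<in>set corner_constraints. cones_meet (\<lambda>i. a ((i + 21 * s) mod 63)) c)"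

text \<open>Makes corner 21 the new corner 0, in the indices as well as in the coordinates, so that
  results at corner 0 cover all three corners.\<close>

definition rotate_polygon :: "(nat \<Rightarrow> vec3) \<Rightarrow> nat \<Rightarrow> vec3" where
  "rotate_polygon a = (\<lambda>i. rot3 (a ((i + 21) mod 63)))"

lemma det3_cycle: "det3 u v w = det3 v w u"
proof -
  obtain a b c d e f g h i where "u = (a,b,c)" "v = (d,e,f)" "w = (g,h,i)"
    by (metis prod.exhaust)
  then show ?thesis by (simp add: algebra_simps)
qed

lemma convex_polygon_rotate_polygon: assumes "convex_polygon a" shows "convex_polygon (rotate_polygon a)"
  unfolding convex_polygon_def
proof (intro allI impI)
  fix i j k :: nat assume "i < j" "j < k" "k < 63"
  have pos: "0 < det3 (a i) (a j) (a k)" if "i < j" "j < k" "k < 63" for i j k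
    using assms that by (auto simp: convex_polygon_def)
  have m: "(x + 21) mod 63 = (if x < 42 then x + 21 else x - 42)" if "x < 63" for x :: nat
    using that by (auto simp: mod_if)
  show "0 < det3 (rotate_polygon a i) (rotate_polygon a j) (rotate_polygon a k)"
    unfolding rotate_polygon_def det3_rot3
    using \<open>i < j\<close> \<open>j < k\<close> \<open>k < 63\<close> pos[of "i + 21" "j + 21" "k + 21"] pos[of "k - 42" "i + 21" "j + 21"]
      pos[of "j - 42" "k - 42" "i + 21"] pos[of "i - 42" "j - 42" "k - 42"]
    by (auto simp: m det3_cycle[of "a (k - 42)"] det3_cycle[of "a (i + 21)" "a (j - 42)" "a (k - 42)"])
qed

lemma rot3_linear: "rot3 (u + v) = rot3 u + rot3 v" "rot3 (c *\<^sub>R u) = c *\<^sub>R rot3 u"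
  by (cases u; cases v; simp)+

lemma rot3_open_cone: "W \<in> open_cone u v w \<Longrightarrow> rot3 W \<in> open_cone (rot3 u) (rot3 v) (rot3 w)"
  unfolding open_cone_def mem_Collect_eq by (metis rot3_linear)

lemma cones_meet_rot3: "cones_meet a cs \<Longrightarrow> cones_meet (\<lambda>i. rot3 (a i)) cs"
  unfolding cones_meet_def using rot3_open_cone by metis

lemma normalized_rotate_polygon: assumes "normalized a" shows "normalized (rotate_polygon a)"
proof -
  note n = assms[unfolded normalized_def]
  have "cones_meet (\<lambda>i. rotate_polygon a ((i + 21 * s) mod 63)) c" if "s < 3" "c \<in> set corner_constraints" for s c
  proof -
    define s' where "s' = (if s = 2 then 0 else s + 1)"
    have "s' < 3" using that(1) by (auto simp: s'_def)
    then have *: "cones_meet (\<lambda>i. a ((i + 21 * s') mod 63)) c" using n that(2) by blast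
    have "((i + 21 * s) mod 63 + 21) mod 63 = (i + 21 * s') mod 63" for i
    proof (cases "s = 2")
      case True
      have "(i + 21 * 2 + 21) mod 63 = (i + 63) mod 63" by (simp add: add.assoc)
      also have "\<dots> = i mod 63" by (rule mod_add_self2)
      finally show ?thesis using True by (simp add: s'_def mod_add_left_eq)
    next
      case False
      moreover have "i + 21 * s + 21 = i + 21 * (s + 1)" by simp
      ultimately show ?thesis by (simp only: s'_def if_False mod_add_left_eq)
    qed
    then show ?thesis unfolding rotate_polygon_def using cones_meet_rot3[OF *] by (simp only:)
  qed
  moreover have "(1, 1, 1) \<in> open_cone (rotate_polygon a 0) (rotate_polygon a 31) (rotate_polygon a 32)" "(1, 1, 1) \<in> open_cone (rotate_polygon a 21) (rotate_polygon a 52) (rotate_polygon a 53)"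
    "(1, 1, 1) \<in> open_cone (rotate_polygon a 42) (rotate_polygon a 10) (rotate_polygon a 11)"
    using n rot3_open_cone[of "(1, 1, 1)" "a 21" "a 52" "a 53"] rot3_open_cone[of "(1, 1, 1)" "a 42" "a 10" "a 11"]
      rot3_open_cone[of "(1, 1, 1)" "a 0" "a 31" "a 32"] by (simp_all add: rotate_polygon_def)
  moreover have "\<exists>p>0. rotate_polygon a 0 = (p, 0, 0)" "\<exists>p>0. rotate_polygon a 21 = (0, p, 0)" "\<exists>p>0. rotate_polygon a 42 = (0, 0, p)"
  proof -
    obtain p1 p2 p3 where "0 < p1" "0 < p2" "0 < p3" "a 0 = (p1, 0, 0)" "a 21 = (0, p2, 0)" "a 42 = (0, 0, p3)"
      using n by blast
    then show "\<exists>p>0. rotate_polygon a 0 = (p, 0, 0)" "\<exists>p>0. rotate_polygon a 21 = (0, p, 0)" "\<exists>p>0. rotate_polygon a 42 = (0, 0, p)"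
      by (simp_all add: rotate_polygon_def)
  qed
  ultimately show ?thesis
    using n convex_polygon_rotate_polygon unfolding normalized_def by blast
qed

section \<open>Affine coordinates near a corner\<close>

text \<open>In the chart \<open>X = 1\<close> with corner 0 as origin, the vertices
  \<open>10 - k\<close> and \<open>53 + k\<close> on its two sides are
  \<open>(w_size, - w_slope)\<close> and \<open>(- u_slope, u_size)\<close>; larger \<open>k\<close>
  is closer to the corner. The slope in the geometric sense is the quotient
  \<open>w_slope / w_size\<close> or \<open>u_slope / u_size\<close>.\<close>

definition w_scale where "w_scale a k = fst (a (10 - k) :: vec3)"
definition w_size where "w_size a k = fst (snd (a (10 - k) :: vec3)) / w_scale a k"
definition w_slope where "w_slope a k = - snd (snd (a (10 - k) :: vec3)) / w_scale a k"
definition u_scale where "u_scale a k = fst (a (53 + k) :: vec3)"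
definition u_size where "u_size a k = snd (snd (a (53 + k) :: vec3)) / u_scale a k"
definition u_slope where "u_slope a k = - fst (snd (a (53 + k) :: vec3)) / u_scale a k"

lemma normalized_corners:
  assumes "normalized a"
  obtains p1 p2 p3 where "0 < p1" "0 < p2" "0 < p3" "a 0 = (p1, 0, 0)" "a 21 = (0, p2, 0)" "a 42 = (0, 0, p3)"
  using assms by (auto simp: normalized_def)

lemma w_form:
  assumes "normalized a" "k \<le> 9"
  shows "a (10 - k) = (w_scale a k, w_size a k * w_scale a k, - w_slope a k * w_scale a k)" "0 < w_scale a k" "0 < w_size a k" "0 < w_slope a k"
proof -
  obtain p1 p2 p3 where p: "0 < p1" "0 < p2" "0 < p3" "a 0 = (p1, 0, 0)" "a 21 = (0, p2, 0)" "a 42 = (0, 0, p3)"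
    using normalized_corners[OF assms(1)] by metis
  obtain x y z where xyz: "a (10 - k) = (x, y, z)" by (metis prod.exhaust)
  have "0 < det3 (a 0) (a (10 - k)) (a 21)" "0 < det3 (a (10 - k)) (a 21) (a 42)" "0 < det3 (a 0) (a (10 - k)) (a 42)"
    using assms by (auto simp: normalized_def convex_polygon_def)
  then have "0 < x \<and> 0 < y \<and> z < 0"
    using p unfolding p(4-6) xyz by (auto simp: zero_less_mult_iff mult_less_0_iff)
  then show "a (10 - k) = (w_scale a k, w_size a k * w_scale a k, - w_slope a k * w_scale a k)" "0 < w_scale a k" "0 < w_size a k" "0 < w_slope a k"
    unfolding w_scale_def w_size_def w_slope_def xyz by (auto simp: field_simps)
qed

lemma u_form:
  assumes "normalized a" "k \<le> 9"
  shows "a (53 + k) = (u_scale a k, - u_slope a k * u_scale a k, u_size a k * u_scale a k)" "0 < u_scale a k" "0 < u_size a k" "0 < u_slope a k"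
proof -
  obtain p1 p2 p3 where p: "0 < p1" "0 < p2" "0 < p3" "a 0 = (p1, 0, 0)" "a 21 = (0, p2, 0)" "a 42 = (0, 0, p3)"
    using normalized_corners[OF assms(1)] by metis
  obtain x y z where xyz: "a (53 + k) = (x, y, z)" by (metis prod.exhaust)
  have "0 < det3 (a 0) (a 42) (a (53 + k))" "0 < det3 (a 21) (a 42) (a (53 + k))" "0 < det3 (a 0) (a 21) (a (53 + k))"
    using assms by (auto simp: normalized_def convex_polygon_def)
  then have "0 < x \<and> y < 0 \<and> 0 < z"
    using p unfolding p(4-6) xyz by (auto simp: zero_less_mult_iff mult_less_0_iff)
  then show "a (53 + k) = (u_scale a k, - u_slope a k * u_scale a k, u_size a k * u_scale a k)" "0 < u_scale a k" "0 < u_size a k" "0 < u_slope a k"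
    unfolding u_scale_def u_size_def u_slope_def xyz by (auto simp: field_simps)
qed

text \<open>The vertices \<open>31 - k\<close> are to corner 21 what the vertices
  \<open>10 - k\<close> are to corner 0.\<close>

lemma w2_form:
  assumes "normalized a" "k \<le> 9"
  shows "a (31 - k) = (- w_slope (rotate_polygon a) k * w_scale (rotate_polygon a) k, w_scale (rotate_polygon a) k, w_size (rotate_polygon a) k * w_scale (rotate_polygon a) k)"
proof -
  have "rot3 (a (31 - k)) = rotate_polygon a (10 - k)"
    using assms(2) by (simp add: rotate_polygon_def)
  moreover obtain x y z where xyz: "a (31 - k) = (x, y, z)" by (metis prod.exhaust)
  ultimately have "(y, z, x) = (w_scale (rotate_polygon a) k, w_size (rotate_polygon a) k * w_scale (rotate_polygon a) k, - w_slope (rotate_polygon a) k * w_scale (rotate_polygon a) k)"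
    unfolding w_form(1)[OF normalized_rotate_polygon[OF assms(1)] assms(2)] xyz rot3.simps by - assumption
  then show ?thesis unfolding xyz prod.inject by (elim conjE) (intro conjI; assumption)
qed

text \<open>The vertices \<open>32 + k\<close> are to corner 42 what the vertices
  \<open>53 + k\<close> are to corner 0.\<close>

lemma u3_form:
  assumes "normalized a" "k \<le> 9"
  shows "a (32 + k) = (- u_slope (rotate_polygon (rotate_polygon a)) k * u_scale (rotate_polygon (rotate_polygon a)) k, u_size (rotate_polygon (rotate_polygon a)) k * u_scale (rotate_polygon (rotate_polygon a)) k, u_scale (rotate_polygon (rotate_polygon a)) k)"
proof -
  have "53 + k + 21 = 11 + k + 63" by simp
  then have "(53 + k + 21) mod 63 = 11 + k" "(11 + k + 21) mod 63 = 32 + k"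
    using assms(2) by (simp_all only: mod_add_self2) simp_all
  then have "rot3 (rot3 (a (32 + k))) = rotate_polygon (rotate_polygon a) (53 + k)"
    unfolding rotate_polygon_def by (simp only:)
  moreover obtain x y z where xyz: "a (32 + k) = (x, y, z)" by (metis prod.exhaust)
  ultimately have "(z, x, y) = (u_scale (rotate_polygon (rotate_polygon a)) k, - u_slope (rotate_polygon (rotate_polygon a)) k * u_scale (rotate_polygon (rotate_polygon a)) k, u_size (rotate_polygon (rotate_polygon a)) k * u_scale (rotate_polygon (rotate_polygon a)) k)"
    unfolding u_form(1)[OF normalized_rotate_polygon[OF normalized_rotate_polygon[OF assms(1)]] assms(2)] xyz rot3.simps by - assumption
  then show ?thesis unfolding xyz prod.inject by (elim conjE) (intro conjI; assumption)
qed

lemma normalized_cones_meet: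
  assumes "normalized a" "[c1, c2, c3] \<in> set corner_constraints"
    "fst c1 < 63" "fst (snd c1) < 63" "snd (snd c1) < 63"
    "fst c2 < 63" "fst (snd c2) < 63" "snd (snd c2) < 63"
    "fst c3 < 63" "fst (snd c3) < 63" "snd (snd c3) < 63"
  obtains W where "W \<in> open_cone (a (fst c1)) (a (fst (snd c1))) (a (snd (snd c1)))"
    "W \<in> open_cone (a (fst c2)) (a (fst (snd c2))) (a (snd (snd c2)))"
    "W \<in> open_cone (a (fst c3)) (a (fst (snd c3))) (a (snd (snd c3)))"
proof -
  have "cones_meet (\<lambda>i. a ((i + 21 * 0) mod 63)) [c1, c2, c3]"
    proof -
    have "\<forall>s<3. \<forall>c\<in>set corner_constraints. cones_meet (\<lambda>i. a ((i + 21 * s) mod 63)) c"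
      using assms(1) unfolding normalized_def by (elim conjE)
    from this[rule_format, of 0, OF _ assms(2)] show ?thesis by (simp only: zero_less_numeral)
  qed
  then obtain W where W: "\<forall>c\<in>set [c1, c2, c3]. W \<in> open_cone (a ((fst c + 21 * 0) mod 63))
      (a ((fst (snd c) + 21 * 0) mod 63)) (a ((snd (snd c) + 21 * 0) mod 63))"
    unfolding cones_meet_def by (elim exE)
  have mem: "c1 \<in> set [c1, c2, c3]" "c2 \<in> set [c1, c2, c3]" "c3 \<in> set [c1, c2, c3]" by auto
  show thesis
    using that[of W] W[rule_format, OF mem(1)] W[rule_format, OF mem(2)] W[rule_format, OF mem(3)]
    by (simp only: mult_0_right add_0_right mod_less assms(3-))
qed

lemma u_size_lt_product:
  assumes a: "normalized a" and "i \<le> 9" "k \<le> 9" "c \<le> 9"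
    and "[(21, 42, 53 + i), (0, 21, 31 - k), (42, 0, 10 - c)] \<in> set corner_constraints"
  shows "u_size a i < w_size (rotate_polygon a) k * w_size a c"
proof -
  obtain p1 p2 p3 where p: "0 < p1" "0 < p2" "0 < p3" "a 0 = (p1, 0, 0)" "a 21 = (0, p2, 0)" "a 42 = (0, 0, p3)"
    using normalized_corners[OF a] by metis
  obtain W where "W \<in> open_cone (a 21) (a 42) (a (53 + i))" "W \<in> open_cone (a 0) (a 21) (a (31 - k))" "W \<in> open_cone (a 42) (a 0) (a (10 - c))"
    by (rule normalized_cones_meet[OF a assms(5)]) (use assms(2-4) in auto)
  then show ?thesis
    using w_form[OF a assms(4)] u_form[OF a assms(2)] w_form[OF normalized_rotate_polygon[OF a] assms(3)] p(1-3)
      size_product_xi[of p1 p2 p3 "u_scale a i" "w_scale (rotate_polygon a) k" "w_scale a c" "w_size (rotate_polygon a) k" "w_size a c" W]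
    unfolding p(4-6) w2_form[OF a assms(3)] by (simp only:)
qed

lemma w_size_lt_product:
  assumes a: "normalized a" and "i \<le> 9" "k \<le> 9" "c \<le> 9"
    and "[(42, 21, 10 - c), (0, 42, 32 + k), (21, 0, 53 + i)] \<in> set corner_constraints"
  shows "w_size a c < u_size (rotate_polygon (rotate_polygon a)) k * u_size a i"
proof -
  obtain p1 p2 p3 where p: "0 < p1" "0 < p2" "0 < p3" "a 0 = (p1, 0, 0)" "a 21 = (0, p2, 0)" "a 42 = (0, 0, p3)"
    using normalized_corners[OF a] by metis
  obtain W where "W \<in> open_cone (a 42) (a 21) (a (10 - c))" "W \<in> open_cone (a 0) (a 42) (a (32 + k))" "W \<in> open_cone (a 21) (a 0) (a (53 + i))"
    by (rule normalized_cones_meet[OF a assms(5)]) (use assms(2-4) in auto)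
  then show ?thesis
    using w_form[OF a assms(4)] u_form[OF a assms(2)] u_form[OF normalized_rotate_polygon[OF normalized_rotate_polygon[OF a]] assms(3)] p(1-3)
      size_product_eta[of p1 p2 p3 "w_scale a c" "u_scale (rotate_polygon (rotate_polygon a)) k" "u_scale a i" "u_size (rotate_polygon (rotate_polygon a)) k" "u_size a i" W]
    unfolding p(4-6) u3_form[OF a assms(3)] by (simp only:)
qed

text \<open>Seen from corner 42, the point \<open>(1, 1, 1)\<close> lies between the vertices 10 and
  11, and convexity makes the ratio \<open>Y / X\<close> larger at 11 than at 10. The point has
  ratio 1, so vertex 10 has a smaller one. Corner 21 and the vertices 52, 53 give the other
  bound.\<close>

lemma sizes_level0:
  assumes a: "normalized a"
  shows "w_size a 0 < 1" "u_size a 0 < 1"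
proof -
  obtain p1 p2 p3 where p: "0 < p1" "0 < p2" "0 < p3" "a 0 = (p1, 0, 0)" "a 21 = (0, p2, 0)" "a 42 = (0, 0, p3)"
    using normalized_corners[OF a] by metis
  have W: "(1, 1, 1) \<in> open_cone (a 42) (a 10) (a 11)" "(1, 1, 1) \<in> open_cone (a 21) (a 52) (a 53)"
    using a by (auto simp: normalized_def)
  obtain x y z x' y' z' where xyz: "a 11 = (x, y, z)" "a 52 = (x', y', z')" by (metis prod.exhaust)
  have "0 < det3 (a 10) (a 11) (a 42)" "0 < det3 (a 21) (a 52) (a 53)"
    using a by (auto simp: normalized_def convex_polygon_def)
  then have g: "w_size a 0 * x < y" "x' * u_size a 0 < z'"
    using w_form[OF a, of 0] u_form[OF a, of 0] p(1-3) unfolding p(4-6) xyz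
    by (auto simp: zero_less_mult_iff algebra_simps)
  obtain q r where qr: "0 < q" "0 < r" "1 = q * w_scale a 0 + r * x" "1 = q * (w_size a 0 * w_scale a 0) + r * y"
    using W(1) w_form(1)[OF a, of 0] unfolding p(4-6) xyz open_cone_def by auto
  have "w_size a 0 * (q * w_scale a 0 + r * x) = q * (w_size a 0 * w_scale a 0) + r * (w_size a 0 * x)"
    by (simp add: algebra_simps)
  then show "w_size a 0 < 1"
    using mult_strict_left_mono[OF g(1) qr(2)] qr(4) unfolding qr(3)[symmetric] by linarith
  obtain q r where qr: "0 < q" "0 < r" "1 = q * x' + r * u_scale a 0" "1 = q * z' + r * (u_size a 0 * u_scale a 0)"
    using W(2) u_form(1)[OF a, of 0] unfolding p(4-6) xyz open_cone_def by auto
  have "u_size a 0 * (q * x' + r * u_scale a 0) = q * (x' * u_size a 0) + r * (u_size a 0 * u_scale a 0)"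
    by (simp add: algebra_simps)
  then show "u_size a 0 < 1"
    using mult_strict_left_mono[OF g(2) qr(1)] qr(4) unfolding qr(3)[symmetric] by linarith
qed

text \<open>Vertex 32 is next to corner 42 in the sense of \<open>u3_form\<close> at level 0; its
  size there is below 1, which supplies the hypothesis \<open>\<phi> \<le> 1\<close> of
  \<open>size_halving_eta\<close>.\<close>

lemma w_size_halving:
  assumes a: "normalized a" and "i \<le> 9" "b \<le> 9" "c \<le> 9"
    and "[(42, 21, 10 - c), (0, 42, 32), (0, 10 - b, 53 + i)] \<in> set corner_constraints"
  shows "w_size a c * (w_size a b + u_size a i) < w_size a b * u_size a i"
proof -
  obtain p1 p2 p3 where p: "0 < p1" "0 < p2" "0 < p3" "a 0 = (p1, 0, 0)" "a 21 = (0, p2, 0)" "a 42 = (0, 0, p3)"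
    using normalized_corners[OF a] by metis
  have "(0::nat) \<le> 9" by simp
  note w2 = u_form[OF normalized_rotate_polygon[OF normalized_rotate_polygon[OF a]] this] u3_form[OF a this, simplified]
  obtain W where "W \<in> open_cone (a 42) (a 21) (a (10 - c))" "W \<in> open_cone (a 0) (a 42) (a 32)" "W \<in> open_cone (a 0) (a (10 - b)) (a (53 + i))"
    by (rule normalized_cones_meet[OF a assms(5)]) (use assms(2-4) in auto)
  then show ?thesis
    using w_form[OF a assms(4)] w_form[OF a assms(3)] u_form[OF a assms(2)] w2 p(1-3) sizes_level0(2)[OF normalized_rotate_polygon[OF normalized_rotate_polygon[OF a]]]
    by (intro size_halving_eta[of p1 p2 p3 "w_scale a c" "u_scale (rotate_polygon (rotate_polygon a)) 0" "w_scale a b" "u_scale a i" "u_size (rotate_polygon (rotate_polygon a)) 0"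
          "u_size a i" "w_size a b" "u_slope a i" "w_slope a b" "w_size a c" W "w_slope a c" "u_slope (rotate_polygon (rotate_polygon a)) 0"])
       (simp_all only: p(4-6) less_imp_le mult_minus_left)
qed

lemma u_size_halving:
  assumes a: "normalized a" and "i \<le> 9" "b \<le> 9" "c \<le> 9"
    and "[(21, 42, 53 + c), (0, 21, 31), (0, 10 - b, 53 + i)] \<in> set corner_constraints"
  shows "u_size a c * (w_size a b + u_size a i) < w_size a b * u_size a i"
proof -
  obtain p1 p2 p3 where p: "0 < p1" "0 < p2" "0 < p3" "a 0 = (p1, 0, 0)" "a 21 = (0, p2, 0)" "a 42 = (0, 0, p3)"
    using normalized_corners[OF a] by metis
  have "(0::nat) \<le> 9" by simp
  note w2 = w_form[OF normalized_rotate_polygon[OF a] this] w2_form[OF a this, simplified]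
  obtain W where "W \<in> open_cone (a 21) (a 42) (a (53 + c))" "W \<in> open_cone (a 0) (a 21) (a 31)" "W \<in> open_cone (a 0) (a (10 - b)) (a (53 + i))"
    by (rule normalized_cones_meet[OF a assms(5)]) (use assms(2-4) in auto)
  then show ?thesis
    using u_form[OF a assms(4)] w_form[OF a assms(3)] u_form[OF a assms(2)] w2 p(1-3) sizes_level0(1)[OF normalized_rotate_polygon[OF a]]
    by (intro size_halving_xi[of p1 p2 p3 "u_scale a c" "w_scale (rotate_polygon a) 0" "w_scale a b" "u_scale a i" "w_size (rotate_polygon a) 0"
          "u_size a i" "w_size a b" "u_slope a i" "w_slope a b" "u_size a c" W "u_slope a c" "w_slope (rotate_polygon a) 0"])
       (simp_all only: p(4-6) less_imp_le mult_minus_left)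
qed

lemma w_size_mono:
  assumes a: "normalized a" and "k < l" "l \<le> 9"
  shows "w_size a l < w_size a k"
proof -
  obtain p1 p2 p3 where p: "0 < p1" "0 < p2" "0 < p3" "a 0 = (p1, 0, 0)" "a 21 = (0, p2, 0)" "a 42 = (0, 0, p3)"
    using normalized_corners[OF a] by metis
  have "0 < det3 (a (10 - l)) (a (10 - k)) (a 42)" using a assms by (auto simp: normalized_def convex_polygon_def)
  then have *: "0 < p3 * (w_scale a l * w_scale a k * (w_size a k - w_size a l))"
    using w_form(1)[OF a assms(3)] w_form(1)[OF a, of k] assms by (simp add: p(6) algebra_simps)
  have "0 < w_scale a l * w_scale a k" using w_form(2)[OF a assms(3)] w_form(2)[OF a, of k] assms by simp
  from zero_less_mult_pos[OF zero_less_mult_pos[OF * p(3)] this] show ?thesis by simp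
qed

lemma u_size_mono:
  assumes a: "normalized a" and "k < l" "l \<le> 9"
  shows "u_size a l < u_size a k"
proof -
  obtain p1 p2 p3 where p: "0 < p1" "0 < p2" "0 < p3" "a 0 = (p1, 0, 0)" "a 21 = (0, p2, 0)" "a 42 = (0, 0, p3)"
    using normalized_corners[OF a] by metis
  have "0 < det3 (a 21) (a (53 + k)) (a (53 + l))" using a assms by (auto simp: normalized_def convex_polygon_def)
  then have *: "0 < p2 * (u_scale a l * u_scale a k * (u_size a k - u_size a l))"
    using u_form(1)[OF a assms(3)] u_form(1)[OF a, of k] assms by (simp add: p(5) algebra_simps)
  have "0 < u_scale a l * u_scale a k" using u_form(2)[OF a assms(3)] u_form(2)[OF a, of k] assms by simp
  from zero_less_mult_pos[OF zero_less_mult_pos[OF * p(2)] this] show ?thesis by simp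
qed

text \<open>By convexity the geometric slope \<open>w_slope / w_size\<close> grows as the vertex
  approaches the corner.\<close>

lemma slope_mono:
  assumes a: "normalized a" and "k < l" "l \<le> 9"
  shows "w_slope a k * w_size a l < w_slope a l * w_size a k"
proof -
  obtain p1 p2 p3 where p: "0 < p1" "0 < p2" "0 < p3" "a 0 = (p1, 0, 0)" "a 21 = (0, p2, 0)" "a 42 = (0, 0, p3)"
    using normalized_corners[OF a] by metis
  have "0 < det3 (a 0) (a (10 - l)) (a (10 - k))" using a assms by (auto simp: normalized_def convex_polygon_def)
  then have *: "0 < p1 * (w_scale a l * w_scale a k * (w_slope a l * w_size a k - w_slope a k * w_size a l))"
    using w_form(1)[OF a assms(3)] w_form(1)[OF a, of k] assms by (simp add: p(4) algebra_simps)
  have "0 < w_scale a l * w_scale a k" using w_form(2)[OF a assms(3)] w_form(2)[OF a, of k] assms by simp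
  from zero_less_mult_pos[OF zero_less_mult_pos[OF * p(1)] this] show ?thesis by simp
qed

text \<open>Half the harmonic mean of two numbers below 1 is below 1/2.\<close>

lemma sizes_level1:
  assumes a: "normalized a"
  shows "w_size a 1 < 1/2" "u_size a 1 < 1/2"
proof -
  have h: "w_size a 1 * (w_size a 0 + u_size a 0) < w_size a 0 * u_size a 0" "u_size a 1 * (w_size a 0 + u_size a 0) < w_size a 0 * u_size a 0"
    by (rule w_size_halving[OF a] u_size_halving[OF a]; simp add: corner_constraints_def)+
  have pos: "0 < w_size a 0" "0 < u_size a 0" "w_size a 0 < 1" "u_size a 0 < 1"
    using w_form(3)[OF a, of 0] u_form(3)[OF a, of 0] sizes_level0[OF a] by auto
  have "w_size a 0 * u_size a 0 \<le> w_size a 0" "w_size a 0 * u_size a 0 \<le> u_size a 0"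
    using pos mult_left_le[of "u_size a 0" "w_size a 0"] mult_right_le_one_le[of "u_size a 0" "w_size a 0"]
    by (auto simp: mult.commute)
  then have "w_size a 0 * u_size a 0 \<le> 1/2 * (w_size a 0 + u_size a 0)" by (simp add: field_simps)
  then have "w_size a 1 * (w_size a 0 + u_size a 0) < 1/2 * (w_size a 0 + u_size a 0)" "u_size a 1 * (w_size a 0 + u_size a 0) < 1/2 * (w_size a 0 + u_size a 0)"
    using h by linarith+
  then show "w_size a 1 < 1/2" "u_size a 1 < 1/2" using pos by (simp_all only: mult_less_cancel_right_pos add_pos_pos)
qed

text \<open>Each size is bounded by a product of two sizes of the level before, one of which is
  taken at another corner. The induction hypothesis therefore ranges over all normalized polygons
  and is applied to rotated ones.\<close>

lemma sizes_step:
  assumes "\<And>a. normalized a \<Longrightarrow> w_size a k < c \<and> u_size a k < c" and k: "k \<in> {1, 2, 3, 4}" and a: "normalized a"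
  shows "w_size a (Suc k) < c * c \<and> u_size a (Suc k) < c * c"
proof -
  have k9: "k \<le> 9" "Suc k \<le> 9" using k by auto
  have "u_size a (Suc k) < w_size (rotate_polygon a) k * w_size a k"
  proof (rule u_size_lt_product[OF a k9(2) k9(1) k9(1)])
    show "[(21, 42, 53 + Suc k), (0, 21, 31 - k), (42, 0, 10 - k)] \<in> set corner_constraints"
      using k by (elim insertE emptyE; simp add: corner_constraints_def)
  qed
  moreover have "w_size a (Suc k) < u_size (rotate_polygon (rotate_polygon a)) k * u_size a k"
  proof (rule w_size_lt_product[OF a k9(1) k9(1) k9(2)])
    show "[(42, 21, 10 - Suc k), (0, 42, 32 + k), (21, 0, 53 + k)] \<in> set corner_constraints"
      using k by (elim insertE emptyE; simp add: corner_constraints_def)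
  qed
  moreover have "w_size (rotate_polygon a) k * w_size a k < c * c"
    by (rule mult_strict_mono') (use assms(1)[OF a] assms(1)[OF normalized_rotate_polygon[OF a]] w_form(3)[OF a k9(1)] w_form(3)[OF normalized_rotate_polygon[OF a] k9(1)] in auto)
  moreover have "u_size (rotate_polygon (rotate_polygon a)) k * u_size a k < c * c"
    by (rule mult_strict_mono') (use assms(1)[OF a] assms(1)[OF normalized_rotate_polygon[OF normalized_rotate_polygon[OF a]]] u_form(3)[OF a k9(1)] u_form(3)[OF normalized_rotate_polygon[OF normalized_rotate_polygon[OF a]] k9(1)] in auto)
  ultimately show ?thesis by linarith
qed

text \<open>Levels 5 and 6 are the vertices 5 and 59 that enter \<open>corner_bound\<close>.
  Squaring 1/2 four times gives 1/65536 at level 5, and monotonicity gives level 6.\<close>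

lemma sizes_small:
  assumes a: "normalized a"
  shows "w_size a 5 \<le> 1/4096" "u_size a 6 \<le> 1/4096"
proof -
  have 1: "w_size a 1 < 1/2 \<and> u_size a 1 < 1/2" if "normalized a" for a using sizes_level1[OF that] by simp
  have 2: "w_size a 2 < 1/4 \<and> u_size a 2 < 1/4" if "normalized a" for a
    using sizes_step[of 1 "1/2" a, OF 1] that by (simp add: numeral_2_eq_2)
  have 3: "w_size a 3 < 1/16 \<and> u_size a 3 < 1/16" if "normalized a" for a
    using sizes_step[of 2 "1/4" a, OF 2] that by (simp add: eval_nat_numeral)
  have 4: "w_size a 4 < 1/256 \<and> u_size a 4 < 1/256" if "normalized a" for a
    using sizes_step[of 3 "1/16" a, OF 3] that by (simp add: eval_nat_numeral)
  have 5: "w_size a 5 < 1/65536 \<and> u_size a 5 < 1/65536" if "normalized a" for a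
    using sizes_step[of 4 "1/256" a, OF 4] that by (simp add: eval_nat_numeral)
  show "w_size a 5 \<le> 1/4096" "u_size a 6 \<le> 1/4096"
    using 5[OF a] u_size_mono[OF a, of 5 6] by auto
qed

lemma slope_lower_eta:
  assumes a: "normalized a" and "i \<le> 9" "b \<le> 9" "c \<le> 9" "b < c"
    and "[(42, 0, 10 - c), (0, 21, 10 - b), (21, 10 - b, 53 + i)] \<in> set corner_constraints"
  shows "u_size a i * (w_size a b - w_size a c) < w_slope a b * (w_size a c + u_slope a i)"
proof -
  obtain p1 p2 p3 where p: "0 < p1" "0 < p2" "0 < p3" "a 0 = (p1, 0, 0)" "a 21 = (0, p2, 0)" "a 42 = (0, 0, p3)"
    using normalized_corners[OF a] by metis
  obtain W where "W \<in> open_cone (a 42) (a 0) (a (10 - c))" "W \<in> open_cone (a 0) (a 21) (a (10 - b))" "W \<in> open_cone (a 21) (a (10 - b)) (a (53 + i))"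
    by (rule normalized_cones_meet[OF a assms(6)]) (use assms(2-4) in auto)
  then show ?thesis
    using w_form[OF a assms(3)] w_form[OF a assms(4)] u_form[OF a assms(2)] p(1-3) w_size_mono[OF a assms(5,4)]
    by (intro slope_lower_w[of p1 p2 p3 "w_scale a c" "w_scale a b" "u_scale a i" "u_size a i" "w_size a b" "u_slope a i" "w_slope a b" "w_size a c" W "w_slope a c"])
       (simp_all only: p(4-6))
qed

lemma slope_lower_xi:
  assumes a: "normalized a" and "i \<le> 9" "b \<le> 9" "c \<le> 9" "b < c"
    and "[(21, 0, 53 + c), (0, 42, 53 + b), (42, 10 - i, 53 + b)] \<in> set corner_constraints"
  shows "w_size a i * (u_size a b - u_size a c) < u_slope a b * (u_size a c + w_slope a i)"
proof -
  obtain p1 p2 p3 where p: "0 < p1" "0 < p2" "0 < p3" "a 0 = (p1, 0, 0)" "a 21 = (0, p2, 0)" "a 42 = (0, 0, p3)"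
    using normalized_corners[OF a] by metis
  obtain W where "W \<in> open_cone (a 21) (a 0) (a (53 + c))" "W \<in> open_cone (a 0) (a 42) (a (53 + b))" "W \<in> open_cone (a 42) (a (10 - i)) (a (53 + b))"
    by (rule normalized_cones_meet[OF a assms(6)]) (use assms(2-4) in auto)
  then show ?thesis
    using u_form[OF a assms(3)] u_form[OF a assms(4)] w_form[OF a assms(2)] p(1-3) u_size_mono[OF a assms(5,4)]
    by (intro slope_lower_u[of p1 p2 p3 "u_scale a c" "w_scale a i" "u_scale a b" "u_size a b" "w_size a i" "u_slope a b" "w_slope a i" "u_size a c" W "u_slope a c"])
       (simp_all only: p(4-6))
qed

lemma slope_upper_eta:
  assumes a: "normalized a" and "i \<le> 9" "b \<le> 9" "c \<le> 9" "b < c"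
    and "[(42, 21, 10 - c), (0, 21, 42), (0, 10 - b, 53 + i)] \<in> set corner_constraints"
  shows "w_slope a b * (w_size a c + u_slope a i) < u_size a i * (w_size a b - w_size a c)"
proof -
  obtain p1 p2 p3 where p: "0 < p1" "0 < p2" "0 < p3" "a 0 = (p1, 0, 0)" "a 21 = (0, p2, 0)" "a 42 = (0, 0, p3)"
    using normalized_corners[OF a] by metis
  obtain W where "W \<in> open_cone (a 42) (a 21) (a (10 - c))" "W \<in> open_cone (a 0) (a 21) (a 42)" "W \<in> open_cone (a 0) (a (10 - b)) (a (53 + i))"
    by (rule normalized_cones_meet[OF a assms(6)]) (use assms(2-4) in auto)
  then show ?thesis
    using w_form[OF a assms(3)] w_form[OF a assms(4)] u_form[OF a assms(2)] p(1-3) w_size_mono[OF a assms(5,4)]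
    by (intro slope_upper_w[of p1 p2 p3 "w_scale a c" "w_scale a b" "u_scale a i" "u_size a i" "w_size a b" "u_slope a i" "w_slope a b" "w_size a c" W "w_slope a c"])
       (simp_all only: p(4-6))
qed

lemma slope_upper_xi:
  assumes a: "normalized a" and "i \<le> 9" "b \<le> 9" "c \<le> 9" "b < c"
    and "[(21, 42, 53 + c), (0, 21, 42), (0, 10 - i, 53 + b)] \<in> set corner_constraints"
  shows "u_slope a b * (u_size a c + w_slope a i) < w_size a i * (u_size a b - u_size a c)"
proof -
  obtain p1 p2 p3 where p: "0 < p1" "0 < p2" "0 < p3" "a 0 = (p1, 0, 0)" "a 21 = (0, p2, 0)" "a 42 = (0, 0, p3)"
    using normalized_corners[OF a] by metis
  obtain W where "W \<in> open_cone (a 21) (a 42) (a (53 + c))" "W \<in> open_cone (a 0) (a 21) (a 42)" "W \<in> open_cone (a 0) (a (10 - i)) (a (53 + b))"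
    by (rule normalized_cones_meet[OF a assms(6)]) (use assms(2-4) in auto)
  then show ?thesis
    using u_form[OF a assms(3)] u_form[OF a assms(4)] w_form[OF a assms(2)] p(1-3) u_size_mono[OF a assms(5,4)]
    by (intro slope_upper_u[of p1 p2 p3 "u_scale a c" "w_scale a i" "u_scale a b" "u_size a b" "w_size a i" "u_slope a b" "w_slope a i" "u_size a c" W "u_slope a c"])
       (simp_all only: p(4-6))
qed

lemma upper_slope_lt_one:
  fixes d e t x c :: real
  assumes "d * (c + t) < x * (e - c)" "x < c" "0 < d" "0 < c" "0 < t" "0 < x" "c < e"
  shows "d < e"
proof -
  have "d * c < d * (c + t)" using assms by simp
  also have "\<dots> < x * (e - c)" by fact
  also have "\<dots> \<le> c * (e - c)" using assms by (intro mult_right_mono) auto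
  also have "\<dots> < e * c" using assms by (simp add: algebra_simps)
  finally show ?thesis using assms by simp
qed

text \<open>\<open>c + t < 2 * x\<close> and \<open>e / 2 < e - c\<close> cost a factor 2 each,
  whence the quarter.\<close>

lemma lower_slope_gt_quarter:
  fixes d e t x c :: real
  assumes "x * (e - c) < d * (c + t)" "c < x" "t < x" "2 * c < e" "0 < d" "0 < x"
  shows "e < 4 * d"
proof -
  have "x * (e / 2) \<le> x * (e - c)" using assms by (intro mult_left_mono) auto
  also have "\<dots> < d * (c + t)" by fact
  also have "\<dots> \<le> d * (2 * x)" using assms by (intro mult_left_mono) auto
  finally have "x * e < x * (4 * d)" by (simp add: algebra_simps)
  then show ?thesis using assms by simp
qed

lemma halving_lt_half:
  fixes e x c :: real
  assumes "c * (e + x) < e * x" "0 < x" "0 < e"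
  shows "x \<le> e \<Longrightarrow> 2 * c < e" "e \<le> x \<Longrightarrow> 2 * c < x"
proof -
  show "2 * c < e" if "x \<le> e"
  proof -
    have "2 * (e * x) \<le> e * (e + x)" using that assms by (simp add: algebra_simps)
    then have "(2 * c) * (e + x) < e * (e + x)" using assms(1) by linarith
    then show ?thesis using assms by (simp only: mult_less_cancel_right_pos add_pos_pos)
  qed
  show "2 * c < x" if "e \<le> x"
  proof -
    have "2 * (e * x) \<le> x * (e + x)" using that assms by (simp add: algebra_simps)
    then have "(2 * c) * (e + x) < x * (e + x)" using assms(1) by linarith
    then show ?thesis using assms by (simp only: mult_less_cancel_right_pos add_pos_pos)
  qed
qed

text \<open>The comparisons interlace the sizes: \<open>u_size\<close> is below
  \<open>w_size\<close> at the levels 5, 7, 9 and above it at 6, 8. With this order the chord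
  estimates turn into slopes between 1/4 and 1. The last bound, by 4/5, is what keeps
  \<open>d * d'\<close> away from 1 in \<open>corner_bound\<close>.\<close>

lemma slope_windows:
  assumes a: "normalized a"
  shows "w_size a 5 < 4 * w_slope a 5" "w_slope a 5 < w_size a 5" "u_size a 6 < 4 * u_slope a 6" "u_slope a 6 < u_size a 6"
    "5 * u_slope a 6 < 4 * u_size a 6"
proof -
  have lt1: "w_size b 0 < 1" "u_size b 0 < 1" if "normalized b" for b using sizes_level0[OF that] by auto
  have sm: "x < c * y \<Longrightarrow> c < 1 \<Longrightarrow> 0 < y \<Longrightarrow> x < y" for x y c :: real
  proof -
    assume "x < c * y" "c < 1" "0 < y"
    moreover have "c * y < 1 * y" using \<open>c < 1\<close> \<open>0 < y\<close> by (rule mult_strict_right_mono)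
    ultimately show "x < y" by linarith
  qed
  have pe: "0 < w_size a k" "0 < w_slope a k" "0 < u_size a k" "0 < u_slope a k" if "k \<le> 9" for k
    using w_form[OF a that] u_form[OF a that] by auto
  have c5: "u_size a 5 < w_size a 5" and c7: "u_size a 7 < w_size a 7" and c9: "u_size a 9 < w_size a 9"
    by (rule sm[OF u_size_lt_product[OF a, of _ 0] lt1(1)[OF normalized_rotate_polygon[OF a]] pe(1)]; simp add: corner_constraints_def)+
  have c6: "w_size a 6 < u_size a 6" and c8: "w_size a 8 < u_size a 8"
    by (rule sm[OF w_size_lt_product[OF a, of _ 0] lt1(2)[OF normalized_rotate_polygon[OF normalized_rotate_polygon[OF a]]] pe(3)]; simp add: corner_constraints_def)+
  have "w_size a 6 * (w_size a 5 + u_size a 5) < w_size a 5 * u_size a 5"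
    by (rule w_size_halving[OF a]; simp add: corner_constraints_def)
  then have h6: "2 * w_size a 6 < w_size a 5" by (rule halving_lt_half) (use c5 pe in auto)
  have "u_size a 7 * (w_size a 6 + u_size a 6) < w_size a 6 * u_size a 6"
    by (rule u_size_halving[OF a]; simp add: corner_constraints_def)
  then have h7: "2 * u_size a 7 < u_size a 6" by (rule halving_lt_half) (use c6 pe in auto)
  have U5: "w_slope a 5 * (w_size a 7 + u_slope a 7) < u_size a 7 * (w_size a 5 - w_size a 7)"
    and U7: "w_slope a 7 * (w_size a 9 + u_slope a 9) < u_size a 9 * (w_size a 7 - w_size a 9)"
    by (rule slope_upper_eta[OF a]; simp add: corner_constraints_def)+
  have U6: "u_slope a 6 * (u_size a 8 + w_slope a 8) < w_size a 8 * (u_size a 6 - u_size a 8)"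
    by (rule slope_upper_xi[OF a]; simp add: corner_constraints_def)
  have L5: "u_size a 6 * (w_size a 5 - w_size a 6) < w_slope a 5 * (w_size a 6 + u_slope a 6)"
    by (rule slope_lower_eta[OF a]; simp add: corner_constraints_def)
  have L6: "w_size a 7 * (u_size a 6 - u_size a 7) < u_slope a 6 * (u_size a 7 + w_slope a 7)"
    by (rule slope_lower_xi[OF a]; simp add: corner_constraints_def)
  show "w_slope a 5 < w_size a 5"
    by (rule upper_slope_lt_one[OF U5 c7]) (use pe w_size_mono[OF a, of 5 7] in auto)
  have d7: "w_slope a 7 < w_size a 7"
    by (rule upper_slope_lt_one[OF U7 c9]) (use pe w_size_mono[OF a, of 7 9] in auto)
  show t6: "u_slope a 6 < u_size a 6"
    by (rule upper_slope_lt_one[OF U6 c8]) (use pe u_size_mono[OF a, of 6 8] in auto)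
  show l5: "w_size a 5 < 4 * w_slope a 5"
    by (rule lower_slope_gt_quarter[OF L5 c6 t6 h6]) (use pe in auto)
  show "u_size a 6 < 4 * u_slope a 6"
    by (rule lower_slope_gt_quarter[OF L6 c7 d7 h7]) (use pe in auto)
  \<comment> \<open>The slope at level 8 exceeds that at level 5, hence 1/4. The term
    \<open>w_slope a 8\<close> in \<open>U6\<close> then adds at least a quarter of
    \<open>w_size a 8\<close>, and this gain of 5/4 becomes the bound 4/5.\<close>
  have "w_size a 5 * w_size a 8 < 4 * w_slope a 5 * w_size a 8" using l5 pe(1)[of 8] by simp
  also have "\<dots> < 4 * w_slope a 8 * w_size a 5" using slope_mono[OF a, of 5 8] by simp
  finally have "w_size a 5 * w_size a 8 < w_size a 5 * (4 * w_slope a 8)" by (simp add: mult_ac)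
  then have d8: "w_size a 8 < 4 * w_slope a 8" using pe(1)[of 5] by simp
  have "u_slope a 6 * (5/4 * w_size a 8) \<le> u_slope a 6 * (u_size a 8 + w_slope a 8)"
    using c8 d8 pe(4)[of 6] by (intro mult_left_mono) auto
  also have "\<dots> < w_size a 8 * (u_size a 6 - u_size a 8)" by fact
  also have "\<dots> < w_size a 8 * u_size a 6" using pe(1,3)[of 8] by simp
  finally have "w_size a 8 * (5 * u_slope a 6) < w_size a 8 * (4 * u_size a 6)" by (simp add: algebra_simps)
  then show "5 * u_slope a 6 < 4 * u_size a 6" using pe(1)[of 8] by simp
qed

text \<open>The pairs \<open>(i, j)\<close> = (0, 21), (0, 42) fix the signs of \<open>k31\<close>
  and \<open>k21\<close>, the pairs (0, 5), (0, 59) give the lower bounds on their combinations, and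
  (5, 0), (59, 0) the upper bounds, in which the small sizes \<open>\<eta>\<close> and
  \<open>\<xi>\<close> of \<open>a\<close> appear as factors.\<close>

lemma corner_bound_if_pinned:
  assumes a: "normalized a" and b: "normalized b"
    and D: "\<And>i j. i < 63 \<Longrightarrow> j < 63 \<Longrightarrow> i \<noteq> j \<Longrightarrow> 0 < det3 (b i) (mat_vec K (a i)) (b j)"
  shows "corner_bound K"
proof -
  obtain k11 k12 k13 k21 k22 k23 k31 k32 k33 where K: "K = ((k11,k12,k13),(k21,k22,k23),(k31,k32,k33))"
    by (metis prod.exhaust)
  obtain p1 p2 p3 where p: "0 < p1" "0 < p2" "0 < p3" "a 0 = (p1, 0, 0)" "a 21 = (0, p2, 0)" "a 42 = (0, 0, p3)"
    using normalized_corners[OF a] by metis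
  obtain q1 q2 q3 where q: "0 < q1" "0 < q2" "0 < q3" "b 0 = (q1, 0, 0)" "b 21 = (0, q2, 0)" "b 42 = (0, 0, q3)"
    using normalized_corners[OF b] by metis
  define x \<eta> \<delta> where "x = w_scale a 5" and "\<eta> = w_size a 5" and "\<delta> = w_slope a 5"
  define x' H \<Delta> where "x' = w_scale b 5" and "H = w_size b 5" and "\<Delta> = w_slope b 5"
  define y \<xi> \<theta> where "y = u_scale a 6" and "\<xi> = u_size a 6" and "\<theta> = u_slope a 6"
  define y' X T where "y' = u_scale b 6" and "X = u_size b 6" and "T = u_slope b 6"
  have wa: "a 5 = (x, \<eta> * x, - \<delta> * x)" "0 < x" "0 < \<eta>" "0 < \<delta>"
    using w_form[OF a, of 5] by (auto simp: x_def \<eta>_def \<delta>_def)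
  have wb: "b 5 = (x', H * x', - \<Delta> * x')" "0 < x'" "0 < H" "0 < \<Delta>"
    using w_form[OF b, of 5] by (auto simp: x'_def H_def \<Delta>_def)
  have ua: "a 59 = (y, - \<theta> * y, \<xi> * y)" "0 < y" "0 < \<xi>" "0 < \<theta>"
    using u_form[OF a, of 6] by (auto simp: y_def \<xi>_def \<theta>_def)
  have ub: "b 59 = (y', - T * y', X * y')" "0 < y'" "0 < X" "0 < T"
    using u_form[OF b, of 6] by (auto simp: y'_def X_def T_def)
  have win: "\<eta> < 4 * \<delta>" "\<delta> < \<eta>" "\<xi> < 4 * \<theta>" "\<theta> < \<xi>"
    "H < 4 * \<Delta>" "\<Delta> < H" "X < 4 * T" "T < X" "5 * T < 4 * X"
    using slope_windows[OF a] slope_windows[OF b]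
    by (auto simp: \<eta>_def \<delta>_def H_def \<Delta>_def \<xi>_def \<theta>_def X_def T_def)
  have small: "\<eta> \<le> 1/4096" "\<xi> \<le> 1/4096" using sizes_small[OF a] by (auto simp: \<eta>_def \<xi>_def)
  have "0 < q1 * p1 * q2 * (- k31)" using D[of 0 21] unfolding p(4) q(4,5) K by (simp add: algebra_simps)
  moreover have "0 < q1 * p1 * q2" using p q by simp
  ultimately have k31: "k31 < 0" using zero_less_mult_pos[of "q1 * p1 * q2" "- k31"] by simp
  have "0 < q1 * p1 * q3 * k21" using D[of 0 42] unfolding p(4) q(4,6) K by (simp add: algebra_simps)
  then have k21: "0 < k21" by (rule zero_less_mult_pos) (use p q wb ub in simp)
  have "0 < q1 * p1 * x' * (- k31 * H - k21 * \<Delta>)" using D[of 0 5] unfolding p(4) q(4) wb(1) K by (simp add: algebra_simps)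
  then have c1: "0 < - k31 * H - k21 * \<Delta>" by (rule zero_less_mult_pos) (use p q wb ub in simp)
  have "0 < q1 * p1 * y' * (k21 * X + k31 * T)" using D[of 0 59] unfolding p(4) q(4) ub(1) K by (simp add: algebra_simps)
  then have c2: "0 < k21 * X + k31 * T" by (rule zero_less_mult_pos) (use p q wb ub in simp)
  have "0 < q1 * x * x' * (H * (k31 + \<eta> * k32 - \<delta> * k33) + \<Delta> * (k21 + \<eta> * k22 - \<delta> * k23))"
    using D[of 5 0] unfolding wa(1) q(4) wb(1) K by (simp add: algebra_simps)
  then have c3: "0 < H * (k31 + \<eta> * k32 - \<delta> * k33) + \<Delta> * (k21 + \<eta> * k22 - \<delta> * k23)"
    by (rule zero_less_mult_pos) (use q wa wb ua ub in simp)
  have "0 < q1 * y * y' * (- T * (k31 - \<theta> * k32 + \<xi> * k33) - X * (k21 - \<theta> * k22 + \<xi> * k23))"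
    using D[of 59 0] unfolding ua(1) q(4) ub(1) K by (simp add: algebra_simps)
  then have c4: "0 < - T * (k31 - \<theta> * k32 + \<xi> * k33) - X * (k21 - \<theta> * k22 + \<xi> * k23)"
    by (rule zero_less_mult_pos) (use q wa wb ua ub in simp)
  define d d' e e' where "d = \<Delta> / H" and "d' = T / X" and "e = \<delta> / \<eta>" and "e' = \<theta> / \<xi>"
  have eqs: "\<Delta> = d * H" "T = d' * X" "\<delta> = e * \<eta>" "\<theta> = e' * \<xi>"
    using wa wb ua ub by (auto simp: d_def d'_def e_def e'_def)
  have w: "1/4 < d" "d < 1" "1/4 < d'" "d' < 4/5" "1/4 < e" "e < 1" "1/4 < e'" "e' < 1"
    using win wa wb ua ub by (auto simp: d_def d'_def e_def e'_def field_simps)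
  have "d * d' < 4/5" using w mult_strict_mono[of d 1 d' "4/5"] by simp
  moreover have "0 < - k31 - d * k21"
  proof -
    have "0 < H * (- k31 - d * k21)" using c1 unfolding eqs by (simp add: algebra_simps)
    from zero_less_mult_pos[OF this wb(3)] show ?thesis by simp
  qed
  moreover have "0 < k21 + d' * k31"
  proof -
    have "0 < X * (k21 + d' * k31)" using c2 unfolding eqs by (simp add: algebra_simps)
    from zero_less_mult_pos[OF this ub(3)] show ?thesis by simp
  qed
  moreover have "- k31 - d * k21 < \<eta> * (d * k22 - e * k33 + k32 - e * d * k23)"
  proof -
    have "0 < H * (k31 + d * k21 + \<eta> * (d * k22 - e * k33 + k32 - e * d * k23))"
      using c3 unfolding eqs by (simp add: algebra_simps)
    from zero_less_mult_pos[OF this wb(3)] show ?thesis by simp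
  qed
  moreover have "k21 + d' * k31 < \<xi> * (e' * k22 - d' * k33 + e' * d' * k32 - k23)"
  proof -
    have "0 < X * (\<xi> * (e' * k22 - d' * k33 + e' * d' * k32 - k23) - (k21 + d' * k31))"
      using c4 unfolding eqs by (simp add: algebra_simps)
    from zero_less_mult_pos[OF this ub(3)] show ?thesis by simp
  qed
  moreover have "d' < 1" using w by simp
  ultimately show ?thesis
    unfolding corner_bound_def K prod.case using w small k21 k31 wa ua by blast
qed

lemma det_nonzero_if_pinned:
  assumes a: "normalized a" and b: "normalized b"
    and D: "\<And>i j. i < 63 \<Longrightarrow> j < 63 \<Longrightarrow> i \<noteq> j \<Longrightarrow> 0 < det3 (b i) (mat_vec K (a i)) (b j)"
  shows "mat_det K \<noteq> 0"
proof -
  have step: "0 < det3 (rotate_polygon b i) (mat_vec (rot_mat K) (rotate_polygon a i)) (rotate_polygon b j)"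
    if D: "\<And>i j. i < 63 \<Longrightarrow> j < 63 \<Longrightarrow> i \<noteq> j \<Longrightarrow> 0 < det3 (b i) (mat_vec K (a i)) (b j)"
      and "i < 63" "j < 63" "i \<noteq> j" for a b K i j
  proof -
    have "(i + 21) mod 63 \<noteq> (j + 21) mod 63" using that(2-4) by (auto simp: mod_if split: if_splits)
    then show ?thesis unfolding rotate_polygon_def mat_vec_rot det3_rot3 by (intro D) auto
  qed
  show ?thesis
  proof (rule corner_bounds_mat_det)
    show "corner_bound K" by (rule corner_bound_if_pinned[OF a b D])
    show "corner_bound (rot_mat K)"
      by (rule corner_bound_if_pinned[OF normalized_rotate_polygon[OF a] normalized_rotate_polygon[OF b] step[OF D]])
    show "corner_bound (rot_mat (rot_mat K))"
      by (rule corner_bound_if_pinned[OF normalized_rotate_polygon[OF normalized_rotate_polygon[OF a]] normalized_rotate_polygon[OF normalized_rotate_polygon[OF b]] step[OF step[OF D]]])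
  qed
qed

section \<open>Rigid polygons\<close>

text \<open>The coordinate-free form of \<open>normalized\<close>: invariant under linear maps of
  positive determinant and under rescaling single vertices by positive factors.\<close>

definition rigid :: "(nat \<Rightarrow> vec3) \<Rightarrow> bool" where
  "rigid a \<longleftrightarrow> convex_polygon a \<and> cones_meet a [(0, 31, 32), (21, 52, 53), (42, 10, 11)] \<and>
    (\<forall>s<3. \<forall>c\<in>set corner_constraints. cones_meet (\<lambda>i. a ((i + 21 * s) mod 63)) c)"

definition lin3 :: "vec3 \<Rightarrow> vec3 \<Rightarrow> vec3 \<Rightarrow> vec3 \<Rightarrow> vec3" where
  "lin3 t u v c = fst c *\<^sub>R t + fst (snd c) *\<^sub>R u + snd (snd c) *\<^sub>R v"

definition coord3 :: "vec3 \<Rightarrow> vec3 \<Rightarrow> vec3 \<Rightarrow> vec3 \<Rightarrow> vec3" where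
  "coord3 t u v w = (det3 w u v / det3 t u v, det3 t w v / det3 t u v, det3 t u w / det3 t u v)"

lemma det3_lin3: "det3 (lin3 t u v x) (lin3 t u v y) (lin3 t u v z) = det3 x y z * det3 t u v"
proof -
  obtain a b c d e f g h i where "t = (a,b,c)" "u = (d,e,f)" "v = (g,h,i)" by (metis prod.exhaust)
  moreover obtain a' b' c' d' e' f' g' h' i' where "x = (a',b',c')" "y = (d',e',f')" "z = (g',h',i')" by (metis prod.exhaust)
  ultimately show ?thesis by (simp add: lin3_def algebra_simps)
qed

lemma det3_zero [simp]: "det3 u u v = 0" "det3 u v v = 0" "det3 u v u = 0"
  by (cases u; cases v; simp add: algebra_simps)+

lemma det3_swap: "det3 u w v = - det3 u v w" "det3 v u w = - det3 u v w"
proof -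
  obtain a b c d e f g h i where "u = (a,b,c)" "v = (d,e,f)" "w = (g,h,i)" by (metis prod.exhaust)
  then show "det3 u w v = - det3 u v w" "det3 v u w = - det3 u v w" by (simp_all add: algebra_simps)
qed

lemma det3_linear:
  "det3 (u + u') v w = det3 u v w + det3 u' v w" "det3 (c *\<^sub>R u) v w = c * det3 u v w"
  "det3 u (v + v') w = det3 u v w + det3 u v' w" "det3 u (c *\<^sub>R v) w = c * det3 u v w"
  "det3 u v (w + w') = det3 u v w + det3 u v w'" "det3 u v (c *\<^sub>R w) = c * det3 u v w"
proof -
  obtain a b c d e f g h i where *: "u = (a,b,c)" "v = (d,e,f)" "w = (g,h,i)" by (metis prod.exhaust)
  obtain a' b' c' d' e' f' g' h' i' where "u' = (a',b',c')" "v' = (d',e',f')" "w' = (g',h',i')" by (metis prod.exhaust)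
  with * show "det3 (u + u') v w = det3 u v w + det3 u' v w" "det3 u (v + v') w = det3 u v w + det3 u v' w" 
    "det3 u v (w + w') = det3 u v w + det3 u v w'"
    by (simp_all add: algebra_simps)
next
  obtain a b c d e f g h i where *: "u = (a,b,c)" "v = (d,e,f)" "w = (g,h,i)" by (metis prod.exhaust)
  then show  "det3 (x *\<^sub>R u) v w = x * det3 u v w" "det3 u (x *\<^sub>R v) w = x * det3 u v w" "det3 u v (x *\<^sub>R w) = x * det3 u v w" for x
    by (simp_all add: algebra_simps)
qed

lemma cramer3: "det3 t u v *\<^sub>R w = det3 w u v *\<^sub>R t + det3 t w v *\<^sub>R u + det3 t u w *\<^sub>R v"
proof -
  obtain a b c d e f g h i j k l where "t = (a,b,c)" "u = (d,e,f)" "v = (g,h,i)" "w = (j,k,l)" by (metis prod.exhaust)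
  then show ?thesis by (simp add: algebra_simps)
qed

lemma lin3_coord3:
  assumes "det3 t u v \<noteq> 0" shows "lin3 t u v (coord3 t u v w) = w"
proof -
  have "w = (1 / det3 t u v) *\<^sub>R (det3 t u v *\<^sub>R w)" using assms by simp
  also have "\<dots> = lin3 t u v (coord3 t u v w)"
    by (subst cramer3) (simp add: lin3_def coord3_def scaleR_add_right)
  finally show ?thesis by simp
qed

lemma lin3_linear: "linear (lin3 t u v)"
  by (rule linearI) (auto simp: lin3_def algebra_simps)

lemma coord3_linear: "linear (coord3 t u v)"
  by (rule linearI) (auto simp: coord3_def det3_linear add_divide_distrib)

lemma coord3_lin3:
  assumes "det3 t u v \<noteq> 0" shows "coord3 t u v (lin3 t u v c) = c"
  using assms by (cases c) (simp add: coord3_def lin3_def det3_linear)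

lemma tri_linear_image: "linear f \<Longrightarrow> W \<in> open_cone u v w \<Longrightarrow> f W \<in> open_cone (f u) (f v) (f w)"
proof -
  assume f: "linear f" and "W \<in> open_cone u v w"
  then obtain p q r where "0 < p" "0 < q" "0 < r" "W = p *\<^sub>R u + q *\<^sub>R v + r *\<^sub>R w"
    unfolding open_cone_def by blast
  then have "f W = p *\<^sub>R f u + q *\<^sub>R f v + r *\<^sub>R f w" 
    by (simp add: linear_add[OF f] linear_cmul[OF f])
  with \<open>0 < p\<close> \<open>0 < q\<close> \<open>0 < r\<close> show ?thesis unfolding open_cone_def by blast
qed

lemma sat_linear_image: "linear f \<Longrightarrow> cones_meet a cs \<Longrightarrow> cones_meet (\<lambda>i. f (a i)) cs"
  unfolding cones_meet_def using tri_linear_image by metis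

text \<open>The corners serve as a basis, rescaled by the coordinates of the common point
  \<open>W\<close> so that \<open>W\<close> becomes \<open>(1, 1, 1)\<close>. These coordinates are
  positive because each of the three triangles containing \<open>W\<close> lies, by convexity, on
  the inner side of one edge of the triangle 0, 21, 42.\<close>

lemma rigid_normalize:
  assumes "rigid a"
  obtains t u v where "0 < det3 t u v" "normalized (\<lambda>i. coord3 t u v (a i))"
proof -
  have cp: "0 < det3 (a i) (a j) (a k)" if "i < j" "j < k" "k < 63" for i j k
    using assms that by (auto simp: rigid_def convex_polygon_def)
  obtain W where W: "W \<in> open_cone (a 0) (a 31) (a 32)" "W \<in> open_cone (a 21) (a 52) (a 53)" "W \<in> open_cone (a 42) (a 10) (a 11)"
    using assms by (auto simp: rigid_def cones_meet_def)
  define t0 u0 v0 where "t0 = a 0" and "u0 = a 21" and "v0 = a 42"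
  define \<Delta> where "\<Delta> = det3 t0 u0 v0"
  have \<Delta>: "0 < \<Delta>" using cp by (simp add: \<Delta>_def t0_def u0_def v0_def)
  obtain x y z where xyz: "W = lin3 t0 u0 v0 (x, y, z)" "coord3 t0 u0 v0 W = (x, y, z)"
    using lin3_coord3[of t0 u0 v0 W] \<Delta> by (metis \<Delta>_def less_irrefl prod.exhaust)
  have "0 < det3 W u0 v0" "0 < det3 t0 W v0" "0 < det3 t0 u0 W"
  proof -
    obtain p q r where "0 < p" "0 < q" "0 < r" "W = p *\<^sub>R a 21 + q *\<^sub>R a 52 + r *\<^sub>R a 53"
      using W(2) by (auto simp: open_cone_def)
    then show "0 < det3 W u0 v0" using cp[of 21 42 52] cp[of 21 42 53]
      by (simp add: u0_def v0_def det3_linear det3_cycle[of "a 52"] det3_cycle[of "a 53"] add_pos_pos)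
    obtain p q r where "0 < p" "0 < q" "0 < r" "W = p *\<^sub>R a 42 + q *\<^sub>R a 10 + r *\<^sub>R a 11"
      using W(3) by (auto simp: open_cone_def)
    then show "0 < det3 t0 W v0" using cp[of 0 10 42] cp[of 0 11 42]
      by (simp add: t0_def v0_def det3_linear add_pos_pos)
    obtain p q r where "0 < p" "0 < q" "0 < r" "W = p *\<^sub>R a 0 + q *\<^sub>R a 31 + r *\<^sub>R a 32"
      using W(1) by (auto simp: open_cone_def)
    then show "0 < det3 t0 u0 W" using cp[of 0 21 31] cp[of 0 21 32]
      by (simp add: t0_def u0_def det3_linear add_pos_pos)
  qed
  then have pos: "0 < x" "0 < y" "0 < z" using xyz(2) \<Delta> by (auto simp: coord3_def \<Delta>_def)
  define t u v where "t = x *\<^sub>R t0" and "u = y *\<^sub>R u0" and "v = z *\<^sub>R v0"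
  have d: "det3 t u v = x * (y * (z * \<Delta>))" by (simp add: t_def u_def v_def det3_linear \<Delta>_def)
  then have dp: "0 < det3 t u v" using pos \<Delta> by simp
  have nz: "det3 t u v \<noteq> 0" using dp by simp
  have lin: "linear (coord3 t u v)" by (rule coord3_linear)
  have W1: "coord3 t u v W = (1, 1, 1)"
    using coord3_lin3[OF nz, of "(1, 1, 1)"] xyz(1) by (simp add: lin3_def t_def u_def v_def)
  have "det3 (coord3 t u v (a i)) (coord3 t u v (a j)) (coord3 t u v (a k)) * det3 t u v = det3 (a i) (a j) (a k)" for i j k
    using det3_lin3[of t u v "coord3 t u v (a i)" "coord3 t u v (a j)" "coord3 t u v (a k)"] by (simp add: lin3_coord3[OF nz])
  then have "0 < det3 (coord3 t u v (a i)) (coord3 t u v (a j)) (coord3 t u v (a k))" if "i < j" "j < k" "k < 63" for i j k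
    using cp[OF that] dp by (metis zero_less_mult_pos2)
  then have "convex_polygon (\<lambda>i. coord3 t u v (a i))"
    unfolding convex_polygon_def by blast
  moreover have "coord3 t u v (a 0) = (1/x, 0, 0)" "coord3 t u v (a 21) = (0, 1/y, 0)" "coord3 t u v (a 42) = (0, 0, 1/z)"
    using pos \<Delta> unfolding t_def u_def v_def t0_def u0_def v0_def \<Delta>_def
    by (simp_all add: coord3_def det3_linear)
  moreover have "cones_meet (\<lambda>i. coord3 t u v (a ((i + 21 * s) mod 63))) c" if "s < 3" "c \<in> set corner_constraints" for s c
    using assms that sat_linear_image[OF lin] unfolding rigid_def by blast
  ultimately have "normalized (\<lambda>i. coord3 t u v (a i))"
    unfolding normalized_def using pos tri_linear_image[OF lin W(1)] tri_linear_image[OF lin W(2)] tri_linear_image[OF lin W(3)]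
    unfolding W1 by (auto intro!: exI[of _ "1/x"] exI[of _ "1/y"] exI[of _ "1/z"])
  then show thesis using that dp by blast
qed

lemma linear_mat_vec:
  fixes g :: "vec3 \<Rightarrow> vec3"
  assumes "linear g" shows "\<exists>K. \<forall>v. g v = mat_vec K v"
proof -
  obtain a b c d e f p q r where e: "g (1,0,0) = (a,b,c)" "g (0,1,0) = (d,e,f)" "g (0,0,1) = (p,q,r)" by (metis prod.exhaust)
  have "g v = mat_vec ((a,d,p),(b,e,q),(c,f,r)) v" for v
  proof -
    obtain x y z where v: "v = (x,y,z)" by (metis prod.exhaust)
    have "v = x *\<^sub>R (1,0,0) + y *\<^sub>R (0,1,0) + z *\<^sub>R (0,0,1)" by (simp add: v)
    then have "g v = x *\<^sub>R g (1,0,0) + y *\<^sub>R g (0,1,0) + z *\<^sub>R g (0,0,1)"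
      by (simp only: linear_add[OF assms] linear_cmul[OF assms])
    then show ?thesis unfolding e by (simp add: v algebra_simps)
  qed
  then show ?thesis by blast
qed

lemma mat_vec_eq_zero:
  assumes "mat_det K \<noteq> 0" "mat_vec K v = 0" shows "v = 0"
proof -
  obtain a b c d e f g h i where K: "K = ((a,b,c),(d,e,f),(g,h,i))" by (metis prod.exhaust)
  obtain x y z where v: "v = (x,y,z)" by (metis prod.exhaust)
  have *: "a*x+b*y+c*z = 0" "d*x+e*y+f*z = 0" "g*x+h*y+i*z = 0"
    using assms(2) by (auto simp: K v zero_prod_def)
  have "mat_det K * x = (a*x+b*y+c*z) * (e*i-f*h) - (d*x+e*y+f*z) * (b*i-c*h) + (g*x+h*y+i*z) * (b*f-c*e)"
    "mat_det K * y = - (a*x+b*y+c*z) * (d*i-f*g) + (d*x+e*y+f*z) * (a*i-c*g) - (g*x+h*y+i*z) * (a*f-c*d)"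
    "mat_det K * z = (a*x+b*y+c*z) * (d*h-e*g) - (d*x+e*y+f*z) * (a*h-b*g) + (g*x+h*y+i*z) * (a*e-b*d)"
    by (simp_all add: K algebra_simps)
  then show ?thesis using assms(1) unfolding * by (simp add: v zero_prod_def)
qed

lemma rigid_pinned_kernel:
  assumes a: "rigid a" and b: "rigid b" and k: "linear k"
    and D: "\<And>i j. i < 63 \<Longrightarrow> j < 63 \<Longrightarrow> i \<noteq> j \<Longrightarrow> 0 < det3 (b i) (k (a i)) (b j)"
    and ker: "k l = 0"
  shows "l = 0"
proof -
  obtain t u v where A: "0 < det3 t u v" "normalized (\<lambda>i. coord3 t u v (a i))" by (rule rigid_normalize[OF a])
  obtain t' u' v' where B: "0 < det3 t' u' v'" "normalized (\<lambda>i. coord3 t' u' v' (b i))" by (rule rigid_normalize[OF b])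
  define g where "g = coord3 t' u' v' \<circ> k \<circ> lin3 t u v"
  have "linear g" unfolding g_def by (intro linear_compose lin3_linear coord3_linear k)
  from linear_mat_vec[OF this] obtain K where K: "\<And>v. g v = mat_vec K v" by blast
  have nz: "det3 t u v \<noteq> 0" "det3 t' u' v' \<noteq> 0" using A B by auto
  have "0 < det3 (coord3 t' u' v' (b i)) (mat_vec K (coord3 t u v (a i))) (coord3 t' u' v' (b j))"
    if "i < 63" "j < 63" "i \<noteq> j" for i j
  proof -
    have "mat_vec K (coord3 t u v (a i)) = coord3 t' u' v' (k (a i))"
      unfolding K[symmetric] g_def by (simp add: lin3_coord3[OF nz(1)])
    moreover have "det3 (coord3 t' u' v' (b i)) (coord3 t' u' v' (k (a i))) (coord3 t' u' v' (b j)) * det3 t' u' v' = det3 (b i) (k (a i)) (b j)"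
      unfolding det3_lin3[symmetric] lin3_coord3[OF nz(2)] ..
    ultimately show ?thesis using D[OF that] B(1) by (metis zero_less_mult_pos2)
  qed
  then have "mat_det K \<noteq> 0" by (rule det_nonzero_if_pinned[OF A(2) B(2)])
  moreover have "mat_vec K (coord3 t u v l) = 0"
    unfolding K[symmetric] g_def using ker by (simp add: lin3_coord3[OF nz(1)] linear_0[OF coord3_linear])
  ultimately have "coord3 t u v l = 0" by (rule mat_vec_eq_zero)
  then show ?thesis using lin3_coord3[OF nz(1), of l] by (simp add: linear_0[OF lin3_linear])
qed

section \<open>Cyclic order and supporting lines\<close>

lemma convex_polygon_cyclic:
  assumes "convex_polygon b" "i < 63" "0 < p" "p < q" "q < 63"
  shows "0 < det3 (b i) (b ((i + p) mod 63)) (b ((i + q) mod 63))"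
proof -
  have pos: "0 < det3 (b i) (b j) (b k)" if "i < j" "j < k" "k < 63" for i j k
    using assms that by (auto simp: convex_polygon_def)
  have m: "(i + x) mod 63 = (if i + x < 63 then i + x else i + x - 63)" if "x < 63" for x
    using that assms(2) by (auto simp: mod_if)
  have "p < 63" using assms by simp
  then show ?thesis
    unfolding m[OF \<open>p < 63\<close>] m[OF assms(5)]
    using assms pos[of i "i + p" "i + q"] pos[of "i + q - 63" i "i + p"] pos[of "i + p - 63" "i + q - 63" i]
    by (auto simp: det3_cycle[of "b (i + q - 63)"] det3_cycle[of "b i" "b (i + p - 63)"])
qed

text \<open>It suffices that the line through \<open>b i\<close> and \<open>v\<close> leaves both
  neighbours of \<open>b i\<close> on one side: the Pluecker relation \<open>e\<close> expresses the
  bracket of any other vertex as a positive combination of the two.\<close>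

lemma supporting_line:
  assumes b: "convex_polygon b" and i: "i < 63" "j < 63" "i \<noteq> j"
    and "det3 (b i) (b ((i + 1) mod 63)) v < 0" and "0 < det3 (b ((i + 62) mod 63)) (b i) v"
  shows "0 < det3 (b i) v (b j)"
proof -
  define n m where "n = b ((i + 1) mod 63)" and "m = b ((i + 62) mod 63)"
  define p where "p = (if i < j then j - i else j + 63 - i)"
  have p: "0 < p" "p < 63" "j = (i + p) mod 63" using i by (auto simp: p_def)
  have e: "det3 (b i) v (b j) * det3 (b i) n m = det3 (b i) v n * det3 (b i) (b j) m + det3 (b i) v m * det3 (b i) n (b j)"
  proof -
    obtain a b' c d e f g h i' where *: "b i = (a,b',c)" "v = (d,e,f)" "n = (g,h,i')" by (metis prod.exhaust)
    obtain a1 b1 c1 d1 e1 f1 where "m = (a1,b1,c1)" "b j = (d1,e1,f1)" by (metis prod.exhaust)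
    with * show ?thesis by (simp add: algebra_simps)
  qed
  have vn: "0 < det3 (b i) v n" using assms(5) det3_swap(1)[of "b i" v n] by (simp add: n_def)
  have vm: "0 < det3 (b i) v m" using assms(6) det3_cycle[of m "b i" v] by (simp add: m_def)
  have nm: "0 < det3 (b i) n m" using convex_polygon_cyclic[OF b i(1), of 1 62] by (simp add: n_def m_def)
  have c: "0 < det3 (b i) (b j) m" if "p \<noteq> 62" using convex_polygon_cyclic[OF b i(1), of p 62] p that by (simp add: m_def)
  have d: "0 < det3 (b i) n (b j)" if "p \<noteq> 1" using convex_polygon_cyclic[OF b i(1), of 1 p] p that by (simp add: n_def)
  have "0 < det3 (b i) v n * det3 (b i) (b j) m + det3 (b i) v m * det3 (b i) n (b j)"
  proof (cases "p = 1 \<or> p = 62")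
    case True
    then show ?thesis
    proof
      assume "p = 1" then show ?thesis using p vn nm by (simp add: n_def)
    next
      assume "p = 62" then show ?thesis using p vm nm by (simp add: m_def)
    qed
  next
    case False
    then show ?thesis using c d vn vm by (simp add: add_pos_pos)
  qed
  then show ?thesis using nm unfolding e[symmetric] by (rule zero_less_mult_pos2)
qed

section \<open>A rigid 63-gon\<close>

definition arc_slope :: real where
  "arc_slope = 23/40"

text \<open>In the chart at its initial corner the point of parameter \<open>t\<close> has size
  \<open>t\<close> and geometric slope \<open>arc_slope / (1 + t)\<close>; in the chart at its final
  corner, reached as \<open>t\<close> tends to infinity, size \<open>1 / t\<close> and slope
  \<open>arc_slope * t / (1 + t)\<close>. Near all corners the slopes are thus close to 23/40,
  inside the window from 1/4 to 4/5.\<close>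

definition arc :: "nat \<Rightarrow> real \<Rightarrow> vec3" where
  "arc j t = (if j = 0 then (1 + t, t + t^2, - arc_slope * t)
     else if j = 1 then (- arc_slope * t, 1 + t, t + t^2) else (t + t^2, - arc_slope * t, 1 + t))"

text \<open>Entry \<open>10 - k\<close> becomes the size of the vertex \<open>10 - k\<close>, and entry \<open>11 + k\<close> the reciprocal of the size of the
  vertex \<open>53 + k\<close>.\<close>

definition arc_parameter :: "real list" where
  "arc_parameter = [0, 1/1296000000000000, 1/230400000000000, 1/36000000000000, 1/6400000000000, 1/1000000000000, 1/500000, 1/500, 1/20, 1/4, 19/20, 20/19, 4, 20, 500, 500000, 3200000000000/3, 6000000000000, 38400000000000, 216000000000000, 1382400000000000]"

definition alpha :: "nat \<Rightarrow> vec3" where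
  "alpha i = arc (i div 21) (arc_parameter ! (i mod 21))"

lemma rot3_arc: "rot3 (arc 0 t) = arc 2 t" "rot3 (arc 1 t) = arc 0 t" "rot3 (arc 2 t) = arc 1 t"
  by (simp_all add: arc_def)

text \<open>The coordinates are polynomials of degree at most 2 in the parameter, so the determinant
  is a constant times a Vandermonde determinant.\<close>

lemma det3_arc_000:
  assumes "0 \<le> t" "t < t'" "t' < t''" shows "0 < det3 (arc 0 t) (arc 0 t') (arc 0 t'')"
proof -
  have "det3 (arc 0 t) (arc 0 t') (arc 0 t'') = arc_slope * (t' - t) * ((t'' - t) * (t'' - t'))"
    by (simp add: arc_def algebra_simps power2_eq_square)
  moreover have "0 < arc_slope * (t' - t) * ((t'' - t) * (t'' - t'))" using assms by (simp add: arc_slope_def)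
  ultimately show ?thesis by simp
qed

lemma det3_arc_001:
  assumes "0 \<le> t" "t < t'" "0 \<le> r" shows "0 < det3 (arc 0 t) (arc 0 t') (arc 1 r)"
proof -
  have "det3 (arc 0 t) (arc 0 t') (arc 1 r) = (t' - t) *
      (arc_slope * (1 + r) + (1 - arc_slope^2) * (t * t') * r + (1 + t + t') * r + (1 + t) * (1 + t') * r^2)"
    by (simp add: arc_def algebra_simps power2_eq_square)
  moreover have "0 < arc_slope * (1 + r) + (1 - arc_slope^2) * (t * t') * r + (1 + t + t') * r + (1 + t) * (1 + t') * r^2"
    using assms by (intro add_pos_nonneg) (auto simp: power2_eq_square arc_slope_def)
  ultimately show ?thesis using assms by simp
qed

lemma det3_arc_002:
  assumes "0 \<le> t" "t < t'" "0 \<le> r" shows "0 < det3 (arc 0 t) (arc 0 t') (arc 2 r)"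
proof -
  have "det3 (arc 0 t) (arc 0 t') (arc 2 r) = (t' - t) *
      (1 + (1 - arc_slope^2) * r + (t + t' + t * t') * (1 + r) + arc_slope * (t * t') * (r + r^2))"
    by (simp add: arc_def algebra_simps power2_eq_square)
  moreover have "0 < 1 + (1 - arc_slope^2) * r + (t + t' + t * t') * (1 + r) + arc_slope * (t * t') * (r + r^2)"
    using assms by (intro add_pos_nonneg) (auto simp: power2_eq_square arc_slope_def)
  ultimately show ?thesis using assms by simp
qed

lemma det3_arc_012:
  assumes "0 \<le> t" "0 \<le> r" "0 \<le> v" shows "0 < det3 (arc 0 t) (arc 1 r) (arc 2 v)"
proof -
  have "det3 (arc 0 t) (arc 1 r) (arc 2 v) =
      1 + (t + r + v + t * r + t * v + r * v) + (1 - arc_slope^3) * (t * r * v) + (1 + t) * (r + r^2) * (arc_slope * v) +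
      (t + t^2) * (arc_slope * r) * (1 + v) + (t + t^2) * (r + r^2) * (v + v^2) + arc_slope * t * (1 + r) * (v + v^2)"
    by (simp add: arc_def algebra_simps power2_eq_square power3_eq_cube)
  also have "\<dots> > 0" using assms
    by (intro add_pos_nonneg mult_nonneg_nonneg add_nonneg_nonneg) (auto simp: power3_eq_cube arc_slope_def)
  finally show ?thesis .
qed

lemma par_mono: "i < j \<Longrightarrow> j < 21 \<Longrightarrow> arc_parameter ! i < arc_parameter ! j"
proof -
  have "sorted_wrt (<) arc_parameter" by (simp add: arc_parameter_def)
  moreover have "length arc_parameter = 21" by (simp add: arc_parameter_def)
  ultimately show "i < j \<Longrightarrow> j < 21 \<Longrightarrow> arc_parameter ! i < arc_parameter ! j" by (simp add: sorted_wrt_iff_nth_less)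
qed

lemma par_nonneg: "j < 21 \<Longrightarrow> 0 \<le> arc_parameter ! j"
  using par_mono[of 0 j] by (cases "j = 0") (auto simp: arc_parameter_def)

text \<open>Up to \<open>rot3\<close> and cyclic permutation, three vertices are distributed over
  the arcs in one of the four patterns treated above.\<close>

lemma convex_polygon_alpha: "convex_polygon alpha"
  unfolding convex_polygon_def
proof (intro allI impI)
  fix i j k :: nat assume ijk: "i < j" "j < k" "k < 63"
  define t where "t x = arc_parameter ! (x mod 21)" for x :: nat
  have t: "0 \<le> t x" for x by (simp add: t_def par_nonneg)
  have tt: "t x < t y" if "x < y" "x div 21 = y div 21" for x y
  proof -
    have "x mod 21 < y mod 21" using that by (metis div_mult_mod_eq add_less_cancel_left)
    then show ?thesis unfolding t_def by (rule par_mono) simp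
  qed
  have div: "i div 21 \<le> j div 21" "j div 21 \<le> k div 21" "k div 21 < 3" using ijk by (auto simp: div_le_mono)
  have a: "alpha x = arc (x div 21) (t x)" for x by (simp add: alpha_def t_def)
  have r: "det3 (arc 2 x) (arc 2 y) (arc l z) = det3 (arc 1 x) (arc 1 y) (rot3 (arc l z))"
    "det3 (arc 1 x) (arc 1 y) (arc l z) = det3 (arc 0 x) (arc 0 y) (rot3 (arc l z))" for x y z l
    using det3_rot3[of "arc 2 x" "arc 2 y" "arc l z"] det3_rot3[of "arc 1 x" "arc 1 y" "arc l z"]
    by (simp_all only: rot3_arc)
  consider "i div 21 = j div 21" "j div 21 = k div 21" | "i div 21 = j div 21" "j div 21 < k div 21"
    | "i div 21 < j div 21" "j div 21 = k div 21" | "i div 21 < j div 21" "j div 21 < k div 21"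
    using div by linarith
  then show "0 < det3 (alpha i) (alpha j) (alpha k)"
  proof cases
    case 1
    then have "0 < det3 (arc 0 (t i)) (arc 0 (t j)) (arc 0 (t k))"
      using ijk by (intro det3_arc_000 t tt) auto
    moreover have "k div 21 = 0 \<or> k div 21 = 1 \<or> k div 21 = 2" using div by linarith
    ultimately show ?thesis unfolding a 1 by (auto simp: r rot3_arc simp del: det3.simps One_nat_def)
  next
    case 2
    then have "0 < det3 (arc 0 (t i)) (arc 0 (t j)) (arc 1 (t k))" "0 < det3 (arc 0 (t i)) (arc 0 (t j)) (arc 2 (t k))"
      using ijk by (auto intro!: det3_arc_001 det3_arc_002 t tt simp del: One_nat_def)
    moreover have "j div 21 = 0 \<and> k div 21 = 1 \<or> j div 21 = 0 \<and> k div 21 = 2 \<or> j div 21 = 1 \<and> k div 21 = 2" using div 2 by linarith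
    ultimately show ?thesis unfolding a 2 by (auto simp: r rot3_arc simp del: det3.simps One_nat_def)
  next
    case 3
    then have "0 < det3 (arc 0 (t j)) (arc 0 (t k)) (arc 1 (t i))" "0 < det3 (arc 0 (t j)) (arc 0 (t k)) (arc 2 (t i))"
      using ijk by (auto intro!: det3_arc_001 det3_arc_002 t tt simp del: One_nat_def)
    moreover have "i div 21 = 0 \<and> k div 21 = 1 \<or> i div 21 = 0 \<and> k div 21 = 2 \<or> i div 21 = 1 \<and> k div 21 = 2" using div 3 by linarith
    ultimately show ?thesis unfolding a 3 det3_cycle[of "arc (i div 21) (t i)"]
      by (auto simp: r rot3_arc simp del: det3.simps One_nat_def)
  next
    case 4
    then have "i div 21 = 0" "j div 21 = 1" "k div 21 = 2" using div by linarith+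
    then show ?thesis unfolding a using det3_arc_012[OF t t t] by simp
  qed
qed

section \<open>Explicit common points of the triangles\<close>

lemma open_cone_if_det3:
  assumes "0 < det3 u v w * det3 W v w" "0 < det3 u v w * det3 u W w" "0 < det3 u v w * det3 u v W"
  shows "W \<in> open_cone u v w"
proof -
  have nz: "det3 u v w \<noteq> 0" using assms(1) by auto
  have "W = lin3 u v w (coord3 u v w W)" using lin3_coord3[OF nz] by simp
  moreover have "0 < fst (coord3 u v w W)" "0 < fst (snd (coord3 u v w W))" "0 < snd (snd (coord3 u v w W))"
    using assms by (auto simp: coord3_def zero_less_mult_iff zero_less_divide_iff)
  ultimately show ?thesis unfolding open_cone_def lin3_def by blast
qed

lemma alpha_cones_meetI:
  assumes "\<And>i j k. (i, j, k) \<in> set cs \<Longrightarrow> 0 < det3 (alpha i) (alpha j) (alpha k) * det3 W (alpha j) (alpha k) \<and>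
      0 < det3 (alpha i) (alpha j) (alpha k) * det3 (alpha i) W (alpha k) \<and>
      0 < det3 (alpha i) (alpha j) (alpha k) * det3 (alpha i) (alpha j) W"
  shows "cones_meet alpha cs"
  unfolding cones_meet_def
proof (rule exI, rule ballI)
  fix c assume "c \<in> set cs"
  moreover obtain i j k where "c = (i, j, k)" by (metis prod.exhaust)
  ultimately show "W \<in> open_cone (alpha (fst c)) (alpha (fst (snd c))) (alpha (snd (snd c)))"
    using assms[of i j k] by (auto intro: open_cone_if_det3)
qed

lemma alpha_eval:
  "alpha 0 = (1, 0, 0)"
  "alpha 1 = (1296000000000001/1296000000000000, 1296000000000001/1679616000000000000000000000000, -23/51840000000000000)"
  "alpha 2 = (230400000000001/230400000000000, 230400000000001/53084160000000000000000000000, -23/9216000000000000)"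
  "alpha 3 = (36000000000001/36000000000000, 36000000000001/1296000000000000000000000000, -23/1440000000000000)"
  "alpha 4 = (6400000000001/6400000000000, 6400000000001/40960000000000000000000000, -23/256000000000000)"
  "alpha 5 = (1000000000001/1000000000000, 1000000000001/1000000000000000000000000, -23/40000000000000)"
  "alpha 6 = (500001/500000, 500001/250000000000, -23/20000000)"
  "alpha 7 = (501/500, 501/250000, -23/20000)"
  "alpha 8 = (21/20, 21/400, -23/800)"
  "alpha 9 = (5/4, 5/16, -23/160)"
  "alpha 10 = (39/20, 741/400, -437/800)"
  "alpha 11 = (39/19, 780/361, -23/38)"
  "alpha 21 = (0, 1, 0)"
  "alpha 27 = (-23/20000000, 500001/500000, 500001/250000000000)"
  "alpha 28 = (-23/20000, 501/500, 501/250000)"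
  "alpha 29 = (-23/800, 21/20, 21/400)"
  "alpha 30 = (-23/160, 5/4, 5/16)"
  "alpha 31 = (-437/800, 39/20, 741/400)"
  "alpha 32 = (-23/38, 39/19, 780/361)"
  "alpha 33 = (-23/10, 5, 20)"
  "alpha 34 = (-23/2, 21, 420)"
  "alpha 35 = (-575/2, 501, 250500)"
  "alpha 36 = (-287500, 500001, 250000500000)"
  "alpha 42 = (0, 0, 1)"
  "alpha 52 = (741/400, -437/800, 39/20)"
  "alpha 53 = (780/361, -23/38, 39/19)"
  "alpha 54 = (20, -23/10, 5)"
  "alpha 55 = (420, -23/2, 21)"
  "alpha 56 = (250500, -575/2, 501)"
  "alpha 57 = (250000500000, -287500, 500001)"
  "alpha 58 = (10240000000009600000000000/9, -1840000000000/3, 3200000000003/3)"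
  "alpha 59 = (36000000000006000000000000, -3450000000000, 6000000000001)"
  "alpha 60 = (1474560000000038400000000000, -22080000000000, 38400000000001)"
  "alpha 61 = (46656000000000216000000000000, -124200000000000, 216000000000001)"
  "alpha 62 = (1911029760000001382400000000000, -794880000000000, 1382400000000001)"
  by (simp_all add: alpha_def arc_def arc_parameter_def arc_slope_def power2_eq_square)

text \<open>A common point only has to lie in an open region, so a short decimal fraction serves as
  witness. In the names, H stands for halving, P for products, C for comparisons at one level, L and
  U for lower and upper slope bounds.\<close>

lemma alpha_cones_meet_Hx1: "cones_meet alpha [(21, 42, 54), (0, 21, 31), (0, 10, 53)]"
  by (rule alpha_cones_meetI[of _ "(1, 17/50, 7/25)"]) (auto simp: alpha_eval simp del: One_nat_def)

lemma alpha_cones_meet_Hx7: "cones_meet alpha [(21, 42, 60), (0, 21, 31), (0, 4, 59)]"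
  by (rule alpha_cones_meetI[of _ "(1, 7/200000000000000, 7/250000000000000)"]) (auto simp: alpha_eval simp del: One_nat_def)

lemma alpha_cones_meet_He1: "cones_meet alpha [(42, 21, 9), (0, 42, 32), (0, 10, 53)]"
  by (rule alpha_cones_meetI[of _ "(1, 7/25, 17/50)"]) (auto simp: alpha_eval simp del: One_nat_def)

lemma alpha_cones_meet_He6: "cones_meet alpha [(42, 21, 4), (0, 42, 32), (0, 5, 58)]"
  by (rule alpha_cones_meetI[of _ "(1, 17/100000000000000, 21/100000000000000)"]) (auto simp: alpha_eval simp del: One_nat_def)

lemma alpha_cones_meet_Px2: "cones_meet alpha [(21, 42, 55), (0, 21, 30), (42, 0, 9)]"
  by (rule alpha_cones_meetI[of _ "(1, 23/100, 27/500)"]) (auto simp: alpha_eval simp del: One_nat_def)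

lemma alpha_cones_meet_Px3: "cones_meet alpha [(21, 42, 56), (0, 21, 29), (42, 0, 8)]"
  by (rule alpha_cones_meetI[of _ "(1, 47/1000, 11/5000)"]) (auto simp: alpha_eval simp del: One_nat_def)

lemma alpha_cones_meet_Px4: "cones_meet alpha [(21, 42, 57), (0, 21, 28), (42, 0, 7)]"
  by (rule alpha_cones_meetI[of _ "(1, 17/10000, 27/10000000)"]) (auto simp: alpha_eval simp del: One_nat_def)

lemma alpha_cones_meet_Px5: "cones_meet alpha [(21, 42, 58), (0, 21, 27), (42, 0, 6)]"
  by (rule alpha_cones_meetI[of _ "(1, 3/2000000, 1/500000000000)"]) (auto simp: alpha_eval simp del: One_nat_def)

lemma alpha_cones_meet_C5: "cones_meet alpha [(21, 42, 58), (0, 21, 31), (42, 0, 5)]"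
  by (rule alpha_cones_meetI[of _ "(1, 249/250000000000000, 471/500000000000000)"]) (auto simp: alpha_eval simp del: One_nat_def)

lemma alpha_cones_meet_C7: "cones_meet alpha [(21, 42, 60), (0, 21, 31), (42, 0, 3)]"
  by (rule alpha_cones_meetI[of _ "(1, 277/10000000000000000, 131/5000000000000000)"]) (auto simp: alpha_eval simp del: One_nat_def)

lemma alpha_cones_meet_C9: "cones_meet alpha [(21, 42, 62), (0, 21, 31), (42, 0, 1)]"
  by (rule alpha_cones_meetI[of _ "(1, 77/100000000000000000, 73/100000000000000000)"]) (auto simp: alpha_eval simp del: One_nat_def)

lemma alpha_cones_meet_Pe2: "cones_meet alpha [(42, 21, 8), (0, 42, 33), (21, 0, 54)]"
  by (rule alpha_cones_meetI[of _ "(1, 27/500, 23/100)"]) (auto simp: alpha_eval simp del: One_nat_def)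

lemma alpha_cones_meet_Pe3: "cones_meet alpha [(42, 21, 7), (0, 42, 34), (21, 0, 55)]"
  by (rule alpha_cones_meetI[of _ "(1, 11/5000, 47/1000)"]) (auto simp: alpha_eval simp del: One_nat_def)

lemma alpha_cones_meet_Pe4: "cones_meet alpha [(42, 21, 6), (0, 42, 35), (21, 0, 56)]"
  by (rule alpha_cones_meetI[of _ "(1, 27/10000000, 17/10000)"]) (auto simp: alpha_eval simp del: One_nat_def)

lemma alpha_cones_meet_Pe5: "cones_meet alpha [(42, 21, 5), (0, 42, 36), (21, 0, 57)]"
  by (rule alpha_cones_meetI[of _ "(1, 1/500000000000, 3/2000000)"]) (auto simp: alpha_eval simp del: One_nat_def)

lemma alpha_cones_meet_C6: "cones_meet alpha [(42, 21, 4), (0, 42, 32), (21, 0, 59)]"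
  by (rule alpha_cones_meetI[of _ "(1, 157/1000000000000000, 83/500000000000000)"]) (auto simp: alpha_eval simp del: One_nat_def)

lemma alpha_cones_meet_C8: "cones_meet alpha [(42, 21, 2), (0, 42, 32), (21, 0, 61)]"
  by (rule alpha_cones_meetI[of _ "(1, 109/25000000000000000, 461/100000000000000000)"]) (auto simp: alpha_eval simp del: One_nat_def)

lemma alpha_cones_meet_Lw: "cones_meet alpha [(42, 0, 4), (0, 21, 5), (21, 5, 59)]"
  by (rule alpha_cones_meetI[of _ "(1, 77/500000000000000, -131/100000000000000000)"]) (auto simp: alpha_eval simp del: One_nat_def)

lemma alpha_cones_meet_Lu: "cones_meet alpha [(21, 0, 60), (0, 42, 59), (42, 3, 59)]"
  by (rule alpha_cones_meetI[of _ "(1, -11/50000000000000000, 13/500000000000000)"]) (auto simp: alpha_eval simp del: One_nat_def)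

lemma alpha_cones_meet_Uw: "cones_meet alpha [(42, 21, 3), (0, 21, 42), (0, 5, 60)]"
  by (rule alpha_cones_meetI[of _ "(1, 7/250000000000000, 3/12500000000000000)"]) (auto simp: alpha_eval simp del: One_nat_def)

lemma alpha_cones_meet_Uw2: "cones_meet alpha [(42, 21, 1), (0, 21, 42), (0, 3, 62)]"
  by (rule alpha_cones_meetI[of _ "(1, 39/50000000000000000, 67/10000000000000000000)"]) (auto simp: alpha_eval simp del: One_nat_def)

lemma alpha_cones_meet_Uu: "cones_meet alpha [(21, 42, 61), (0, 21, 42), (0, 2, 59)]"
  by (rule alpha_cones_meetI[of _ "(1, 1/25000000000000000, 47/10000000000000000)"]) (auto simp: alpha_eval simp del: One_nat_def)

lemma alpha_cones_meet_W0: "cones_meet alpha [(0, 31, 32), (21, 52, 53), (42, 10, 11)]"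
  by (rule alpha_cones_meetI[of _ "(1, 1, 1)"]) (auto simp: alpha_eval simp del: One_nat_def)

text \<open>The threefold symmetry of \<open>alpha\<close>, which reduces the constraints at all
  corners to those at corner 0.\<close>

lemma alpha_shift: "alpha ((i + 21) mod 63) = rot3 (rot3 (alpha (i mod 63)))"
proof -
  define m where "m = i mod 63"
  have "(i + 21) mod 63 = (m + 21) mod 63" by (simp add: m_def mod_add_left_eq)
  moreover have "m < 63" by (simp add: m_def)
  moreover have "(m + 21) mod 63 = (if m < 42 then m + 21 else m - 42)" using \<open>m < 63\<close> by (auto simp: mod_if)
  moreover have "alpha (m + 21) = rot3 (rot3 (alpha m))" if "m < 42"
  proof -
    have "m div 21 = 0 \<or> m div 21 = 1" using that by linarith
    then show ?thesis by (auto simp: alpha_def rot3_arc simp del: One_nat_def)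
  qed
  moreover have "alpha (m - 42) = rot3 (rot3 (alpha m))" if "42 \<le> m"
  proof -
    obtain l where l: "m = l + 42" using \<open>42 \<le> m\<close> by (metis le_add_diff_inverse2)
    then have "l < 21" using \<open>m < 63\<close> by simp
    moreover have "(l + 42) div 21 = l div 21 + 2" "(l + 42) mod 21 = l mod 21"
      using div_mult_self1[of 21 l 2] mod_mult_self1[of l 2 21] by simp_all
    ultimately show ?thesis unfolding l
      by (simp add: alpha_def rot3_arc rot3_arc[unfolded numeral_2_eq_2] del: One_nat_def)
  qed
  ultimately show ?thesis by (auto simp: m_def)
qed

lemma corner_constraints_bound: "c \<in> set corner_constraints \<Longrightarrow> t \<in> set c \<Longrightarrow> fst t < 63 \<and> fst (snd t) < 63 \<and> snd (snd t) < 63"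
  by (auto simp: corner_constraints_def)

lemma alpha_cones_meet_corner: "c \<in> set corner_constraints \<Longrightarrow> cones_meet alpha c"
  using alpha_cones_meet_Hx1 alpha_cones_meet_Hx7 alpha_cones_meet_He1 alpha_cones_meet_He6 alpha_cones_meet_Px2 alpha_cones_meet_Px3 alpha_cones_meet_Px4 alpha_cones_meet_Px5 alpha_cones_meet_C5 alpha_cones_meet_C7 alpha_cones_meet_C9 alpha_cones_meet_Pe2 alpha_cones_meet_Pe3 alpha_cones_meet_Pe4 alpha_cones_meet_Pe5 alpha_cones_meet_C6 alpha_cones_meet_C8 alpha_cones_meet_Lw alpha_cones_meet_Lu alpha_cones_meet_Uw alpha_cones_meet_Uw2 alpha_cones_meet_Uu
  by (auto simp: corner_constraints_def)

lemma alpha_cones_meet_shift: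
  assumes "c \<in> set corner_constraints" shows "cones_meet (\<lambda>i. alpha ((i + 21 * s) mod 63)) c"
proof (induction s)
  case 0
  show ?case using alpha_cones_meet_corner[OF assms] corner_constraints_bound[OF assms] by (simp add: cones_meet_def)
next
  case (Suc s)
  have e: "i + 21 * Suc s = i + 21 * s + 21" for i by simp
  show ?case unfolding e alpha_shift by (rule cones_meet_rot3[OF cones_meet_rot3[OF Suc.IH]])
qed

lemma rigid_alpha: "rigid alpha"
  unfolding rigid_def using convex_polygon_alpha alpha_cones_meet_W0 alpha_cones_meet_shift by blast

section \<open>Slack matrices of layered posets\<close>

text \<open>\<open>Q\<close> stands for the affine functionals, evaluated at points attached to the elements of \<open>V\<close>. Elements
  satisfying \<open>R\<close> stand for faces of dimension at most two, in which any four points are affinely dependent.\<close>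

definition slack_rows :: "'i rel \<Rightarrow> 'i set \<Rightarrow> ('i \<Rightarrow> bool) \<Rightarrow> ('i \<Rightarrow> 'i \<Rightarrow> real) \<Rightarrow> ('i \<Rightarrow> real) set \<Rightarrow> bool" where
  "slack_rows r V R A Q \<longleftrightarrow>
    (\<forall>T\<in>Field r. \<forall>x\<in>V. 0 \<le> A T x \<and> (A T x = 0 \<longleftrightarrow> (x, T) \<in> r)) \<and>
    (\<forall>T\<in>Field r. A T \<in> Q) \<and>
    (\<forall>S\<in>Field r. R S \<longrightarrow> (\<forall>x. (\<forall>m<4. x m \<in> V \<and> (x m, S) \<in> r) \<longrightarrow>
       (\<exists>\<kappa> :: nat \<Rightarrow> real. (\<exists>m<4. \<kappa> m \<noteq> 0) \<and> (\<forall>\<rho>\<in>Q. (\<Sum>m<4. \<kappa> m * \<rho> (x m)) = 0))))"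

text \<open>The face \<open>fG\<close> is the polygon with vertices \<open>g m\<close>; layer \<open>l\<close> consists of \<open>c l 0, c l 1, c l 2\<close>. The face
  \<open>fT i l\<close> contains edge \<open>i\<close> of the polygon, and \<open>fT (tr l D) l\<close> all of layer \<open>l\<close> except \<open>c l D\<close>. Within a group
  of three layers, \<open>fW l\<close> contains the layers \<open>l\<close> and \<open>l + 1\<close>.\<close>

locale layered =
  fixes r :: "'i rel" and V :: "'i set" and R :: "'i \<Rightarrow> bool" and M :: nat and tr :: "nat \<Rightarrow> nat \<Rightarrow> nat"
    and g :: "nat \<Rightarrow> 'i" and c :: "nat \<Rightarrow> nat \<Rightarrow> 'i"
    and fG :: 'i and fT :: "nat \<Rightarrow> nat \<Rightarrow> 'i" and fW :: "nat \<Rightarrow> 'i" and fS :: "nat \<Rightarrow> nat \<Rightarrow> 'i"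
  assumes V: "\<And>m. m < 63 \<Longrightarrow> g m \<in> V" "\<And>l C. 0 < l \<Longrightarrow> l \<le> M \<Longrightarrow> C < 3 \<Longrightarrow> c l C \<in> V"
    and F: "fG \<in> Field r" "\<And>i l. i < 63 \<Longrightarrow> 0 < l \<Longrightarrow> l \<le> M \<Longrightarrow> fT i l \<in> Field r"
      "\<And>l. 0 < l \<Longrightarrow> l < M \<Longrightarrow> fW l \<in> Field r"
      "\<And>l D. 0 < l \<Longrightarrow> l \<le> M \<Longrightarrow> D < 3 \<Longrightarrow> fS l D \<in> Field r"
    and tr: "\<And>l D. 0 < l \<Longrightarrow> l \<le> M \<Longrightarrow> D < 3 \<Longrightarrow> tr l D < 63" and M: "0 < M"
    and G: "\<And>m. m < 63 \<Longrightarrow> (g m, fG) \<in> r" "\<And>l C. 0 < l \<Longrightarrow> l \<le> M \<Longrightarrow> C < 3 \<Longrightarrow> (c l C, fG) \<notin> r"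
      "R fG"
    and T: "\<And>i l m. i < 63 \<Longrightarrow> m < 63 \<Longrightarrow> 0 < l \<Longrightarrow> l \<le> M \<Longrightarrow> (g m, fT i l) \<in> r \<longleftrightarrow> m = i \<or> m = (i + 1) mod 63"
      "\<And>l C D. 0 < l \<Longrightarrow> l \<le> M \<Longrightarrow> C < 3 \<Longrightarrow> D < 3 \<Longrightarrow> (c l C, fT (tr l D) l) \<in> r \<longleftrightarrow> C \<noteq> D"
    and W: "\<And>l m. 0 < l \<Longrightarrow> l < M \<Longrightarrow> m < 63 \<Longrightarrow> (g m, fW l) \<notin> r"
      "\<And>l C. 0 < l \<Longrightarrow> l < M \<Longrightarrow> l mod 3 \<noteq> 0 \<Longrightarrow> C < 3 \<Longrightarrow> (c l C, fW l) \<in> r \<and> (c (Suc l) C, fW l) \<in> r"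
    and S: "\<And>l D. 0 < l \<Longrightarrow> l \<le> M \<Longrightarrow> D < 3 \<Longrightarrow> R (fS l D)"
      "\<And>l D. 0 < l \<Longrightarrow> l \<le> M \<Longrightarrow> D < 3 \<Longrightarrow> (g (tr l D), fS l D) \<in> r \<and> (g ((tr l D + 1) mod 63), fS l D) \<in> r"
      "\<And>l C D. 0 < l \<Longrightarrow> l \<le> M \<Longrightarrow> C < 3 \<Longrightarrow> D < 3 \<Longrightarrow> C \<noteq> D \<Longrightarrow> (c l C, fS l D) \<in> r"

locale layered_slack = layered r V R M tr g c fG fT fW fS
  for r :: "'i rel" and V R M tr g c fG fT fW fS +
  fixes A :: "'i \<Rightarrow> 'i \<Rightarrow> real" and Q :: "('i \<Rightarrow> real) set"
  assumes slack: "slack_rows r V R A Q"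
begin

lemma nonneg: "T \<in> Field r \<Longrightarrow> x \<in> V \<Longrightarrow> 0 \<le> A T x"
  and zero_iff: "T \<in> Field r \<Longrightarrow> x \<in> V \<Longrightarrow> A T x = 0 \<longleftrightarrow> (x, T) \<in> r"
  and rows: "T \<in> Field r \<Longrightarrow> A T \<in> Q"
  using slack by (auto simp: slack_rows_def)

lemma pos: "T \<in> Field r \<Longrightarrow> x \<in> V \<Longrightarrow> (x, T) \<notin> r \<Longrightarrow> 0 < A T x"
  using nonneg zero_iff by (metis less_eq_real_def)

lemma dependent4:
  assumes "S \<in> Field r" "R S"
    "w \<in> V" "x \<in> V" "y \<in> V" "z \<in> V" "(w, S) \<in> r" "(x, S) \<in> r" "(y, S) \<in> r" "(z, S) \<in> r"
  shows "\<exists>k0 k1 k2 k3. (k0 \<noteq> 0 \<or> k1 \<noteq> 0 \<or> k2 \<noteq> 0 \<or> k3 \<noteq> 0) \<and>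
    (\<forall>\<rho>\<in>Q. k0 * \<rho> w + k1 * \<rho> x + k2 * \<rho> y + k3 * \<rho> z = 0)"
proof -
  define f where "f m = (if m = 0 then w else if m = 1 then x else if m = 2 then y else z)" for m :: nat
  have "\<forall>m<4. f m \<in> V \<and> (f m, S) \<in> r" using assms by (auto simp: f_def)
  then obtain \<kappa> :: "nat \<Rightarrow> real" where "\<exists>m<4. \<kappa> m \<noteq> 0" and \<kappa>: "\<forall>\<rho>\<in>Q. (\<Sum>m<4. \<kappa> m * \<rho> (f m)) = 0"
    using slack assms(1,2) unfolding slack_rows_def by blast
  then have "\<kappa> 0 \<noteq> 0 \<or> \<kappa> 1 \<noteq> 0 \<or> \<kappa> 2 \<noteq> 0 \<or> \<kappa> 3 \<noteq> 0" by (auto simp: less_Suc_eq numeral_eq_Suc)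
  moreover have "\<forall>\<rho>\<in>Q. \<kappa> 0 * \<rho> w + \<kappa> 1 * \<rho> x + \<kappa> 2 * \<rho> y + \<kappa> 3 * \<rho> z = 0"
    using \<kappa> by (simp add: f_def numeral_eq_Suc)
  ultimately show ?thesis by blast
qed

text \<open>Values at three vertices of the polygon serve as homogeneous coordinates for functionals
  on its plane.\<close>

definition ground_vec :: "('i \<Rightarrow> real) \<Rightarrow> vec3" where
  "ground_vec \<rho> = (\<rho> (g 0), \<rho> (g 1), \<rho> (g 2))"

lemma T_zero:
  assumes "i < 63" "m < 63" "0 < l" "l \<le> M"
  shows "A (fT i l) (g m) = 0 \<longleftrightarrow> m = i \<or> m = (i + 1) mod 63"
  using zero_iff[OF F(2) V(1), of i l m] T(1)[of i m l] assms by auto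

lemma T_pos:
  assumes "i < 63" "m < 63" "0 < l" "l \<le> M" "m \<noteq> i" "m \<noteq> (i + 1) mod 63"
  shows "0 < A (fT i l) (g m)"
  using T_zero[of i m l] nonneg[OF F(2) V(1), of i l m] assms by auto

text \<open>The polygon satisfies \<open>R\<close>, so its vertices 0, 1, 2 and \<open>m\<close> are
  dependent. The rows of the edges 0, 1, 2 show that the first three vertices are independent, so
  vertex \<open>m\<close> has a nonzero coefficient.\<close>

lemma coordinates:
  assumes "m < 63"
  shows "\<exists>x. \<forall>\<rho>\<in>Q. \<rho> (g m) = x \<bullet> ground_vec \<rho>"
proof -
  have "\<exists>k0 k1 k2 k3. (k0 \<noteq> 0 \<or> k1 \<noteq> 0 \<or> k2 \<noteq> 0 \<or> k3 \<noteq> 0) \<and>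
    (\<forall>\<rho>\<in>Q. k0 * \<rho> (g 0) + k1 * \<rho> (g 1) + k2 * \<rho> (g 2) + k3 * \<rho> (g m) = 0)"
    by (rule dependent4[OF F(1) G(3)]) (use assms V G in auto)
  then obtain k0 k1 k2 k3 where k: "k0 \<noteq> 0 \<or> k1 \<noteq> 0 \<or> k2 \<noteq> 0 \<or> k3 \<noteq> (0::real)"
    "\<And>\<rho>. \<rho> \<in> Q \<Longrightarrow> k0 * \<rho> (g 0) + k1 * \<rho> (g 1) + k2 * \<rho> (g 2) + k3 * \<rho> (g m) = 0" by blast
  have "k3 \<noteq> 0"
  proof
    assume "k3 = 0"
    have row: "A (fT i 1) \<in> Q" if "i < 63" for i using rows F(2) M that by simp
    have "k2 = 0" using k(2)[OF row[of 0]] T_zero[of 0 0 1] T_zero[of 0 1 1] T_zero[of 0 2 1] M \<open>k3 = 0\<close> by simp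
    moreover have "k0 = 0" using k(2)[OF row[of 1]] T_zero[of 1 0 1] T_zero[of 1 1 1] T_zero[of 1 2 1] M \<open>k3 = 0\<close>
      by simp
    moreover have "k1 = 0" using k(2)[OF row[of 2]] T_zero[of 2 0 1] T_zero[of 2 1 1] T_zero[of 2 2 1] M \<open>k3 = 0\<close> calculation
      by simp
    ultimately show False using k(1) \<open>k3 = 0\<close> by simp
  qed
  then have "\<rho> (g m) = (- k0 / k3, - k1 / k3, - k2 / k3) \<bullet> ground_vec \<rho>" if "\<rho> \<in> Q" for \<rho>
  proof -
    have "k3 * \<rho> (g m) = - k0 * \<rho> (g 0) - k1 * \<rho> (g 1) - k2 * \<rho> (g 2)" using k(2)[OF that] by linarith
    then have "\<rho> (g m) = (- k0 * \<rho> (g 0) - k1 * \<rho> (g 1) - k2 * \<rho> (g 2)) / k3"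
      using \<open>k3 \<noteq> 0\<close> by (simp add: eq_divide_eq mult.commute)
    then show ?thesis by (simp add: ground_vec_def diff_divide_distrib)
  qed
  then show ?thesis by blast
qed

definition X :: "nat \<Rightarrow> vec3" where
  "X m = (if m = 0 then (1, 0, 0) else if m = 1 then (0, 1, 0) else if m = 2 then (0, 0, 1)
     else (SOME x. \<forall>\<rho>\<in>Q. \<rho> (g m) = x \<bullet> ground_vec \<rho>))"

lemma X: "m < 63 \<Longrightarrow> \<rho> \<in> Q \<Longrightarrow> \<rho> (g m) = X m \<bullet> ground_vec \<rho>"
  using someI_ex[OF coordinates, of m] by (auto simp: X_def ground_vec_def)

text \<open>The line of edge \<open>i\<close>, read off at layer 1; \<open>al_scale\<close> shows
  that all layers yield the same line.\<close>

definition al :: "nat \<Rightarrow> vec3" where "al i = ground_vec (A (fT i 1))"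

lemma al_inner:
  assumes "i < 63" "m < 63"
  shows "0 \<le> X m \<bullet> al i" "X m \<bullet> al i = 0 \<longleftrightarrow> m = i \<or> m = (i + 1) mod 63"
proof -
  have "A (fT i 1) (g m) = X m \<bullet> al i"
    unfolding al_def using X[OF assms(2) rows[OF F(2)]] assms M by simp
  then show "0 \<le> X m \<bullet> al i" "X m \<bullet> al i = 0 \<longleftrightarrow> m = i \<or> m = (i + 1) mod 63"
    using nonneg[OF F(2) V(1), of i 1 m] T_zero[of i m 1] assms M by auto
qed

end

section \<open>A polygon and its polar recovered from incidences\<close>

fun cross :: "vec3 \<Rightarrow> vec3 \<Rightarrow> vec3" where
  "cross (a, b, c) (d, e, f) = (b * f - c * e, c * d - a * f, a * e - b * d)"

lemma det3_cross: "det3 u v w = cross u v \<bullet> w"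
proof -
  obtain a b c d e f g h i where "u = (a,b,c)" "v = (d,e,f)" "w = (g,h,i)" by (metis prod.exhaust)
  then show ?thesis by (simp add: algebra_simps)
qed

lemma cross_cross: "cross (cross a b) (cross b c) = det3 a b c *\<^sub>R b"
proof -
  obtain a1 b1 c1 d e f g h i where "a = (a1,b1,c1)" "b = (d,e,f)" "c = (g,h,i)" by (metis prod.exhaust)
  then show ?thesis by (simp add: algebra_simps)
qed

lemma cross_scale: "cross (p *\<^sub>R a) (q *\<^sub>R b) = (p * q) *\<^sub>R cross a b"
  by (cases a; cases b; simp add: algebra_simps)

lemma det3_orthogonal:
  assumes "u \<bullet> n = 0" "v \<bullet> n = 0" shows "det3 u v w *\<^sub>R n = (w \<bullet> n) *\<^sub>R cross u v"
proof -
  obtain a b c d e f g h i where *: "u = (a,b,c)" "v = (d,e,f)" "w = (g,h,i)" by (metis prod.exhaust)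
  obtain x y z where n: "n = (x,y,z)" by (metis prod.exhaust)
  have 1: "a * x + b * y + c * z = 0" and 2: "d * x + e * y + f * z = 0" using assms unfolding * n by auto
  have "(a * (e * i - f * h) - b * (d * i - f * g) + c * (d * h - e * g)) * x - (g * x + h * y + i * z) * (b * f - c * e)
     = (a * x + b * y + c * z) * (e * i - f * h) - (d * x + e * y + f * z) * (b * i - c * h)" by algebra
  moreover have "(a * (e * i - f * h) - b * (d * i - f * g) + c * (d * h - e * g)) * y - (g * x + h * y + i * z) * (c * d - a * f)
     = - (a * x + b * y + c * z) * (d * i - f * g) + (d * x + e * y + f * z) * (a * i - c * g)" by algebra
  moreover have "(a * (e * i - f * h) - b * (d * i - f * g) + c * (d * h - e * g)) * z - (g * x + h * y + i * z) * (a * e - b * d)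
     = (a * x + b * y + c * z) * (d * h - e * g) - (d * x + e * y + f * z) * (a * h - b * g)" by algebra
  ultimately show ?thesis unfolding * n 1 2 by simp
qed

lemma convex_polygonI:
  assumes H: "\<And>m k. Suc m < 63 \<Longrightarrow> k < 63 \<Longrightarrow> k \<noteq> m \<Longrightarrow> k \<noteq> Suc m \<Longrightarrow> 0 < det3 (a m) (a (Suc m)) (a k)"
  shows "convex_polygon a"
  unfolding convex_polygon_def
proof (intro allI impI)
  fix i j k :: nat assume ijk: "i < j" "j < k" "k < 63"
  have cons: "0 < det3 (a i) (a q) (a (Suc q))" if "i < q" "Suc q < 63" for q
    using H[of q i] that by (simp add: det3_cycle[of "a i"])
  have first: "0 < det3 (a i) (a (Suc i)) (a q)" if "Suc i < q" "q < 63" for q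
    using H[of i q] that by simp
  show "0 < det3 (a i) (a j) (a k)"
  proof (cases "j = Suc i")
    case True
    then show ?thesis using first ijk by simp
  next
    case False
    then have j: "Suc i < j" using ijk by simp
    have "Suc j \<le> k" using ijk by simp
    then show ?thesis using \<open>k < 63\<close>
    proof (induction k rule: dec_induct)
      case base
      then show ?case using cons[of j] ijk by simp
    next
      case (step q)
      define s where "s = Suc i"
      have e: "det3 (a i) (a j) (a (Suc q)) * det3 (a i) (a s) (a q) =
          det3 (a i) (a s) (a j) * det3 (a i) (a q) (a (Suc q)) + det3 (a i) (a s) (a (Suc q)) * det3 (a i) (a j) (a q)"
      proof -
        obtain x1 x2 x3 y1 y2 y3 z1 z2 z3 where *: "a i = (x1,x2,x3)" "a j = (y1,y2,y3)" "a q = (z1,z2,z3)" by (metis prod.exhaust)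
        obtain u1 u2 u3 v1 v2 vec3 where "a (Suc q) = (u1,u2,u3)" "a s = (v1,v2,vec3)" by (metis prod.exhaust)
        with * show ?thesis by (simp add: algebra_simps)
      qed
      have "0 < det3 (a i) (a s) (a j) * det3 (a i) (a q) (a (Suc q)) + det3 (a i) (a s) (a (Suc q)) * det3 (a i) (a j) (a q)"
        using step j ijk cons[of q] first[of j] first[of "Suc q"] unfolding s_def
        by (intro add_pos_pos mult_pos_pos) auto
      then have "0 < det3 (a i) (a j) (a (Suc q)) * det3 (a i) (a s) (a q)" unfolding e .
      then show ?case by (rule zero_less_mult_pos2) (use first[of q] step j in \<open>auto simp: s_def\<close>)
    qed
  qed
qed

text \<open>\<open>X\<close> lists vertices and \<open>al\<close> edge lines of one polygon. The
  orientation is fixed at the first edge, where \<open>X 0\<close>, \<open>X 1\<close>,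
  \<open>X 2\<close> are the standard basis, and passes from edge to edge because the preceding
  vertex lies strictly on the positive side of the next edge.\<close>

lemma polygon_from_incidence:
  fixes X al :: "nat \<Rightarrow> vec3"
  assumes X: "X 0 = (1, 0, 0)" "X 1 = (0, 1, 0)" "X 2 = (0, 0, 1)"
    and nn: "\<And>i m. i < 63 \<Longrightarrow> m < 63 \<Longrightarrow> 0 \<le> X m \<bullet> al i"
    and z: "\<And>i m. i < 63 \<Longrightarrow> m < 63 \<Longrightarrow> X m \<bullet> al i = 0 \<longleftrightarrow> m = i \<or> m = (i + 1) mod 63"
  shows "\<And>m. m < 63 \<Longrightarrow> \<exists>k>0. cross (X m) (X ((m + 1) mod 63)) = k *\<^sub>R al m"
    and "\<And>m. m < 63 \<Longrightarrow> \<exists>k>0. cross (al m) (al ((m + 1) mod 63)) = k *\<^sub>R X ((m + 1) mod 63)"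
    and "convex_polygon al"
proof -
  have p: "0 < X m \<bullet> al i" if "i < 63" "m < 63" "m \<noteq> i" "m \<noteq> (i + 1) mod 63" for i m
    using nn[OF that(1,2)] z[OF that(1,2)] that by auto
  show 1: "\<exists>k>0. cross (X m) (X ((m + 1) mod 63)) = k *\<^sub>R al m" if "m < 63" for m
    using that
  proof (induction m)
    case 0
    obtain x y w where a: "al 0 = (x, y, w)" by (metis prod.exhaust)
    have "x = 0" "y = 0" "0 < w" using z[of 0 0] z[of 0 1] p[of 0 2] X by (auto simp: a)
    then show ?case using X by (intro exI[of _ "1/w"]) (auto simp: a)
  next
    case (Suc m)
    define a b c where "a = X m" and "b = X (Suc m)" and "c = X ((m + 2) mod 63)"
    have m2: "(m + 2) mod 63 \<noteq> m" "(m + 2) mod 63 \<noteq> Suc m" using Suc.prems by (auto simp: mod_if)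
    obtain k where k: "0 < k" "cross a b = k *\<^sub>R al m" using Suc by (auto simp: a_def b_def)
    have "0 < det3 a b c" unfolding det3_cross k using k(1) p[of m "(m + 2) mod 63"] m2 Suc.prems
      by (simp add: c_def inner_commute)
    then have d: "0 < det3 b c a" by (simp add: det3_cycle[of a])
    have n: "b \<bullet> al (Suc m) = 0" "c \<bullet> al (Suc m) = 0"
      using z[of "Suc m" "Suc m"] z[of "Suc m" "(m + 2) mod 63"] Suc.prems by (auto simp: b_def c_def)
    have an: "0 < a \<bullet> al (Suc m)" using p[of "Suc m" m] m2 Suc.prems by (simp add: a_def)
    have "cross b c = (1 / (a \<bullet> al (Suc m))) *\<^sub>R ((a \<bullet> al (Suc m)) *\<^sub>R cross b c)" using an by simp
    also have "\<dots> = (det3 b c a / (a \<bullet> al (Suc m))) *\<^sub>R al (Suc m)"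
      unfolding det3_orthogonal[OF n, of a, symmetric] by simp
    finally show ?case using d an by (intro exI[of _ "det3 b c a / (a \<bullet> al (Suc m))"]) (auto simp: b_def c_def)
  qed
  show 2: "\<exists>k>0. cross (al m) (al ((m + 1) mod 63)) = k *\<^sub>R X ((m + 1) mod 63)" if mlt: "m < 63" for m
  proof -
    define a b c where "a = X m" and "b = X ((m + 1) mod 63)" and "c = X ((m + 2) mod 63)"
    have m2: "(m + 2) mod 63 \<noteq> m" "(m + 2) mod 63 \<noteq> (m + 1) mod 63" using mlt by (auto simp: mod_if)
    obtain k where k: "0 < k" "cross a b = k *\<^sub>R al m" using 1[OF mlt] by (auto simp: a_def b_def)
    have "((m + 1) mod 63 + 1) mod 63 = (m + 2) mod 63" by (simp add: mod_Suc_eq)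
    then obtain k' where k': "0 < k'" "cross b c = k' *\<^sub>R al ((m + 1) mod 63)"
      using 1[of "(m + 1) mod 63"] by (auto simp: b_def c_def)
    have d: "0 < det3 a b c" unfolding det3_cross k using k(1) p[of m "(m + 2) mod 63"] m2 mlt
      by (simp add: c_def inner_commute)
    have "al m = (1/k) *\<^sub>R cross a b" "al ((m + 1) mod 63) = (1/k') *\<^sub>R cross b c" using k k' by auto
    then have "cross (al m) (al ((m + 1) mod 63)) = (1/k * (1/k') * det3 a b c) *\<^sub>R b"
      by (simp only: cross_scale cross_cross scaleR_scaleR)
    then show ?thesis using k k' d by (intro exI[of _ "1/k * (1/k') * det3 a b c"]) (auto simp: b_def)
  qed
  show "convex_polygon al"
  proof (rule convex_polygonI)
    fix m k :: nat assume *: "Suc m < 63" "k < 63" "k \<noteq> m" "k \<noteq> Suc m"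
    obtain q where q: "0 < q" "cross (al m) (al (Suc m)) = q *\<^sub>R X (Suc m)" using 2[of m] * by auto
    have "Suc m \<noteq> (k + 1) mod 63" using * by (auto simp: mod_Suc)
    then show "0 < det3 (al m) (al (Suc m)) (al k)"
      unfolding det3_cross q using q(1) p[of k "Suc m"] * by simp
  qed
qed

context layered_slack
begin

text \<open>Two functionals that vanish at both ends of edge \<open>i\<close> and are positive at a
  third vertex agree on the polygon plane up to a positive factor.\<close>

lemma al_scale:
  assumes "i < 63" "0 < l" "l \<le> M"
  shows "\<exists>t>0. ground_vec (A (fT i l)) = t *\<^sub>R al i"
proof -
  define n where "n = ground_vec (A (fT i l))"
  have X012: "X 0 = (1, 0, 0)" "X 1 = (0, 1, 0)" "X 2 = (0, 0, 1)" by (auto simp: X_def)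
  obtain k where k: "0 < k" "cross (X i) (X ((i + 1) mod 63)) = k *\<^sub>R al i"
    using polygon_from_incidence(1)[OF X012 al_inner assms(1)] by metis
  define w where "w = X ((i + 2) mod 63)"
  have i2: "(i + 2) mod 63 \<noteq> i" "(i + 2) mod 63 \<noteq> (i + 1) mod 63" using assms(1) by (auto simp: mod_if)
  have n: "X m \<bullet> n = A (fT i l) (g m)" if "m < 63" for m
    using X[OF that rows[OF F(2)[OF assms]]] by (simp add: n_def)
  have 0: "X i \<bullet> n = 0" "X ((i + 1) mod 63) \<bullet> n = 0" using T_zero[OF assms(1) _ assms(2,3)] assms(1) by (auto simp: n)
  have wn: "0 < w \<bullet> n" unfolding w_def using T_pos[OF assms(1) _ assms(2,3)] i2 by (auto simp: n)
  have wa: "0 < w \<bullet> al i" unfolding w_def using al_inner[OF assms(1), of "(i + 2) mod 63"] i2 by auto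
  have d: "det3 (X i) (X ((i + 1) mod 63)) w = k * (w \<bullet> al i)"
    unfolding det3_cross k by (simp add: inner_commute)
  have "(k * (w \<bullet> al i)) *\<^sub>R n = ((w \<bullet> n) * k) *\<^sub>R al i"
    using det3_orthogonal[OF 0, of w] unfolding d k by simp
  moreover have "0 < k * (w \<bullet> al i)" using k wa by simp
  ultimately have "n = ((w \<bullet> n) * k / (k * (w \<bullet> al i))) *\<^sub>R al i"
    by (metis (no_types, opaque_lifting) divide_inverse less_numeral_extra(3) mult.commute pth_5 scaleR_one scaleR_scaleR right_inverse)
  moreover have "0 < (w \<bullet> n) * k / (k * (w \<bullet> al i))" using wn k wa by simp
  ultimately show ?thesis unfolding n_def by blast
qed

text \<open>The face \<open>fS l D\<close> is at most 2-dimensional and contains edge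
  \<open>tr l D\<close> together with two points of layer \<open>l\<close>. The line through these
  two points thus meets the line of the edge, and \<open>d\<close> represents the meeting point. The
  weights \<open>1 / A fG\<close> are forced because \<open>fG\<close> vanishes at both ends of the
  edge.\<close>

lemma layer_diff:
  assumes l: "0 < l" "l \<le> M" and D: "D < 3" "C < 3" "C' < 3" "C \<noteq> D" "C' \<noteq> D" "C \<noteq> C'"
  shows "\<exists>d. \<forall>T\<in>Field r. A T (c l C') / A fG (c l C') - A T (c l C) / A fG (c l C) = d \<bullet> ground_vec (A T)"
proof -
  define i where "i = tr l D"
  define i' where "i' = (i + 1) mod 63"
  have i: "i < 63" "i' < 63" using tr[OF l D(1)] by (auto simp: i_def i'_def)
  have s: "0 < A fG (c l C)" "0 < A fG (c l C')" using pos[OF F(1) V(2)[OF l] G(2)[OF l]] D by auto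
  have "\<exists>k0 k1 k2 k3. (k0 \<noteq> 0 \<or> k1 \<noteq> 0 \<or> k2 \<noteq> 0 \<or> k3 \<noteq> 0) \<and>
    (\<forall>\<rho>\<in>Q. k0 * \<rho> (g i) + k1 * \<rho> (g i') + k2 * \<rho> (c l C) + k3 * \<rho> (c l C') = 0)"
    by (rule dependent4[OF F(4)[OF l D(1)] S(1)[OF l D(1)]])
      (use S(2)[OF l D(1)] S(3)[OF l] V(1)[OF i(1)] V(1)[OF i(2)] V(2)[OF l] D in \<open>auto simp: i_def i'_def\<close>)
  then obtain k0 k1 k2 k3 where nz: "k0 \<noteq> 0 \<or> k1 \<noteq> 0 \<or> k2 \<noteq> 0 \<or> k3 \<noteq> (0::real)"
    and k: "\<And>\<rho>. \<rho> \<in> Q \<Longrightarrow> k0 * \<rho> (g i) + k1 * \<rho> (g i') + k2 * \<rho> (c l C) + k3 * \<rho> (c l C') = 0" by blast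
  have "A fG (g i) = 0" "A fG (g i') = 0" using zero_iff[OF F(1) V(1)] G(1) i by auto
  then have k23: "k2 * A fG (c l C) + k3 * A fG (c l C') = 0" using k[OF rows[OF F(1)]] by simp
  have "k2 \<noteq> 0"
  proof
    assume "k2 = 0"
    then have "k3 = 0" using k23 s by simp
    have "i' \<noteq> i" using i by (auto simp: i'_def mod_Suc)
    define i2 where "i2 = (i + 62) mod 63"
    have i2: "i2 < 63" "i2 \<noteq> i'" "i = (i2 + 1) mod 63" using i by (auto simp: i2_def i'_def mod_if split: if_splits)
    have ni: "i \<noteq> (i' + 1) mod 63" using i by (auto simp: i'_def mod_if)
    have "A (fT i' 1) (g i') = 0" "A (fT i' 1) (g i) \<noteq> 0"
      using T_zero[of i' i' 1] T_zero[of i' i 1] i M ni \<open>i' \<noteq> i\<close> by auto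
    then have "k0 = 0" using k[OF rows[OF F(2)], of i' 1] i M \<open>k2 = 0\<close> \<open>k3 = 0\<close> by simp
    have "A (fT i2 1) (g i') \<noteq> 0" using T_zero[of i2 i' 1] i i2 M \<open>i' \<noteq> i\<close> by auto
    then have "k1 = 0" using k[OF rows[OF F(2)], of i2 1] i2 M \<open>k2 = 0\<close> \<open>k3 = 0\<close> \<open>k0 = 0\<close> by simp
    then show False using nz \<open>k0 = 0\<close> \<open>k2 = 0\<close> \<open>k3 = 0\<close> by simp
  qed
  define u where "u = k2 * A fG (c l C)"
  have u: "u \<noteq> 0" "k2 = u / A fG (c l C)" "k3 = - u / A fG (c l C')"
    using \<open>k2 \<noteq> 0\<close> s k23 by (auto simp: u_def field_simps)
  have "A T (c l C') / A fG (c l C') - A T (c l C) / A fG (c l C) = ((k0 / u) *\<^sub>R X i + (k1 / u) *\<^sub>R X i') \<bullet> ground_vec (A T)"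
    if "T \<in> Field r" for T
  proof -
    have "k0 * A T (g i) + k1 * A T (g i') = u * (A T (c l C') / A fG (c l C') - A T (c l C) / A fG (c l C))"
      using k[OF rows[OF that]] unfolding u(2,3) by (simp add: algebra_simps)
    then have "A T (c l C') / A fG (c l C') - A T (c l C) / A fG (c l C) = (k0 * A T (g i) + k1 * A T (g i')) / u"
      using u(1) by simp
    then show ?thesis
      using X[OF i(1) rows[OF that]] X[OF i(2) rows[OF that]] by (simp add: inner_add_left add_divide_distrib)
  qed
  then show ?thesis by blast
qed

end

lemma cross_inner_cross: "cross a b \<bullet> cross c d = (a \<bullet> c) * (b \<bullet> d) - (a \<bullet> d) * (b \<bullet> c)"
proof -
  obtain a1 a2 a3 b1 b2 b3 c1 c2 c3 where *: "a = (a1,a2,a3)" "b = (b1,b2,b3)" "c = (c1,c2,c3)" by (metis prod.exhaust)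
  obtain d1 d2 d3 where "d = (d1,d2,d3)" by (metis prod.exhaust)
  with * show ?thesis by (simp add: algebra_simps)
qed

lemma cross_cross_right: "cross l (cross x y) = (l \<bullet> y) *\<^sub>R x - (l \<bullet> x) *\<^sub>R y"
proof -
  obtain a1 a2 a3 b1 b2 b3 c1 c2 c3 where *: "l = (a1,a2,a3)" "x = (b1,b2,b3)" "y = (c1,c2,c3)" by (metis prod.exhaust)
  then show ?thesis by (simp add: algebra_simps)
qed

lemma scaleR_solve:
  fixes x y :: "'a::real_vector"
  assumes "a \<noteq> 0" "a *\<^sub>R x = b *\<^sub>R y" shows "x = (b / a) *\<^sub>R y"
proof -
  have "(1 / a) *\<^sub>R (a *\<^sub>R x) = (1 / a) *\<^sub>R (b *\<^sub>R y)" using assms(2) by simp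
  then show ?thesis using assms(1) by simp
qed

context layered_slack
begin

text \<open>The row of \<open>fT (tr l D) l\<close> is scaled to agree with that of
  \<open>fG\<close> at \<open>c l D\<close>, and it vanishes at the other two points of the layer.
  The sum of the three scaled rows minus the row of \<open>fG\<close> therefore vanishes on the
  whole layer; since \<open>fG\<close> is zero on the polygon, its trace there is
  \<open>star_center l\<close>.\<close>

definition star_vec :: "nat \<Rightarrow> nat \<Rightarrow> vec3" where
  "star_vec l D = (A fG (c l D) / A (fT (tr l D) l) (c l D)) *\<^sub>R ground_vec (A (fT (tr l D) l))"

definition star_center :: "nat \<Rightarrow> vec3" where
  "star_center l = star_vec l 0 + star_vec l 1 + star_vec l 2"

lemma X012: "X 0 = (1, 0, 0)" "X 1 = (0, 1, 0)" "X 2 = (0, 0, 1)"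
  by (auto simp: X_def)

lemma X_ground_vec: "m < 63 \<Longrightarrow> T \<in> Field r \<Longrightarrow> X m \<bullet> ground_vec (A T) = A T (g m)"
  using X rows by metis

lemma star_vec_al:
  assumes "0 < l" "l \<le> M" "D < 3"
  shows "\<exists>t>0. star_vec l D = t *\<^sub>R al (tr l D)"
proof -
  obtain t where t: "0 < t" "ground_vec (A (fT (tr l D) l)) = t *\<^sub>R al (tr l D)"
    using al_scale[OF tr[OF assms] assms(1,2)] by blast
  have "0 < A fG (c l D)" "0 < A (fT (tr l D) l) (c l D)"
    using pos[OF F(1) V(2)[OF assms] G(2)[OF assms]] pos[OF F(2)[OF tr[OF assms] assms(1,2)] V(2)[OF assms]]
      T(2)[OF assms(1,2,3,3)] by auto
  then show ?thesis unfolding star_vec_def t using t(1)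
    by (intro exI[of _ "A fG (c l D) / A (fT (tr l D) l) (c l D) * t"]) auto
qed

lemma star_center_open_cone:
  assumes "0 < l" "l \<le> M" "0 < t"
  shows "t *\<^sub>R star_center l \<in> open_cone (al (tr l 0)) (al (tr l 1)) (al (tr l 2))"
proof -
  obtain t0 where t0: "0 < t0" "star_vec l 0 = t0 *\<^sub>R al (tr l 0)" using star_vec_al[OF assms(1,2), of 0] by auto
  obtain t1 where t1: "0 < t1" "star_vec l 1 = t1 *\<^sub>R al (tr l 1)" using star_vec_al[OF assms(1,2), of 1] by auto
  obtain t2 where t2: "0 < t2" "star_vec l 2 = t2 *\<^sub>R al (tr l 2)" using star_vec_al[OF assms(1,2), of 2] by auto
  have "t *\<^sub>R star_center l = (t * t0) *\<^sub>R al (tr l 0) + (t * t1) *\<^sub>R al (tr l 1) + (t * t2) *\<^sub>R al (tr l 2)"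
    by (simp add: star_center_def t0 t1 t2 scaleR_add_right del: One_nat_def)
  then show ?thesis unfolding open_cone_def using t0 t1 t2 assms(3) by (auto intro!: exI mult_pos_pos)
qed

text \<open>A functional vanishing on layer \<open>l\<close> is orthogonal to the meeting points
  \<open>d0\<close> and \<open>d1\<close> of \<open>layer_diff\<close>, and so is
  \<open>star_center l\<close>. As \<open>d0\<close> and \<open>d1\<close> are independent, both are
  multiples of \<open>q\<close>; evaluation at a polygon vertex makes the ratio positive.\<close>

lemma center:
  assumes l: "0 < l" "l \<le> M" and H: "T \<in> Field r" "\<And>C. C < 3 \<Longrightarrow> A T (c l C) = 0" "\<And>m. m < 63 \<Longrightarrow> 0 < A T (g m)"
  shows "\<exists>t>0. ground_vec (A T) = t *\<^sub>R star_center l"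
proof -
  define n where "n = ground_vec (A T)"
  have f: "fT (tr l D) l \<in> Field r" if "D < 3" for D using F(2)[OF tr[OF l that] l] .
  have sg: "0 < A fG (c l C)" if "C < 3" for C using pos[OF F(1) V(2)[OF l that] G(2)[OF l that]] .
  have z: "A (fT (tr l D) l) (c l C) = 0 \<longleftrightarrow> C \<noteq> D" if "C < 3" "D < 3" for C D
    using zero_iff[OF f[OF that(2)] V(2)[OF l that(1)]] T(2)[OF l that] by simp
  obtain d0 where d0: "\<And>T. T \<in> Field r \<Longrightarrow> d0 \<bullet> ground_vec (A T) = A T (c l 2) / A fG (c l 2) - A T (c l 1) / A fG (c l 1)"
    using layer_diff[OF l, of 0 1 2] by auto
  obtain d1 where d1: "\<And>T. T \<in> Field r \<Longrightarrow> d1 \<bullet> ground_vec (A T) = A T (c l 0) / A fG (c l 0) - A T (c l 2) / A fG (c l 2)"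
    using layer_diff[OF l, of 1 2 0] by auto
  have n0: "d0 \<bullet> n = 0" "d1 \<bullet> n = 0" using d0[OF H(1)] d1[OF H(1)] H(2) by (auto simp: n_def)
  have z': "A (fT (tr l 0) l) (c l 1) = 0" "A (fT (tr l 0) l) (c l 2) = 0" "A (fT (tr l 1) l) (c l 0) = 0"
    "A (fT (tr l 1) l) (c l 2) = 0" "A (fT (tr l 2) l) (c l 0) = 0" "A (fT (tr l 2) l) (c l 1) = 0"
    "A (fT (tr l 0) l) (c l 0) \<noteq> 0" "A (fT (tr l 1) l) (c l 1) \<noteq> 0" "A (fT (tr l 2) l) (c l 2) \<noteq> 0"
    using z by simp_all
  have s': "A fG (c l 0) \<noteq> 0" "A fG (c l 1) \<noteq> 0" "A fG (c l 2) \<noteq> 0" using sg[of 0] sg[of 1] sg[of 2] by simp_all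
  have f': "fT (tr l 0) l \<in> Field r" "fT (tr l 1) l \<in> Field r" "fT (tr l 2) l \<in> Field r" using f by simp_all
  have dl: "d0 \<bullet> star_vec l 0 = 0" "d0 \<bullet> star_vec l 1 = -1" "d0 \<bullet> star_vec l 2 = 1"
     "d1 \<bullet> star_vec l 0 = 1" "d1 \<bullet> star_vec l 1 = 0" "d1 \<bullet> star_vec l 2 = -1"
    unfolding star_vec_def inner_scaleR_right d0[OF f'(1)] d0[OF f'(2)] d0[OF f'(3)] d1[OF f'(1)] d1[OF f'(2)] d1[OF f'(3)] z'(1-6)
    using z'(7-9) s' by simp_all
  then have c0: "d0 \<bullet> star_center l = 0" "d1 \<bullet> star_center l = 0" by (auto simp: star_center_def inner_add_right)
  define q where "q = cross d0 d1"
  have "q \<bullet> cross (star_vec l 0) (star_vec l 1) \<noteq> 0" unfolding q_def cross_inner_cross dl by simp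
  then have "0 < q \<bullet> q" by auto
  have qn: "(q \<bullet> q) *\<^sub>R n = (q \<bullet> n) *\<^sub>R q" and qc: "(q \<bullet> q) *\<^sub>R star_center l = (q \<bullet> star_center l) *\<^sub>R q"
    using det3_orthogonal[OF n0, of q] det3_orthogonal[OF c0, of q] by (simp_all add: det3_cross q_def[symmetric])
  define m where "m = (tr l 0 + 2) mod 63"
  have m: "m < 63" "m \<noteq> tr l 0" "m \<noteq> (tr l 0 + 1) mod 63" using tr[OF l, of 0] by (auto simp: m_def mod_if)
  have nn: "0 \<le> X m \<bullet> star_vec l D" if "D < 3" for D
    using nonneg[OF f[OF that] V(1)[OF m(1)]] nonneg[OF f[OF that] V(2)[OF l that]] sg[OF that]
    by (simp add: star_vec_def X_ground_vec[OF m(1) f[OF that]])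
  have "0 < X m \<bullet> star_vec l 0"
    using T_pos[OF tr[OF l, of 0] m(1) l m(2,3)] sg[of 0] z[of 0 0] nonneg[OF f[of 0] V(2)[OF l, of 0]]
    by (simp add: star_vec_def X_ground_vec[OF m(1) f] less_le)
  then have Xc: "0 < X m \<bullet> star_center l" using nn[of 1] nn[of 2] by (simp add: star_center_def inner_add_right)
  have Xn: "0 < X m \<bullet> n" using H(3)[OF m(1)] X_ground_vec[OF m(1) H(1)] by (simp add: n_def)
  have "(q \<bullet> q) * (X m \<bullet> star_center l) = (q \<bullet> star_center l) * (X m \<bullet> q)" using arg_cong[OF qc, of "inner (X m)"] by simp
  moreover have "0 < (q \<bullet> q) * (X m \<bullet> star_center l)" using \<open>0 < q \<bullet> q\<close> Xc by simp
  ultimately have "q \<bullet> star_center l \<noteq> 0" by auto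
  then have q: "q = ((q \<bullet> q) / (q \<bullet> star_center l)) *\<^sub>R star_center l" using scaleR_solve[OF _ qc[symmetric]] by simp
  have "n = ((q \<bullet> n) / (q \<bullet> q)) *\<^sub>R q" using scaleR_solve[OF _ qn] \<open>0 < q \<bullet> q\<close> by simp
  also have "\<dots> = ((q \<bullet> n) / (q \<bullet> q) * ((q \<bullet> q) / (q \<bullet> star_center l))) *\<^sub>R star_center l" by (subst (3) q) (simp only: scaleR_scaleR)
  finally have n: "n = ((q \<bullet> n) / (q \<bullet> star_center l)) *\<^sub>R star_center l" using \<open>0 < q \<bullet> q\<close> by simp
  have "X m \<bullet> n = ((q \<bullet> n) / (q \<bullet> star_center l)) * (X m \<bullet> star_center l)" using arg_cong[OF n, of "inner (X m)"] by simp
  then have "0 < (q \<bullet> n) / (q \<bullet> star_center l)" using Xn Xc zero_less_mult_pos2[of "(q \<bullet> n) / (q \<bullet> star_center l)" "X m \<bullet> star_center l"] by simp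
  then show ?thesis using n unfolding n_def by blast
qed

text \<open>The layers \<open>3 * j + 1\<close> to \<open>3 * j + 3\<close> form a group. The two
  faces \<open>fW\<close> joining consecutive ones make their three centers positive multiples of
  each other.\<close>

lemma constraint:
  assumes "3 * j + 3 \<le> M"
  shows "\<exists>W. \<forall>e<3. W \<in> open_cone (al (tr (3 * j + e + 1) 0)) (al (tr (3 * j + e + 1) 1)) (al (tr (3 * j + e + 1) 2))"
proof -
  define l where "l = 3 * j + 1"
  have l: "0 < l" "l \<le> M" "l < M" "Suc l \<le> M" "Suc l < M" "l + 2 \<le> M" "l mod 3 \<noteq> 0" "Suc l mod 3 \<noteq> 0"
    using assms by (auto simp: l_def mod_simps) presburger+
  have cz: "A (fW k) (c k C) = 0" "A (fW k) (c (Suc k) C) = 0" if "k = l \<or> k = Suc l" "C < 3" for k C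
    using that zero_iff[OF F(3) V(2)] W(2)[of k C] l by (auto simp: le_Suc_eq)
  have gp: "0 < A (fW k) (g m)" if "k = l \<or> k = Suc l" "m < 63" for k m
    using that pos[OF F(3) V(1) W(1)] l by auto
  obtain t where t: "0 < t" "ground_vec (A (fW l)) = t *\<^sub>R star_center l"
    using center[of l "fW l"] F(3)[of l] cz[of l] gp[of l] l by auto
  obtain t1 where t1: "0 < t1" "ground_vec (A (fW l)) = t1 *\<^sub>R star_center (Suc l)"
    using center[of "Suc l" "fW l"] F(3)[of l] cz[of l] gp[of l] l by auto
  obtain t2 where t2: "0 < t2" "ground_vec (A (fW (Suc l))) = t2 *\<^sub>R star_center (Suc l)"
    using center[of "Suc l" "fW (Suc l)"] F(3)[of "Suc l"] cz[of "Suc l"] gp[of "Suc l"] l by auto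
  obtain t3 where t3: "0 < t3" "ground_vec (A (fW (Suc l))) = t3 *\<^sub>R star_center (l + 2)"
    using center[of "l + 2" "fW (Suc l)"] F(3)[of "Suc l"] cz[of "Suc l"] gp[of "Suc l"] l by auto
  have "star_center (Suc l) = (1 / t2) *\<^sub>R (t2 *\<^sub>R star_center (Suc l))" using t2 by simp
  also have "\<dots> = (t3 / t2) *\<^sub>R star_center (l + 2)" unfolding t2(2)[symmetric] t3(2) by simp
  finally have "ground_vec (A (fW l)) = (t1 * (t3 / t2)) *\<^sub>R star_center (l + 2)" unfolding t1(2) by simp
  moreover have "0 < t1 * (t3 / t2)" using t1 t2 t3 by simp
  ultimately have m1: "ground_vec (A (fW l)) \<in> open_cone (al (tr (l + 2) 0)) (al (tr (l + 2) 1)) (al (tr (l + 2) 2))"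
    using star_center_open_cone[of "l + 2" "t1 * (t3 / t2)"] l by simp
  have m2: "ground_vec (A (fW l)) \<in> open_cone (al (tr l 0)) (al (tr l 1)) (al (tr l 2))"
    using star_center_open_cone[of l t] t l by simp
  have m3: "ground_vec (A (fW l)) \<in> open_cone (al (tr (Suc l) 0)) (al (tr (Suc l) 1)) (al (tr (Suc l) 2))"
    using star_center_open_cone[of "Suc l" t1] t1 l by simp
  have "ground_vec (A (fW l)) \<in> open_cone (al (tr (3 * j + e + 1) 0)) (al (tr (3 * j + e + 1) 1)) (al (tr (3 * j + e + 1) 2))"
    if "e < 3" for e
  proof -
    have "3 * j + e + 1 = l \<or> 3 * j + e + 1 = Suc l \<or> 3 * j + e + 1 = l + 2" using that by (auto simp: l_def)
    then show ?thesis using m1 m2 m3 by (elim disjE) (simp_all only:)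
  qed
  then show ?thesis by blast
qed

lemma convex_polygon_al: "convex_polygon al"
  using polygon_from_incidence(3)[OF X012 al_inner] .

end

section \<open>The singular linear map of a slack pair\<close>

text \<open>\<open>(1, 1, 1)\<close> represents the constant functional 1, so
  \<open>cross (1, 1, 1) (a.al i)\<close> is a positive multiple of the difference of the ends
  \<open>i\<close> and \<open>i + 1\<close> of the edge. At vertex \<open>j\<close> of the other
  polygon, \<open>k (a.al i)\<close> then takes a positive multiple of
  \<open>N (g j) (g i) - N (g j) (g (i + 1))\<close>, with indices modulo 63. These values pin
  \<open>k\<close>, although \<open>k (1, 1, 1) = 0\<close>.\<close>

lemma layered_no_slack_pair:
  fixes A B N :: "'i \<Rightarrow> 'i \<Rightarrow> real"
  assumes star_vec: "layered r V R M tr g c fG fT fW fS" and "trans r"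
    and A: "slack_rows r V R A Q" "\<And>y. y \<in> V \<Longrightarrow> N y \<in> Q" "(\<lambda>_. 1) \<in> Q"
    and B: "slack_rows r V R B Q'" "\<And>y y'. y \<in> V \<Longrightarrow> y' \<in> V \<Longrightarrow> (\<lambda>x. N x y - N x y') \<in> Q'"
    and N: "\<And>x y. x \<in> V \<Longrightarrow> y \<in> V \<Longrightarrow> (y, x) \<notin> r \<Longrightarrow> N x y < N x x"
    and rigid: "\<And>a. convex_polygon a \<Longrightarrow> (\<And>j. 3 * j + 3 \<le> M \<Longrightarrow> \<exists>W. \<forall>e<3.
        W \<in> open_cone (a (tr (3 * j + e + 1) 0)) (a (tr (3 * j + e + 1) 1)) (a (tr (3 * j + e + 1) 2))) \<Longrightarrow> rigid a"
  shows False
proof -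
  interpret a: layered_slack r V R M tr g c fG fT fW fS A Q
    using star_vec A(1) by (simp add: layered_slack_def layered_slack_axioms_def)
  interpret b: layered_slack r V R M tr g c fG fT fW fS B Q'
    using star_vec B(1) by (simp add: layered_slack_def layered_slack_axioms_def)
  have ga: "rigid a.al" by (rule rigid[OF a.convex_polygon_al a.constraint])
  have gb: "rigid b.al" by (rule rigid[OF b.convex_polygon_al b.constraint])
  define NR where "NR m = a.ground_vec (N (g m))" for m
  define k where "k v = (let u = cross (1, 1, 1) v in (NR 0 \<bullet> u, NR 1 \<bullet> u, NR 2 \<bullet> u))" for v
  have lc: "cross (1, 1, 1) (u + v) = cross (1, 1, 1) u + cross (1, 1, 1) v" "cross (1, 1, 1) (s *\<^sub>R u) = s *\<^sub>R cross (1, 1, 1) u" for u v s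
    by (cases u; cases v; simp add: algebra_simps)+
  have lin: "linear k"
    by (rule linearI) (simp_all add: k_def Let_def lc inner_add_right)
  have X1: "a.X m \<bullet> (1, 1, 1) = 1" if "m < 63" for m
    using a.X[OF that A(3)] by (simp add: a.ground_vec_def)
  \<comment> \<open>Only differences of columns of \<open>N\<close> are known to lie in
    \<open>Q'\<close>. The entries of \<open>a.X i - a.X i'\<close> add up to 0, which allows every
    column to be taken relative to that of \<open>g 0\<close>.\<close>
  have ndiff: "b.X j \<bullet> (NR 0 \<bullet> (a.X i - a.X i'), NR 1 \<bullet> (a.X i - a.X i'), NR 2 \<bullet> (a.X i - a.X i')) = N (g j) (g i) - N (g j) (g i')"
    if "i < 63" "i' < 63" "j < 63" for i i' j
  proof -
    obtain u0 u1 u2 where u: "a.X i - a.X i' = (u0, u1, u2)" by (metis prod.exhaust)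
    obtain x0 x1 x2 where x: "b.X j = (x0, x1, x2)" by (metis prod.exhaust)
    have "(a.X i - a.X i') \<bullet> (1, 1, 1) = 0" using X1 that by (simp add: inner_diff_left)
    then have s: "u0 = - u1 - u2" unfolding u by simp
    have g: "g j \<in> V" "g 0 \<in> V" "g 1 \<in> V" "g 2 \<in> V" using a.V(1) that by auto
    have "N (g j) (g i) - N (g j) (g i') = (a.X i - a.X i') \<bullet> a.ground_vec (N (g j))"
      using a.X[OF that(1) A(2)[OF g(1)]] a.X[OF that(2) A(2)[OF g(1)]] by (simp add: inner_diff_left)
    then have l: "N (g j) (g i) - N (g j) (g i') = u0 * N (g j) (g 0) + u1 * N (g j) (g 1) + u2 * N (g j) (g 2)"
      unfolding u a.ground_vec_def by simp
    have r1: "N (g j) (g 1) - N (g j) (g 0) = x0 * (N (g 0) (g 1) - N (g 0) (g 0)) + x1 * (N (g 1) (g 1) - N (g 1) (g 0)) + x2 * (N (g 2) (g 1) - N (g 2) (g 0))"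
      using b.X[OF that(3) B(2)[OF g(3,2)]] unfolding x b.ground_vec_def by simp
    have r2: "N (g j) (g 2) - N (g j) (g 0) = x0 * (N (g 0) (g 2) - N (g 0) (g 0)) + x1 * (N (g 1) (g 2) - N (g 1) (g 0)) + x2 * (N (g 2) (g 2) - N (g 2) (g 0))"
      using b.X[OF that(3) B(2)[OF g(4,2)]] unfolding x b.ground_vec_def by simp
    have "N (g j) (g i) - N (g j) (g i') = u1 * (N (g j) (g 1) - N (g j) (g 0)) + u2 * (N (g j) (g 2) - N (g j) (g 0))"
      unfolding l s by (simp add: algebra_simps)
    then show ?thesis unfolding r1 r2 u x NR_def a.ground_vec_def s by (simp add: algebra_simps)
  qed
  have kal: "\<exists>q>0. k (a.al i) = q *\<^sub>R (NR 0 \<bullet> (a.X i - a.X ((i + 1) mod 63)), NR 1 \<bullet> (a.X i - a.X ((i + 1) mod 63)), NR 2 \<bullet> (a.X i - a.X ((i + 1) mod 63)))"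
    if "i < 63" for i
  proof -
    obtain q where q: "0 < q" "cross (a.X i) (a.X ((i + 1) mod 63)) = q *\<^sub>R a.al i"
      using polygon_from_incidence(1)[OF a.X012 a.al_inner \<open>i < 63\<close>] by metis
    have "q *\<^sub>R cross (1, 1, 1) (a.al i) = a.X i - a.X ((i + 1) mod 63)"
      using X1[of i] X1[of "(i + 1) mod 63"] \<open>i < 63\<close> unfolding lc(2)[symmetric] q(2)[symmetric] cross_cross_right
      by (simp add: inner_commute)
    then have "(1 / q) *\<^sub>R (q *\<^sub>R cross (1, 1, 1) (a.al i)) = (1 / q) *\<^sub>R (a.X i - a.X ((i + 1) mod 63))" by simp
    then have "cross (1, 1, 1) (a.al i) = (1 / q) *\<^sub>R (a.X i - a.X ((i + 1) mod 63))" using q(1) by simp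
    then show ?thesis using q(1) by (intro exI[of _ "1 / q"]) (simp add: k_def Let_def)
  qed
  have neg: "N (g j) (g i) < N (g j) (g j)" if "i < 63" "j < 63" "i \<noteq> j" for i j
  proof (rule N)
    show "g j \<in> V" "g i \<in> V" using a.V(1) that by auto
    \<comment> \<open>Otherwise \<open>g i\<close> would lie in the faces of both edges at
      \<open>g j\<close>, which share no other vertex of the polygon.\<close>
    show "(g i, g j) \<notin> r"
    proof
      assume *: "(g i, g j) \<in> r"
      define j' where "j' = (j + 62) mod 63"
      have j': "j' < 63" "(j' + 1) mod 63 = j" using that by (auto simp: j'_def mod_if)
      have "(g i, fT j 1) \<in> r" using * a.T(1)[of j j 1] a.M that \<open>trans r\<close> by (auto dest: transD)
      moreover have "(g i, fT j' 1) \<in> r" using * a.T(1)[of j' j 1] a.M that j' \<open>trans r\<close> by (auto dest: transD)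
      ultimately have "i = (j + 1) mod 63" "i = j'" using a.T(1)[of j i 1] a.T(1)[of j' i 1] a.M that j' by auto
      then show False using that by (auto simp: j'_def mod_if split: if_splits)
    qed
  qed
  \<comment> \<open>Only the two neighbours of \<open>i\<close> have to be checked, and their
    brackets are the inequalities for \<open>N\<close> between the two ends of edge
    \<open>i\<close>.\<close>
  have D: "0 < det3 (b.al i) (k (a.al i)) (b.al j)" if ij: "i < 63" "j < 63" "i \<noteq> j" for i j
  proof (rule supporting_line[OF b.convex_polygon_al ij])
    define i' where "i' = (i + 1) mod 63"
    define m where "m = (i + 62) mod 63"
    have i': "i' < 63" "i' \<noteq> i" "m < 63" "(m + 1) mod 63 = i" using ij by (auto simp: i'_def m_def mod_if)
    obtain q where q: "0 < q" "k (a.al i) = q *\<^sub>R (NR 0 \<bullet> (a.X i - a.X i'), NR 1 \<bullet> (a.X i - a.X i'), NR 2 \<bullet> (a.X i - a.X i'))"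
      using kal[OF ij(1)] unfolding i'_def by blast
    obtain p where p: "0 < p" "cross (b.al i) (b.al i') = p *\<^sub>R b.X i'"
      using polygon_from_incidence(2)[OF b.X012 b.al_inner ij(1)] unfolding i'_def by blast
    obtain p' where p': "0 < p'" "cross (b.al m) (b.al i) = p' *\<^sub>R b.X i"
      using polygon_from_incidence(2)[OF b.X012 b.al_inner i'(3)] unfolding i'(4) by blast
    have "det3 (b.al i) (b.al i') (k (a.al i)) = p * q * (N (g i') (g i) - N (g i') (g i'))"
      unfolding det3_cross p q inner_scaleR_left inner_scaleR_right using ndiff[OF ij(1) i'(1) i'(1)] by simp
    then show "det3 (b.al i) (b.al ((i + 1) mod 63)) (k (a.al i)) < 0"
      using neg[OF ij(1) i'(1)] i' p q unfolding i'_def[symmetric] by (simp add: mult_pos_neg)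
    have "det3 (b.al m) (b.al i) (k (a.al i)) = p' * q * (N (g i) (g i) - N (g i) (g i'))"
      unfolding det3_cross p' q inner_scaleR_left inner_scaleR_right using ndiff[OF ij(1) i'(1) ij(1)] by simp
    then show "0 < det3 (b.al ((i + 62) mod 63)) (b.al i) (k (a.al i))"
      using neg[OF i'(1) ij(1)] i' p' q unfolding m_def[symmetric] by simp
  qed
  have "k (1, 1, 1) = 0" by (simp add: k_def Let_def inner_prod_def zero_prod_def)
  with rigid_pinned_kernel[OF ga gb lin] D have "(1, 1, 1) = (0 :: vec3)" by blast
  then show False by (simp add: zero_prod_def)
qed

section \<open>Towers over a polygon\<close>

text \<open>Homogeneous coordinates of 4-space: three for the polygon plane and two that vanish on
  it; on a layer these are 1 and the index of the layer.\<close>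

type_synonym vec5 = "vec3 \<times> real \<times> real"

lemma positive_for_large_parameter:
  fixes a b :: "'i \<Rightarrow> real"
  assumes "finite I" and b: "\<And>i. i \<in> I \<Longrightarrow> 0 < b i"
  shows "\<exists>t. \<forall>i\<in>I. 0 < a i + t * b i"
proof (intro exI ballI)
  fix i assume i: "i \<in> I"
  have "\<bar>a i\<bar> / b i \<le> (\<Sum>j\<in>I. \<bar>a j\<bar> / b j)"
    using assms i by (intro member_le_sum) (auto intro!: divide_nonneg_pos)
  then have "(\<bar>a i\<bar> / b i + 1) * b i \<le> ((\<Sum>j\<in>I. \<bar>a j\<bar> / b j) + 1) * b i"
    using b[OF i] by (intro mult_right_mono) auto
  moreover have "(\<bar>a i\<bar> / b i + 1) * b i = \<bar>a i\<bar> + b i" using b[OF i] by (simp add: field_simps)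
  ultimately show "0 < a i + ((\<Sum>j\<in>I. \<bar>a j\<bar> / b j) + 1) * b i" using b[OF i] by linarith
qed

lemma dim_orthogonal_to_two:
  fixes w1 w2 :: vec5
  assumes ind: "independent {w1, w2}" "w1 \<noteq> w2" and Z: "\<And>v. v \<in> Z \<Longrightarrow> w1 \<bullet> v = 0 \<and> w2 \<bullet> v = 0"
  shows "dim Z \<le> 3"
proof -
  define A where "A = span {w1, w2}"
  have "dim {y \<in> UNIV. \<forall>x\<in>A. orthogonal x y} + dim A = dim (UNIV :: vec5 set)"
    unfolding A_def by (rule dim_subspace_orthogonal_to_vectors) auto
  moreover have "dim A = 2" unfolding A_def dim_span using dim_eq_card_independent[OF ind(1)] ind(2) by simp
  moreover have "dim (UNIV :: vec5 set) = 5" by simp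
  moreover have "Z \<subseteq> {y \<in> UNIV. \<forall>x\<in>A. orthogonal x y}"
  proof
    fix v assume "v \<in> Z"
    then have "w1 \<bullet> v = 0" "w2 \<bullet> v = 0" using Z by auto
    then have "A \<subseteq> {x. x \<bullet> v = 0}" unfolding A_def
      by (intro span_minimal) (auto simp: subspace_def inner_add_left)
    then have "x \<bullet> v = 0" if "x \<in> A" for x using that by blast
    then show "v \<in> {y \<in> UNIV. \<forall>x\<in>A. orthogonal x y}" by (simp add: orthogonal_def)
  qed
  then have "dim Z \<le> dim {y \<in> UNIV. \<forall>x\<in>A. orthogonal x y}" by (rule dim_subset)
  ultimately show ?thesis by linarith
qed

text \<open>The points of layer \<open>l\<close> will project to the basis dual to the vectors \<open>al (tr l D)\<close>, scaled to lie on the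
  line \<open>W l \<bullet> x = 1\<close>.\<close>

locale tower =
  fixes al :: "nat \<Rightarrow> vec3" and tr :: "nat \<Rightarrow> nat \<Rightarrow> nat" and W :: "nat \<Rightarrow> vec3" and M :: nat
  assumes cp: "convex_polygon al"
    and al1: "\<And>i. i < 63 \<Longrightarrow> 0 < (1, 1, 1) \<bullet> al i"
    and unit: "(1, 1, 1) \<in> open_cone (al 0) (al 21) (al 42)"
    and tr: "\<And>l D. D < 3 \<Longrightarrow> tr l D < 63"
    and trd: "\<And>l. tr l 0 \<noteq> tr l 1" "\<And>l. tr l 1 \<noteq> tr l 2" "\<And>l. tr l 0 \<noteq> tr l 2"
    and W: "\<And>l. W l \<in> open_cone (al (tr l 0)) (al (tr l 1)) (al (tr l 2))"
begin

text \<open>Vertex \<open>m\<close> is where the edge lines \<open>m - 1\<close> and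
  \<open>m\<close> meet, since 62 is -1 modulo 63.\<close>

definition X :: "nat \<Rightarrow> vec3" where "X m = cross (al ((m + 62) mod 63)) (al m)"

lemma X_al:
  assumes "i < 63" "m < 63"
  shows "0 \<le> X m \<bullet> al i" "X m \<bullet> al i = 0 \<longleftrightarrow> m = i \<or> m = (i + 1) mod 63"
proof -
  define m' where "m' = (m + 62) mod 63"
  have m': "m' < 63" "m = (m' + 1) mod 63" using assms(2) by (auto simp: m'_def mod_if)
  have e: "X m \<bullet> al i = det3 (al m') (al m) (al i)" by (simp only: X_def m'_def det3_cross)
  have "m = (i + 1) mod 63 \<longleftrightarrow> i = m'" using assms m' by (auto simp: mod_if split: if_splits)
  moreover have "0 < X m \<bullet> al i" if "i \<noteq> m" "i \<noteq> m'"
  proof -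
    define q where "q = (i + 63 - m') mod 63"
    have q: "1 < q" "q < 63" "(m' + q) mod 63 = i" using that assms m' by (auto simp: q_def mod_if split: if_splits)
    show ?thesis unfolding e using convex_polygon_cyclic[OF cp m'(1) _ q(1,2)] q(3) m'(2) by simp
  qed
  moreover have "X m \<bullet> al m = 0" "i = m' \<Longrightarrow> X m \<bullet> al i = 0" unfolding e
    using det3_zero by (auto simp: X_def m'_def det3_cross[symmetric])
  ultimately show "0 \<le> X m \<bullet> al i" "X m \<bullet> al i = 0 \<longleftrightarrow> m = i \<or> m = (i + 1) mod 63"
    by (cases "i = m"; cases "i = m'"; force)+
qed

lemma det_tr: "det3 (al (tr l 0)) (al (tr l 1)) (al (tr l 2)) \<noteq> 0"
proof -
  have pos: "0 < det3 (al i) (al j) (al k)" if "i < j" "j < k" "k < 63" for i j k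
    using cp that unfolding convex_polygon_def by blast
  have sw: "det3 u v w = - det3 v u w" "det3 u v w = - det3 u w v" for u v w
    by (cases u; cases v; cases w; simp add: algebra_simps)+
  define i j k where "i = tr l 0" and "j = tr l 1" and "k = tr l 2"
  have b: "i < 63" "j < 63" "k < 63" "i \<noteq> j" "j \<noteq> k" "i \<noteq> k"
    using tr[of 0 l] tr[of 1 l] tr[of 2 l] trd[of l] by (auto simp: i_def j_def k_def)
  then consider "i < j" "j < k" | "i < k" "k < j" | "j < i" "i < k" | "j < k" "k < i" | "k < i" "i < j" | "k < j" "j < i"
    by linarith
  then have "det3 (al i) (al j) (al k) \<noteq> 0"
  proof cases
    case 1 then show ?thesis using pos[of i j k] b by simp
  next
    case 2 then show ?thesis using pos[of i k j] b sw(2)[of "al i" "al j" "al k"] by simp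
  next
    case 3 then show ?thesis using pos[of j i k] b sw(1)[of "al i" "al j" "al k"] by simp
  next
    case 4 then show ?thesis using pos[of j k i] b det3_cycle[of "al i" "al j" "al k"] by simp
  next
    case 5 then show ?thesis using pos[of k i j] b det3_cycle[of "al i" "al j" "al k"] det3_cycle[of "al j" "al k" "al i"] by simp
  next
    case 6 then show ?thesis using pos[of k j i] b sw(1)[of "al i" "al j" "al k"] det3_cycle[of "al j" "al i" "al k"]
      det3_cycle[of "al i" "al k" "al j"] by simp
  qed
  then show ?thesis by (simp add: i_def j_def k_def)
qed

definition cell_dir :: "nat \<Rightarrow> nat \<Rightarrow> vec3" where
  "cell_dir l C = cross (al (tr l ((C + 1) mod 3))) (al (tr l ((C + 2) mod 3)))"

text \<open>The division also cancels the orientation of the triple \<open>tr l\<close>, which may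
  be either one.\<close>

definition cell :: "nat \<Rightarrow> nat \<Rightarrow> vec3" where
  "cell l C = (1 / (W l \<bullet> cell_dir l C)) *\<^sub>R cell_dir l C"

lemma less3: "C < (3::nat) \<longleftrightarrow> C = 0 \<or> C = 1 \<or> C = 2" by auto

lemma cell:
  assumes "C < 3" "D < 3"
  shows "D \<noteq> C \<Longrightarrow> al (tr l D) \<bullet> cell l C = 0" "0 < al (tr l C) \<bullet> cell l C" "W l \<bullet> cell l C = 1"
proof -
  obtain p q s where p: "W l = p *\<^sub>R al (tr l 0) + q *\<^sub>R al (tr l 1) + s *\<^sub>R al (tr l 2)" "0 < p" "0 < q" "0 < s"
    using W[of l] unfolding open_cone_def by auto
  define d where "d = det3 (al (tr l 0)) (al (tr l 1)) (al (tr l 2))"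
  have d: "d \<noteq> 0" using det_tr by (simp add: d_def)
  have dual: "al (tr l D) \<bullet> cell_dir l C = (if D = C then d else 0)" if "D < 3" "C < 3" for C D
    using that det3_zero det3_cycle[of "al (tr l 0)" "al (tr l 1)" "al (tr l 2)"] det3_cycle[of "al (tr l 1)" "al (tr l 2)" "al (tr l 0)"]
    unfolding less3 by (auto simp: cell_dir_def inner_commute[of "al _"] det3_cross[symmetric] d_def numeral_2_eq_2 simp del: det3.simps cross.simps)
  define pp where "pp = (if C = 0 then p else if C = 1 then q else s)"
  have Wn: "W l \<bullet> cell_dir l C = pp * d"
    using assms(1) dual[of 0 C] dual[of 1 C] dual[of 2 C] unfolding p less3 by (auto simp: inner_add_left pp_def)
  have pp: "0 < pp" using p by (simp add: pp_def)
  show "D \<noteq> C \<Longrightarrow> al (tr l D) \<bullet> cell l C = 0" using dual[OF assms(2,1)] by (simp add: cell_def)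
  show "W l \<bullet> cell l C = 1" using Wn pp d by (simp add: cell_def)
  show "0 < al (tr l C) \<bullet> cell l C" using dual[OF assms(1,1)] pp d by (simp add: cell_def Wn)
qed

definition lowest :: "vec3 \<Rightarrow> nat \<Rightarrow> real" where
  "lowest \<alpha> l = Min ((\<lambda>C. \<alpha> \<bullet> cell l C) ` {..<3})"

lemma lowest_le: "C < 3 \<Longrightarrow> lowest \<alpha> l \<le> \<alpha> \<bullet> cell l C"
  unfolding lowest_def by (intro Min_le) auto

lemma lowest_eqI: "C < 3 \<Longrightarrow> \<alpha> \<bullet> cell l C = a \<Longrightarrow> (\<And>D. D < 3 \<Longrightarrow> a \<le> \<alpha> \<bullet> cell l D) \<Longrightarrow> lowest \<alpha> l = a"
  unfolding lowest_def by (intro Min_eqI) auto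

lemma lowest_attained: "\<exists>C<3. lowest \<alpha> l = \<alpha> \<bullet> cell l C"
proof -
  have "lowest \<alpha> l \<in> (\<lambda>C. \<alpha> \<bullet> cell l C) ` {..<3}" unfolding lowest_def by (intro Min_in) (auto simp: lessThan_empty_iff)
  then show ?thesis by auto
qed

lemma lowest_al: "D < 3 \<Longrightarrow> lowest (al (tr l D)) l = 0"
proof (rule lowest_eqI)
  assume D: "D < 3"
  show "(D + 1) mod 3 < 3" by simp
  show "al (tr l D) \<bullet> cell l ((D + 1) mod 3) = 0" using D by (intro cell(1)) (auto simp: less3)
  show "0 \<le> al (tr l D) \<bullet> cell l C" if "C < 3" for C using cell(1)[OF that D] cell(2)[OF D D] by (cases "C = D") (auto intro: less_imp_le)
qed

lemma lowest_W: "lowest (W l) l = 1"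
  by (rule lowest_eqI[of 0]) (use cell(3)[of _ 0] in auto)

lemma open_cone_pos:
  assumes "w \<in> open_cone (al i) (al j) (al k)" "i < 63" "j < 63" "k < 63" "i \<noteq> j" "j \<noteq> k" "i \<noteq> k" "m < 63"
  shows "0 < w \<bullet> X m"
proof -
  obtain p q s where p: "w = p *\<^sub>R al i + q *\<^sub>R al j + s *\<^sub>R al k" "0 < p" "0 < q" "0 < s"
    using assms(1) unfolding open_cone_def by auto
  have nn: "0 \<le> al i \<bullet> X m" "0 \<le> al j \<bullet> X m" "0 \<le> al k \<bullet> X m"
    using X_al(1)[of _ m] assms by (simp_all add: inner_commute)
  have "\<not> (al i \<bullet> X m = 0 \<and> al j \<bullet> X m = 0 \<and> al k \<bullet> X m = 0)"
    using X_al(2)[of i m] X_al(2)[of j m] X_al(2)[of k m] assms(2-)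
    by (auto simp: inner_commute mod_if split: if_splits)
  then have "0 < p * (al i \<bullet> X m) + q * (al j \<bullet> X m) + s * (al k \<bullet> X m)"
    using nn p by (smt (verit) mult_nonneg_nonneg mult_pos_pos)
  then show ?thesis unfolding p by (simp add: inner_add_left)
qed

lemma W_pos: "m < 63 \<Longrightarrow> 0 < W l \<bullet> X m"
  using open_cone_pos[OF W] tr trd by simp

lemma X1: "m < 63 \<Longrightarrow> 0 < (1, 1, 1) \<bullet> X m"
  using open_cone_pos[OF unit] by simp

lemma W1: "0 < (1, 1, 1) \<bullet> W l"
proof -
  obtain p q s where p: "W l = p *\<^sub>R al (tr l 0) + q *\<^sub>R al (tr l 1) + s *\<^sub>R al (tr l 2)" "0 < p" "0 < q" "0 < s"
    using W[of l] unfolding open_cone_def by auto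
  have "0 < (1, 1, 1) \<bullet> al (tr l 0)" "0 < (1, 1, 1) \<bullet> al (tr l 1)" "0 < (1, 1, 1) \<bullet> al (tr l 2)" using tr by (auto intro: al1)
  then have "0 < p * ((1, 1, 1) \<bullet> al (tr l 0)) + q * ((1, 1, 1) \<bullet> al (tr l 1)) + s * ((1, 1, 1) \<bullet> al (tr l 2))"
    using p by (intro add_pos_pos mult_pos_pos)
  then show ?thesis unfolding p by (simp add: inner_add_right)
qed

lemma X_spanning: assumes "\<And>m. m < 63 \<Longrightarrow> \<beta> \<bullet> X m = 0" shows "\<beta> = 0"
proof -
  have d: "0 < det3 (al 0) (al 1) (al 2)" using cp by (simp add: convex_polygon_def)
  have 0: "det3 (al 0) (al 1) \<beta> = 0" using assms[of 1] by (simp add: X_def det3_cross inner_commute)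
  have 1: "det3 \<beta> (al 1) (al 2) = 0" using assms[of 2]
    unfolding det3_cycle[of \<beta>] by (simp add: X_def det3_cross inner_commute numeral_2_eq_2)
  have "\<beta> = lin3 (al 0) (al 1) (al 2) (coord3 (al 0) (al 1) (al 2) \<beta>)" using d by (simp add: lin3_coord3)
  then have e: "\<beta> = fst (snd (coord3 (al 0) (al 1) (al 2) \<beta>)) *\<^sub>R al 1" (is "_ = ?c *\<^sub>R _")
    using 0 1 by (simp add: lin3_def coord3_def)
  have "\<beta> \<bullet> X 5 = ?c * (al 1 \<bullet> X 5)" by (subst e) simp
  moreover have "0 < X 5 \<bullet> al 1" using X_al[of 1 5] by (simp add: less_le)
  ultimately have "?c = 0" using assms[of 5] by (simp add: inner_commute)
  then show ?thesis using e by simp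
qed

text \<open>The deviation of \<open>lowest \<alpha>\<close> at layer \<open>l\<close> from the line
  through its values at \<open>k\<close> and \<open>k + 1\<close>. Below, \<open>bend\<close> is the
  same deviation for the lift \<open>l^2 * ((1, 1, 1) \<bullet> \<alpha>)\<close>, positive by
  convexity of the square.\<close>

definition gap :: "vec3 \<Rightarrow> nat \<Rightarrow> nat \<Rightarrow> real" where
  "gap \<alpha> k l = lowest \<alpha> l - lowest \<alpha> k - (real l - real k) * (lowest \<alpha> (Suc k) - lowest \<alpha> k)"

definition bend :: "vec3 \<Rightarrow> nat \<Rightarrow> nat \<Rightarrow> real" where
  "bend \<alpha> k l = ((1, 1, 1) \<bullet> \<alpha>) * ((real l - real k) * (real l - real k - 1))"

lemma bend_pos: assumes "0 < (1, 1, 1) \<bullet> \<alpha>" "l \<noteq> k" "l \<noteq> Suc k" shows "0 < bend \<alpha> k l"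
proof -
  have "real l - real k < 0 \<or> 1 < real l - real k" using assms(2,3) by linarith
  then have "0 < (real l - real k) * (real l - real k - 1)" by (auto simp: zero_less_mult_iff)
  then show ?thesis using assms(1) unfolding bend_def by simp
qed

lemma exists_height:
  "\<exists>\<Gamma>. \<forall>\<alpha>\<in>al ` {..<63} \<union> W ` {..M}. \<forall>k\<le>M. \<forall>l\<le>Suc M. l \<noteq> k \<longrightarrow> l \<noteq> Suc k \<longrightarrow> 0 < gap \<alpha> k l + \<Gamma> * bend \<alpha> k l"
proof -
  define I where "I = {(\<alpha>, k, l) | \<alpha> k l. \<alpha> \<in> al ` {..<63} \<union> W ` {..M} \<and> k \<le> M \<and> l \<le> Suc M \<and> l \<noteq> k \<and> l \<noteq> Suc k}"
  have "I \<subseteq> (al ` {..<63} \<union> W ` {..M}) \<times> {..M} \<times> {..Suc M}" by (auto simp: I_def)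
  then have "finite I" by (rule finite_subset) simp
  moreover have "0 < (case i of (\<alpha>, k, l) \<Rightarrow> bend \<alpha> k l)" if "i \<in> I" for i
    using that al1 W1 by (auto simp: I_def intro!: bend_pos)
  ultimately have "\<exists>t. \<forall>i\<in>I. 0 < (case i of (\<alpha>, k, l) \<Rightarrow> gap \<alpha> k l) + t * (case i of (\<alpha>, k, l) \<Rightarrow> bend \<alpha> k l)"
    by (rule positive_for_large_parameter)
  then obtain t where t: "\<forall>i\<in>I. 0 < (case i of (\<alpha>, k, l) \<Rightarrow> gap \<alpha> k l) + t * (case i of (\<alpha>, k, l) \<Rightarrow> bend \<alpha> k l)" by blast
  have "0 < gap \<alpha> k l + t * bend \<alpha> k l"
    if "\<alpha> \<in> al ` {..<63} \<union> W ` {..M}" "k \<le> M" "l \<le> Suc M" "l \<noteq> k" "l \<noteq> Suc k" for \<alpha> k l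
  proof -
    have "(\<alpha>, k, l) \<in> I" unfolding I_def using that by blast
    then show ?thesis using t by fastforce
  qed
  then show ?thesis by blast
qed

definition ground_vertex :: "nat \<Rightarrow> vec5" where "ground_vertex m = (X m, 0, 0)"

definition layer_vertex :: "real \<Rightarrow> nat \<Rightarrow> nat \<Rightarrow> vec5" where
  "layer_vertex \<Gamma> l C = (cell l C + (\<Gamma> * (real l)^2) *\<^sub>R (1, 1, 1), 1, real l)"

text \<open>The first component of the functional is \<open>\<alpha>\<close>, the other two make it vanish on the lowest points of
  the layers \<open>k\<close> and \<open>k + 1\<close>. Since layer \<open>l\<close> is lifted by \<open>\<Gamma> l\<^sup>2\<close>, it is then positive on all other layers
  if \<open>\<Gamma>\<close> is large.\<close>

definition side_functional :: "real \<Rightarrow> vec3 \<Rightarrow> nat \<Rightarrow> vec5" where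
  "side_functional \<Gamma> \<alpha> k = (let q = - (lowest \<alpha> (Suc k) - lowest \<alpha> k) - \<Gamma> * (2 * real k + 1) * ((1, 1, 1) \<bullet> \<alpha>)
     in (\<alpha>, - lowest \<alpha> k - \<Gamma> * (real k)^2 * ((1, 1, 1) \<bullet> \<alpha>) - q * real k, q))"

lemma side_functional_ground: "side_functional \<Gamma> \<alpha> k \<bullet> ground_vertex m = \<alpha> \<bullet> X m"
  by (simp add: side_functional_def ground_vertex_def Let_def)

lemma side_functional_layer_eq: "side_functional \<Gamma> \<alpha> k \<bullet> layer_vertex \<Gamma> l C = (\<alpha> \<bullet> cell l C - lowest \<alpha> l) + (gap \<alpha> k l + \<Gamma> * bend \<alpha> k l)"
proof -
  have "\<alpha> \<bullet> (cell l C + (\<Gamma> * (real l)^2) *\<^sub>R (1, 1, 1)) = \<alpha> \<bullet> cell l C + \<Gamma> * (real l)^2 * ((1, 1, 1) \<bullet> \<alpha>)"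
    by (simp only: inner_add_right inner_scaleR_right inner_commute)
  then show ?thesis unfolding side_functional_def layer_vertex_def Let_def gap_def bend_def
    by (simp add: algebra_simps power2_eq_square)
qed

end

text \<open>The layers 0 and \<open>Suc M\<close> are extra: they place each of the layers 1 to
  \<open>M\<close> between two others, so that sides below and above it exist.\<close>

locale high_tower = tower al tr W M for al tr W M +
  fixes \<Gamma> :: real and H :: "vec5 set"
  assumes \<Gamma>: "\<And>\<alpha> k l. \<alpha> \<in> al ` {..<63} \<union> W ` {..M} \<Longrightarrow> k \<le> M \<Longrightarrow> l \<le> Suc M \<Longrightarrow> l \<noteq> k \<Longrightarrow> l \<noteq> Suc k \<Longrightarrow>
      0 < gap \<alpha> k l + \<Gamma> * bend \<alpha> k l"
    and H_def: "H = ground_vertex ` {..<63} \<union> {layer_vertex \<Gamma> l C | l C. l \<le> Suc M \<and> C < 3}"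
begin

lemma finite_H: "finite H"
proof -
  have "{layer_vertex \<Gamma> l C | l C. l \<le> Suc M \<and> C < 3} \<subseteq> (\<lambda>(l, C). layer_vertex \<Gamma> l C) ` ({..Suc M} \<times> {..<3})" by auto
  then show ?thesis unfolding H_def by (intro finite_UnI finite_imageI finite_subset[OF \<open>_ \<subseteq> _\<close>]) auto
qed

lemma side_functional_layer:
  assumes "\<alpha> \<in> al ` {..<63} \<union> W ` {..M}" "k \<le> M" "l \<le> Suc M" "C < 3"
  shows "0 \<le> side_functional \<Gamma> \<alpha> k \<bullet> layer_vertex \<Gamma> l C" "side_functional \<Gamma> \<alpha> k \<bullet> layer_vertex \<Gamma> l C = 0 \<longleftrightarrow> (l = k \<or> l = Suc k) \<and> \<alpha> \<bullet> cell l C = lowest \<alpha> l"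
proof -
  have "gap \<alpha> k l + \<Gamma> * bend \<alpha> k l = 0" if "l = k \<or> l = Suc k" using that by (auto simp: gap_def bend_def)
  then show "0 \<le> side_functional \<Gamma> \<alpha> k \<bullet> layer_vertex \<Gamma> l C" "side_functional \<Gamma> \<alpha> k \<bullet> layer_vertex \<Gamma> l C = 0 \<longleftrightarrow> (l = k \<or> l = Suc k) \<and> \<alpha> \<bullet> cell l C = lowest \<alpha> l"
    unfolding side_functional_layer_eq using \<Gamma>[OF assms(1-3)] lowest_le[OF assms(4), of \<alpha> l] by (cases "l = k \<or> l = Suc k"; force)+
qed

lemma al_mem: "i < 63 \<Longrightarrow> al i \<in> al ` {..<63} \<union> W ` {..M}" and W_mem: "l \<le> M \<Longrightarrow> W l \<in> al ` {..<63} \<union> W ` {..M}"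
  by auto

lemma side_functional_nonneg:
  assumes "\<alpha> \<in> al ` {..<63} \<union> W ` {..M}" "k \<le> M" "v \<in> H"
  shows "0 \<le> side_functional \<Gamma> \<alpha> k \<bullet> v"
proof -
  have "0 \<le> \<alpha> \<bullet> X m" if "m < 63" for m
    using assms(1) X_al(1)[OF _ that] W_pos[OF that] by (auto simp: inner_commute intro: less_imp_le)
  then show ?thesis using assms(3) side_functional_layer(1)[OF assms(1,2)] unfolding H_def by (auto simp: side_functional_ground)
qed

lemma H_spanning: assumes "\<And>v. v \<in> H \<Longrightarrow> w \<bullet> v = 0" shows "w = 0"
proof -
  obtain \<beta> p q where w: "w = (\<beta>, p, q)" by (metis prod.exhaust)
  have "\<beta> \<bullet> X m = 0" if "m < 63" for m
    using assms[of "ground_vertex m"] that by (auto simp: H_def w ground_vertex_def)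
  then have \<beta>: "\<beta> = 0" by (rule X_spanning)
  have "layer_vertex \<Gamma> l 0 \<in> H" if "l \<le> Suc M" for l using that unfolding H_def by (intro UnI2 CollectI exI[of _ l] exI[of _ 0]) simp
  then have "p + q * real l = 0" if "l \<le> Suc M" for l
    using assms[of "layer_vertex \<Gamma> l 0"] that by (simp add: w \<beta> layer_vertex_def)
  from this[of 0] this[of 1] show ?thesis by (simp add: w \<beta> zero_prod_def)
qed

text \<open>Yields the functional by which the points are scaled into a common affine hyperplane;
  its leading coefficients 1 allow a coordinate to be eliminated later.\<close>

lemma exists_normalization: "\<exists>L. \<forall>v\<in>H. 0 < ((1, 1, 1), L, 0) \<bullet> v"
proof -
  obtain L where L: "\<forall>v\<in>H - ground_vertex ` {..<63}. 0 < (1, 1, 1) \<bullet> fst v + L * 1"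
    using positive_for_large_parameter[of "H - ground_vertex ` {..<63}" "\<lambda>_. 1" "\<lambda>v. (1, 1, 1) \<bullet> fst v"] finite_H by auto
  have "0 < ((1, 1, 1), L, 0) \<bullet> v" if v: "v \<in> H" for v
  proof (cases "v \<in> ground_vertex ` {..<63}")
    case True
    then obtain m where "m < 63" "v = ground_vertex m" by auto
    then show ?thesis using X1[of m] by (simp add: ground_vertex_def)
  next
    case False
    then obtain l C where "v = layer_vertex \<Gamma> l C" using v by (auto simp: H_def)
    then have "snd v = (1, real l)" by (simp add: layer_vertex_def)
    moreover have "0 < (1, 1, 1) \<bullet> fst v + L * 1" using L v False by blast
    ultimately show ?thesis by (cases v) simp
  qed
  then show ?thesis by blast
qed

lemma ground_dim: "dim {v\<in>H. ((0, 0, 0), 1, 0) \<bullet> v = (0::real)} \<le> 3"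
proof (rule dim_orthogonal_to_two)
  show "independent {((0, 0, 0), 1, 0) :: vec5, ((0, 0, 0), 0, 1)}"
  proof (rule pairwise_orthogonal_independent)
    show "pairwise orthogonal {((0, 0, 0), 1, 0) :: vec5, ((0, 0, 0), 0, 1)}"
      by (auto simp: pairwise_def orthogonal_def)
  qed (auto simp: zero_prod_def)
  show "((0, 0, 0), 1, 0) \<noteq> (((0, 0, 0), 0, 1) :: vec5)" by simp
  fix v assume "v \<in> {v\<in>H. ((0, 0, 0), 1, 0) \<bullet> v = (0::real)}"
  then show "((0, 0, 0), 1, 0) \<bullet> v = 0 \<and> ((0, 0, 0), 0, 1) \<bullet> v = (0::real)"
    by (auto simp: H_def ground_vertex_def layer_vertex_def inner_prod_def)
qed

text \<open>A sum of two nonnegative functionals vanishes exactly where both do, so this one exposes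
  the intersection of the sides below and above layer \<open>l\<close>.\<close>

definition ridge_functional :: "nat \<Rightarrow> nat \<Rightarrow> vec5" where
  "ridge_functional l D = side_functional \<Gamma> (al (tr l D)) (l - 1) + side_functional \<Gamma> (al (tr l D)) l"

text \<open>The two side functionals differ but share a nonzero first component, hence are
  independent. Two linear conditions in dimension 5 leave linear dimension 3, that is, a face of
  dimension at most 2.\<close>

lemma side_dim:
  assumes "0 < l" "l \<le> M" "D < 3"
  shows "dim {v\<in>H. ridge_functional l D \<bullet> v = 0} \<le> 3"
proof (rule dim_orthogonal_to_two)
  define \<alpha> where "\<alpha> = al (tr l D)"
  have \<alpha>: "\<alpha> \<in> al ` {..<63} \<union> W ` {..M}" unfolding \<alpha>_def by (rule al_mem[OF tr[OF assms(3)]])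
  define w1 w2 where "w1 = side_functional \<Gamma> \<alpha> (l - 1)" and "w2 = side_functional \<Gamma> \<alpha> l"
  have l: "l - 1 \<le> M" "Suc l \<le> Suc M" using assms by auto
  \<comment> \<open>A lowest point of layer \<open>l + 1\<close> lies on the upper side and not on
    the lower one, which tells the two functionals apart.\<close>
  obtain C where C: "C < 3" "lowest \<alpha> (Suc l) = \<alpha> \<bullet> cell (Suc l) C" using lowest_attained by blast
  have ne: "w1 \<noteq> w2"
    using side_functional_layer(2)[OF \<alpha> l C(1)] side_functional_layer(2)[OF \<alpha> assms(2) l(2) C(1)] C(2) assms(1) by (auto simp: w1_def w2_def)
  then show "w1 \<noteq> w2" .
  have a0: "\<alpha> \<noteq> 0" using al1[OF tr[OF assms(3), of l]] by (auto simp: \<alpha>_def)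
  have f: "fst w1 = \<alpha>" "fst w2 = \<alpha>" by (simp_all add: w1_def w2_def side_functional_def Let_def)
  have "w1 \<notin> span {w2}"
  proof
    assume "w1 \<in> span {w2}"
    then obtain t where t: "w1 = t *\<^sub>R w2" by (auto simp: span_singleton)
    then have "\<alpha> = t *\<^sub>R \<alpha>" using f by simp
    then have "(t - 1) *\<^sub>R \<alpha> = 0" by (simp add: scaleR_left_diff_distrib)
    then have "t = 1" using a0 by simp
    then show False using t ne by simp
  qed
  moreover have "w2 \<noteq> 0" using f(2) a0 by auto
  ultimately show "independent {w1, w2}" using ne by (simp add: independent_insert)
  fix v assume v: "v \<in> {v\<in>H. ridge_functional l D \<bullet> v = 0}"
  then have "0 \<le> w1 \<bullet> v" "0 \<le> w2 \<bullet> v" "w1 \<bullet> v + w2 \<bullet> v = 0"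
    using side_functional_nonneg[OF \<alpha> l(1)] side_functional_nonneg[OF \<alpha> assms(2)] by (auto simp: w1_def w2_def ridge_functional_def \<alpha>_def inner_add_left)
  then show "w1 \<bullet> v = 0 \<and> w2 \<bullet> v = 0" by linarith
qed

end

section \<open>Faces and supporting functionals\<close>

text \<open>Stated for families because the points may repeat; a repetition is itself a
  dependency.\<close>

lemma affine_dependent_family:
  fixes p :: "nat \<Rightarrow> 'a::euclidean_space"
  assumes "\<And>m. m < n \<Longrightarrow> p m \<in> S" and "aff_dim S + 1 < int n"
  shows "\<exists>\<kappa>. (\<exists>m<n. \<kappa> m \<noteq> 0) \<and> (\<Sum>m<n. \<kappa> m) = (0::real) \<and> (\<Sum>m<n. \<kappa> m *\<^sub>R p m) = 0"
proof (cases "inj_on p {..<n}")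
  case True
  define B where "B = p ` {..<n}"
  have "B \<subseteq> S" "finite B" "card B = n" using assms(1) True by (auto simp: B_def card_image)
  then have "affine_dependent B"
    using aff_dim_affine_independent[of B] aff_dim_subset[of B S] assms(2) by linarith
  then obtain u v where u: "sum u B = 0" "v \<in> B" "u v \<noteq> 0" "(\<Sum>v\<in>B. u v *\<^sub>R v) = 0"
    using \<open>finite B\<close> by (auto simp: affine_dependent_explicit_finite)
  show ?thesis
  proof (intro exI[of _ "u \<circ> p"] conjI)
    show "\<exists>m<n. (u \<circ> p) m \<noteq> 0" using u(2,3) by (auto simp: B_def)
    show "(\<Sum>m<n. (u \<circ> p) m) = 0" using u(1) unfolding B_def sum.reindex[OF True] by simp
    show "(\<Sum>m<n. (u \<circ> p) m *\<^sub>R p m) = 0" using u(4) unfolding B_def sum.reindex[OF True] by (simp add: o_def)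
  qed
next
  case False
  then obtain i j where ij: "i < n" "j < n" "i \<noteq> j" "p i = p j" by (auto simp: inj_on_def)
  define \<kappa> where "\<kappa> m = (if m = i then 1 else 0) - (if m = j then 1 else (0::real))" for m
  have "(\<Sum>m<n. \<kappa> m) = 0" using ij by (simp add: \<kappa>_def sum_subtractf sum.delta)
  moreover have "(\<Sum>m<n. \<kappa> m *\<^sub>R p m) = 0"
  proof -
    have "\<kappa> m *\<^sub>R p m = (if m = i then p m else 0) - (if m = j then p m else 0)" for m by (simp add: \<kappa>_def)
    then show ?thesis using ij by (simp add: sum_subtractf sum.delta)
  qed
  moreover have "\<kappa> i \<noteq> 0" using ij by (simp add: \<kappa>_def)
  ultimately show ?thesis using ij(1) by blast
qed

lemma linear_dependent_family:
  fixes v :: "nat \<Rightarrow> 'a::euclidean_space"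
  assumes "\<And>m. m < n \<Longrightarrow> v m \<in> S" and "dim S < n"
  shows "\<exists>\<kappa>. (\<exists>m<n. \<kappa> m \<noteq> (0::real)) \<and> (\<Sum>m<n. \<kappa> m *\<^sub>R v m) = 0"
proof (cases "inj_on v {..<n}")
  case True
  define B where "B = v ` {..<n}"
  have B: "B \<subseteq> S" "finite B" "card B = n" using assms(1) True by (auto simp: B_def card_image)
  have "dependent B"
  proof (rule ccontr)
    assume "independent B"
    then have "card B \<le> dim S" using B(1) independent_card_le_dim by blast
    then show False using B(3) assms(2) by simp
  qed
  then obtain u where u: "(\<Sum>v\<in>B. u v *\<^sub>R v) = 0" "\<exists>v\<in>B. u v \<noteq> 0"
    using dependent_finite[OF B(2)] by auto
  then show ?thesis unfolding B_def sum.reindex[OF True]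
    by (intro exI[of _ "u \<circ> v"]) (auto simp: o_def)
next
  case False
  then obtain i j where ij: "i < n" "j < n" "i \<noteq> j" "v i = v j" by (auto simp: inj_on_def)
  define \<kappa> where "\<kappa> m = (if m = i then 1 else 0) - (if m = j then 1 else (0::real))" for m
  have "(\<Sum>m<n. \<kappa> m *\<^sub>R v m) = 0"
  proof -
    have "\<kappa> m *\<^sub>R v m = (if m = i then v m else 0) - (if m = j then v m else 0)" for m by (simp add: \<kappa>_def)
    then show ?thesis using ij by (simp add: sum_subtractf sum.delta)
  qed
  moreover have "\<kappa> i \<noteq> 0" using ij by (simp add: \<kappa>_def)
  ultimately show ?thesis using ij(1) by blast
qed

text \<open>On \<open>G\<close>, an affine functional vanishing on \<open>F\<close> is determined by
  the part of its gradient in \<open>E\<close>, the directions of \<open>G\<close> orthogonal to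
  those of \<open>F\<close>. The dimension of \<open>E\<close> is
  \<open>aff_dim G - aff_dim F\<close>.\<close>

lemma dependent_functionals:
  fixes a :: "nat \<Rightarrow> 'a::euclidean_space" and b :: "nat \<Rightarrow> real"
  assumes "F \<noteq> {}" "F \<subseteq> G" and zero: "\<And>m x. m < n \<Longrightarrow> x \<in> F \<Longrightarrow> a m \<bullet> x + b m = 0"
    and dim: "aff_dim G - aff_dim F < int n"
  shows "\<exists>\<kappa>. (\<exists>m<n. \<kappa> m \<noteq> (0::real)) \<and> (\<forall>x\<in>G. (\<Sum>m<n. \<kappa> m * (a m \<bullet> x + b m)) = 0)"
proof -
  obtain o' where o': "o' \<in> F" "o' \<in> G" using assms(1,2) by blast
  define U where "U = span ((\<lambda>x. - o' + x) ` F)"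
  define W where "W = span ((\<lambda>x. - o' + x) ` G)"
  have UW: "U \<subseteq> W" "subspace U" "subspace W" using assms(2) by (auto simp: U_def W_def intro!: span_mono)
  have dU: "int (dim U) = aff_dim F" and dW: "int (dim W) = aff_dim G"
    using aff_dim_eq_dim[of o' F] aff_dim_eq_dim[of o' G] o' by (auto simp: U_def W_def hull_inc)
  define E where "E = {y \<in> W. \<forall>x \<in> U. orthogonal x y}"
  have "dim E + dim U = dim W" unfolding E_def by (rule dim_subspace_orthogonal_to_vectors[OF UW(2,3,1)])
  then have "dim E < n" using dU dW dim by linarith
  have "\<exists>p. p \<in> E \<and> (\<forall>x\<in>W. a m \<bullet> x = p \<bullet> x)" if m: "m < n" for m
  proof -
    obtain y z where yz: "y \<in> span W" "\<And>w. w \<in> span W \<Longrightarrow> orthogonal z w" "a m = y + z"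
      using orthogonal_subspace_decomp_exists[of W "a m"] by metis
    have W: "span W = W" using UW(3) by (simp add: span_eq_iff)
    have eq: "a m \<bullet> x = y \<bullet> x" if "x \<in> W" for x
      using yz(2)[of x] that W by (simp add: yz(3) inner_add_left orthogonal_def)
    have "orthogonal x y" if "x \<in> U" for x
    proof -
      have "a m \<bullet> x = 0"
        using that unfolding U_def
      proof (induction rule: span_induct_alt)
        case base then show ?case by simp
      next
        case (step c x y)
        then obtain z where z: "z \<in> F" "x = - o' + z" by auto
        then have "a m \<bullet> z = a m \<bullet> o'" using zero[OF m o'(1)] zero[OF m z(1)] by linarith
        then show ?case using step z(2) by (simp add: inner_add_right inner_diff_right)
      qed
      then show ?thesis using eq[of x] that UW(1) by (auto simp: orthogonal_def inner_commute)
    qed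
    then show ?thesis using yz(1) W eq unfolding E_def by auto
  qed
  then obtain p where p: "\<And>m. m < n \<Longrightarrow> p m \<in> E" "\<And>m x. m < n \<Longrightarrow> x \<in> W \<Longrightarrow> a m \<bullet> x = p m \<bullet> x" by metis
  obtain \<kappa> where k: "\<exists>m<n. \<kappa> m \<noteq> (0::real)" "(\<Sum>m<n. \<kappa> m *\<^sub>R p m) = 0"
    using linear_dependent_family[of n p E] p(1) \<open>dim E < n\<close> by blast
  have "(\<Sum>m<n. \<kappa> m * (a m \<bullet> x + b m)) = 0" if "x \<in> G" for x
  proof -
    have xW: "x - o' \<in> W" unfolding W_def using that by (intro span_base) auto
    have "(\<Sum>m<n. \<kappa> m * (a m \<bullet> x + b m)) = (\<Sum>m<n. \<kappa> m * (p m \<bullet> (x - o')))"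
    proof (rule sum.cong)
      fix m assume "m \<in> {..<n}"
      then have "a m \<bullet> x + b m = a m \<bullet> (x - o')" "a m \<bullet> (x - o') = p m \<bullet> (x - o')"
        using zero[OF _ o'(1), of m] p(2)[OF _ xW, of m] by (auto simp: inner_diff_right)
      then show "\<kappa> m * (a m \<bullet> x + b m) = \<kappa> m * (p m \<bullet> (x - o'))" by simp
    qed simp
    also have "\<dots> = (\<Sum>m<n. \<kappa> m *\<^sub>R p m) \<bullet> (x - o')" by (simp add: inner_sum_left)
    finally show ?thesis using k(2) by simp
  qed
  then show ?thesis using k(1) by blast
qed

text \<open>Going down from \<open>G\<close> through facets that contain \<open>F\<close> lowers the
  dimension by exactly one each time; a single point has the empty face below it.\<close>

lemma face_chain:
  fixes P :: "'a::euclidean_space set"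
  assumes P: "polytope P" and F: "F face_of P" and G: "G face_of P" "F \<subseteq> G"
    and "aff_dim G = aff_dim F + int k"
  shows "\<exists>H. (\<forall>m\<le>k. H m face_of P) \<and> (\<forall>m<k. H m \<subset> H (Suc m)) \<and> F \<subseteq> H 0 \<and> H k = G"
  using G assms(5)
proof (induction k arbitrary: G)
  case 0
  then show ?case by (intro exI[of _ "\<lambda>_. G"]) auto
next
  case (Suc k)
  have polyG: "polytope G" "polyhedron G" "convex G"
    using face_of_polytope_polytope[OF P Suc.prems(1)] polytope_imp_polyhedron polytope_imp_convex by auto
  have FG: "F face_of G" using F Suc.prems by (simp add: face_of_face[OF Suc.prems(1)])
  obtain G' where G': "G' face_of G" "F \<subseteq> G'" "aff_dim G' = aff_dim G - 1"
  proof (cases "F = {}")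
    case True
    show thesis
    proof (cases "aff_dim G = 0")
      case True
      then show thesis using that[of "{}"] \<open>F = {}\<close> by auto
    next
      case False
      then have "0 < aff_dim G" using Suc.prems(3) \<open>F = {}\<close> by auto
      then obtain H where "H facet_of G" using polytope_facet_exists[OF polyG(1)] by blast
      then show thesis using that[of H] \<open>F = {}\<close> by (auto simp: facet_of_def)
    qed
  next
    case False
    moreover have "F \<noteq> G" using Suc.prems(3) by auto
    ultimately obtain H where "H facet_of G" "F \<subseteq> H"
      using face_of_polyhedron_subset_facet[OF polyG(2) FG] by blast
    then show thesis using that[of H] by (auto simp: facet_of_def)
  qed
  have "G' face_of P" using G'(1) Suc.prems(1) face_of_trans by blast
  then obtain H where H: "\<forall>m\<le>k. H m face_of P" "\<forall>m<k. H m \<subset> H (Suc m)" "F \<subseteq> H 0" "H k = G'"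
    using Suc.IH[of G'] G' Suc.prems(3) by auto
  have sub: "G' \<subset> G" using G' face_of_imp_subset by (metis diff_add_cancel less_add_one order.irrefl psubsetI)
  define H' where "H' m = (if m = Suc k then G else H m)" for m
  have "\<forall>m\<le>Suc k. H' m face_of P" using H(1) Suc.prems(1) by (auto simp: H'_def)
  moreover have "\<forall>m<Suc k. H' m \<subset> H' (Suc m)" using H(2,4) sub by (auto simp: H'_def less_Suc_eq)
  ultimately show ?case using H(3) by (intro exI[of _ H']) (auto simp: H'_def)
qed

lemma face_functional:
  fixes P :: "'a::euclidean_space set"
  assumes "polytope P" "F face_of P"
  shows "\<exists>a b. (\<forall>x\<in>P. 0 \<le> a \<bullet> x + b) \<and> (\<forall>x\<in>P. a \<bullet> x + b = 0 \<longleftrightarrow> x \<in> F)"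
proof -
  have "F exposed_face_of P"
    using assms exposed_face_of_polyhedron polytope_imp_polyhedron by blast
  then obtain a b where "P \<subseteq> {x. a \<bullet> x \<le> b}" "F = P \<inter> {x. a \<bullet> x = b}"
    unfolding exposed_face_of_def by blast
  then show ?thesis by (intro exI[of _ "- a"] exI[of _ b]) auto
qed

section \<open>Slack pairs from balanced pairs, antiprisms and interval polytopes\<close>

text \<open>For a balanced pair \<open>N y x\<close> is the pairing of a point of \<open>P1\<close> with a point of \<open>P2\<close>.\<close>

definition slack_pair :: "'i rel \<Rightarrow> 'i set \<Rightarrow> ('i \<Rightarrow> bool) \<Rightarrow> bool" where
  "slack_pair r V R \<longleftrightarrow> (\<exists>A B N Q Q'. slack_rows r V R A Q \<and> slack_rows r V R B Q' \<and>
    (\<forall>y\<in>V. N y \<in> Q) \<and> (\<lambda>_. 1) \<in> Q \<and> (\<forall>y\<in>V. \<forall>y'\<in>V. (\<lambda>x. N x y - N x y') \<in> Q') \<and>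
    (\<forall>x\<in>V. \<forall>y\<in>V. (y, x) \<notin> r \<longrightarrow> N x y < N x x))"

lemma poset_isoD:
  assumes "poset_iso \<psi> s (face_lattice Q)"
  shows "x \<in> Field s \<Longrightarrow> \<psi> x face_of Q"
    and "x \<in> Field s \<Longrightarrow> y \<in> Field s \<Longrightarrow> (x, y) \<in> s \<longleftrightarrow> \<psi> x \<subseteq> \<psi> y"
    and "F face_of Q \<Longrightarrow> \<exists>x\<in>Field s. \<psi> x = F"
proof -
  have b: "bij_betw \<psi> (Field s) {F. F face_of Q}"
    using assms by (simp add: poset_iso_def Field_face_lattice)
  show f: "x \<in> Field s \<Longrightarrow> \<psi> x face_of Q" for x using b by (auto simp: bij_betw_def)
  show "x \<in> Field s \<Longrightarrow> y \<in> Field s \<Longrightarrow> (x, y) \<in> s \<longleftrightarrow> \<psi> x \<subseteq> \<psi> y"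
    using assms f[of x] f[of y] by (simp add: poset_iso_def face_lattice_iff)
  show "F face_of Q \<Longrightarrow> \<exists>x\<in>Field s. \<psi> x = F"
    using b unfolding bij_betw_def by (metis imageE mem_Collect_eq)
qed

lemma strict_mono_steps:
  fixes f :: "nat \<Rightarrow> int"
  assumes "\<And>m. m < k \<Longrightarrow> f m < f (Suc m)"
  shows "m \<le> k \<Longrightarrow> f 0 + int m \<le> f m"
proof (induction m)
  case (Suc m) then show ?case using assms[of m] by auto
qed simp

text \<open>A chain of faces with one step per dimension pulls back to a chain in \<open>s\<close>,
  along which \<open>\<rho>\<close> gains at least 1 per step. In this way a rank known on the poset
  bounds dimensions in an arbitrary realization.\<close>

lemma aff_dim_diff_le:
  fixes Q :: "'a::euclidean_space set" and \<rho> :: "'j \<Rightarrow> int"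
  assumes Q: "polytope Q" and iso: "poset_iso \<psi> s (face_lattice Q)"
    and mono: "\<And>x y. (x, y) \<in> s \<Longrightarrow> x \<noteq> y \<Longrightarrow> \<rho> x < \<rho> y" and xy: "(x, y) \<in> s"
  shows "aff_dim (\<psi> y) - aff_dim (\<psi> x) \<le> \<rho> y - \<rho> x"
proof -
  note iso' = poset_isoD[OF iso]
  have fld: "x \<in> Field s" "y \<in> Field s" using xy by (auto simp: Field_def)
  have sub: "\<psi> x \<subseteq> \<psi> y" using iso'(2)[OF fld] xy by simp
  define k where "k = nat (aff_dim (\<psi> y) - aff_dim (\<psi> x))"
  have k: "aff_dim (\<psi> y) = aff_dim (\<psi> x) + int k" using aff_dim_subset[OF sub] by (simp add: k_def)
  obtain H where H: "\<forall>m\<le>k. H m face_of Q" "\<forall>m<k. H m \<subset> H (Suc m)" "\<psi> x \<subseteq> H 0" "H k = \<psi> y"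
    using face_chain[OF Q iso'(1)[OF fld(1)] iso'(1)[OF fld(2)] sub k] by blast
  have "\<forall>m\<in>{..k}. \<exists>z. z \<in> Field s \<and> \<psi> z = H m" using iso'(3) H(1) by blast
  from bchoice[OF this] obtain K where "\<forall>m\<in>{..k}. K m \<in> Field s \<and> \<psi> (K m) = H m" by blast
  then have K: "\<And>m. m \<le> k \<Longrightarrow> K m \<in> Field s" "\<And>m. m \<le> k \<Longrightarrow> \<psi> (K m) = H m" by auto
  have step: "\<rho> (K m) < \<rho> (K (Suc m))" if "m < k" for m
  proof -
    have e: "\<psi> (K m) \<subset> \<psi> (K (Suc m))" using H(2) K(2)[of m] K(2)[of "Suc m"] that by simp
    then have "K m \<noteq> K (Suc m)" by auto
    then show ?thesis
      using mono[of "K m" "K (Suc m)"] iso'(2)[OF K(1) K(1), of m "Suc m"] e that by auto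
  qed
  have le: "\<rho> (K 0) + int k \<le> \<rho> (K k)"
    using strict_mono_steps[of k "\<lambda>m. \<rho> (K m)" k, OF step] by simp
  have mono': "\<rho> a \<le> \<rho> b" if "(a, b) \<in> s" for a b using mono[OF that] by (cases "a = b") auto
  have "\<rho> x \<le> \<rho> (K 0)" using mono' iso'(2)[OF fld(1) K(1)[of 0]] H(3) K(2)[of 0] by auto
  moreover have "\<rho> (K k) \<le> \<rho> y" using mono' iso'(2)[OF K(1)[of k] fld(2)] H(4) K(2)[of k] by auto
  ultimately show ?thesis using le k by simp
qed

lemma face_points:
  fixes Q :: "'a::euclidean_space set"
  assumes Q: "polytope Q" and iso: "poset_iso \<psi> s (face_lattice Q)"
  shows "\<exists>pt fa fb. (\<forall>I\<in>Field s. \<psi> I \<noteq> {} \<longrightarrow> pt I \<in> rel_interior (\<psi> I) \<and> pt I \<in> \<psi> I \<and> pt I \<in> Q) \<and>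
     (\<forall>J\<in>Field s. \<forall>z\<in>Q. (0::real) \<le> fa J \<bullet> z + fb J \<and> (fa J \<bullet> z + fb J = 0 \<longleftrightarrow> z \<in> \<psi> J)) \<and>
     (\<forall>I\<in>Field s. \<forall>J\<in>Field s. \<psi> I \<noteq> {} \<longrightarrow> (fa J \<bullet> pt I + fb J = 0 \<longleftrightarrow> (I, J) \<in> s))"
proof -
  note iso' = poset_isoD[OF iso]
  have conv: "convex (\<psi> I)" if "I \<in> Field s" for I using face_of_imp_convex[OF iso'(1)[OF that]] .
  define pt where "pt I = (SOME z. z \<in> rel_interior (\<psi> I))" for I
  have pt: "pt I \<in> rel_interior (\<psi> I)" if "I \<in> Field s" "\<psi> I \<noteq> {}" for I
    unfolding pt_def using rel_interior_eq_empty[OF conv[OF that(1)]] that(2) by (simp add: some_in_eq)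
  have "\<forall>J\<in>Field s. \<exists>ab. (\<forall>x\<in>Q. 0 \<le> fst ab \<bullet> x + snd ab) \<and> (\<forall>x\<in>Q. fst ab \<bullet> x + snd ab = 0 \<longleftrightarrow> x \<in> \<psi> J)"
    using face_functional[OF Q iso'(1)] by fastforce
  then obtain ab where ab: "\<And>J x. J \<in> Field s \<Longrightarrow> x \<in> Q \<Longrightarrow> 0 \<le> fst (ab J) \<bullet> x + snd (ab J)"
    "\<And>J x. J \<in> Field s \<Longrightarrow> x \<in> Q \<Longrightarrow> fst (ab J) \<bullet> x + snd (ab J) = 0 \<longleftrightarrow> x \<in> \<psi> J"
    by (metis (no_types, lifting))
  have mem: "pt I \<in> \<psi> I" "pt I \<in> Q" if "I \<in> Field s" "\<psi> I \<noteq> {}" for I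
    using pt[OF that] rel_interior_subset[of "\<psi> I"] face_of_imp_subset[OF iso'(1)[OF that(1)]] by auto
  have "fst (ab J) \<bullet> pt I + snd (ab J) = 0 \<longleftrightarrow> (I, J) \<in> s" if "I \<in> Field s" "J \<in> Field s" "\<psi> I \<noteq> {}" for I J
  proof -
    have "pt I \<in> \<psi> J \<longleftrightarrow> \<psi> I \<subseteq> \<psi> J"
      using subset_of_face_of[OF iso'(1)[OF that(2)] face_of_imp_subset[OF iso'(1)[OF that(1)]]]
        pt[OF that(1,3)] mem[OF that(1,3)] by auto
    then show ?thesis using ab(2)[OF that(2) mem(2)[OF that(1,3)]] iso'(2)[OF that(1,2)] by simp
  qed
  then show ?thesis using pt mem ab
    by (intro exI[of _ pt] exI[of _ "fst \<circ> ab"] exI[of _ "snd \<circ> ab"]) auto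
qed

section \<open>Ranked posets and balanced pairs\<close>

text \<open>\<open>h\<close> stands for the dimensions of faces in one fixed realization; other
  realizations are compared with it through \<open>aff_dim_diff_le\<close>.\<close>

locale ranked_poset =
  fixes r :: "'i rel" and h :: "'i \<Rightarrow> int" and bot top :: 'i and d :: nat
  assumes po: "Partial_order r" and bot: "\<And>x. x \<in> Field r \<Longrightarrow> (bot, x) \<in> r" and top: "\<And>x. x \<in> Field r \<Longrightarrow> (x, top) \<in> r"
    and mem: "bot \<in> Field r" "top \<in> Field r"
    and h: "\<And>x y. (x, y) \<in> r \<Longrightarrow> x \<noteq> y \<Longrightarrow> h x < h y" "h bot = -1" "h top = int d" and d: "2 < d"
begin

abbreviation "V \<equiv> Field r - {bot}"
abbreviation "R \<equiv> \<lambda>S. h S \<le> 2"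

lemma refl: "x \<in> Field r \<Longrightarrow> (x, x) \<in> r"
  and antisym: "(x, y) \<in> r \<Longrightarrow> (y, x) \<in> r \<Longrightarrow> x = y"
  and trans: "(x, y) \<in> r \<Longrightarrow> (y, z) \<in> r \<Longrightarrow> (x, z) \<in> r"
  using po by (auto simp: partial_order_on_def preorder_on_def refl_on_def antisym_def trans_def)

lemma FieldI: "(x, y) \<in> r \<Longrightarrow> x \<in> Field r \<and> y \<in> Field r"
  by (auto simp: Field_def)

text \<open>The outward functional \<open>- a\<close> that exposes \<open>F\<close> belongs to the
  normal cone. As \<open>u\<close> is relatively interior, it can be moved a little away from
  \<open>- a\<close> inside the cone, and the weak inequality there becomes a strict one at
  \<open>u\<close>.\<close>

lemma normal_cone_strict:
  fixes P :: "'a::euclidean_space set"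
  assumes F: "polytope P" "F face_of P" "x \<in> F" and u: "u \<in> rel_interior (normal_cone P F)" and y: "y \<in> P" "y \<notin> F"
  shows "u \<bullet> y < u \<bullet> x"
proof -
  define C where "C = normal_cone P F"
  have uC: "u \<in> C" using u rel_interior_subset by (auto simp: C_def)
  obtain a b where ab: "\<forall>x\<in>P. 0 \<le> a \<bullet> x + b" "\<forall>x\<in>P. a \<bullet> x + b = 0 \<longleftrightarrow> x \<in> F"
    using face_functional[OF F(1,2)] by blast
  have xP: "x \<in> P" using F face_of_imp_subset by blast
  have "- a \<in> C" unfolding C_def normal_cone_def
    using ab face_of_imp_subset[OF F(2)] by (fastforce simp: inner_simps)
  have "convex C" unfolding C_def normal_cone_def convex_alt
    by (auto simp: inner_simps intro!: add_mono mult_left_mono)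
  moreover have "C \<noteq> {}" using uC by blast
  ultimately obtain e where e: "e > 1" "(1 - e) *\<^sub>R (- a) + e *\<^sub>R u \<in> C"
    using convex_rel_interior_iff[of C u] u \<open>- a \<in> C\<close> unfolding C_def by blast
  have le: "((1 - e) *\<^sub>R (- a) + e *\<^sub>R u) \<bullet> y \<le> ((1 - e) *\<^sub>R (- a) + e *\<^sub>R u) \<bullet> x"
    using e(2) F(3) y(1) unfolding C_def normal_cone_def by blast
  have "a \<bullet> x + b = 0" "0 < a \<bullet> y + b" using ab xP F(3) y by (auto simp: less_le)
  then have "a \<bullet> x < a \<bullet> y" by linarith
  then have "(e - 1) * (a \<bullet> x) < (e - 1) * (a \<bullet> y)" using e(1) by simp
  moreover have "(e - 1) * (a \<bullet> y) + e * (u \<bullet> y) \<le> (e - 1) * (a \<bullet> x) + e * (u \<bullet> x)"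
    using le by (simp add: inner_simps algebra_simps)
  ultimately have "e * (u \<bullet> y) < e * (u \<bullet> x)" by linarith
  then show ?thesis using e(1) by simp
qed

text \<open>\<open>p x\<close> is chosen in the relative interior of face \<open>x\<close> of
  \<open>P1\<close>, and \<open>q x\<close> in the intersection that balance provides for
  \<open>g = f = x\<close>. Being relatively interior to face \<open>x\<close> of \<open>P2\<close>,
  \<open>q x\<close> gives \<open>B\<close> the right zeros; being relatively interior to the normal
  cone, it gives the strict inequality for \<open>N x y = q x \<bullet> p y\<close>.\<close>

lemma balanced_slack_pair:
  assumes "has_balanced_pair TYPE('a::euclidean_space) r"
  shows "slack_pair r V R"
proof -
  obtain P1 P2 :: "'a set" and \<phi>1 \<phi>2 where bp: "balanced_pair r P1 \<phi>1 P2 \<phi>2"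
    using assms unfolding has_balanced_pair_def by blast
  have P: "polytope P1" "polytope P2" and iso: "poset_iso \<phi>1 r (face_lattice P1)" "poset_iso \<phi>2 r (face_lattice P2)"
    and re: "realization r P1 \<phi>1" "realization r P2 \<phi>2"
    using bp by (auto simp: balanced_pair_def realization_def)
  have pb: "poset_bot r = bot"
    using realization_bot(1,2)[OF re(1)] bot mem antisym by blast
  have e0: "\<phi>1 bot = {}" "\<phi>2 bot = {}" using realization_bot(3)[OF re(1)] realization_bot(3)[OF re(2)] pb by auto
  have ne: "\<phi>1 x \<noteq> {}" "\<phi>2 x \<noteq> {}" if "x \<in> V" for x
    using that poset_isoD(2)[OF iso(1), of x bot] poset_isoD(2)[OF iso(2), of x bot] mem antisym[of x bot] bot e0 by auto
  have dim: "aff_dim (\<phi>1 S) \<le> h S" "aff_dim (\<phi>2 S) \<le> h S" if "S \<in> Field r" for S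
    using aff_dim_diff_le[where \<rho> = h, OF P(1) iso(1) h(1) bot[OF that]] aff_dim_diff_le[where \<rho> = h, OF P(2) iso(2) h(1) bot[OF that]] e0 h(2) by auto
  obtain p fa fb where p: "\<forall>I\<in>Field r. \<phi>1 I \<noteq> {} \<longrightarrow> p I \<in> rel_interior (\<phi>1 I) \<and> p I \<in> \<phi>1 I \<and> p I \<in> P1"
     "\<forall>J\<in>Field r. \<forall>z\<in>P1. (0::real) \<le> fa J \<bullet> z + fb J \<and> (fa J \<bullet> z + fb J = 0 \<longleftrightarrow> z \<in> \<phi>1 J)"
     "\<forall>I\<in>Field r. \<forall>J\<in>Field r. \<phi>1 I \<noteq> {} \<longrightarrow> (fa J \<bullet> p I + fb J = 0 \<longleftrightarrow> (I, J) \<in> r)"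
    using face_points[OF P(1) iso(1)] by (elim exE conjE) (rule that)
  obtain p' ga gb where g: "\<forall>J\<in>Field r. \<forall>z\<in>P2. (0::real) \<le> ga J \<bullet> z + gb J \<and> (ga J \<bullet> z + gb J = 0 \<longleftrightarrow> z \<in> \<phi>2 J)"
    using face_points[OF P(2) iso(2)] by (elim exE conjE) (rule that)
  have "\<forall>x\<in>V. \<exists>z. z \<in> rel_interior (normal_cone P1 (\<phi>1 x)) \<and> z \<in> rel_interior (\<phi>2 x)"
    using bp refl unfolding balanced_pair_def pb by blast
  then obtain q where q: "\<And>x. x \<in> V \<Longrightarrow> q x \<in> rel_interior (normal_cone P1 (\<phi>1 x))" "\<And>x. x \<in> V \<Longrightarrow> q x \<in> rel_interior (\<phi>2 x)"
    by (metis (no_types, lifting))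
  have q': "q x \<in> \<phi>2 x" "q x \<in> P2" if "x \<in> V" for x
    using q(2)[OF that] rel_interior_subset face_of_imp_subset[OF poset_isoD(1)[OF iso(2)]] that by blast+
  have qz: "ga T \<bullet> q x + gb T = 0 \<longleftrightarrow> (x, T) \<in> r" if "x \<in> V" "T \<in> Field r" for x T
  proof -
    have "q x \<in> \<phi>2 T \<longleftrightarrow> \<phi>2 x \<subseteq> \<phi>2 T"
      using subset_of_face_of[OF poset_isoD(1)[OF iso(2) that(2)] face_of_imp_subset[OF poset_isoD(1)[OF iso(2)]], of x]
        q(2) q' that by blast
    then show ?thesis using g q'(2) that poset_isoD(2)[OF iso(2)] by auto
  qed
  have dep: "\<exists>\<kappa>. (\<exists>m<4. \<kappa> m \<noteq> 0) \<and> (\<forall>\<rho>\<in>{\<lambda>x. a \<bullet> w x + b | a b. True}. (\<Sum>m<4. \<kappa> m * \<rho> (x m)) = (0::real))"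
    if wF: "\<And>m. m < 4 \<Longrightarrow> w (x m) \<in> F" "aff_dim F \<le> 2" for w :: "'i \<Rightarrow> 'a" and F and x :: "nat \<Rightarrow> 'i"
  proof -
    obtain \<kappa> where k: "\<exists>m<4. \<kappa> m \<noteq> 0" "(\<Sum>m<4. \<kappa> m) = (0::real)" "(\<Sum>m<4. \<kappa> m *\<^sub>R w (x m)) = 0"
      using affine_dependent_family[of 4 "\<lambda>m. w (x m)" F] wF by auto
    have "(\<Sum>m<4. \<kappa> m * (a \<bullet> w (x m) + b)) = a \<bullet> (\<Sum>m<4. \<kappa> m *\<^sub>R w (x m)) + b * (\<Sum>m<4. \<kappa> m)" for a b
      by (simp add: inner_sum_right sum_distrib_left distrib_left sum.distrib mult.commute mult.left_commute)
    then show ?thesis using k by auto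
  qed
  show ?thesis
    unfolding slack_pair_def
  proof (intro exI conjI)
    show "slack_rows r V R (\<lambda>T x. fa T \<bullet> p x + fb T) {\<lambda>x. a \<bullet> p x + b | a b. True}"
      unfolding slack_rows_def
    proof (intro conjI ballI impI allI)
      fix S and x :: "nat \<Rightarrow> 'i" assume S: "S \<in> Field r" "h S \<le> 2" and x: "\<forall>m<4. x m \<in> V \<and> (x m, S) \<in> r"
      show "\<exists>\<kappa>. (\<exists>m<4. \<kappa> m \<noteq> 0) \<and> (\<forall>\<rho>\<in>{\<lambda>x. a \<bullet> p x + b | a b. True}. (\<Sum>m<4. \<kappa> m * \<rho> (x m)) = (0::real))"
      proof (rule dep)
        show "p (x m) \<in> \<phi>1 S" if "m < 4" for m
          using x that p(1) ne(1) poset_isoD(2)[OF iso(1) _ S(1)] by blast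
        show "aff_dim (\<phi>1 S) \<le> 2" using dim(1)[OF S(1)] S(2) by simp
      qed
    qed (use p ne in auto)
    show "slack_rows r V R (\<lambda>T x. ga T \<bullet> q x + gb T) {\<lambda>x. a \<bullet> q x + b | a b. True}"
      unfolding slack_rows_def
    proof (intro conjI ballI impI allI)
      fix S and x :: "nat \<Rightarrow> 'i" assume S: "S \<in> Field r" "h S \<le> 2" and x: "\<forall>m<4. x m \<in> V \<and> (x m, S) \<in> r"
      show "\<exists>\<kappa>. (\<exists>m<4. \<kappa> m \<noteq> 0) \<and> (\<forall>\<rho>\<in>{\<lambda>x. a \<bullet> q x + b | a b. True}. (\<Sum>m<4. \<kappa> m * \<rho> (x m)) = (0::real))"
      proof (rule dep)
        show "q (x m) \<in> \<phi>2 S" if "m < 4" for m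
          using x that q'(1) poset_isoD(2)[OF iso(2) _ S(1)] by blast
        show "aff_dim (\<phi>2 S) \<le> 2" using dim(2)[OF S(1)] S(2) by simp
      qed
    qed (use g q' qz in auto)
    show "\<forall>y\<in>V. (\<lambda>x. q y \<bullet> p x) \<in> {\<lambda>x. a \<bullet> p x + b | a b. True}"
    proof
      fix y show "(\<lambda>x. q y \<bullet> p x) \<in> {\<lambda>x. a \<bullet> p x + b | a b. True}"
        by (rule CollectI, intro exI[of _ "q y"] exI[of _ 0]) simp
    qed
    show "(\<lambda>_. 1) \<in> {\<lambda>x. a \<bullet> p x + b | a b. True}"
      by (rule CollectI, rule exI[of _ 0], rule exI[of _ 1]) simp
    show "\<forall>y\<in>V. \<forall>y'\<in>V. (\<lambda>x. q x \<bullet> p y - q x \<bullet> p y') \<in> {\<lambda>x. a \<bullet> q x + b | a b. True}"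
    proof (intro ballI)
      fix y y' show "(\<lambda>x. q x \<bullet> p y - q x \<bullet> p y') \<in> {\<lambda>x. a \<bullet> q x + b | a b. True}"
        by (rule CollectI, intro exI[of _ "p y - p y'"] exI[of _ 0]) (auto simp: inner_simps inner_commute)
    qed
    show "\<forall>x\<in>V. \<forall>y\<in>V. (y, x) \<notin> r \<longrightarrow> q x \<bullet> p y < q x \<bullet> p x"
    proof (intro ballI impI)
      fix x y assume xy: "x \<in> V" "y \<in> V" "(y, x) \<notin> r"
      have "p y \<notin> \<phi>1 x" using p(2,3) xy ne(1)[OF xy(2)] p(1) by auto
      then show "q x \<bullet> p y < q x \<bullet> p x"
        using normal_cone_strict[OF P(1) poset_isoD(1)[OF iso(1)] _ q(1)[OF xy(1)], of "p x" "p y"] p(1) xy ne(1) by auto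
    qed
  qed
qed

end

section \<open>Interval posets, antiprisms and interval polytopes\<close>

context ranked_poset
begin

definition ivl :: "'i \<Rightarrow> 'i \<Rightarrow> 'i set" where
  "ivl x y = {z. (x, z) \<in> r \<and> (z, y) \<in> r}"

lemma ivl_subset: "(x, y) \<in> r \<Longrightarrow> ivl x y \<subseteq> ivl x' y' \<longleftrightarrow> (x', x) \<in> r \<and> (y, y') \<in> r"
  unfolding ivl_def using refl trans FieldI by blast

lemma ivl_inj: "(x, y) \<in> r \<Longrightarrow> (x', y') \<in> r \<Longrightarrow> ivl x y = ivl x' y' \<Longrightarrow> x = x' \<and> y = y'"
  using ivl_subset[of x y x' y'] ivl_subset[of x' y' x y] antisym by auto

lemma ivl_nonempty: "(x, y) \<in> r \<Longrightarrow> ivl x y \<noteq> {}"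
  unfolding ivl_def using refl FieldI by blast

lemma intervals_ivl: "intervals r = insert {} {ivl x y | x y. (x, y) \<in> r}"
  by (auto simp: intervals_def ivl_def)

lemma interval_poset_iff: "(I, J) \<in> interval_poset r \<longleftrightarrow> I \<in> intervals r \<and> J \<in> intervals r \<and> I \<subseteq> J"
  by (auto simp: interval_poset_def relation_of_def)

lemma Field_interval_poset: "Field (interval_poset r) = intervals r" "Field ((interval_poset r)\<inverse>) = intervals r"
  by (auto simp: interval_poset_def Field_relation_of_subset)

text \<open>Well defined because a nonempty interval determines its ends. It is a rank for the
  interval poset, and its negative one for the reversed order.\<close>

definition ivl_rank :: "'i set \<Rightarrow> int" where
  "ivl_rank I = (if I = {} then -1 else (THE n. \<exists>x y. (x, y) \<in> r \<and> I = ivl x y \<and> n = h y - h x))"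

lemma ivl_rank_ivl: assumes "(x, y) \<in> r" shows "ivl_rank (ivl x y) = h y - h x"
proof -
  have "(THE n. \<exists>x' y'. (x', y') \<in> r \<and> ivl x y = ivl x' y' \<and> n = h y' - h x') = h y - h x"
    by (rule the_equality) (use assms ivl_inj in blast)+
  then show ?thesis using ivl_nonempty[OF assms] by (simp add: ivl_rank_def)
qed

lemma h_mono: "(x, y) \<in> r \<Longrightarrow> h x \<le> h y"
  using h(1) by (cases "x = y") (auto simp: less_imp_le)

lemma ivl_rank_mono:
  assumes "(I, J) \<in> interval_poset r" "I \<noteq> J" shows "ivl_rank I < ivl_rank J"
proof -
  have IJ: "I \<in> intervals r" "J \<in> intervals r" "I \<subseteq> J" using assms by (auto simp: interval_poset_iff)
  then have "J \<noteq> {}" using assms(2) by auto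
  then obtain x' y' where J: "(x', y') \<in> r" "J = ivl x' y'" using IJ(2) by (auto simp: intervals_ivl)
  show ?thesis
  proof (cases "I = {}")
    case True
    then show ?thesis using ivl_rank_ivl[OF J(1)] h_mono[OF J(1)] J(2) by (simp add: ivl_rank_def[of "{}"])
  next
    case False
    then obtain x y where I: "(x, y) \<in> r" "I = ivl x y" using IJ(1) by (auto simp: intervals_ivl)
    have le: "(x', x) \<in> r" "(y, y') \<in> r" using IJ(3) ivl_subset[OF I(1)] I J by auto
    have "x' \<noteq> x \<or> y \<noteq> y'" using assms(2) I J by auto
    then have "h x' < h x \<or> h y < h y'" using h(1) le by blast
    then show ?thesis using h_mono[OF le(1)] h_mono[OF le(2)] ivl_rank_ivl[OF I(1)] ivl_rank_ivl[OF J(1)] I J by auto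
  qed
qed

lemma ivl_in: "(x, y) \<in> r \<Longrightarrow> ivl x y \<in> intervals r"
  by (auto simp: intervals_ivl)

lemma V_bot: "x \<in> V \<Longrightarrow> (x, bot) \<notin> r"
  using bot antisym by blast

lemma small_ne_top: "S \<in> Field r \<Longrightarrow> h S \<le> 2 \<Longrightarrow> (top, S) \<notin> r"
  using h_mono[of top S] h(3) d by auto

text \<open>Let \<open>\<phi> f\<close> expose the face of \<open>{f}\<close>, let
  \<open>a x\<close> be interior to the face of \<open>[x, top]\<close> and \<open>c T\<close> to
  that of \<open>[bot, T]\<close>. Then \<open>\<phi> f (a x) = 0\<close> iff \<open>x\<close> is
  below \<open>f\<close>, and \<open>\<phi> f (c T) = 0\<close> iff \<open>f\<close> is below
  \<open>T\<close>. The functional \<open>\<phi> bot\<close> is positive at every \<open>a x\<close>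
  and zero at every \<open>c T\<close>: dividing by it puts the constant 1 into \<open>QA\<close>,
  and it does not affect the rows of \<open>B\<close>.\<close>

lemma antiprism_slack_pair_euclidean:
  fixes Q :: "'a::euclidean_space set"
  assumes Q: "polytope Q" and iso: "poset_iso \<psi> ((interval_poset r)\<inverse>) (face_lattice Q)"
  shows "slack_pair r V R"
proof -
  note iso' = poset_isoD[OF iso, unfolded Field_interval_poset]
  have sub: "\<psi> I \<subseteq> \<psi> J \<longleftrightarrow> J \<subseteq> I" if "I \<in> intervals r" "J \<in> intervals r" for I J
    using iso'(2)[OF that] that by (simp add: interval_poset_iff)
  have bt: "(bot, top) \<in> r" using bot mem by simp
  have le_bt: "I \<subseteq> ivl bot top" if "I \<in> intervals r" for I
    using that bot top FieldI by (auto simp: intervals_ivl ivl_def)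
  have empty: "\<psi> (ivl bot top) = {}"
  proof -
    obtain I where I: "I \<in> intervals r" "\<psi> I = {}" using iso'(3)[of "{}"] by auto
    have "\<psi> (ivl bot top) \<subseteq> \<psi> I" using sub[OF ivl_in[OF bt] I(1)] le_bt[OF I(1)] by simp
    then show ?thesis using I(2) by simp
  qed
  have ne: "\<psi> (ivl x y) \<noteq> {}" if "(x, y) \<in> r" "x \<noteq> bot \<or> y \<noteq> top" for x y
  proof
    assume "\<psi> (ivl x y) = {}"
    then have "ivl bot top \<subseteq> ivl x y" using sub[OF ivl_in[OF that(1)] ivl_in[OF bt]] empty by simp
    then have "(x, bot) \<in> r" "(top, y) \<in> r" using ivl_subset[OF bt] by auto
    then have "x = bot" "y = top" using bot top antisym FieldI by blast+
    then show False using that(2) by simp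
  qed
  obtain pt fa fb where p: "\<forall>I\<in>intervals r. \<psi> I \<noteq> {} \<longrightarrow> pt I \<in> rel_interior (\<psi> I) \<and> pt I \<in> \<psi> I \<and> pt I \<in> Q"
     "\<forall>J\<in>intervals r. \<forall>z\<in>Q. (0::real) \<le> fa J \<bullet> z + fb J \<and> (fa J \<bullet> z + fb J = 0 \<longleftrightarrow> z \<in> \<psi> J)"
     "\<forall>I\<in>intervals r. \<forall>J\<in>intervals r. \<psi> I \<noteq> {} \<longrightarrow> (fa J \<bullet> pt I + fb J = 0 \<longleftrightarrow> (I, J) \<in> (interval_poset r)\<inverse>)"
    using face_points[OF Q iso] unfolding Field_interval_poset by (elim exE conjE) (rule that)
  define \<phi> where "\<phi> f z = fa (ivl f f) \<bullet> z + fb (ivl f f)" for f z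
  define a where "a x = pt (ivl x top)" for x
  \<comment> \<open>The face of \<open>[bot, top]\<close> is empty and has no point. Since every
    element lies below \<open>top\<close>, its row in \<open>B\<close> is set to 0 instead.\<close>
  define c where "c T = (if T = top then undefined else pt (ivl bot T))" for T
  have dimb: "aff_dim (\<psi> I) - aff_dim (\<psi> J) \<le> ivl_rank J - ivl_rank I" if "I \<in> intervals r" "J \<in> intervals r" "I \<subseteq> J" for I J
  proof -
    have "aff_dim (\<psi> I) - aff_dim (\<psi> J) \<le> - ivl_rank I - (- ivl_rank J)"
      by (rule aff_dim_diff_le[where \<rho> = "\<lambda>I. - ivl_rank I", OF Q iso]) (use that ivl_rank_mono in \<open>auto simp: interval_poset_iff\<close>)
    then show ?thesis by simp
  qed
  have aQ: "a x \<in> Q" "a x \<in> \<psi> (ivl x top)" if "x \<in> V" for x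
    using p(1) ne[of x top] ivl_in top that unfolding a_def by auto
  have pos: "0 \<le> \<phi> f z" if "f \<in> Field r" "z \<in> Q" for f z
    using p(2) ivl_in[OF refl[OF that(1)]] that unfolding \<phi>_def by auto
  have \<phi>a: "\<phi> f (a x) = 0 \<longleftrightarrow> (x, f) \<in> r" if "f \<in> Field r" "x \<in> V" for f x
  proof -
    have "\<phi> f (a x) = 0 \<longleftrightarrow> ivl f f \<subseteq> ivl x top"
      using p(3) ivl_in[OF refl[OF that(1)]] ivl_in[of x top] top ne[of x top] that
      unfolding \<phi>_def a_def by (auto simp: interval_poset_iff)
    then show ?thesis using ivl_subset[OF refl[OF that(1)]] top[OF that(1)] by simp
  qed
  have lam: "0 < \<phi> bot (a x)" if "x \<in> V" for x
    using pos[OF mem(1) aQ(1)[OF that]] \<phi>a[OF mem(1) that] V_bot[OF that] by simp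
  have cQ: "c T \<in> Q" if "T \<in> Field r" "T \<noteq> top" for T
    using p(1) ne[of bot T] ivl_in bot that unfolding c_def by auto
  have \<phi>c: "\<phi> f (c T) = 0 \<longleftrightarrow> (f, T) \<in> r" if "f \<in> Field r" "T \<in> Field r" "T \<noteq> top" for f T
  proof -
    have "\<phi> f (c T) = 0 \<longleftrightarrow> ivl f f \<subseteq> ivl bot T"
      using p(3) ivl_in[OF refl[OF that(1)]] ivl_in[of bot T] bot ne[of bot T] that
      unfolding \<phi>_def c_def by (auto simp: interval_poset_iff)
    then show ?thesis using ivl_subset[OF refl[OF that(1)]] bot[OF that(1)] by simp
  qed
  define N where "N y x = - \<phi> y (a x) / \<phi> bot (a x)" for x y
  define QA where "QA = {\<lambda>x. (u \<bullet> a x + b) / \<phi> bot (a x) | u b. True} \<union> {\<lambda>x. \<phi> bot (a x) / \<phi> bot (a x)} \<union> {\<lambda>_. 1}"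
  define B where "B T x = (if T = top then 0 else \<phi> x (c T))" for T x
  define QB where "QB = B ` Field r \<union> {\<lambda>x. N x y - N x y' | y y'. y \<in> V \<and> y' \<in> V}"
  show ?thesis
    unfolding slack_pair_def
  proof (intro exI conjI)
    show "slack_rows r V R (\<lambda>T x. \<phi> T (a x) / \<phi> bot (a x)) QA"
      unfolding slack_rows_def
    proof (intro conjI ballI impI allI)
      fix S and x :: "nat \<Rightarrow> 'i" assume S: "S \<in> Field r" "h S \<le> 2" and x: "\<forall>m<4. x m \<in> V \<and> (x m, S) \<in> r"
      define F where "F = \<psi> (ivl S top)"
      \<comment> \<open>The subtracted face is empty, of dimension -1, so this says that
        \<open>F\<close> has dimension at most \<open>h S\<close>.\<close>
      have "aff_dim F - aff_dim (\<psi> (ivl bot top)) \<le> ivl_rank (ivl bot top) - ivl_rank (ivl S top)"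
        unfolding F_def using top[OF S(1)] bot[OF S(1)] bt ivl_in ivl_subset refl mem by (intro dimb) auto
      then have dF: "aff_dim F + 1 < int 4"
        using S(2) by (simp add: empty ivl_rank_ivl[OF bt] ivl_rank_ivl[OF top[OF S(1)]] h)
      have xF: "a (x m) \<in> F" if "m < 4" for m
      proof -
        have xm: "x m \<in> V" "(x m, S) \<in> r" "(x m, top) \<in> r" using x top that by auto
        have "\<psi> (ivl (x m) top) \<subseteq> F" unfolding F_def
          using sub[OF ivl_in[OF xm(3)] ivl_in[OF top[OF S(1)]]] ivl_subset[OF top[OF S(1)]] xm(2) refl mem(2) by simp
        then show ?thesis using aQ(2)[OF xm(1)] by blast
      qed
      obtain \<kappa> where k: "\<exists>m<4. \<kappa> m \<noteq> 0" "(\<Sum>m<4. \<kappa> m) = (0::real)" "(\<Sum>m<4. \<kappa> m *\<^sub>R a (x m)) = 0"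
        using affine_dependent_family[of 4 "\<lambda>m. a (x m)" F, OF xF dF] by blast
      have lin: "(\<Sum>m<4. \<kappa> m * (u \<bullet> a (x m) + b)) = 0" for u b
      proof -
        have "(\<Sum>m<4. \<kappa> m * (u \<bullet> a (x m) + b)) = u \<bullet> (\<Sum>m<4. \<kappa> m *\<^sub>R a (x m)) + b * (\<Sum>m<4. \<kappa> m)"
          by (simp add: inner_sum_right sum_distrib_left distrib_left sum.distrib mult.commute mult.left_commute)
        then show ?thesis using k by simp
      qed
      define \<kappa>' where "\<kappa>' m = \<kappa> m * \<phi> bot (a (x m))" for m
      have l0: "\<phi> bot (a (x m)) \<noteq> 0" if "m < 4" for m using lam[of "x m"] x that by auto
      have s: "(\<Sum>m<4. \<kappa>' m * ((u \<bullet> a (x m) + b) / \<phi> bot (a (x m)))) = 0" for u b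
      proof -
        have "(\<Sum>m<4. \<kappa>' m * ((u \<bullet> a (x m) + b) / \<phi> bot (a (x m)))) = (\<Sum>m<4. \<kappa> m * (u \<bullet> a (x m) + b))"
          by (rule sum.cong) (use l0 in \<open>auto simp: \<kappa>'_def\<close>)
        then show ?thesis using lin by simp
      qed
      have s1: "(\<Sum>m<4. \<kappa>' m) = 0"
        using lin[of "fa (ivl bot bot)" "fb (ivl bot bot)"] by (simp add: \<kappa>'_def \<phi>_def)
      have "(\<Sum>m<4. \<kappa>' m * (\<phi> bot (a (x m)) / \<phi> bot (a (x m)))) = (\<Sum>m<4. \<kappa>' m)"
        by (rule sum.cong) (use l0 in auto)
      then have "\<forall>\<rho>\<in>QA. (\<Sum>m<4. \<kappa>' m * \<rho> (x m)) = 0" unfolding QA_def using s s1 by auto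
      moreover have "\<exists>m<4. \<kappa>' m \<noteq> 0" using k(1) l0 by (auto simp: \<kappa>'_def)
      ultimately show "\<exists>\<kappa>. (\<exists>m<4. \<kappa> m \<noteq> 0) \<and> (\<forall>\<rho>\<in>QA. (\<Sum>m<4. \<kappa> m * \<rho> (x m)) = (0::real))" by blast
    next
      fix T x assume T: "T \<in> Field r" and x: "x \<in> V"
      show "0 \<le> \<phi> T (a x) / \<phi> bot (a x)" using pos[OF T aQ(1)[OF x]] lam[OF x] by simp
      show "\<phi> T (a x) / \<phi> bot (a x) = 0 \<longleftrightarrow> (x, T) \<in> r" using \<phi>a[OF T x] lam[OF x] by simp
    next
      fix T show "(\<lambda>x. \<phi> T (a x) / \<phi> bot (a x)) \<in> QA" unfolding QA_def \<phi>_def by blast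
    qed
    show "\<forall>y\<in>V. N y \<in> QA"
    proof
      fix y
      have "N y = (\<lambda>x. ((- fa (ivl y y)) \<bullet> a x + (- fb (ivl y y))) / \<phi> bot (a x))"
        by (rule ext) (simp add: N_def \<phi>_def)
      then show "N y \<in> QA" unfolding QA_def by blast
    qed
    show "(\<lambda>_. 1) \<in> QA" by (simp add: QA_def)
    show "\<forall>y\<in>V. \<forall>y'\<in>V. (\<lambda>x. N x y - N x y') \<in> QB" unfolding QB_def by blast
    show "\<forall>x\<in>V. \<forall>y\<in>V. (y, x) \<notin> r \<longrightarrow> N x y < N x x"
    proof (intro ballI impI)
      fix x y assume xy: "x \<in> V" "y \<in> V" "(y, x) \<notin> r"
      have "\<phi> x (a x) = 0" using \<phi>a[of x x] xy refl by auto
      moreover have "0 < \<phi> x (a y)" using \<phi>a[of x y] pos[of x "a y"] aQ[of y] xy by (simp add: less_le)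
      ultimately show "N x y < N x x" using lam[OF xy(2)] by (simp add: N_def)
    qed
    show "slack_rows r V R B QB"
      unfolding slack_rows_def
    proof (intro conjI ballI impI allI)
      fix S and x :: "nat \<Rightarrow> 'i" assume S: "S \<in> Field r" "h S \<le> 2" and x: "\<forall>m<4. x m \<in> V \<and> (x m, S) \<in> r"
      define F where "F = \<psi> (ivl bot S)"
      have St: "S \<noteq> top" using small_ne_top[OF S] refl mem by auto
      have F0: "F \<noteq> {}" unfolding F_def using ne[OF bot[OF S(1)]] St by simp
      have FQ: "F \<subseteq> Q" unfolding F_def using iso'(1)[OF ivl_in[OF bot[OF S(1)]]] face_of_imp_subset by blast
      \<comment> \<open>\<open>bot\<close> is added as a fifth element: \<open>F\<close> has
        codimension at most \<open>h S + 2\<close>, hence at most 4, so the five functionals are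
        dependent.\<close>
      define w where "w m = (if m = 4 then bot else x m)" for m
      have w: "w m \<in> Field r" "(w m, S) \<in> r" if "m < 5" for m
        using x that bot[OF S(1)] mem(1) by (auto simp: w_def)
      have zero: "fa (ivl (w m) (w m)) \<bullet> z + fb (ivl (w m) (w m)) = 0" if "m < 5" "z \<in> F" for m z
      proof -
        have "F \<subseteq> \<psi> (ivl (w m) (w m))" unfolding F_def
          using sub[OF ivl_in[OF bot[OF S(1)]] ivl_in[OF refl[OF w(1)[OF that(1)]]]] ivl_subset[OF refl[OF w(1)[OF that(1)]]]
            w[OF that(1)] bot by simp
        then show ?thesis using p(2) ivl_in[OF refl[OF w(1)[OF that(1)]]] that(2) FQ by blast
      qed
      obtain I0 where "I0 \<in> intervals r" "\<psi> I0 = Q" using iso'(3)[OF face_of_refl[OF polytope_imp_convex[OF Q]]] by blast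
      then have "\<psi> {} = Q" using sub[of I0 "{}"] iso'(1)[of "{}"] face_of_imp_subset[of "\<psi> {}" Q]
        by (auto simp: intervals_ivl)
      then have "aff_dim Q - aff_dim F \<le> ivl_rank (ivl bot S) - ivl_rank {}"
        unfolding F_def using dimb[of "{}" "ivl bot S"] ivl_in[OF bot[OF S(1)]] by (simp add: intervals_ivl)
      then have "aff_dim Q - aff_dim F < int 5"
        using S(2) by (simp add: ivl_rank_ivl[OF bot[OF S(1)]] h ivl_rank_def[of "{}"])
      then obtain \<kappa> where k: "\<exists>m<5. \<kappa> m \<noteq> (0::real)"
        "\<forall>z\<in>Q. (\<Sum>m<5. \<kappa> m * (fa (ivl (w m) (w m)) \<bullet> z + fb (ivl (w m) (w m)))) = 0"
        using dependent_functionals[of F Q 5 "\<lambda>m. fa (ivl (w m) (w m))" "\<lambda>m. fb (ivl (w m) (w m))", OF F0 FQ zero] by blast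
      have k2: "(\<Sum>m<4. \<kappa> m * \<phi> (x m) z) + \<kappa> 4 * \<phi> bot z = 0" if "z \<in> Q" for z
      proof -
        have "(\<Sum>m<Suc 4. \<kappa> m * \<phi> (w m) z) = 0" using k(2) that by (simp add: \<phi>_def)
        moreover have "(\<Sum>m<4. \<kappa> m * \<phi> (w m) z) = (\<Sum>m<4. \<kappa> m * \<phi> (x m) z)"
          by (rule sum.cong) (auto simp: w_def)
        ultimately show ?thesis by (simp only: sum.lessThan_Suc) (simp add: w_def)
      qed
      have xV: "x 0 \<in> V" using x by simp
      have nz: "\<exists>m<4. \<kappa> m \<noteq> 0"
      proof (rule ccontr)
        assume *: "\<not> (\<exists>m<4. \<kappa> m \<noteq> 0)"
        then have "\<kappa> 4 * \<phi> bot (a (x 0)) = 0" using k2[OF aQ(1)[OF xV]] by simp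
        then have "\<kappa> 4 = 0" using lam[OF xV] by simp
        then have "\<kappa> m = 0" if "m < 5" for m using * that by (cases "m = 4") auto
        then show False using k(1) by blast
      qed
      have "(\<Sum>m<4. \<kappa> m * B T (x m)) = 0" if "T \<in> Field r" for T
      proof (cases "T = top")
        case False
        then show ?thesis using k2[OF cQ[OF that False]] \<phi>c[OF mem(1) that False] bot[OF that] by (simp add: B_def)
      qed (simp add: B_def)
      moreover have "(\<Sum>m<4. \<kappa> m * (N (x m) y - N (x m) y')) = 0" if "y \<in> V" "y' \<in> V" for y y'
      proof -
        \<comment> \<open>The right-hand side does not depend on \<open>y\<close>, so it cancels in
          the differences of \<open>N\<close> that belong to \<open>QB\<close>.\<close>
        have e: "(\<Sum>m<4. \<kappa> m * N (x m) y) = \<kappa> 4" if y: "y \<in> V" for y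
        proof -
          have "(\<Sum>m<4. \<kappa> m * N (x m) y) = - (\<Sum>m<4. \<kappa> m * \<phi> (x m) (a y)) / \<phi> bot (a y)"
            by (simp add: N_def sum_divide_distrib sum_negf)
          also have "- (\<Sum>m<4. \<kappa> m * \<phi> (x m) (a y)) = \<kappa> 4 * \<phi> bot (a y)"
            using k2[OF aQ(1)[OF y]] by linarith
          finally show ?thesis using lam[OF y] by simp
        qed
        show ?thesis using e[OF that(1)] e[OF that(2)] by (simp add: right_diff_distrib sum_subtractf)
      qed
      ultimately have "\<forall>\<rho>\<in>QB. (\<Sum>m<4. \<kappa> m * \<rho> (x m)) = 0" unfolding QB_def by auto
      then show "\<exists>\<kappa>. (\<exists>m<4. \<kappa> m \<noteq> 0) \<and> (\<forall>\<rho>\<in>QB. (\<Sum>m<4. \<kappa> m * \<rho> (x m)) = (0::real))" using nz by blast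
    next
      fix T x assume T: "T \<in> Field r" and x: "x \<in> V"
      show "0 \<le> B T x" using pos[of x "c T"] cQ[OF T] x by (auto simp: B_def)
      show "B T x = 0 \<longleftrightarrow> (x, T) \<in> r" using \<phi>c[of x T] T x top[of x] by (auto simp: B_def)
    next
      fix T assume "T \<in> Field r" then show "B T \<in> QB" by (simp add: QB_def)
    qed
  qed
qed

text \<open>Compared with the antiprism, points and functionals trade places: \<open>q f\<close> is
  interior to the face of \<open>{f}\<close>, \<open>\<phi> x\<close> exposes the face of
  \<open>[x, top]\<close>, and \<open>ch T\<close> that of \<open>[bot, T]\<close>. In
  \<open>A\<close> and \<open>N\<close> an element \<open>x\<close> is represented by
  \<open>\<phi> x\<close>, normalized to 1 at \<open>q bot\<close>; in \<open>B\<close> it is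
  represented by \<open>q x\<close>, and \<open>QB\<close> consists of the affine functionals
  vanishing at \<open>q bot\<close>.\<close>

lemma interval_slack_pair_euclidean:
  fixes Q :: "'a::euclidean_space set"
  assumes Q: "polytope Q" and iso: "poset_iso \<psi> (interval_poset r) (face_lattice Q)"
  shows "slack_pair r V R"
proof -
  note iso' = poset_isoD[OF iso, unfolded Field_interval_poset]
  have sub: "\<psi> I \<subseteq> \<psi> J \<longleftrightarrow> I \<subseteq> J" if "I \<in> intervals r" "J \<in> intervals r" for I J
    using iso'(2)[OF that] that by (simp add: interval_poset_iff)
  have bt: "(bot, top) \<in> r" using bot mem by simp
  have e: "{} \<in> intervals r" by (simp add: intervals_ivl)
  have empty: "\<psi> {} = {}"
  proof -
    obtain I where I: "I \<in> intervals r" "\<psi> I = {}" using iso'(3)[of "{}"] by auto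
    have "\<psi> {} \<subseteq> \<psi> I" using sub[OF e I(1)] by simp
    then show ?thesis using I(2) by simp
  qed
  have ne: "\<psi> (ivl x y) \<noteq> {}" if "(x, y) \<in> r" for x y
    using sub[OF ivl_in[OF that] e] empty ivl_nonempty[OF that] by auto
  have full: "\<psi> (ivl bot top) = Q"
  proof -
    obtain I where I: "I \<in> intervals r" "\<psi> I = Q"
      using iso'(3)[OF face_of_refl[OF polytope_imp_convex[OF Q]]] by blast
    have "I \<subseteq> ivl bot top" using I(1) bot top FieldI by (auto simp: intervals_ivl ivl_def)
    then have "\<psi> I \<subseteq> \<psi> (ivl bot top)" using sub[OF I(1) ivl_in[OF bt]] by simp
    then show ?thesis using I(2) face_of_imp_subset[OF iso'(1)[OF ivl_in[OF bt]]] by blast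
  qed
  obtain pt fa fb where p: "\<forall>I\<in>intervals r. \<psi> I \<noteq> {} \<longrightarrow> pt I \<in> rel_interior (\<psi> I) \<and> pt I \<in> \<psi> I \<and> pt I \<in> Q"
     "\<forall>J\<in>intervals r. \<forall>z\<in>Q. (0::real) \<le> fa J \<bullet> z + fb J \<and> (fa J \<bullet> z + fb J = 0 \<longleftrightarrow> z \<in> \<psi> J)"
     "\<forall>I\<in>intervals r. \<forall>J\<in>intervals r. \<psi> I \<noteq> {} \<longrightarrow> (fa J \<bullet> pt I + fb J = 0 \<longleftrightarrow> (I, J) \<in> interval_poset r)"
    using face_points[OF Q iso] unfolding Field_interval_poset by (elim exE conjE) (rule that)
  define \<phi> where "\<phi> x z = fa (ivl x top) \<bullet> z + fb (ivl x top)" for x z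
  define q where "q f = pt (ivl f f)" for f
  have dimb: "aff_dim (\<psi> J) - aff_dim (\<psi> I) \<le> ivl_rank J - ivl_rank I" if "I \<in> intervals r" "J \<in> intervals r" "I \<subseteq> J" for I J
    by (rule aff_dim_diff_le[where \<rho> = ivl_rank, OF Q iso]) (use that ivl_rank_mono in \<open>auto simp: interval_poset_iff\<close>)
  have qQ: "q f \<in> Q" "q f \<in> \<psi> (ivl f f)" if "f \<in> Field r" for f
    using p(1) ne[of f f] ivl_in[of f f] refl[OF that] unfolding q_def by auto
  have pos: "0 \<le> \<phi> x z" if "x \<in> Field r" "z \<in> Q" for x z
    using p(2) ivl_in[OF top[OF that(1)]] that unfolding \<phi>_def by auto
  have \<phi>q: "\<phi> x (q f) = 0 \<longleftrightarrow> (x, f) \<in> r" if "x \<in> Field r" "f \<in> Field r" for f x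
  proof -
    have "\<phi> x (q f) = 0 \<longleftrightarrow> ivl f f \<subseteq> ivl x top"
      using p(3) ivl_in[OF refl[OF that(2)]] ivl_in[OF top[OF that(1)]] ne[OF refl[OF that(2)]]
      unfolding \<phi>_def q_def by (auto simp: interval_poset_iff)
    then show ?thesis using ivl_subset[OF refl[OF that(2)]] top[OF that(2)] by simp
  qed
  define lam0 where "lam0 x = \<phi> x (q bot)" for x
  have lam: "0 < lam0 x" if "x \<in> V" for x
    using pos[of x "q bot"] qQ(1)[OF mem(1)] \<phi>q[of x bot] mem(1) V_bot[OF that] that by (auto simp: lam0_def less_le)
  define N where "N y x = - \<phi> x (q y) / lam0 x" for x y
  define QA where "QA = {\<lambda>x. s * \<phi> x (q f) / lam0 x | s f. f \<in> Field r} \<union> {\<lambda>_. 1}"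
  define ch where "ch T z = fa (ivl bot T) \<bullet> z + fb (ivl bot T)" for T z
  define QB where "QB = {\<lambda>x. u \<bullet> q x + b | u b. u \<bullet> q bot + b = 0}"
  have chq: "ch T (q f) = 0 \<longleftrightarrow> (f, T) \<in> r" if "f \<in> Field r" "T \<in> Field r" for f T
  proof -
    have "ch T (q f) = 0 \<longleftrightarrow> ivl f f \<subseteq> ivl bot T"
      using p(3) ivl_in[OF refl[OF that(1)]] ivl_in[OF bot[OF that(2)]] ne[OF refl[OF that(1)]]
      unfolding ch_def q_def by (auto simp: interval_poset_iff)
    then show ?thesis using ivl_subset[OF refl[OF that(1)]] bot[OF that(1)] by simp
  qed
  show ?thesis
    unfolding slack_pair_def
  proof (intro exI conjI)
    show "slack_rows r V R (\<lambda>T x. \<phi> x (q T) / lam0 x) QA"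
      unfolding slack_rows_def
    proof (intro conjI ballI impI allI)
      fix S and x :: "nat \<Rightarrow> 'i" assume S: "S \<in> Field r" "h S \<le> 2" and x: "\<forall>m<4. x m \<in> V \<and> (x m, S) \<in> r"
      define F where "F = \<psi> (ivl S top)"
      have F0: "F \<noteq> {}" unfolding F_def by (rule ne[OF top[OF S(1)]])
      have FQ: "F \<subseteq> Q" unfolding F_def using iso'(1)[OF ivl_in[OF top[OF S(1)]]] face_of_imp_subset by blast
      have "aff_dim Q - aff_dim F \<le> ivl_rank (ivl bot top) - ivl_rank (ivl S top)"
        unfolding F_def full[symmetric] using top[OF S(1)] bot[OF S(1)] bt ivl_in ivl_subset refl mem by (intro dimb) auto
      then have dF: "aff_dim Q - aff_dim F < int 4"
        using S(2) by (simp add: ivl_rank_ivl[OF bt] ivl_rank_ivl[OF top[OF S(1)]] h)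
      have zero: "fa (ivl (x m) top) \<bullet> z + fb (ivl (x m) top) = 0" if "m < 4" "z \<in> F" for m z
      proof -
        have xm: "x m \<in> Field r" "(x m, S) \<in> r" "(x m, top) \<in> r" using x top that by auto
        have "F \<subseteq> \<psi> (ivl (x m) top)" unfolding F_def
          using sub[OF ivl_in[OF top[OF S(1)]] ivl_in[OF xm(3)]] ivl_subset[OF top[OF S(1)]] xm(2) refl mem(2) by simp
        then show ?thesis using p(2) ivl_in[OF xm(3)] that(2) FQ by blast
      qed
      obtain \<kappa> where k: "\<exists>m<4. \<kappa> m \<noteq> (0::real)"
        "\<forall>z\<in>Q. (\<Sum>m<4. \<kappa> m * (fa (ivl (x m) top) \<bullet> z + fb (ivl (x m) top))) = 0"
        using dependent_functionals[of F Q 4 "\<lambda>m. fa (ivl (x m) top)" "\<lambda>m. fb (ivl (x m) top)", OF F0 FQ zero dF] by blast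
      define \<kappa>' where "\<kappa>' m = \<kappa> m * lam0 (x m)" for m
      have l0: "lam0 (x m) \<noteq> 0" if "m < 4" for m using lam[of "x m"] x that by auto
      have k2: "(\<Sum>m<4. \<kappa> m * \<phi> (x m) (q f)) = 0" if "f \<in> Field r" for f
        using k(2) qQ(1)[OF that] unfolding \<phi>_def by blast
      have s: "(\<Sum>m<4. \<kappa>' m * (s * \<phi> (x m) (q f) / lam0 (x m))) = 0" if "f \<in> Field r" for f s
      proof -
        have "(\<Sum>m<4. \<kappa>' m * (s * \<phi> (x m) (q f) / lam0 (x m))) = (\<Sum>m<4. s * (\<kappa> m * \<phi> (x m) (q f)))"
          by (rule sum.cong) (use l0 in \<open>auto simp: \<kappa>'_def\<close>)
        also have "\<dots> = 0" using k2[OF that] by (simp flip: sum_distrib_left)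
        finally show ?thesis .
      qed
      have "(\<Sum>m<4. \<kappa>' m * 1) = 0" using k2[OF mem(1)] by (simp add: \<kappa>'_def lam0_def)
      then have "\<forall>\<rho>\<in>QA. (\<Sum>m<4. \<kappa>' m * \<rho> (x m)) = 0" unfolding QA_def using s by auto
      moreover have "\<exists>m<4. \<kappa>' m \<noteq> 0" using k(1) l0 by (auto simp: \<kappa>'_def)
      ultimately show "\<exists>\<kappa>. (\<exists>m<4. \<kappa> m \<noteq> 0) \<and> (\<forall>\<rho>\<in>QA. (\<Sum>m<4. \<kappa> m * \<rho> (x m)) = (0::real))" by blast
    next
      fix T x assume T: "T \<in> Field r" and x: "x \<in> V"
      show "0 \<le> \<phi> x (q T) / lam0 x" using pos[of x "q T"] qQ(1)[OF T] x lam[OF x] by simp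
      show "\<phi> x (q T) / lam0 x = 0 \<longleftrightarrow> (x, T) \<in> r" using \<phi>q[of x T] x T lam[OF x] by simp
    next
      fix T assume "T \<in> Field r"
      then have "(\<lambda>x. 1 * \<phi> x (q T) / lam0 x) \<in> QA" unfolding QA_def by blast
      then show "(\<lambda>x. \<phi> x (q T) / lam0 x) \<in> QA" by simp
    qed
    show "\<forall>y\<in>V. N y \<in> QA"
    proof
      fix y assume y: "y \<in> V"
      have "N y = (\<lambda>x. (-1) * \<phi> x (q y) / lam0 x)" by (rule ext) (simp add: N_def)
      then show "N y \<in> QA" unfolding QA_def using y by blast
    qed
    show "(\<lambda>_. 1) \<in> QA" by (simp add: QA_def)
    show "\<forall>x\<in>V. \<forall>y\<in>V. (y, x) \<notin> r \<longrightarrow> N x y < N x x"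
    proof (intro ballI impI)
      fix x y assume xy: "x \<in> V" "y \<in> V" "(y, x) \<notin> r"
      have "\<phi> x (q x) = 0" using \<phi>q[of x x] xy refl by auto
      moreover have "0 < \<phi> y (q x)" using \<phi>q[of y x] pos[of y "q x"] qQ[of x] xy by (simp add: less_le)
      ultimately show "N x y < N x x" using lam[OF xy(2)] by (simp add: N_def)
    qed
    show "\<forall>y\<in>V. \<forall>y'\<in>V. (\<lambda>x. N x y - N x y') \<in> QB"
    proof (intro ballI)
      fix y y' assume y: "y \<in> V" "y' \<in> V"
      define u where "u = (1 / lam0 y') *\<^sub>R fa (ivl y' top) - (1 / lam0 y) *\<^sub>R fa (ivl y top)"
      define b where "b = fb (ivl y' top) / lam0 y' - fb (ivl y top) / lam0 y"
      have ub: "u \<bullet> z + b = \<phi> y' z / lam0 y' - \<phi> y z / lam0 y" for z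
        by (simp add: u_def b_def \<phi>_def inner_simps add_divide_distrib)
      have "u \<bullet> q bot + b = 0" using lam y unfolding ub by (simp add: lam0_def[symmetric] less_imp_neq[symmetric])
      moreover have "(\<lambda>x. N x y - N x y') = (\<lambda>x. u \<bullet> q x + b)"
        by (rule ext) (simp add: ub N_def)
      ultimately show "(\<lambda>x. N x y - N x y') \<in> QB" unfolding QB_def by blast
    qed
    show "slack_rows r V R (\<lambda>T x. ch T (q x)) QB"
      unfolding slack_rows_def
    proof (intro conjI ballI impI allI)
      fix S and x :: "nat \<Rightarrow> 'i" assume S: "S \<in> Field r" "h S \<le> 2" and x: "\<forall>m<4. x m \<in> V \<and> (x m, S) \<in> r"
      define F where "F = \<psi> (ivl bot S)"
      \<comment> \<open>\<open>F\<close> has dimension at most \<open>h S + 1\<close>, hence at most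
        3, so four points need \<open>q bot\<close> as a fifth. Members of \<open>QB\<close> vanish
        there, which removes it from the resulting relation.\<close>
      define w where "w m = (if m = 4 then bot else x m)" for m
      have w: "w m \<in> Field r" "(w m, S) \<in> r" if "m < 5" for m
        using x that bot[OF S(1)] mem(1) by (auto simp: w_def)
      have wF: "q (w m) \<in> F" if "m < 5" for m
      proof -
        have "\<psi> (ivl (w m) (w m)) \<subseteq> F" unfolding F_def
          using sub[OF ivl_in[OF refl[OF w(1)[OF that]]] ivl_in[OF bot[OF S(1)]]] ivl_subset[OF refl[OF w(1)[OF that]]]
            w[OF that] bot by simp
        then show ?thesis using qQ(2)[OF w(1)[OF that]] by blast
      qed
      have "aff_dim F - aff_dim (\<psi> {}) \<le> ivl_rank (ivl bot S) - ivl_rank {}"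
        unfolding F_def using dimb[of "{}" "ivl bot S"] ivl_in[OF bot[OF S(1)]] e by simp
      then have "aff_dim F + 1 < int 5"
        using S(2) by (simp add: empty ivl_rank_ivl[OF bot[OF S(1)]] h ivl_rank_def[of "{}"])
      from affine_dependent_family[of 5 "\<lambda>m. q (w m)" F, OF wF this] obtain \<kappa>
        where k: "\<exists>m<5. \<kappa> m \<noteq> 0" "(\<Sum>m<5. \<kappa> m) = (0::real)" "(\<Sum>m<5. \<kappa> m *\<^sub>R q (w m)) = 0" by blast
      have "(\<Sum>m<Suc 4. \<kappa> m) = 0" using k(2) by simp
      then have k4: "(\<Sum>m<4. \<kappa> m) + \<kappa> 4 = 0" by (simp only: sum.lessThan_Suc)
      have nz: "\<exists>m<4. \<kappa> m \<noteq> 0"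
      proof (rule ccontr)
        assume *: "\<not> (\<exists>m<4. \<kappa> m \<noteq> 0)"
        then have "\<kappa> 4 = 0" using k4 by simp
        then have "\<kappa> m = 0" if "m < 5" for m using * that by (cases "m = 4") auto
        then show False using k(1) by blast
      qed
      have "(\<Sum>m<4. \<kappa> m * (u \<bullet> q (x m) + b)) = 0" if ub: "u \<bullet> q bot + b = 0" for u b
      proof -
        have "(\<Sum>m<Suc 4. \<kappa> m * (u \<bullet> q (w m) + b)) = u \<bullet> (\<Sum>m<5. \<kappa> m *\<^sub>R q (w m)) + b * (\<Sum>m<5. \<kappa> m)"
          by (simp add: inner_sum_right sum_distrib_left distrib_left sum.distrib mult.commute mult.left_commute)
        then have "(\<Sum>m<Suc 4. \<kappa> m * (u \<bullet> q (w m) + b)) = 0" using k by simp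
        then have "(\<Sum>m<4. \<kappa> m * (u \<bullet> q (w m) + b)) = 0"
          by (simp only: sum.lessThan_Suc) (simp add: w_def ub)
        moreover have "(\<Sum>m<4. \<kappa> m * (u \<bullet> q (w m) + b)) = (\<Sum>m<4. \<kappa> m * (u \<bullet> q (x m) + b))"
          by (rule sum.cong) (auto simp: w_def)
        ultimately show ?thesis by simp
      qed
      then have "\<forall>\<rho>\<in>QB. (\<Sum>m<4. \<kappa> m * \<rho> (x m)) = 0" unfolding QB_def by auto
      then show "\<exists>\<kappa>. (\<exists>m<4. \<kappa> m \<noteq> 0) \<and> (\<forall>\<rho>\<in>QB. (\<Sum>m<4. \<kappa> m * \<rho> (x m)) = (0::real))" using nz by blast
    next
      fix T x assume T: "T \<in> Field r" and x: "x \<in> V"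
      have xF: "x \<in> Field r" using x by simp
      show "0 \<le> ch T (q x)" using p(2) ivl_in[OF bot[OF T]] qQ(1)[OF xF] by (auto simp: ch_def)
      show "ch T (q x) = 0 \<longleftrightarrow> (x, T) \<in> r" using chq[OF xF T] .
    next
      fix T assume T: "T \<in> Field r"
      show "(\<lambda>x. ch T (q x)) \<in> QB" unfolding QB_def
        using chq[OF mem(1) T] bot[OF T] by (intro CollectI exI[of _ "fa (ivl bot T)"] exI[of _ "fb (ivl bot T)"]) (auto simp: ch_def)
    qed
  qed
qed

end

section \<open>Transferring polytopes to a Euclidean space\<close>

lemma face_of_preimage:
  fixes \<pi> :: "'a::real_vector \<Rightarrow> 'b::real_vector"
  assumes \<pi>: "linear \<pi>" and Q: "convex Q" and H: "H face_of \<pi> ` Q"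
  shows "Q \<inter> \<pi> -` H face_of Q"
  unfolding face_of_def
proof (intro conjI ballI impI)
  interpret linear \<pi> by fact
  have cv: "convex H" using H by (rule face_of_imp_convex)
  show "convex (Q \<inter> \<pi> -` H)" using convex_Int[OF Q convex_linear_vimage[OF \<pi> cv]] .
  have ends: "a \<in> \<pi> -` H \<and> b \<in> \<pi> -` H" if ab: "a \<in> Q" "b \<in> Q" and x: "x \<in> Q \<inter> \<pi> -` H" "x \<in> open_segment a b" for a b x
  proof -
    obtain u where u: "0 < u" "u < 1" "x = (1 - u) *\<^sub>R a + u *\<^sub>R b" using x(2) by (auto simp: in_segment)
    then have px: "\<pi> x = (1 - u) *\<^sub>R \<pi> a + u *\<^sub>R \<pi> b" by (simp add: add scale)
    show ?thesis
    proof (cases "\<pi> a = \<pi> b")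
      case True
      then have "\<pi> x = \<pi> b" using px by (simp add: scaleR_left_diff_distrib)
      then show ?thesis using True x(1) by auto
    next
      case False
      then have "\<pi> x \<in> open_segment (\<pi> a) (\<pi> b)" using u px by (auto simp: in_segment)
      then show ?thesis using face_ofD[OF H, of "\<pi> x" "\<pi> a" "\<pi> b"] ab x(1) by simp
    qed
  qed
  show "a \<in> Q \<inter> \<pi> -` H" "b \<in> Q \<inter> \<pi> -` H" if "a \<in> Q" "b \<in> Q" "x \<in> Q \<inter> \<pi> -` H" "x \<in> open_segment a b" for a b x
    using ends[OF that] that by auto
qed auto

lemma poset_iso_face_lattice_linear_image_inj_on:
  fixes \<pi> :: "'a::real_vector \<Rightarrow> 'b::real_vector"
  assumes \<pi>: "linear \<pi>" "inj_on \<pi> (span Q)" and Q: "convex Q"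
  shows "poset_iso ((`) \<pi>) (face_lattice Q) (face_lattice (\<pi> ` Q))"
proof -
  interpret linear \<pi> by fact
  have inj: "inj_on \<pi> Q" using \<pi>(2) span_superset by (rule inj_on_subset)
  have sub: "\<pi> ` F \<subseteq> \<pi> ` G \<longleftrightarrow> F \<subseteq> G" if "F \<subseteq> Q" "G \<subseteq> Q" for F G
    by (rule inj_on_image_subset_iff[OF inj that])
  have img: "\<pi> ` F face_of \<pi> ` Q" if F: "F face_of Q" for F
  proof -
    have FQ: "F \<subseteq> Q" using F by (rule face_of_imp_subset)
    have "a \<in> F \<and> b \<in> F" if ab: "a \<in> Q" "b \<in> Q" and x: "x \<in> F" "\<pi> x \<in> open_segment (\<pi> a) (\<pi> b)" for a b x
    proof -
      obtain u where u: "\<pi> a \<noteq> \<pi> b" "0 < u" "u < 1" "\<pi> x = (1 - u) *\<^sub>R \<pi> a + u *\<^sub>R \<pi> b"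
        using x(2) by (auto simp: in_segment)
      have "\<pi> x = \<pi> ((1 - u) *\<^sub>R a + u *\<^sub>R b)" using u(4) by (simp add: add scale)
      moreover have "(1 - u) *\<^sub>R a + u *\<^sub>R b \<in> Q"
        using Q ab u(2,3) unfolding convex_alt by simp
      moreover have "x \<in> Q" using x(1) FQ by blast
      ultimately have "x = (1 - u) *\<^sub>R a + u *\<^sub>R b" using inj_onD[OF inj] by simp
      moreover have "a \<noteq> b" using u(1) by auto
      ultimately have "x \<in> open_segment a b" using u(2,3) by (auto simp: in_segment)
      then show ?thesis using face_ofD[OF F _ ab x(1)] by simp
    qed
    moreover have "convex (\<pi> ` F)" using convex_linear_image[OF \<pi>(1) face_of_imp_convex[OF F]] .
    moreover have "\<pi> ` F \<subseteq> \<pi> ` Q" using FQ by (rule image_mono)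
    ultimately show ?thesis unfolding face_of_def ball_simps by blast
  qed
  show ?thesis
    unfolding poset_iso_def Field_face_lattice bij_betw_def
  proof (intro conjI ballI)
    show "inj_on ((`) \<pi>) {F. F face_of Q}"
    proof (rule inj_onI)
      fix F G assume "F \<in> {F. F face_of Q}" "G \<in> {F. F face_of Q}" "\<pi> ` F = \<pi> ` G"
      then have "\<pi> ` F \<subseteq> \<pi> ` G" "\<pi> ` G \<subseteq> \<pi> ` F" "F \<subseteq> Q" "G \<subseteq> Q" using face_of_imp_subset by auto
      then show "F = G" using sub[of F G] sub[of G F] by simp
    qed
    show "(`) \<pi> ` {F. F face_of Q} = {F. F face_of \<pi> ` Q}"
    proof (intro equalityI subsetI)
      fix G assume "G \<in> {F. F face_of \<pi> ` Q}"
      then have G: "G face_of \<pi> ` Q" by simp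
      have "G = \<pi> ` (Q \<inter> \<pi> -` G)" using face_of_imp_subset[OF G] by blast
      then show "G \<in> (`) \<pi> ` {F. F face_of Q}" using face_of_preimage[OF \<pi>(1) Q G] by blast
    qed (use img in auto)
    show "(F, G) \<in> face_lattice Q \<longleftrightarrow> (\<pi> ` F, \<pi> ` G) \<in> face_lattice (\<pi> ` Q)"
      if "F \<in> {F. F face_of Q}" "G \<in> {F. F face_of Q}" for F G
      using that sub[of F G] img[of F] img[of G] face_of_imp_subset[of F Q] face_of_imp_subset[of G Q] by (simp add: face_lattice_iff)
  qed
qed

lemma polytope_linear_image:
  fixes \<pi> :: "'a::real_vector \<Rightarrow> 'b::real_vector"
  assumes "linear \<pi>" "polytope Q" shows "polytope (\<pi> ` Q)"
proof -
  obtain S where "finite S" "Q = convex hull S" using assms(2) by (auto simp: polytope_def)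
  then show ?thesis unfolding polytope_def using convex_hull_linear_image[OF assms(1), of S] by (intro exI[of _ "\<pi> ` S"]) simp
qed

lemma polytope_span_finite_basis:
  fixes Q :: "'a::real_vector set"
  assumes "polytope Q"
  obtains B where "finite B" "independent B" "span B = span Q"
proof -
  obtain S where S: "finite S" "Q = convex hull S" using assms by (auto simp: polytope_def)
  obtain B where B: "B \<subseteq> S" "independent B" "S \<subseteq> span B" by (rule maximal_independent_subset[of S])
  have "Q \<subseteq> span B" unfolding S(2) by (rule hull_minimal[OF B(3)]) (rule subspace_imp_convex[OF subspace_span])
  moreover have "B \<subseteq> Q" unfolding S(2) by (rule subset_trans[OF B(1) hull_subset])
  ultimately have "span B = span Q" using span_mono[of B Q] span_mono[of Q "span B"] unfolding span_span by auto
  then show ?thesis using that B finite_subset[OF B(1) S(1)] by blast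
qed

text \<open>The dimension arguments above live in Euclidean spaces, whereas \<open>Q\<close> may lie
  in any real vector space. If the span of \<open>Q\<close> fits into \<open>'e\<close>, it is
  embedded. Otherwise a linear map sends the span onto \<open>'e\<close>, and the preimages of a
  maximal chain of faces of the image form a chain too long for the range of
  \<open>\<rho>\<close>.\<close>

lemma polytope_into_euclidean_space:
  fixes Q :: "'b::real_vector set" and \<rho> :: "'j \<Rightarrow> int"
  assumes Q: "polytope Q" and iso: "poset_iso \<psi> s (face_lattice Q)"
    and mono: "\<And>x y. (x, y) \<in> s \<Longrightarrow> x \<noteq> y \<Longrightarrow> \<rho> x < \<rho> y"
    and bnd: "\<And>x. x \<in> Field s \<Longrightarrow> lo \<le> \<rho> x \<and> \<rho> x \<le> hi" and dim: "hi - lo < int DIM('e)"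
  shows "\<exists>(Q' :: 'e::euclidean_space set) \<psi>'. polytope Q' \<and> poset_iso \<psi>' s (face_lattice Q')"
proof -
  obtain B where B: "finite B" "independent B" "span B = span Q" by (rule polytope_span_finite_basis[OF Q])
  show ?thesis
  proof (cases "card B \<le> DIM('e)")
    case True
    then obtain f :: "'b \<Rightarrow> 'e" where f: "f ` B \<subseteq> Basis" "inj_on f B"
      using card_le_inj[OF B(1), of "Basis :: 'e set"] by auto
    obtain \<pi> where \<pi>: "linear \<pi>" "\<forall>x\<in>B. \<pi> x = f x" using linear_independent_extend[OF B(2)] by blast
    have "independent (\<pi> ` B)" "inj_on \<pi> B"
      using independent_mono[OF independent_Basis f(1)] \<pi>(2) f(2) by (auto simp: inj_on_def)
    then have "inj_on \<pi> (span Q)"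
      using linear_inj_on_span_independent_image[OF \<pi>(1), of B] B(3) by simp
    from poset_iso_trans[OF iso poset_iso_face_lattice_linear_image_inj_on[OF \<pi>(1) this polytope_imp_convex[OF Q]]]
    show ?thesis using polytope_linear_image[OF \<pi>(1) Q] by blast
  next
    case False
    then obtain g :: "'e \<Rightarrow> 'b" where g: "g ` Basis \<subseteq> B" "inj_on g Basis"
      using card_le_inj[of "Basis :: 'e set" B] B(1) by auto
    obtain \<pi> :: "'b \<Rightarrow> 'e" where \<pi>: "linear \<pi>" "\<forall>x\<in>B. \<pi> x = inv_into Basis g x"
      using linear_independent_extend[OF B(2)] by blast
    have "Basis \<subseteq> \<pi> ` B"
    proof
      fix b :: 'e assume b: "b \<in> Basis"
      then have "\<pi> (g b) = b" using \<pi>(2) g by (auto simp: inv_into_f_f)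
      moreover have "g b \<in> B" using b g(1) by blast
      ultimately show "b \<in> \<pi> ` B" by force
    qed
    then have "UNIV \<subseteq> span (\<pi> ` B)" using span_mono[of "Basis" "\<pi> ` B"] by simp
    also have "span (\<pi> ` B) = span (\<pi> ` Q)" using \<pi>(1) B(3) by (simp add: linear_span_image)
    finally have sp: "span (\<pi> ` Q) = UNIV" by blast
    have pP: "polytope (\<pi> ` Q)" by (rule polytope_linear_image[OF \<pi>(1) Q])
    \<comment> \<open>The linear span is the whole space, but the affine hull may miss the origin,
      which costs one dimension.\<close>
    have ad: "int DIM('e) \<le> aff_dim (\<pi> ` Q) + 1"
    proof -
      have "affine hull (insert 0 (\<pi> ` Q)) = UNIV"
        using affine_hull_insert_span_gen[of 0 "\<pi> ` Q"] sp by simp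
      then have "aff_dim (insert 0 (\<pi> ` Q)) = int DIM('e)"
        using aff_dim_affine_hull[of "insert 0 (\<pi> ` Q)"] by simp
      moreover have "aff_dim (insert 0 (\<pi> ` Q)) \<le> aff_dim (\<pi> ` Q) + 1" by (simp add: aff_dim_insert)
      ultimately show ?thesis by simp
    qed
    define k where "k = nat (aff_dim (\<pi> ` Q) + 1)"
    have k: "aff_dim (\<pi> ` Q) = aff_dim ({} :: 'e set) + int k"
      using aff_dim_geq[of "\<pi> ` Q"] by (simp add: k_def)
    obtain H where H: "\<forall>m\<le>k. H m face_of \<pi> ` Q" "\<forall>m<k. H m \<subset> H (Suc m)"
      using face_chain[OF pP empty_face_of face_of_refl[OF polytope_imp_convex[OF pP]] _ k] by blast
    note iso' = poset_isoD[OF iso]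
    have "\<forall>m\<in>{..k}. \<exists>z. z \<in> Field s \<and> \<psi> z = Q \<inter> \<pi> -` H m"
      
    proof
      fix m assume "m \<in> {..k}"
      then have "Q \<inter> \<pi> -` H m face_of Q"
        using face_of_preimage[OF \<pi>(1) polytope_imp_convex[OF Q]] H(1) by simp
      then show "\<exists>z. z \<in> Field s \<and> \<psi> z = Q \<inter> \<pi> -` H m" using iso'(3) by blast
    qed
    from bchoice[OF this] obtain K where "\<forall>m\<in>{..k}. K m \<in> Field s \<and> \<psi> (K m) = Q \<inter> \<pi> -` H m" by blast
    then have K: "\<And>m. m \<le> k \<Longrightarrow> K m \<in> Field s" "\<And>m. m \<le> k \<Longrightarrow> \<psi> (K m) = Q \<inter> \<pi> -` H m" by auto
    have "\<rho> (K m) < \<rho> (K (Suc m))" if m: "m < k" for m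
    proof -
      obtain y where y: "y \<in> H (Suc m)" "y \<notin> H m" using H(2) m by blast
      moreover have "H (Suc m) \<subseteq> \<pi> ` Q" using H(1)[rule_format, of "Suc m"] m face_of_imp_subset by auto
      ultimately obtain x where x: "x \<in> Q" "y = \<pi> x" by blast
      have "\<psi> (K m) \<subset> \<psi> (K (Suc m))" using H(2) m K(2)[of m] K(2)[of "Suc m"] x y by auto
      then have "(K m, K (Suc m)) \<in> s" "K m \<noteq> K (Suc m)"
        using iso'(2)[OF K(1) K(1), of m "Suc m"] m by auto
      then show ?thesis by (rule mono)
    qed
    from strict_mono_steps[of k "\<lambda>m. \<rho> (K m)" k, OF this] have "\<rho> (K 0) + int k \<le> \<rho> (K k)" by simp
    moreover have "lo \<le> \<rho> (K 0)" "\<rho> (K k) \<le> hi" using bnd K(1)[of 0] K(1)[of k] by auto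
    ultimately have "lo + int k \<le> hi" by linarith
    moreover have "int DIM('e) \<le> int k" using ad k by simp
    ultimately show ?thesis using dim by linarith
  qed
qed

context ranked_poset
begin

lemma ivl_rank_bounds: assumes "I \<in> intervals r" shows "-1 \<le> ivl_rank I \<and> ivl_rank I \<le> int d + 1"
proof (cases "I = {}")
  case False
  then obtain x y where xy: "(x, y) \<in> r" "I = ivl x y" using assms by (auto simp: intervals_ivl)
  have "x \<in> Field r" "y \<in> Field r" using FieldI[OF xy(1)] by auto
  then have "-1 \<le> h x" "h y \<le> int d" using h_mono[OF bot[of x]] h_mono[OF top[of y]] h(2,3) by simp_all
  then show ?thesis using h_mono[OF xy(1)] unfolding xy(2) ivl_rank_ivl[OF xy(1)] by simp
qed (simp add: ivl_rank_def)

lemma antiprism_slack_pair: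
  assumes "antiprism_of r (Q :: 'b::real_vector set)" and dim: "int d + 2 < int DIM('e::euclidean_space)"
  shows "slack_pair r V R"
proof -
  obtain \<psi> where Q: "polytope Q" and iso: "poset_iso \<psi> ((interval_poset r)\<inverse>) (face_lattice Q)"
    using assms by (auto simp: antiprism_of_def)
  have "\<exists>(Q' :: 'e set) \<psi>'. polytope Q' \<and> poset_iso \<psi>' ((interval_poset r)\<inverse>) (face_lattice Q')"
  proof (rule polytope_into_euclidean_space[OF Q iso, where \<rho> = "\<lambda>I. - ivl_rank I" and lo = "- int d - 1" and hi = 1])
    show "- ivl_rank I < - ivl_rank J" if "(I, J) \<in> (interval_poset r)\<inverse>" "I \<noteq> J" for I J
      using ivl_rank_mono[of J I] that by auto
    show "- int d - 1 \<le> - ivl_rank I \<and> - ivl_rank I \<le> 1" if "I \<in> Field ((interval_poset r)\<inverse>)" for I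
      using ivl_rank_bounds[of I] that by (simp only: Field_interval_poset) auto
  qed (use dim in simp)
  then show ?thesis by (elim exE conjE) (rule antiprism_slack_pair_euclidean)
qed

lemma interval_slack_pair:
  assumes "interval_polytope_of r (Q :: 'b::real_vector set)" and dim: "int d + 2 < int DIM('e::euclidean_space)"
  shows "slack_pair r V R"
proof -
  obtain \<psi> where Q: "polytope Q" and iso: "poset_iso \<psi> (interval_poset r) (face_lattice Q)"
    using assms by (auto simp: interval_polytope_of_def)
  have "\<exists>(Q' :: 'e set) \<psi>'. polytope Q' \<and> poset_iso \<psi>' (interval_poset r) (face_lattice Q')"
  proof (rule polytope_into_euclidean_space[OF Q iso, where \<rho> = ivl_rank and lo = "-1" and hi = "int d + 1"])
    show "-1 \<le> ivl_rank I \<and> ivl_rank I \<le> int d + 1" if "I \<in> Field (interval_poset r)" for I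
      using ivl_rank_bounds[of I] that by (simp only: Field_interval_poset)
  qed (use dim ivl_rank_mono in auto)
  then show ?thesis by (elim exE conjE) (rule interval_slack_pair_euclidean)
qed

end

section \<open>Realizing the tower\<close>

lemma affine_sum:
  assumes "affine A" "finite I" "\<And>i. i \<in> I \<Longrightarrow> f i \<in> A" "sum u I = 1"
  shows "(\<Sum>i\<in>I. u i *\<^sub>R f i) \<in> A"
proof -
  have "I \<noteq> {}" using assms(4) by auto
  then obtain a where a: "a \<in> A" using assms(3) by blast
  have "(\<Sum>i\<in>I. u i *\<^sub>R (f i - a)) \<in> (\<lambda>x. x - a) ` A"
    using assms(3) by (intro subspace_sum subspace_scale affine_diffs_subspace_subtract[OF assms(1) a]) auto
  moreover have "(\<Sum>i\<in>I. u i *\<^sub>R (f i - a)) = (\<Sum>i\<in>I. u i *\<^sub>R f i) - a"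
    by (simp add: scaleR_diff_right sum_subtractf assms(4) flip: scaleR_left.sum)
  ultimately show ?thesis by auto
qed

text \<open>A linear combination of vectors \<open>b\<close> with coefficients \<open>c b\<close>
  equal to \<open>v\<close> turns into an affine combination of the scaled points, with weights
  \<open>c b * (lam \<bullet> b) / (lam \<bullet> v)\<close>.\<close>

lemma aff_dim_projected:
  fixes lin :: "'h::euclidean_space \<Rightarrow> 'a::euclidean_space"
  assumes lin: "linear lin" and pos: "\<And>v. v \<in> Z \<Longrightarrow> 0 < lam \<bullet> v"
  shows "aff_dim ((\<lambda>v. (1 / (lam \<bullet> v)) *\<^sub>R lin v) ` Z) + 1 \<le> int (dim Z)"
proof -
  define pt where "pt v = (1 / (lam \<bullet> v)) *\<^sub>R lin v" for v
  obtain B where B: "B \<subseteq> Z" "independent B" "Z \<subseteq> span B" "card B = dim Z" by (rule basis_exists)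
  have fin: "finite B" by (rule independent_imp_finite[OF B(2)])
  have "pt v \<in> affine hull (pt ` B)" if v: "v \<in> Z" for v
  proof -
    obtain c where c: "v = (\<Sum>b\<in>B. c b *\<^sub>R b)" using B(3) v unfolding span_finite[OF fin] by auto
    have lb: "lam \<bullet> b \<noteq> 0" if "b \<in> B" for b using pos[of b] B(1) that by auto
    have "(\<Sum>b\<in>B. (c b * (lam \<bullet> b) / (lam \<bullet> v)) *\<^sub>R pt b) \<in> affine hull (pt ` B)"
    proof (rule affine_sum[OF affine_affine_hull fin])
      show "pt b \<in> affine hull (pt ` B)" if "b \<in> B" for b using that by (simp add: hull_inc)
      have "(\<Sum>b\<in>B. c b * (lam \<bullet> b)) = lam \<bullet> v" by (simp add: c inner_sum_right)
      then show "(\<Sum>b\<in>B. c b * (lam \<bullet> b) / (lam \<bullet> v)) = 1"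
        using pos[OF v] by (simp flip: sum_divide_distrib)
    qed
    also have "(\<Sum>b\<in>B. (c b * (lam \<bullet> b) / (lam \<bullet> v)) *\<^sub>R pt b) = (\<Sum>b\<in>B. (1 / (lam \<bullet> v)) *\<^sub>R (c b *\<^sub>R lin b))"
      by (rule sum.cong) (use lb in \<open>auto simp: pt_def\<close>)
    also have "\<dots> = (1 / (lam \<bullet> v)) *\<^sub>R lin (\<Sum>b\<in>B. c b *\<^sub>R b)"
      by (simp add: linear_sum[OF lin] linear_cmul[OF lin] scaleR_sum_right)
    also have "\<dots> = pt v" by (simp add: pt_def flip: c)
    finally show ?thesis .
  qed
  then have "pt ` Z \<subseteq> affine hull (pt ` B)" by blast
  then have "aff_dim (pt ` Z) \<le> aff_dim (pt ` B)" using aff_dim_subset[of "pt ` Z" "affine hull (pt ` B)"] by simp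
  also have "\<dots> \<le> int (card (pt ` B)) - 1" using aff_dim_le_card[of "pt ` B"] fin by simp
  also have "\<dots> \<le> int (dim Z) - 1" using card_image_le[OF fin, of pt] B(4) by simp
  finally show ?thesis unfolding pt_def by simp
qed

text \<open>The points \<open>v\<close> are scaled into an affine hyperplane and coned off by unit vectors in the unused
  coordinate directions.\<close>

lemma homogeneous_polytope:
  fixes H :: "vec5 set" and L :: real
  defines "scaling \<equiv> ((1, 1, 1), L, 0)"
  assumes H0: "finite H" "\<forall>v\<in>H. 0 < scaling \<bullet> v" and sp: "\<forall>w. (\<forall>v\<in>H. w \<bullet> v = 0) \<longrightarrow> w = 0"
    and card: "4 \<le> CARD('n::finite)"
  shows "\<exists>(P :: (real ^ 'n) set) pt. polytope P \<and> aff_dim P = int CARD('n) \<and> (\<forall>v\<in>H. pt v \<in> P) \<and>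
    (\<forall>w. (\<forall>v\<in>H. 0 \<le> w \<bullet> v) \<longrightarrow> (\<exists>F. F face_of P \<and> (\<forall>v\<in>H. pt v \<in> F \<longleftrightarrow> w \<bullet> v = 0) \<and>
        aff_dim F + 1 \<le> int (dim {v\<in>H. w \<bullet> v = 0})))"
proof -
  have H: "finite H" "\<And>v. v \<in> H \<Longrightarrow> 0 < scaling \<bullet> v" using H0 by auto
  obtain I :: "'n set" where I: "card I = 4" using obtain_subset_with_card_n[OF card] by blast
  then have "finite I" by simp
  then obtain e where "bij_betw e {0..<4::nat} I" using ex_bij_betw_nat_finite[of I] I by auto
  then have e: "inj_on e {0..<4::nat}" by (simp add: bij_betw_def)
  have ed: "e 0 \<noteq> e 1" "e 0 \<noteq> e 2" "e 0 \<noteq> e 3" "e 1 \<noteq> e 2" "e 1 \<noteq> e 3" "e 2 \<noteq> e 3"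
    by (simp_all add: inj_on_eq_iff[OF e])
  \<comment> \<open>The third coordinate is dropped: where \<open>scaling\<close> is 1 it is
    determined by the others, because its coefficient there is 1.\<close>
  define lin :: "vec5 \<Rightarrow> real ^ 'n" where "lin v = fst (fst v) *\<^sub>R axis (e 0) 1 + fst (snd (fst v)) *\<^sub>R axis (e 1) 1 +
    fst (snd v) *\<^sub>R axis (e 2) 1 + snd (snd v) *\<^sub>R axis (e 3) 1" for v
  have lin: "linear lin" by (rule linearI) (simp_all add: lin_def algebra_simps)
  define pt where "pt v = (1 / (scaling \<bullet> v)) *\<^sub>R lin v" for v
  define J where "J = - {e 0, e 1, e 2, e 3}"
  define ap where "ap = (\<lambda>m. axis m (1::real)) ` J"
  define P where "P = convex hull (pt ` H \<union> ap)"
  have fin: "finite (pt ` H \<union> ap)" using H(1) by (simp add: ap_def)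
  have P: "polytope P" unfolding P_def polytope_def using fin by blast
  \<comment> \<open>The affine functional that takes the value
    \<open>(w \<bullet> v) / (scaling \<bullet> v)\<close> at \<open>pt v\<close>. The entries
    \<open>1 - b\<close> give it the value 1 at each apex, so the faces below contain no apex and
    their dimension is controlled by \<open>H\<close> alone.\<close>
  define a :: "vec5 \<Rightarrow> real ^ 'n" where "a w = (\<chi> m. let b = snd (snd (fst w)) in
     if m = e 0 then fst (fst w) - b else if m = e 1 then fst (snd (fst w)) - b
     else if m = e 2 then fst (snd w) - b * L else if m = e 3 then snd (snd w) else 1 - b)" for w
  define b :: "vec5 \<Rightarrow> real" where "b w = snd (snd (fst w))" for w
  have alin: "a w \<bullet> lin v = w \<bullet> v - b w * (scaling \<bullet> v)" for w v
    using ed by (cases w; cases v; cases "fst w"; cases "fst v") (auto simp: a_def b_def lin_def scaling_def Let_def inner_add_right inner_axis algebra_simps)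
  have apt: "a w \<bullet> pt v + b w = (w \<bullet> v) / (scaling \<bullet> v)" if "v \<in> H" for w v
    using H(2)[OF that] by (simp add: pt_def alin diff_divide_distrib)
  have aap: "a w \<bullet> y + b w = 1" if "y \<in> ap" for w y
    using that by (auto simp: ap_def J_def a_def b_def inner_axis Let_def split: if_splits)
  have "aff_dim P = int CARD('n)"
  proof (rule ccontr)
    assume "aff_dim P \<noteq> int CARD('n)"
    then have "aff_dim P < int DIM(real ^ 'n)" using aff_dim_le_DIM[of P] by simp
    then obtain u \<beta> where u: "u \<noteq> 0" "P \<subseteq> {x. u \<bullet> x = \<beta>}" by (rule aff_lowdim_subset_hyperplane)
    have pP: "u \<bullet> pt v = \<beta>" if "v \<in> H" for v using u(2) that hull_subset[of "pt ` H \<union> ap" convex] by (auto simp: P_def)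
    have aP: "u $ m = \<beta>" if "m \<in> J" for m
    proof -
      have "axis m 1 \<in> P" unfolding P_def ap_def using that by (intro hull_inc) auto
      then have "u \<bullet> axis m 1 = \<beta>" using u(2) by blast
      then show ?thesis by (simp add: inner_axis)
    qed
    \<comment> \<open>The functional \<open>u - \<beta>\<close> pulled back to \<open>vec5\<close>.
      It vanishes on \<open>H\<close>, hence everywhere, and then \<open>u\<close> vanishes
      too.\<close>
    define w :: vec5 where "w = ((u $ e 0 - \<beta>, u $ e 1 - \<beta>, - \<beta>), u $ e 2 - \<beta> * L, u $ e 3)"
    have "w \<bullet> v = 0" if "v \<in> H" for v
    proof -
      have "u \<bullet> lin v = \<beta> * (scaling \<bullet> v)" using pP[OF that] H(2)[OF that] by (simp add: pt_def field_simps)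
      moreover have "w \<bullet> v = u \<bullet> lin v - \<beta> * (scaling \<bullet> v)"
        by (cases v; cases "fst v") (simp add: w_def lin_def scaling_def inner_add_right inner_axis algebra_simps)
      ultimately show ?thesis by simp
    qed
    then have "w = 0" using sp by blast
    then have "\<beta> = 0" "u $ e 0 = 0" "u $ e 1 = 0" "u $ e 2 = 0" "u $ e 3 = 0" by (auto simp: w_def zero_prod_def)
    then have "u $ m = 0" for m using aP[of m] by (cases "m \<in> J") (auto simp: J_def)
    then show False using u(1) by (simp add: vec_eq_iff)
  qed
  moreover have "\<exists>F. F face_of P \<and> (\<forall>v\<in>H. pt v \<in> F \<longleftrightarrow> w \<bullet> v = 0) \<and> aff_dim F + 1 \<le> int (dim {v\<in>H. w \<bullet> v = 0})"
    if w: "\<forall>v\<in>H. 0 \<le> w \<bullet> v" for w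
  proof (intro exI conjI)
    define F where "F = P \<inter> {y. a w \<bullet> y = - b w}"
    have "P \<subseteq> {y. a w \<bullet> y \<ge> - b w}"
      unfolding P_def
    proof (rule hull_minimal)
      show "pt ` H \<union> ap \<subseteq> {y. a w \<bullet> y \<ge> - b w}"
      proof
        fix y assume "y \<in> pt ` H \<union> ap"
        then have "0 \<le> a w \<bullet> y + b w"
        proof
          assume "y \<in> pt ` H"
          then obtain v where v: "v \<in> H" "y = pt v" by blast
          have "0 \<le> (w \<bullet> v) / (scaling \<bullet> v)" using w v(1) H(2)[OF v(1)] by simp
          then show ?thesis using apt[OF v(1)] v(2) by simp
        qed (use aap in simp)
        then show "y \<in> {y. a w \<bullet> y \<ge> - b w}" by simp
      qed
    qed (rule convex_halfspace_ge)
    then show F: "F face_of P" unfolding F_def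
      by (intro face_of_Int_supporting_hyperplane_ge) (auto simp: P_def convex_convex_hull)
    show mem: "\<forall>v\<in>H. pt v \<in> F \<longleftrightarrow> w \<bullet> v = 0"
    proof
      fix v assume v: "v \<in> H"
      have "pt v \<in> P" unfolding P_def using v by (simp add: hull_inc)
      then have "pt v \<in> F \<longleftrightarrow> a w \<bullet> pt v + b w = 0" by (auto simp: F_def)
      then show "pt v \<in> F \<longleftrightarrow> w \<bullet> v = 0" using apt[OF v] H(2)[OF v] by simp
    qed
    obtain S' where S': "S' \<subseteq> pt ` H \<union> ap" "F = convex hull S'"
      using face_of_convex_hull_subset[OF finite_imp_compact[OF fin] F[unfolded P_def]] by blast
    have "S' \<subseteq> pt ` {v\<in>H. w \<bullet> v = 0}"
    proof
      fix y assume y: "y \<in> S'"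
      then have yF: "y \<in> F" unfolding S'(2) by (rule hull_inc)
      then have "a w \<bullet> y + b w = 0" by (simp add: F_def)
      then have "y \<notin> ap" using aap[of y w] by auto
      then show "y \<in> pt ` {v\<in>H. w \<bullet> v = 0}" using y S'(1) yF mem by auto
    qed
    then have "aff_dim F \<le> aff_dim (pt ` {v\<in>H. w \<bullet> v = 0})" unfolding S'(2) aff_dim_convex_hull by (rule aff_dim_subset)
    moreover have "aff_dim (pt ` {v\<in>H. w \<bullet> v = 0}) + 1 \<le> int (dim {v\<in>H. w \<bullet> v = 0})"
      unfolding pt_def by (rule aff_dim_projected[OF lin]) (use H(2) in auto)
    ultimately show "aff_dim F + 1 \<le> int (dim {v\<in>H. w \<bullet> v = 0})" by linarith
  qed
  moreover have "\<forall>v\<in>H. pt v \<in> P" unfolding P_def by (simp add: hull_inc)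
  ultimately show ?thesis using P by blast
qed

text \<open>Coding faces by natural numbers yields a poset on \<open>nat\<close>, with
  \<open>e\<close> and \<open>\<phi>\<close> translating between faces and codes.\<close>

lemma ranked_poset_of_polytope:
  fixes P :: "'a::euclidean_space set"
  assumes P: "polytope P" "aff_dim P = int d" and d: "2 < d"
  shows "\<exists>(r :: nat rel) \<phi> e bot top. realization r P \<phi> \<and> ranked_poset r (\<lambda>x. aff_dim (\<phi> x)) bot top d \<and>
     (\<forall>F. F face_of P \<longrightarrow> e F \<in> Field r \<and> \<phi> (e F) = F \<and> (F \<noteq> {} \<longrightarrow> e F \<noteq> bot)) \<and>
     (\<forall>F G. F face_of P \<longrightarrow> G face_of P \<longrightarrow> (e F, e G) \<in> r \<longleftrightarrow> F \<subseteq> G)"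
proof -
  obtain e :: "'a set \<Rightarrow> nat" where e: "inj_on e {F. F face_of P}"
    using finite_imp_inj_to_nat_seg[OF finite_polytope_faces[OF P(1)]] by blast
  define r where "r = {(e F, e G) | F G. F face_of P \<and> G face_of P \<and> F \<subseteq> G}"
  define \<phi> where "\<phi> = inv_into {F. F face_of P} e"
  have \<phi>: "\<phi> (e F) = F" if "F face_of P" for F unfolding \<phi>_def using e that by (simp add: inv_into_f_f)
  have r: "(e F, e G) \<in> r \<longleftrightarrow> F \<subseteq> G" if "F face_of P" "G face_of P" for F G
    unfolding r_def using that e by (auto dest: inj_onD)
  have fld: "Field r = e ` {F. F face_of P}"
  proof
    show "Field r \<subseteq> e ` {F. F face_of P}" by (auto simp: Field_def r_def)
    show "e ` {F. F face_of P} \<subseteq> Field r"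
    proof
      fix x assume "x \<in> e ` {F. F face_of P}"
      then have "(x, x) \<in> r" using r by auto
      then show "x \<in> Field r" by (rule FieldI1)
    qed
  qed
  have f: "\<phi> x face_of P" "e (\<phi> x) = x" if "x \<in> Field r" for x using that \<phi> unfolding fld by auto
  have Pf: "P face_of P" using P(1) by (simp add: face_of_refl polytope_imp_convex)
  have le: "(x, y) \<in> r \<longleftrightarrow> \<phi> x \<subseteq> \<phi> y" if "x \<in> Field r" "y \<in> Field r" for x y
    using r[of "\<phi> x" "\<phi> y"] f that by simp
  have re: "realization r P \<phi>"
    unfolding realization_def poset_iso_def Field_face_lattice
  proof (intro conjI ballI)
    show "bij_betw \<phi> (Field r) {F. F face_of P}"
      unfolding fld \<phi>_def using e by (intro bij_betw_inv_into) (simp add: bij_betw_def)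
    show "(x, y) \<in> r \<longleftrightarrow> (\<phi> x, \<phi> y) \<in> face_lattice P" if "x \<in> Field r" "y \<in> Field r" for x y
      using le[OF that] f(1) that by (simp add: face_lattice_iff)
  qed (rule P(1))
  have "ranked_poset r (\<lambda>x. aff_dim (\<phi> x)) (e {}) (e P) d"
  proof
    show "Partial_order r" by (rule realization_Partial_order[OF re])
    show "(e {}, x) \<in> r" "(x, e P) \<in> r" if "x \<in> Field r" for x
      using that r[of "{}"] r[of _ P] Pf face_of_imp_subset[of _ P] unfolding fld by auto
    show "e {} \<in> Field r" "e P \<in> Field r" using Pf by (auto simp: fld)
    show "aff_dim (\<phi> (e {})) = -1" "aff_dim (\<phi> (e P)) = int d" using \<phi> Pf P(2) by auto
    show "aff_dim (\<phi> x) < aff_dim (\<phi> y)" if "(x, y) \<in> r" "x \<noteq> y" for x y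
    proof -
      have xy: "x \<in> Field r" "y \<in> Field r" using that by (auto simp: Field_def)
      have "\<phi> x \<subseteq> \<phi> y" "\<phi> x \<noteq> \<phi> y" using le[OF xy] that f(2)[OF xy(1)] f(2)[OF xy(2)] by auto
      moreover have "\<phi> x face_of \<phi> y"
        using face_of_subset[OF f(1)[OF xy(1)] \<open>\<phi> x \<subseteq> \<phi> y\<close> face_of_imp_subset[OF f(1)[OF xy(2)]]] .
      ultimately show ?thesis using face_of_aff_dim_lt[OF face_of_imp_convex[OF f(1)[OF xy(2)]]] by blast
    qed
  qed (rule d)
  moreover have "e F \<noteq> e {}" if "F face_of P" "F \<noteq> {}" for F using e that by (auto dest: inj_onD)
  ultimately show ?thesis using re r \<phi> fld by (intro exI[of _ r] exI[of _ \<phi>] exI[of _ e]) blast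
qed

context tower
begin

text \<open>The sides come from the edge lines \<open>al i\<close>, the faces \<open>fW l\<close>
  from \<open>W l\<close>, and the ridges from \<open>ridge_functional\<close>. All points of layer
  \<open>l\<close> have value 1 under \<open>W l\<close> before lifting; equality of
  \<open>W\<close> within a group therefore places two consecutive layers entirely in
  \<open>fW l\<close>.\<close>

lemma exists_layered_poset:
  assumes card: "4 \<le> CARD('n::finite)" and M: "0 < M"
    and Weq: "\<forall>l. 0 < l \<longrightarrow> l < M \<longrightarrow> l mod 3 \<noteq> 0 \<longrightarrow> W (Suc l) = W l"
  shows "\<exists>(r :: nat rel) h bot top g c fG fT fW fS. combinatorial_polytope TYPE(real ^ 'n) CARD('n) r \<and>
    ranked_poset r h bot top CARD('n) \<and> layered r (Field r - {bot}) (\<lambda>S. h S \<le> 2) M tr g c fG fT fW fS"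
proof -
  obtain \<Gamma> where \<Gamma>: "\<forall>\<alpha>\<in>al ` {..<63} \<union> W ` {..M}. \<forall>k\<le>M. \<forall>l\<le>Suc M. l \<noteq> k \<longrightarrow> l \<noteq> Suc k \<longrightarrow> 0 < gap \<alpha> k l + \<Gamma> * bend \<alpha> k l"
    using exists_height by blast
  define H where "H = ground_vertex ` {..<63} \<union> {layer_vertex \<Gamma> l C | l C. l \<le> Suc M \<and> C < 3}"
  interpret high_tower al tr W M \<Gamma> H
    by unfold_locales (use \<Gamma> H_def in blast)+
  obtain L where L: "\<forall>v\<in>H. 0 < ((1, 1, 1), L, 0) \<bullet> v" using exists_normalization by blast
  have sp: "\<forall>w. (\<forall>v\<in>H. w \<bullet> v = 0) \<longrightarrow> w = 0" using H_spanning by blast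
  from homogeneous_polytope[OF finite_H L sp card]
  obtain P :: "(real ^ 'n) set" and pt where P: "polytope P" "aff_dim P = int CARD('n)" "\<forall>v\<in>H. pt v \<in> P"
    and ex: "\<forall>w. (\<forall>v\<in>H. 0 \<le> w \<bullet> v) \<longrightarrow> (\<exists>F. F face_of P \<and> (\<forall>v\<in>H. pt v \<in> F \<longleftrightarrow> w \<bullet> v = 0) \<and>
        aff_dim F + 1 \<le> int (dim {v\<in>H. w \<bullet> v = 0}))"
    by (elim exE conjE) (rule that)
  define Fc where "Fc w = (SOME F. F face_of P \<and> (\<forall>v\<in>H. pt v \<in> F \<longleftrightarrow> w \<bullet> v = 0) \<and>
      aff_dim F + 1 \<le> int (dim {v\<in>H. w \<bullet> v = 0}))" for w
  have Fc: "Fc w face_of P" "\<And>v. v \<in> H \<Longrightarrow> pt v \<in> Fc w \<longleftrightarrow> w \<bullet> v = 0"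
      "aff_dim (Fc w) + 1 \<le> int (dim {v\<in>H. w \<bullet> v = 0})" if "\<And>v. v \<in> H \<Longrightarrow> 0 \<le> w \<bullet> v" for w
  proof -
    have "\<exists>F. F face_of P \<and> (\<forall>v\<in>H. pt v \<in> F \<longleftrightarrow> w \<bullet> v = 0) \<and> aff_dim F + 1 \<le> int (dim {v\<in>H. w \<bullet> v = 0})"
      using ex that by blast
    from someI_ex[OF this] show "Fc w face_of P" "\<And>v. v \<in> H \<Longrightarrow> pt v \<in> Fc w \<longleftrightarrow> w \<bullet> v = 0"
      "aff_dim (Fc w) + 1 \<le> int (dim {v\<in>H. w \<bullet> v = 0})" unfolding Fc_def by blast+
  qed
  have "2 < CARD('n)" using card by simp
  from ranked_poset_of_polytope[OF P(1,2) this] obtain r :: "nat rel" and \<phi> e bot top where re: "realization r P \<phi>" and rp: "ranked_poset r (\<lambda>x. aff_dim (\<phi> x)) bot top CARD('n)"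
    and e: "\<forall>F. F face_of P \<longrightarrow> e F \<in> Field r \<and> \<phi> (e F) = F \<and> (F \<noteq> {} \<longrightarrow> e F \<noteq> bot)"
      "\<forall>F G. F face_of P \<longrightarrow> G face_of P \<longrightarrow> (e F, e G) \<in> r \<longleftrightarrow> F \<subseteq> G"
    by (elim exE conjE) (rule that)
  \<comment> \<open>Elements of the poset are represented by smallest faces containing a point, so that no vertex has to be
    identified and only incidences between points and functionals matter.\<close>
  define mf where "mf v = \<Inter>{F. F face_of P \<and> pt v \<in> F}" for v
  have mf: "mf v face_of P" "pt v \<in> mf v" "\<And>F. F face_of P \<Longrightarrow> mf v \<subseteq> F \<longleftrightarrow> pt v \<in> F" if "v \<in> H" for v
  proof -
    have "P face_of P" using P(1) by (simp add: face_of_refl polytope_imp_convex)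
    then show "mf v face_of P" unfolding mf_def using P(3) that by (intro face_of_Inter) auto
    show "pt v \<in> mf v" by (simp add: mf_def)
    then show "mf v \<subseteq> F \<longleftrightarrow> pt v \<in> F" if "F face_of P" for F using that by (auto simp: mf_def)
  qed
  define el where "el v = e (mf v)" for v
  define fe where "fe w = e (Fc w)" for w
  have el: "el v \<in> Field r - {bot}" if "v \<in> H" for v
    using e(1) mf(1,2)[OF that] by (auto simp: el_def)
  have fe: "fe w \<in> Field r" if "\<And>v. v \<in> H \<Longrightarrow> 0 \<le> w \<bullet> v" for w
    using e(1) Fc(1)[OF that] by (auto simp: fe_def)
  have inc: "(el v, fe w) \<in> r \<longleftrightarrow> w \<bullet> v = 0" if "v \<in> H" "\<And>v. v \<in> H \<Longrightarrow> 0 \<le> w \<bullet> v" for v w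
    using e(2) mf(1)[OF that(1)] Fc(1)[OF that(2)] mf(3)[OF that(1) Fc(1)[OF that(2)]] Fc(2)[OF that(2) that(1)]
    by (simp add: el_def fe_def)
  have small: "aff_dim (\<phi> (fe w)) \<le> 2" if "\<And>v. v \<in> H \<Longrightarrow> 0 \<le> w \<bullet> v" "dim {v\<in>H. w \<bullet> v = 0} \<le> 3" for w
    using e(1) Fc(1)[OF that(1)] Fc(3)[OF that(1)] that(2) by (simp add: fe_def)
  have gH: "ground_vertex m \<in> H" if "m < 63" for m using that by (simp add: H_def)
  have cH: "layer_vertex \<Gamma> l C \<in> H" if "l \<le> Suc M" "C < 3" for l C unfolding H_def using that by blast
  define wG :: vec5 where "wG = ((0, 0, 0), 1, 0)"
  have wG: "wG \<bullet> ground_vertex m = 0" "wG \<bullet> layer_vertex \<Gamma> l C = 1" for m l C by (simp_all add: wG_def ground_vertex_def layer_vertex_def inner_prod_def)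
  have nG: "0 \<le> wG \<bullet> v" if "v \<in> H" for v using that wG by (auto simp: H_def)
  have nT: "0 \<le> side_functional \<Gamma> (al i) l \<bullet> v" if "i < 63" "l \<le> M" "v \<in> H" for i l v
    using side_functional_nonneg[OF al_mem] that by blast
  have nW: "0 \<le> side_functional \<Gamma> (W l) l \<bullet> v" if "l \<le> M" "v \<in> H" for l v
    using side_functional_nonneg[OF W_mem] that by blast
  have nS: "0 \<le> ridge_functional l D \<bullet> v" if "0 < l" "l \<le> M" "D < 3" "v \<in> H" for l D v
    unfolding ridge_functional_def inner_add_left using nT[OF tr[OF that(3)]] that by (intro add_nonneg_nonneg) auto
  have Tg: "side_functional \<Gamma> (al i) l \<bullet> ground_vertex m = 0 \<longleftrightarrow> m = i \<or> m = (i + 1) mod 63" if "i < 63" "m < 63" for i l m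
    unfolding side_functional_ground using X_al(2)[OF that] by (simp only: inner_commute)
  have Tc: "side_functional \<Gamma> (al (tr l D)) k \<bullet> layer_vertex \<Gamma> l C = 0 \<longleftrightarrow> C \<noteq> D" if "C < 3" "D < 3" "l \<le> Suc M" "k \<le> M" "l = k \<or> l = Suc k" for k l C D
    using side_functional_layer(2)[OF al_mem[OF tr[OF that(2)]] that(4,3,1), of l] that(5) cell(1)[OF that(1,2), of l] cell(2)[OF that(1,1), of l]
      lowest_al[OF that(2), of l] by (cases "C = D") auto
  have star_vec: "layered r (Field r - {bot}) (\<lambda>S. aff_dim (\<phi> S) \<le> 2) M tr (\<lambda>m. el (ground_vertex m)) (\<lambda>l C. el (layer_vertex \<Gamma> l C))
    (fe wG) (\<lambda>i l. fe (side_functional \<Gamma> (al i) l)) (\<lambda>l. fe (side_functional \<Gamma> (W l) l)) (\<lambda>l D. fe (ridge_functional l D))"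
  proof
    fix l assume "0 < l" "l < M"
    show "fe (side_functional \<Gamma> (W l) l) \<in> Field r" using nW \<open>l < M\<close> by (intro fe) auto
    show "(el (ground_vertex m), fe (side_functional \<Gamma> (W l) l)) \<notin> r" if "m < 63" for m
      using inc[OF gH[OF that] nW] \<open>l < M\<close> W_pos[OF that, of l] by (simp add: side_functional_ground)
    show "(el (layer_vertex \<Gamma> l C), fe (side_functional \<Gamma> (W l) l)) \<in> r \<and> (el (layer_vertex \<Gamma> (Suc l) C), fe (side_functional \<Gamma> (W l) l)) \<in> r" if "l mod 3 \<noteq> 0" "C < 3" for C
    proof -
      have l: "l \<le> M" "l \<le> Suc M" "Suc l \<le> Suc M" using \<open>l < M\<close> by auto
      have "W (Suc l) = W l" using Weq \<open>0 < l\<close> \<open>l < M\<close> that(1) by blast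
      then have "W l \<bullet> cell (Suc l) C = 1" "lowest (W l) (Suc l) = 1"
        using cell(3)[OF that(2,2), of "Suc l"] lowest_W[of "Suc l"] by simp_all
      then have "side_functional \<Gamma> (W l) l \<bullet> layer_vertex \<Gamma> l C = 0" "side_functional \<Gamma> (W l) l \<bullet> layer_vertex \<Gamma> (Suc l) C = 0"
        using side_functional_layer(2)[OF W_mem[OF l(1)] l(1,2) that(2)] side_functional_layer(2)[OF W_mem[OF l(1)] l(1,3) that(2)]
          cell(3)[OF that(2,2), of l] lowest_W[of l] by simp_all
      then show ?thesis using inc[OF cH[OF l(2) that(2)] nW[OF l(1)]] inc[OF cH[OF l(3) that(2)] nW[OF l(1)]] by simp
    qed
  next
    fix l D assume l: "0 < l" "l \<le> M" "(D::nat) < 3"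
    have l': "l - 1 \<le> M" "l \<le> Suc M" using l by auto
    show "fe (ridge_functional l D) \<in> Field r" using nS[OF l] by (rule fe)
    show "aff_dim (\<phi> (fe (ridge_functional l D))) \<le> 2" using nS[OF l] side_dim[OF l] by (rule small)
    have t: "tr l D < 63" "(tr l D + 1) mod 63 < 63" using tr l(3) by auto
    show "(el (ground_vertex (tr l D)), fe (ridge_functional l D)) \<in> r \<and> (el (ground_vertex ((tr l D + 1) mod 63)), fe (ridge_functional l D)) \<in> r"
      using inc[OF gH[OF t(1)] nS[OF l]] inc[OF gH[OF t(2)] nS[OF l]] Tg[OF t(1) t(1)] Tg[OF t(1) t(2)]
      by (simp add: ridge_functional_def inner_add_left)
    show "(el (layer_vertex \<Gamma> l C), fe (ridge_functional l D)) \<in> r" if "C < 3" "C \<noteq> D" for C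
      using inc[OF cH[OF l'(2) that(1)] nS[OF l]] Tc[OF that(1) l(3) l'(2) l'(1)] Tc[OF that(1) l(3) l'(2) l(2)] that(2) l(1)
      by (simp add: ridge_functional_def inner_add_left)
  next
    show "fe wG \<in> Field r" using nG by (rule fe)
    show "aff_dim (\<phi> (fe wG)) \<le> 2" by (rule small[OF nG]) (simp_all add: wG_def ground_dim)
    show "(el (ground_vertex m), fe wG) \<in> r" if "m < 63" for m using inc[OF gH[OF that] nG] wG by simp
    show "(el (layer_vertex \<Gamma> l C), fe wG) \<notin> r" if "0 < l" "l \<le> M" "C < 3" for l C
      using inc[OF cH nG] wG that by simp
    show "el (ground_vertex m) \<in> Field r - {bot}" if "m < 63" for m using el gH that by blast
    show "el (layer_vertex \<Gamma> l C) \<in> Field r - {bot}" if "0 < l" "l \<le> M" "C < 3" for l C using el cH that by simp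
    show "fe (side_functional \<Gamma> (al i) l) \<in> Field r" if "i < 63" "0 < l" "l \<le> M" for i l using nT that by (intro fe) auto
    show "(el (ground_vertex m), fe (side_functional \<Gamma> (al i) l)) \<in> r \<longleftrightarrow> m = i \<or> m = (i + 1) mod 63" if "i < 63" "m < 63" "0 < l" "l \<le> M" for i l m
      using inc[OF gH[OF that(2)] nT[OF that(1,4)]] Tg[OF that(1,2)] by simp
    show "(el (layer_vertex \<Gamma> l C), fe (side_functional \<Gamma> (al (tr l D)) l)) \<in> r \<longleftrightarrow> C \<noteq> D" if "0 < l" "l \<le> M" "C < 3" "D < 3" for l C D
      using inc[OF cH[of l C] nT[OF tr[OF that(4)] that(2)]] Tc[OF that(3,4) _ that(2)] that by simp
  qed (use tr M in auto)
  have "combinatorial_polytope TYPE(real ^ 'n) CARD('n) r" unfolding combinatorial_polytope_def using re P(2) by blast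
  with rp star_vec show ?thesis by blast
qed

end

lemma (in ranked_poset) no_slack_pair:
  assumes star_vec: "layered r V R M tr g c fG fT fW fS"
    and rigid: "\<And>a. convex_polygon a \<Longrightarrow> (\<And>j. 3 * j + 3 \<le> M \<Longrightarrow> \<exists>W. \<forall>e<3. W \<in> open_cone (a (tr (3 * j + e + 1) 0)) (a (tr (3 * j + e + 1) 1)) (a (tr (3 * j + e + 1) 2))) \<Longrightarrow> rigid a"
  shows "\<not> slack_pair r V R"
proof
  assume "slack_pair r V R"
  then obtain A B N Q Q' where s: "slack_rows r V R A Q" "slack_rows r V R B Q'"
    "\<forall>y\<in>V. N y \<in> Q" "(\<lambda>_. 1) \<in> Q" "\<forall>y\<in>V. \<forall>y'\<in>V. (\<lambda>x. N x y - N x y') \<in> Q'"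
    "\<forall>x\<in>V. \<forall>y\<in>V. (y, x) \<notin> r \<longrightarrow> N x y < N x x"
    unfolding slack_pair_def by (elim exE conjE) (rule that)
  have tr: "Relation.trans r" using po by (simp add: partial_order_on_def preorder_on_def)
  show False
  proof (rule layered_no_slack_pair[where N = N, OF star_vec tr s(1) _ s(4) s(2) _ _ rigid])
    show "N y \<in> Q" if "y \<in> V" for y using s(3) that by blast
    show "(\<lambda>x. N x y - N x y') \<in> Q'" if "y \<in> V" "y' \<in> V" for y y' using s(5) that by blast
    show "N x y < N x x" if "x \<in> V" "y \<in> V" "(y, x) \<notin> r" for x y using s(6) that by blast
  qed
qed

section \<open>Assembling the constraints into one tower\<close>

text \<open>One condition for the frame and 22 constraints at each of three corners make 67; with
  three triangles each, the tower needs 201 layers.\<close>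

definition all_constraints :: "(nat \<times> nat \<times> nat) list list" where
  "all_constraints = [(0, 31, 32), (21, 52, 53), (42, 10, 11)] #
     [[((i + 21 * s) mod 63, (j + 21 * s) mod 63, (k + 21 * s) mod 63). (i, j, k) \<leftarrow> c]. s \<leftarrow> [0..<3], c \<leftarrow> corner_constraints]"

lemma all_constraints:
  "length all_constraints = 67"
  "\<forall>c\<in>set all_constraints. length c = 3 \<and> (\<forall>(i, j, k)\<in>set c. i < 63 \<and> j < 63 \<and> k < 63 \<and> i \<noteq> j \<and> j \<noteq> k \<and> i \<noteq> k)"
  by (simp_all add: all_constraints_def corner_constraints_def upt_rec)

lemma rigid_iff_all_constraints: "rigid a \<longleftrightarrow> convex_polygon a \<and> (\<forall>c\<in>set all_constraints. cones_meet a c)"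
proof -
  have e: "cones_meet a [((i + 21 * s) mod 63, (j + 21 * s) mod 63, (k + 21 * s) mod 63). (i, j, k) \<leftarrow> c] \<longleftrightarrow> cones_meet (\<lambda>i. a ((i + 21 * s) mod 63)) c" for s c
    unfolding cones_meet_def by (simp add: split_beta)
  have "set all_constraints = insert [(0, 31, 32), (21, 52, 53), (42, 10, 11)]
      (\<Union>s<3. (\<lambda>c. [((i + 21 * s) mod 63, (j + 21 * s) mod 63, (k + 21 * s) mod 63). (i, j, k) \<leftarrow> c]) ` set corner_constraints)"
    unfolding all_constraints_def by (simp add: atLeast0LessThan)
  then have "(\<forall>c\<in>set all_constraints. cones_meet a c) \<longleftrightarrow> cones_meet a [(0, 31, 32), (21, 52, 53), (42, 10, 11)] \<and>
      (\<forall>s<3. \<forall>c\<in>set corner_constraints. cones_meet a [((i + 21 * s) mod 63, (j + 21 * s) mod 63, (k + 21 * s) mod 63). (i, j, k) \<leftarrow> c])"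
    by (simp only: ball_simps UN_iff bex_simps) auto
  then show ?thesis unfolding rigid_def e by (simp only:)
qed

text \<open>Layer \<open>3 * j + e + 1\<close> realizes triangle \<open>e\<close> of constraint
  \<open>j\<close>. Truncated subtraction and \<open>min\<close> keep the index valid at the extra
  layers 0 and 202, which reuse triangles of the first and the last constraint.\<close>

definition triple :: "nat \<Rightarrow> nat \<times> nat \<times> nat" where
  "triple l = all_constraints ! (min ((l - 1) div 3) 66) ! ((l - 1) mod 3)"

definition corner :: "nat \<Rightarrow> nat \<Rightarrow> nat" where
  "corner l D = (if D = 0 then fst (triple l) else if D = 1 then fst (snd (triple l)) else snd (snd (triple l)))"

lemma triple_mem: "triple l \<in> set (all_constraints ! (min ((l - 1) div 3) 66))" "all_constraints ! (min ((l - 1) div 3) 66) \<in> set all_constraints"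
proof -
  show *: "all_constraints ! (min ((l - 1) div 3) 66) \<in> set all_constraints" by (rule nth_mem) (simp add: all_constraints(1))
  have "length (all_constraints ! (min ((l - 1) div 3) 66)) = 3" using bspec[OF all_constraints(2) *] by (rule conjunct1)
  then show "triple l \<in> set (all_constraints ! (min ((l - 1) div 3) 66))"
    unfolding triple_def by (intro nth_mem) (simp only: mod_less_divisor zero_less_numeral)
qed

lemma corner: "D < 3 \<Longrightarrow> corner l D < 63" "corner l 0 \<noteq> corner l 1" "corner l 1 \<noteq> corner l 2" "corner l 0 \<noteq> corner l 2"
proof -
  obtain i j k where t: "triple l = (i, j, k)" by (metis prod.exhaust)
  have "case triple l of (i, j, k) \<Rightarrow> i < 63 \<and> j < 63 \<and> k < 63 \<and> i \<noteq> j \<and> j \<noteq> k \<and> i \<noteq> k"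
    using bspec[OF conjunct2[OF bspec[OF all_constraints(2) triple_mem(2)]] triple_mem(1)] .
  then show "D < 3 \<Longrightarrow> corner l D < 63" "corner l 0 \<noteq> corner l 1" "corner l 1 \<noteq> corner l 2" "corner l 0 \<noteq> corner l 2"
    by (simp_all add: t corner_def)
qed

lemma triple_at: "j < 67 \<Longrightarrow> e < 3 \<Longrightarrow> triple (3 * j + e + 1) = all_constraints ! j ! e"
  by (simp add: triple_def)

lemma rigid_if_corners:
  assumes "convex_polygon a" "\<And>j. 3 * j + 3 \<le> 201 \<Longrightarrow> \<exists>W. \<forall>e<3. W \<in> open_cone (a (corner (3 * j + e + 1) 0)) (a (corner (3 * j + e + 1) 1)) (a (corner (3 * j + e + 1) 2))"
  shows "rigid a"
  unfolding rigid_iff_all_constraints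
proof (intro conjI ballI)
  fix c assume c: "c \<in> set all_constraints"
  then obtain j where j: "j < 67" "c = all_constraints ! j" using all_constraints(1) by (metis in_set_conv_nth)
  obtain W where W: "\<forall>e<3. W \<in> open_cone (a (corner (3 * j + e + 1) 0)) (a (corner (3 * j + e + 1) 1)) (a (corner (3 * j + e + 1) 2))"
    using assms(2)[of j] j(1) by auto
  have "W \<in> open_cone (a (fst t)) (a (fst (snd t))) (a (snd (snd t)))" if t: "t \<in> set c" for t
  proof -
    obtain e where e: "e < 3" "t = c ! e" using all_constraints(2) c t by (metis in_set_conv_nth)
    then have "triple (3 * j + e + 1) = t" using triple_at[OF j(1) e(1)] j(2) by simp
    then show ?thesis using W[rule_format, OF e(1)] by (simp add: corner_def)
  qed
  then show "cones_meet a c" unfolding cones_meet_def by blast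
qed (rule assms(1))

lemma alpha_sum_pos: assumes "i < 63" shows "0 < (1, 1, 1) \<bullet> alpha i"
proof -
  define t where "t = arc_parameter ! (i mod 21)"
  have t: "0 \<le> t" unfolding t_def by (rule par_nonneg) simp
  have "(1, 1, 1) \<bullet> alpha i = 1 + t + (t + t^2) - arc_slope * t" by (auto simp: alpha_def arc_def t_def)
  moreover have "0 < 1 + t + (t + t^2) - arc_slope * t" 
  proof -
    have "1 + t + (t + t^2) - arc_slope * t = 1 + (2 - arc_slope) * t + t^2" by (simp add: algebra_simps)
    moreover have "0 \<le> (2 - arc_slope) * t" using t by (simp add: arc_slope_def)
    ultimately show ?thesis using zero_le_power2[of t] by linarith
  qed
  ultimately show ?thesis by simp
qed

theorem theorem3p9:
  fixes d :: nat
  assumes "d \<ge> 4" and "CARD('n::finite) = d"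
  shows "\<exists>r :: nat rel.
    combinatorial_polytope TYPE(real ^ 'n) d r \<and>
    \<not> has_balanced_pair TYPE(real ^ 'n) r \<and>
    \<not> has_antiprism r \<and>
    \<not> has_interval_polytope r"
proof -
  have "\<exists>W. \<forall>t\<in>set (all_constraints ! j). W \<in> open_cone (alpha (fst t)) (alpha (fst (snd t))) (alpha (snd (snd t)))" if "j < 67" for j
  proof -
    have "all_constraints ! j \<in> set all_constraints" using that all_constraints(1) by simp
    then have "cones_meet alpha (all_constraints ! j)" using rigid_alpha unfolding rigid_iff_all_constraints by blast
    then show ?thesis unfolding cones_meet_def .
  qed
  then have "\<forall>j\<in>{..<67}. \<exists>W. \<forall>t\<in>set (all_constraints ! j). W \<in> open_cone (alpha (fst t)) (alpha (fst (snd t))) (alpha (snd (snd t)))"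
    by simp
  from bchoice[OF this] obtain WW where WW: "\<forall>j\<in>{..<67}. \<forall>t\<in>set (all_constraints ! j). WW j \<in> open_cone (alpha (fst t)) (alpha (fst (snd t))) (alpha (snd (snd t)))"
    by (elim exE) (rule that)
  \<comment> \<open>The same index as in \<open>triple\<close>, so the three layers of a group share
    their point.\<close>
  define W where "W l = WW (min ((l - 1) div 3) 66)" for l
  interpret tower alpha corner W 201
  proof
    show "W l \<in> open_cone (alpha (corner l 0)) (alpha (corner l 1)) (alpha (corner l 2))" for l
      using bspec[OF bspec[OF WW] triple_mem(1), of l] by (simp add: W_def corner_def)
    show "(1, 1, 1) \<in> open_cone (alpha 0) (alpha 21) (alpha 42)"
      unfolding open_cone_def by (rule CollectI, intro exI[of _ 1]) (simp add: alpha_eval)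
  qed (use convex_polygon_alpha alpha_sum_pos corner in simp_all)
  have card: "4 \<le> CARD('n)" using assms by simp
  have Weq: "W (Suc l) = W l" if "0 < l" "l < 201" "l mod 3 \<noteq> 0" for l
  proof -
    have "(l - 1) div 3 = l div 3" using that div_Suc[of "l - 1" 3] by simp
    then show ?thesis by (simp add: W_def)
  qed
  then have Weq': "\<forall>l. 0 < l \<longrightarrow> l < 201 \<longrightarrow> l mod 3 \<noteq> 0 \<longrightarrow> W (Suc l) = W l" by blast
  have M: "0 < (201 :: nat)" by simp
  from exists_layered_poset[OF card M Weq'] obtain r :: "nat rel" and h bot top g c fG fT fW fS where r: "combinatorial_polytope TYPE(real ^ 'n) CARD('n) r"
    "ranked_poset r h bot top CARD('n)" "layered r (Field r - {bot}) (\<lambda>S. h S \<le> 2) 201 corner g c fG fT fW fS"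
    by (elim exE conjE) (rule that)
  interpret rp: ranked_poset r h bot top "CARD('n)" by (rule r(2))
  have no: "\<not> slack_pair r rp.V rp.R" by (rule rp.no_slack_pair[OF r(3) rigid_if_corners])
  \<comment> \<open>Interval ranks range from -1 to \<open>d + 1\<close>, a spread of
    \<open>d + 2\<close>; three additional dimensions exceed it.\<close>
  have dim: "int CARD('n) + 2 < int DIM((real ^ 'n) \<times> vec3)" by simp
  have "\<not> has_balanced_pair TYPE(real ^ 'n) r"
    using no rp.balanced_slack_pair by blast
  moreover have "\<not> has_antiprism r"
    using no rp.antiprism_slack_pair[OF _ dim] unfolding has_antiprism_def by blast
  moreover have "\<not> has_interval_polytope r"
    using no rp.interval_slack_pair[OF _ dim] unfolding has_interval_polytope_def by blast
  ultimately show ?thesis using r(1) assms(2) by blast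
qed

end
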